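(* Let $p\in(0,1)$ and an integer $r\ge 2$ be fixed. All statements below are asymptotic as $n\to\infty$, "a.a.s." means "with probability tending to $1$ as $n\to\infty$", and $\log$ is the natural logarithm. (a) Suppose $r=2^q$ for some integer $q\ge 1$. There is a constant $C=C(r,p)>0$ such that for every sequence $k=k(n)$ of positive integers with $C\,(n-rk)\le n^{r/(r+1)}(\log n)^{-1/(r+1)}$ for all sufficiently large $n$, a.a.s. $\chi(KG^r_{n,k}(p))\ge \chi(KG^r_{n,k+1})$. (b) Let $r=2$ and let $l\ge 2$ be a fixed integer. There is $C=C(p,l)>0$ such that for every sequence $k=k(n)\ge 2$ with $k\ge C(n\log n)^{1/l}$ for all large $n$, a.a.s. $\chi(KG_{n,k}(p))\ge\chi(KG_{n,k+l})$. (c) Let $r=2$ and let $k\ge 2$ be a fixed integer. There is $C=C(p,k)>0$ such that for every sequence $l=l(n)\ge 2$ with $l\ge C(n\log n)^{1/k}$ for all large $n$, a.a.s. $\chi(KG_{n,k}(p))\ge\chi(KG_{n,k+l})$. (d) Let $r=3$ and let $l\ge 2$ be a fixed integer. There is $C=C(p,l)>0$ such that for every sequence $k=k(n)\ge 2$ with $k\ge C(\log n)^{1/(3l-4)}$ for all large $n$, a.a.s. $\chi(KG^3_{n,k}(p))\ge\chi(KG^3_{n,k+l})$. (e) Let $r=3$ and let $k\ge 2$ be a fixed integer. There is $C=C(p,k)>0$ such that for every sequence $l=l(n)\ge 2$ with $l\ge C(\log n)^{2/(6k-11)}$ for all large $n$, a.a.s. $\chi(KG^3_{n,k}(p))\ge\chi(KG^3_{n,k+l})$.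 (f) Let $r>3$ and let $l\ge 3$ be a fixed integer. There is $C=C(r,p,l)>0$ such that for every sequence $k=k(n)\ge 2$ with $k\ge C(\log n)^{1/(r(l-2)-1)}$ for all large $n$, a.a.s. $\chi(KG^r_{n,k}(p))\ge\chi(KG^r_{n,k+l})$. (g) Let $r>3$ and let $k\ge 2$ be a fixed integer. There is $C=C(r,p,k)>0$ such that for every sequence $l=l(n)\ge 2$ with $l\ge C(\log n)^{1/\left(r(k-1)-\frac{2r-1}{r-1}\right)}$ for all large $n$, a.a.s. $\chi(KG^r_{n,k}(p))\ge\chi(KG^r_{n,k+l})$.
   Context: For positive integers $n,k$ and $r\ge 2$, the Kneser $r$-graph $KG^r_{n,k}$ is the $r$-uniform hypergraph whose vertex set is $\binom{[n]}{k}$ (all $k$-element subsets of $[n]=\{1,\dots,n\}$) and whose edges are all $r$-tuples of pairwise disjoint $k$-sets; for $r=2$ we write $KG_{n,k}$. The chromatic number $\chi(\mathcal H)$ of a hypergraph is the least number of colors in a vertex coloring with no monochromatic edge (it is known that $\chi(KG^r_{n,k})=\lceil\frac{n-r(k-1)}{r-1}\rceil$ for $n\ge rk$). For a hypergraph $\mathcal H$ and $p\in(0,1)$, the random hypergraph $\mathcal H(p)$ has the same vertex set as $\mathcal H$ and contains each edge of $\mathcal H$ independently with probability $p$. *)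

theory Defs
  imports "HOL-Probability.Probability" "HOL-Probability.Product_PMF"
begin

type_synonym 'a hypergraph = "'a set \<times> 'a set set"

abbreviation vertices :: "'a hypergraph \<Rightarrow> 'a set" where
  "vertices \<equiv> fst"

abbreviation edges :: "'a hypergraph \<Rightarrow> 'a set set" where
  "edges \<equiv> snd"

definition proper_coloring :: "'a hypergraph \<Rightarrow> nat \<Rightarrow> ('a \<Rightarrow> nat) \<Rightarrow> bool" where
  "proper_coloring H m f \<longleftrightarrow>
     f ` vertices H \<subseteq> {..<m} \<and> (\<forall>e\<in>edges H. \<not> (\<exists>c. \<forall>v\<in>e. f v = c))"

(* Meaningful when the vertex set is finite and every edge has at least two elements;
   then the vertices can be colored with pairwise distinct colors, so that the minimum exists.
   It is 0 for the hypergraph without vertices and 1 for a nonempty one without edges. *)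
definition chromatic_number :: "'a hypergraph \<Rightarrow> nat" where
  "chromatic_number H = (LEAST m. \<exists>f. proper_coloring H m f)"

(* An edge is the unordered set of the r disjoint k-sets; for k > 0, disjoint k-sets are distinct. *)
definition kneser :: "nat \<Rightarrow> nat \<Rightarrow> nat \<Rightarrow> nat set hypergraph" where
  "kneser r n k =
     (let V = {A. A \<subseteq> {1..n} \<and> card A = k}
      in (V, {e. e \<subseteq> V \<and> card e = r \<and> pairwise disjnt e}))"

(* The product distribution makes sense only for a finite edge set. *)
definition random_subhypergraph :: "'a hypergraph \<Rightarrow> real \<Rightarrow> 'a hypergraph pmf" where
  "random_subhypergraph H p =
     map_pmf (\<lambda>w. (vertices H, {e \<in> edges H. w e}))
       (Pi_pmf (edges H) False (\<lambda>_. bernoulli_pmf p))"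

definition asymptotically_almost_surely ::
  "(nat \<Rightarrow> 'a pmf) \<Rightarrow> (nat \<Rightarrow> 'a \<Rightarrow> bool) \<Rightarrow> bool" where
  "asymptotically_almost_surely X P \<longleftrightarrow>
     (\<lambda>n. measure_pmf.prob (X n) {x. P n x}) \<longlonglongrightarrow> 1"

definition aas_chromatic_bound ::
  "nat \<Rightarrow> real \<Rightarrow> (nat \<Rightarrow> nat) \<Rightarrow> (nat \<Rightarrow> nat) \<Rightarrow> bool" where
  "aas_chromatic_bound r p k l \<longleftrightarrow>
     asymptotically_almost_surely (\<lambda>n. random_subhypergraph (kneser r n (k n)) p)
       (\<lambda>n H. chromatic_number H \<ge> chromatic_number (kneser r n (k n + l n)))"

end

theory Submission
  imports Defs "HOL-Real_Asymp.Real_Asymp"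
begin

text \<open>
  Fix a colouring f of the k-sets that is proper for the random hypergraph, with fewer colours than
  the chromatic number on (k+l)-sets. All edges monochromatic under f are then missing, so it suffices
  to exhibit, for every f, a set of monochromatic edges taken from a collection X for which the sum
  over E in X of (1-p)^|E| tends to 0.

  The basic device is transfer: colour a (k+l)-set by a colour that is popular among its k-subsets.
  This cannot be proper, so r disjoint (k+l)-sets share a popular colour c, and their c-coloured
  k-subsets span many monochromatic edges. In (a) the transfer is carried out on r-stable sets, which
  are few; this uses the chromatic number of stable Kneser hypergraphs (octahedral Tucker lemma plus
  composition for powers of two). In (b) one passes to a family closed under finding a disjoint set
  with the same popular colour and encodes the popular k-sets by lists with few jumps. For r at
  least 3 one first deletes elements dominated by a single colour (kernels), which leaves a universe
  T of size polynomial in k or l, in which fewer colours compete. In (d) a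
  maximal family of disjoint (k+l)-sets without a popular colour is absorbed by stars of colours with
  spare capacity; when the capacity does not suffice, these sets span many monochromatic edges, among
  themselves or together with pairs of hosts of a saturated colour.
\<close>

text \<open>A union bound over all colourings is hopeless, as there are about m to the power (n
  choose k) of them. So every event is described by a small piece of f, and the proof is a contest
  between the length of this description and the number of edges it forbids. For popular hosts the
  description names r hosts and t k-subsets of each, and t^r edges are forbidden; the thresholds
  come from r (ln(number of hosts) + t ln(k-subsets of a host)) being small against t^r. In (c) the
  single host {1..n} suffices. In (b), near the threshold, hosts cost k ln n, more than t^2 with t
  of order ln n; hence a description spread over many sets that differ little. For r at least 3 the
  assumed k or l may be only polylogarithmic, so a pigeonhole over m colours, m up to order n,
  yields nothing. Hence the universe T with |C| < |T|, whose size fixes t: about k^(l-2) from |T| =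
  O(k^2) in (f), l^(k - r/(r-1)) from |T| = O(l^(r/(r-1))) in (e) and (g). In (d) the threshold is
  relative to k+l instead of |T|, so t is about k^(l-1). That t^r must pay (k+l) ln n for a host
  gives the exponents.\<close>

section \<open>Kneser hypergraphs and their colourings\<close>

definition ksub :: "nat set \<Rightarrow> nat \<Rightarrow> nat set set" where
  "ksub T k = {A. A \<subseteq> T \<and> card A = k}"

definition kedges :: "nat \<Rightarrow> nat set set \<Rightarrow> nat set set set" where
  "kedges r F = {e. e \<subseteq> F \<and> card e = r \<and> pairwise disjnt e}"

definition mono_edge :: "(nat set \<Rightarrow> nat) \<Rightarrow> nat set set \<Rightarrow> bool" where
  "mono_edge f e \<longleftrightarrow> (\<exists>c. \<forall>v\<in>e. f v = c)"

definition colorable :: "nat \<Rightarrow> nat \<Rightarrow> nat \<Rightarrow> nat \<Rightarrow> bool" where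
  "colorable r n d m \<longleftrightarrow> (\<exists>g. g ` ksub {1..n} d \<subseteq> {..<m} \<and>
   (\<forall>c<m. kedges r {A \<in> ksub {1..n} d. g A = c} = {}))"

lemma finite_ksub [simp]: "finite T \<Longrightarrow> finite (ksub T k)"
  by (rule finite_subset[of _ "Pow T"]) (auto simp: ksub_def)

lemma card_ksub: "finite T \<Longrightarrow> card (ksub T k) = card T choose k"
  by (simp add: ksub_def n_subsets)

lemma ksub_mono: "S \<subseteq> T \<Longrightarrow> ksub S k \<subseteq> ksub T k"
  by (auto simp: ksub_def)

lemma kedges_mono: "F \<subseteq> G \<Longrightarrow> kedges r F \<subseteq> kedges r G"
  by (auto simp: kedges_def)

lemma finite_kedges [simp]: "finite F \<Longrightarrow> finite (kedges r F)"
  by (rule finite_subset[of _ "Pow F"]) (auto simp: kedges_def)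

lemma kneser_eq: "kneser r n k = (ksub {1..n} k, kedges r (ksub {1..n} k))"
  by (simp add: kneser_def ksub_def kedges_def Let_def)

lemma proper_coloring_kneser:
  assumes "r \<ge> 1"
  shows "(\<exists>g. proper_coloring (kneser r n d) m g) \<longleftrightarrow> colorable r n d m"
proof
  assume "\<exists>g. proper_coloring (kneser r n d) m g"
  then obtain g where g: "g ` ksub {1..n} d \<subseteq> {..<m}"
   and e: "\<forall>e\<in>kedges r (ksub {1..n} d). \<not> mono_edge g e"
   by (auto simp: proper_coloring_def kneser_eq mono_edge_def)
  have "kedges r {A \<in> ksub {1..n} d. g A = c} = {}" for c
  proof -
   have "e \<in> kedges r (ksub {1..n} d) \<and> mono_edge g e"
    if "e \<in> kedges r {A \<in> ksub {1..n} d. g A = c}" for e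
    using that unfolding kedges_def mono_edge_def by blast
   then show ?thesis using e by blast
  qed
  with g show "colorable r n d m" unfolding colorable_def by blast
next
  assume "colorable r n d m"
  then obtain g where g: "g ` ksub {1..n} d \<subseteq> {..<m}"
   and e: "\<And>c. c < m \<Longrightarrow> kedges r {A \<in> ksub {1..n} d. g A = c} = {}"
   by (auto simp: colorable_def)
  have "\<not> (\<exists>c. \<forall>v\<in>e. g v = c)" if h: "e \<in> kedges r (ksub {1..n} d)" for e
  proof
   assume "\<exists>c. \<forall>v\<in>e. g v = c"
   then obtain c where c: "\<forall>v\<in>e. g v = c" by auto
   from h assms have "e \<noteq> {}" by (auto simp: kedges_def)
   then obtain v where v: "v \<in> e" by auto
   then have "v \<in> ksub {1..n} d" using h by (auto simp: kedges_def)
   with v c g have "c < m" by auto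
   moreover have "e \<in> kedges r {A \<in> ksub {1..n} d. g A = c}" using h c by (auto simp: kedges_def)
   ultimately show False using e by auto
  qed
  then show "\<exists>g. proper_coloring (kneser r n d) m g"
   using g by (auto simp: proper_coloring_def kneser_eq)
qed

text \<open>An optimal proper colouring of the random hypergraph is the f handed to the
  combinatorial part: its number m of colours lies below the chromatic number on d-sets, so m
  colours do not suffice there, and every edge monochromatic under f is absent.\<close>

lemma chromatic_bound_fails:
  assumes r: "r \<ge> 2" and H: "H = (ksub {1..n} k, {e \<in> kedges r (ksub {1..n} k). w e})"
   and less: "\<not> chromatic_number (kneser r n d) \<le> chromatic_number H"
  obtains m f where "\<not> colorable r n d m" "f ` ksub {1..n} k \<subseteq> {..<m}"
   "\<And>e. e \<in> kedges r (ksub {1..n} k) \<Longrightarrow> mono_edge f e \<Longrightarrow> \<not> w e"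
proof -
  \<comment> \<open>\<open>LEAST\<close> says something only if a proper colouring exists. An
    injective one is proper because edges have at least two vertices.\<close>
  have ex: "\<exists>m f. proper_coloring H m f"
  proof -
   obtain f :: "nat set \<Rightarrow> nat" where f: "inj_on f (ksub {1..n} k)"
    using finite_imp_inj_to_nat_seg[of "ksub {1..n} k"] by auto
   obtain m where m: "f ` ksub {1..n} k \<subseteq> {..<m}"
    using finite_nat_set_iff_bounded[of "f ` ksub {1..n} k"] by auto
   have "\<not> (\<exists>c. \<forall>v\<in>e. f v = c)" if h: "e \<in> kedges r (ksub {1..n} k)" for e
   proof
    assume "\<exists>c. \<forall>v\<in>e. f v = c"
    then obtain c where c: "\<forall>v\<in>e. f v = c" by auto
    have sub: "e \<subseteq> ksub {1..n} k" and ce: "card e = r" using h by (auto simp: kedges_def)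
    have "card (f ` e) \<le> card {c}" using c by (intro card_mono) auto
    moreover have "card (f ` e) = r" using card_image[of f e] f sub ce by (meson inj_on_subset)
    ultimately show False using r by simp
   qed
   then have "proper_coloring H m f" using m by (auto simp: H proper_coloring_def)
   then show ?thesis by blast
  qed
  define m where "m = chromatic_number H"
  have "\<exists>f. proper_coloring H m f"
   unfolding m_def chromatic_number_def using ex by (rule LeastI_ex)
  then obtain f where f: "proper_coloring H m f" by auto
  have "m < chromatic_number (kneser r n d)" using less by (simp add: m_def)
  then have "\<not> (\<exists>g. proper_coloring (kneser r n d) m g)"
   unfolding chromatic_number_def by (rule not_less_Least)
  then have "\<not> colorable r n d m" using proper_coloring_kneser[of r] r by simp
  moreover have "f ` ksub {1..n} k \<subseteq> {..<m}"
   "\<And>e. e \<in> kedges r (ksub {1..n} k) \<Longrightarrow> mono_edge f e \<Longrightarrow> \<not> w e"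
   using f by (auto simp: H proper_coloring_def mono_edge_def)
  ultimately show ?thesis using that by blast
qed

section \<open>Sets of missing edges and the union bound\<close>

lemma prob_no_edge:
  assumes "finite A" "E \<subseteq> A" "0 < p" "p < 1"
  shows "measure_pmf.prob (Pi_pmf A False (\<lambda>_. bernoulli_pmf p)) {w. \<forall>e\<in>E. \<not> w e} = (1 - p) ^ card E"
proof -
  define B where "B = (\<lambda>e. if e \<in> E then {False} else (UNIV :: bool set))"
  have "{w. \<forall>e\<in>E. \<not> w e} = Pi A B"
   using assms(2) by (auto simp: B_def Pi_def)
  then have "measure_pmf.prob (Pi_pmf A False (\<lambda>_. bernoulli_pmf p)) {w. \<forall>e\<in>E. \<not> w e}
   = (\<Prod>x\<in>A. measure_pmf.prob (bernoulli_pmf p) (B x))"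
   using measure_Pi_pmf_Pi[OF assms(1)] by simp
  also have "\<dots> = (\<Prod>x\<in>A. if x \<in> E then 1 - p else 1)"
   using assms by (intro prod.cong) (auto simp: B_def measure_pmf_single)
  also have "\<dots> = (\<Prod>x\<in>E. 1 - p)"
   using assms by (simp add: prod.If_cases Int_absorb1)
  finally show ?thesis by simp
qed

text \<open>The summand is the probability that all edges of E are missing, so this is a union bound
  that tends to 0. Finiteness is included since a sum over an infinite set is 0 in HOL and would
  make the limit vacuous.\<close>

definition negligible :: "real \<Rightarrow> (nat \<Rightarrow> nat set set set set) \<Rightarrow> bool" where
  "negligible p X \<longleftrightarrow> (\<forall>n. finite (X n)) \<and> (\<lambda>n. \<Sum>E\<in>X n. (1 - p) ^ card E) \<longlonglongrightarrow> 0"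

lemma negligible_Un:
  assumes "negligible p X" "negligible p Y" "p < 1"
  shows "negligible p (\<lambda>n. X n \<union> Y n)"
proof -
  have "(\<lambda>n. (\<Sum>E\<in>X n. (1 - p) ^ card E) + (\<Sum>E\<in>Y n. (1 - p) ^ card E)) \<longlonglongrightarrow> 0 + 0"
   using assms by (intro tendsto_add) (auto simp: negligible_def)
  then have lim: "(\<lambda>n. (\<Sum>E\<in>X n. (1 - p) ^ card E) + (\<Sum>E\<in>Y n. (1 - p) ^ card E)) \<longlonglongrightarrow> 0"
   by simp
  have "(\<lambda>n. \<Sum>E\<in>X n \<union> Y n. (1 - p) ^ card E) \<longlonglongrightarrow> 0"
  proof (rule tendsto_sandwich[OF _ _ tendsto_const lim])
   show "\<forall>\<^sub>F n in sequentially. 0 \<le> (\<Sum>E\<in>X n \<union> Y n. (1 - p) ^ card E)"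
    using assms(3) by (intro always_eventually allI sum_nonneg) simp
   show "\<forall>\<^sub>F n in sequentially. (\<Sum>E\<in>X n \<union> Y n. (1 - p) ^ card E)
     \<le> (\<Sum>E\<in>X n. (1 - p) ^ card E) + (\<Sum>E\<in>Y n. (1 - p) ^ card E)"
   proof (intro always_eventually allI)
    fix n
    have "(\<Sum>E\<in>X n \<union> Y n. (1 - p) ^ card E) + (\<Sum>E\<in>X n \<inter> Y n. (1 - p) ^ card E)
     = (\<Sum>E\<in>X n. (1 - p) ^ card E) + (\<Sum>E\<in>Y n. (1 - p) ^ card E)"
     using assms by (intro sum.union_inter) (auto simp: negligible_def)
    moreover have "(\<Sum>E\<in>X n \<inter> Y n. (1 - p) ^ card E) \<ge> 0"
     using assms(3) by (intro sum_nonneg) simp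
    ultimately show "(\<Sum>E\<in>X n \<union> Y n. (1 - p) ^ card E)
     \<le> (\<Sum>E\<in>X n. (1 - p) ^ card E) + (\<Sum>E\<in>Y n. (1 - p) ^ card E)" by linarith
   qed
  qed
  then show ?thesis using assms by (auto simp: negligible_def)
qed

text \<open>The only place where probability meets colourings. What remains for each statement is
  the deterministic claim \<open>ev\<close>, that the monochromatic edges of every f include one of
  the listed edge sets, together with the negligibility of the list. The list may depend on n, but
  not on f or m.\<close>

lemma aas_chromatic_boundI:
  assumes p: "0 < p" "p < 1" and r: "r \<ge> 2" and X: "negligible p X"
   and ev: "\<forall>\<^sub>F n in sequentially. \<forall>m f. \<not> colorable r n (k n + l n) m \<longrightarrow>
    f ` ksub {1..n} (k n) \<subseteq> {..<m} \<longrightarrow>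
    (\<exists>E\<in>X n. E \<subseteq> kedges r (ksub {1..n} (k n)) \<and> (\<forall>e\<in>E. mono_edge f e))"
  shows "aas_chromatic_bound r p k l"
proof -
  define P where "P = (\<lambda>n (H::nat set hypergraph).
   chromatic_number (kneser r n (k n + l n)) \<le> chromatic_number H)"
  define R where "R = (\<lambda>n. random_subhypergraph (kneser r n (k n)) p)"
  define s where "s = (\<lambda>n. \<Sum>E\<in>X n. (1 - p) ^ card E)"
  have "\<forall>\<^sub>F n in sequentially. 1 - s n \<le> measure_pmf.prob (R n) {H. P n H}"
   using ev
  proof eventually_elim
   case (elim n)
   define A where "A = kedges r (ksub {1..n} (k n))"
   define M where "M = Pi_pmf A False (\<lambda>_. bernoulli_pmf p)"
   define g where "g = (\<lambda>w. (ksub {1..n} (k n), {e \<in> A. w e}))"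
   define Y where "Y = {E \<in> X n. E \<subseteq> A}"
   have fA: "finite A" by (simp add: A_def)
   have fX: "finite (X n)" using X by (simp add: negligible_def)
   have R: "R n = map_pmf g M"
    by (simp add: R_def random_subhypergraph_def kneser_eq g_def M_def A_def)
   have bad: "- {H. P n H} = {H. \<not> P n H}" by auto
   have "measure_pmf.prob (R n) {H. \<not> P n H} = measure_pmf.prob M {w. \<not> P n (g w)}"
    by (simp add: R vimage_def)
   also have "\<dots> \<le> measure_pmf.prob M (\<Union>E\<in>Y. {w. \<forall>e\<in>E. \<not> w e})"
   proof (rule measure_pmf.finite_measure_mono)
    show "{w. \<not> P n (g w)} \<subseteq> (\<Union>E\<in>Y. {w. \<forall>e\<in>E. \<not> w e})"
    proof
     fix w assume "w \<in> {w. \<not> P n (g w)}"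
     then have b: "\<not> chromatic_number (kneser r n (k n + l n)) \<le> chromatic_number (g w)"
      by (simp add: P_def)
     have gw: "g w = (ksub {1..n} (k n), {e \<in> kedges r (ksub {1..n} (k n)). w e})"
      by (simp add: g_def A_def)
     obtain m f where mf: "\<not> colorable r n (k n + l n) m" "f ` ksub {1..n} (k n) \<subseteq> {..<m}"
      "\<And>e. e \<in> A \<Longrightarrow> mono_edge f e \<Longrightarrow> \<not> w e"
      using chromatic_bound_fails[OF r gw b] A_def by metis
     then obtain E where "E \<in> X n" "E \<subseteq> A" "\<forall>e\<in>E. mono_edge f e"
      using elim A_def by metis
     then show "w \<in> (\<Union>E\<in>Y. {w. \<forall>e\<in>E. \<not> w e})"
      using mf(3) by (auto simp: Y_def)
    qed
   qed simp
   also have "\<dots> \<le> (\<Sum>E\<in>Y. measure_pmf.prob M {w. \<forall>e\<in>E. \<not> w e})"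
    using fX by (intro measure_pmf.finite_measure_subadditive_finite) (auto simp: Y_def)
   also have "\<dots> = (\<Sum>E\<in>Y. (1 - p) ^ card E)"
    using prob_no_edge[OF fA _ p] by (intro sum.cong) (auto simp: Y_def M_def)
   also have "\<dots> \<le> s n"
    unfolding s_def using fX p by (intro sum_mono2) (auto simp: Y_def)
   finally have "measure_pmf.prob (R n) {H. \<not> P n H} \<le> s n" .
   moreover have "measure_pmf.prob (R n) {H. \<not> P n H} = 1 - measure_pmf.prob (R n) {H. P n H}"
    using measure_pmf.prob_compl[of "{H. P n H}" "R n"] by (simp add: bad[symmetric] Compl_eq_Diff_UNIV)
   ultimately show ?case by simp
  qed
  note lower = this
  have "(\<lambda>n. 1 - s n) \<longlonglongrightarrow> 1 - 0"
   using X by (intro tendsto_diff tendsto_const) (simp add: negligible_def s_def)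
  then have lim: "(\<lambda>n. 1 - s n) \<longlonglongrightarrow> 1" by simp
  have upper: "\<forall>\<^sub>F n in sequentially. measure_pmf.prob (R n) {H. P n H} \<le> 1"
   by (intro always_eventually allI) simp
  have "(\<lambda>n. measure_pmf.prob (R n) {H. P n H}) \<longlonglongrightarrow> 1"
   by (rule tendsto_sandwich[OF lower upper lim tendsto_const])
  then show ?thesis
   by (simp add: aas_chromatic_bound_def asymptotically_almost_surely_def P_def R_def)
qed

text \<open>Events are graded by a weight w. The surplus \<open>real w * x n\<close> in the exponent
  leaves at most exp(- x n)^w for the events of weight w, and the geometric series over all weights
  is at most 2 exp(- x n). Even n choose k many weights are therefore affordable.\<close>

lemma negligibleI:
  fixes I :: "nat \<Rightarrow> nat \<Rightarrow> 'i set" and Ed :: "nat \<Rightarrow> nat \<Rightarrow> 'i \<Rightarrow> nat set set set"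
  assumes p: "0 < p" "p < 1"
   and fin: "\<And>n w. finite (I n w)"
   and ev: "\<forall>\<^sub>F n in sequentially. \<forall>w\<in>{1..W n}. real (card (I n w)) \<le> exp (a n w) \<and>
    a n w + real w * x n \<le> - ln (1 - p) * g n w"
   and x: "filterlim x at_top sequentially"
  shows "negligible p (\<lambda>n. \<Union>w\<in>{1..W n}. {Ed n w i |i. i \<in> I n w \<and> g n w \<le> real (card (Ed n w i))})"
   (is "negligible p ?X")
proof -
  define J where "J = (\<lambda>n w. {i \<in> I n w. g n w \<le> real (card (Ed n w i))})"
  have fJ: "finite (J n w)" for n w using fin by (simp add: J_def)
  have X: "?X n = (\<Union>w\<in>{1..W n}. Ed n w ` J n w)" for n by (auto simp: J_def)
  have finX: "finite (?X n)" for n unfolding X using fJ by auto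
  have le: "\<forall>\<^sub>F n in sequentially. (\<Sum>E\<in>?X n. (1 - p) ^ card E) \<le> 2 * exp (- x n)"
   using ev filterlim_at_top[THEN iffD1, OF x, rule_format, of 1]
  proof eventually_elim
   case (elim n)
   define S where "S = Sigma {1..W n} (J n)"
   have fS: "finite S" using fJ by (simp add: S_def)
   have XS: "?X n = (\<lambda>(w, i). Ed n w i) ` S" unfolding X S_def by auto
   have nn: "0 \<le> (1 - p) ^ card ((\<lambda>(w, i). Ed n w i) z)" for z using p by simp
   have "(\<Sum>E\<in>?X n. (1 - p) ^ card E) \<le> (\<Sum>z\<in>S. (1 - p) ^ card ((\<lambda>(w, i). Ed n w i) z))"
    unfolding XS using sum_image_le[OF fS, of "\<lambda>E. (1 - p) ^ card E" "\<lambda>(w, i). Ed n w i"] nn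
    by (simp add: comp_def)
   also have "\<dots> = (\<Sum>(w, i)\<in>S. (1 - p) ^ card (Ed n w i))"
    by (rule sum.cong) auto
   also have "\<dots> = (\<Sum>w\<in>{1..W n}. \<Sum>i\<in>J n w. (1 - p) ^ card (Ed n w i))"
    unfolding S_def using fJ by (intro sum.Sigma[symmetric]) auto
   also have "\<dots> \<le> (\<Sum>w\<in>{1..W n}. exp (- x n) ^ w)"
   proof (rule sum_mono)
    fix w assume w: "w \<in> {1..W n}"
    have "(\<Sum>i\<in>J n w. (1 - p) ^ card (Ed n w i)) \<le> (\<Sum>i\<in>J n w. exp (ln (1 - p) * g n w))"
    proof (rule sum_mono)
     fix i assume i: "i \<in> J n w"
     have "(1 - p) ^ card (Ed n w i) = exp (ln (1 - p) * card (Ed n w i))"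
      using p by (simp add: exp_of_nat2_mult)
     also have "\<dots> \<le> exp (ln (1 - p) * g n w)"
      using i p by (auto simp: J_def intro!: mult_left_mono_neg)
     finally show "(1 - p) ^ card (Ed n w i) \<le> exp (ln (1 - p) * g n w)" .
    qed
    also have "\<dots> = card (J n w) * exp (ln (1 - p) * g n w)" by simp
    also have "\<dots> \<le> exp (a n w) * exp (ln (1 - p) * g n w)"
    proof (intro mult_right_mono)
     have "real (card (J n w)) \<le> card (I n w)"
      using fin by (intro of_nat_mono card_mono) (auto simp: J_def)
     then show "real (card (J n w)) \<le> exp (a n w)" using elim w by force
    qed simp
    also have "\<dots> = exp (a n w + ln (1 - p) * g n w)" by (simp add: exp_add)
    also have "\<dots> \<le> exp (real w * (- x n))"
    proof -
     have "a n w + real w * x n \<le> - ln (1 - p) * g n w" using elim w by blast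
     then show ?thesis by simp
    qed
    also have "\<dots> = exp (- x n) ^ w" by (rule exp_of_nat_mult)
    finally show "(\<Sum>i\<in>J n w. (1 - p) ^ card (Ed n w i)) \<le> exp (- x n) ^ w" .
   qed
   also have "\<dots> \<le> 2 * exp (- x n)"
   proof -
    define y where "y = exp (- x n)"
    have "y \<le> exp (-1)" using elim by (simp add: y_def)
    also have "exp (-1) \<le> (1/2 :: real)"
     using exp_ge_add_one_self[of "1::real"] by (simp add: exp_minus field_simps)
    finally have y: "0 < y" "y \<le> 1/2" by (auto simp: y_def)
    \<comment> \<open>The subtracted term makes the induction go through for y \<le> 1/2.\<close>
    have "(\<Sum>w\<in>{1..N}. y ^ w) \<le> 2 * y - 2 * y ^ Suc N" for N
    proof (induction N)
     case (Suc N)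
     have "y ^ Suc (Suc N) \<le> 1/2 * y ^ Suc N" using y by simp
     moreover have "(\<Sum>w\<in>{1..Suc N}. y ^ w) = (\<Sum>w\<in>{1..N}. y ^ w) + y ^ Suc N" by simp
     ultimately show ?case using Suc by linarith
    qed (use y in simp)
    moreover have "y ^ Suc (W n) \<ge> 0" using y by simp
    moreover have "(\<Sum>w\<in>{1..W n}. y ^ w) \<le> 2 * y - 2 * y ^ Suc (W n)" by fact
    ultimately have "(\<Sum>w\<in>{1..W n}. y ^ w) \<le> 2 * y" by linarith
    then show ?thesis by (simp add: y_def)
   qed
   finally show ?case .
  qed
  have "(\<lambda>n. 2 * exp (- x n)) \<longlonglongrightarrow> 2 * 0"
   by (intro tendsto_mult tendsto_const filterlim_compose[OF exp_at_bot])
    (use x in \<open>simp add: filterlim_uminus_at_bot\<close>)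
  then have lim: "(\<lambda>n. 2 * exp (- x n)) \<longlonglongrightarrow> 0" by simp
  have ge: "\<forall>\<^sub>F n in sequentially. 0 \<le> (\<Sum>E\<in>?X n. (1 - p) ^ card E)"
   using p by (intro always_eventually allI sum_nonneg) simp
  have "(\<lambda>n. \<Sum>E\<in>?X n. (1 - p) ^ card E) \<longlonglongrightarrow> 0"
   by (rule tendsto_sandwich[OF ge le tendsto_const lim])
  then show ?thesis unfolding negligible_def using finX by blast
qed

section \<open>Parity proof of Tucker's lemma by counting alternating simplices\<close>

section \<open>Tucker's lemma for the cross-polytope\<close>

fun alt :: "bool \<Rightarrow> bool list \<Rightarrow> bool" where
  "alt b [] = True"
| "alt b (x # xs) = (x = b \<and> alt (\<not> b) xs)"

definition delnth :: "nat \<Rightarrow> 'a list \<Rightarrow> 'a list" where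
  "delnth i xs = take i xs @ drop (Suc i) xs"

lemma delnth_0 [simp]: "delnth 0 (x # xs) = xs"
  and delnth_Suc [simp]: "delnth (Suc i) (x # xs) = x # delnth i xs"
  by (simp_all add: delnth_def)

lemma map_delnth: "map f (delnth i xs) = delnth i (map f xs)"
  by (simp add: delnth_def take_map drop_map)

lemma mset_delnth: "i < length xs \<Longrightarrow> mset (delnth i xs) = mset xs - {#xs ! i#}"
proof -
  assume "i < length xs"
  then have "mset xs = mset (take i xs @ xs ! i # drop (Suc i) xs)" by (simp only: id_take_nth_drop[symmetric])
  then show ?thesis by (simp add: delnth_def)
qed

lemma set_delnth: "set (delnth i xs) \<subseteq> set xs"
  using set_take_subset set_drop_subset by (fastforce simp: delnth_def)

lemma sorted_delnth: "sorted xs \<Longrightarrow> sorted (delnth i xs)"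
proof (induction xs arbitrary: i)
  case (Cons x xs)
  show ?case
  proof (cases i)
   case (Suc j)
   then show ?thesis using Cons set_delnth[of j xs] by auto
  qed (use Cons in simp)
qed (simp add: delnth_def)

lemma alt_exclusive: "xs \<noteq> [] \<Longrightarrow> alt b xs \<Longrightarrow> \<not> alt (\<not> b) xs"
  by (cases xs) auto

lemma alt_nth: "alt b xs \<Longrightarrow> Suc i < length xs \<Longrightarrow> xs ! i \<noteq> xs ! Suc i"
proof (induction b xs arbitrary: i rule: alt.induct)
  case (2 b x xs)
  then show ?case by (cases i; cases xs) auto
qed simp

text \<open>An alternating word admits exactly one such deletion, at its last place if it starts
  with b and at its first place otherwise. A word starting with b that has a single pair of equal
  neighbours admits two, and all other words admit none.\<close>

lemma odd_alt_deletions: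
  "xs \<noteq> [] \<Longrightarrow> odd (\<Sum>i<length xs. of_bool (alt b (delnth i xs)) :: nat) \<longleftrightarrow> alt b xs \<or> alt (\<not> b) xs"
proof (induction b xs rule: alt.induct)
  case (2 b x xs)
  have *: "(\<Sum>i<length (x # xs). of_bool (alt b (delnth i (x # xs))) :: nat)
   = of_bool (alt b xs) + (\<Sum>i<length xs. of_bool (x = b \<and> alt (\<not> b) (delnth i xs)))"
   by (simp add: sum.lessThan_Suc_shift del: sum.lessThan_Suc)
  show ?case
  proof (cases "xs = []")
   case False
   then have ex: "\<not> (alt b xs \<and> alt (\<not> b) xs)" using alt_exclusive by blast
   show ?thesis
   proof (cases "x = b")
    case True
    then show ?thesis using 2(1)[OF False] ex unfolding * by auto
   next
    case False
    then show ?thesis unfolding * by auto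
   qed
  qed auto
qed simp

text \<open>Sorting by this key is sorting by absolute value, a positive label before the negative
  one of the same size. The key is injective, so the sorted list depends only on the multiset of
  labels.\<close>

definition lkey :: "int \<Rightarrow> nat" where
  "lkey y = 2 * nat \<bar>y\<bar> + (if y < 0 then 1 else 0)"

lemma inj_lkey: "inj_on lkey A"
proof (rule inj_onI)
  fix x y assume "lkey x = lkey y"
  moreover have "lkey z mod 2 = (if z < 0 then 1 else 0)" "lkey z div 2 = nat \<bar>z\<bar>" for z
   by (auto simp: lkey_def)
  ultimately have "(if x < 0 then 1 else 0 :: nat) = (if y < 0 then 1 else 0)" "nat \<bar>x\<bar> = nat \<bar>y\<bar>"
   by metis+
  then show "x = y" by (simp split: if_splits)
qed

text \<open>The alternating simplices of Ky Fan's lemma: read by increasing absolute value, the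
  labels alternate in sign, and b tells whether the smallest is positive.\<close>

definition palt :: "bool \<Rightarrow> int list \<Rightarrow> bool" where
  "palt b ys = alt b (map (\<lambda>y. y > 0) (sort_key lkey ys))"

lemma sort_key_lkey_eq: "mset xs = mset ys \<Longrightarrow> sort_key lkey xs = sort_key lkey ys"
  by (rule sort_key_inj_key_eq) (auto simp: inj_lkey)

lemma palt_cong: "mset xs = mset ys \<Longrightarrow> palt b xs = palt b ys"
  using sort_key_lkey_eq[of xs ys] by (simp add: palt_def)

lemma palt_exclusive:
  assumes "ys \<noteq> []" "palt b ys"
  shows "\<not> palt (\<not> b) ys"
proof -
  have "length (map (\<lambda>y. y > 0) (sort_key lkey ys)) \<noteq> 0" using assms(1) by simp
  then have "map (\<lambda>y. y > 0) (sort_key lkey ys) \<noteq> []" by (metis length_0_conv)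
  from alt_exclusive[OF this] show ?thesis using assms(2) unfolding palt_def by blast
qed

text \<open>Deletions in a list and in its sorted version correspond up to reordering, since the
  deleted entry determines the result as a multiset. This carries \<open>odd_alt_deletions\<close>
  from sorted words to label lists.\<close>

lemma card_delnth_mset:
  "card {i. i < length ys \<and> Q (mset (delnth i ys))} = size (filter_mset (\<lambda>y. Q (mset ys - {#y#})) (mset ys))"
proof -
  have "size (filter_mset (\<lambda>y. Q (mset ys - {#y#})) (mset ys)) = length (filter (\<lambda>y. Q (mset ys - {#y#})) ys)"
   by (metis mset_filter size_mset)
  also have "\<dots> = card {i. i < length ys \<and> Q (mset ys - {#ys ! i#})}"
   by (simp add: length_filter_conv_card)
  also have "{i. i < length ys \<and> Q (mset ys - {#ys ! i#})} = {i. i < length ys \<and> Q (mset (delnth i ys))}"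
   by (intro Collect_cong conj_cong refl) (simp add: mset_delnth)
  finally show ?thesis by simp
qed

lemma odd_palt_deletions:
  assumes "ys \<noteq> []"
  shows "odd (card {i. i < length ys \<and> palt b (delnth i ys)}) \<longleftrightarrow> palt b ys \<or> palt (\<not> b) ys"
proof -
  define zs where "zs = sort_key lkey ys"
  define Q where "Q = (\<lambda>M. \<exists>xs. mset xs = M \<and> palt b xs)"
  have Q: "Q (mset xs) = palt b xs" for xs unfolding Q_def using palt_cong by blast
  have mz: "mset zs = mset ys" by (simp add: zs_def)
  have ne: "map (\<lambda>y. y > 0) zs \<noteq> []"
  proof -
   have "length zs = length ys" by (simp add: zs_def)
   then show ?thesis using assms by (cases zs) auto
  qed
  have sorted: "sorted (map lkey zs)" by (simp add: zs_def)
  have del: "palt b (delnth i zs) = alt b (delnth i (map (\<lambda>y. y > 0) zs))" if "i < length zs" for i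
  proof -
   have "sorted (map lkey (delnth i zs))"
    using sorted_delnth[OF sorted] by (simp add: map_delnth)
   then have "sort_key lkey (delnth i zs) = delnth i zs"
    by (intro sort_key_inj_key_eq) (auto simp: inj_lkey)
   then show ?thesis by (simp add: palt_def map_delnth)
  qed
  have "card {i. i < length ys \<and> palt b (delnth i ys)} = card {i. i < length zs \<and> palt b (delnth i zs)}"
   using card_delnth_mset[of ys Q] card_delnth_mset[of zs Q] by (simp add: Q mz)
  also have "\<dots> = card {i. i < length zs \<and> alt b (delnth i (map (\<lambda>y. y > 0) zs))}"
   using del by (intro arg_cong[of _ _ card]) auto
  also have "\<dots> = (\<Sum>i<length (map (\<lambda>y. y > 0) zs). of_bool (alt b (delnth i (map (\<lambda>y. y > 0) zs))))"
   by (simp add: Int_def conj_commute flip: sum.inter_filter)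
  finally show ?thesis
   using odd_alt_deletions[OF ne, of b] by (simp add: palt_def zs_def)
qed

lemma even_card_involution:
  assumes "finite S" "\<And>x. x \<in> S \<Longrightarrow> h x \<in> S" "\<And>x. x \<in> S \<Longrightarrow> h (h x) = x" "\<And>x. x \<in> S \<Longrightarrow> h x \<noteq> x"
  shows "even (card S)"
  using assms
proof (induction "card S" arbitrary: S rule: less_induct)
  case less
  show ?case
  proof (cases "S = {}")
   case False
   then obtain x where x: "x \<in> S" by auto
   define T where "T = S - {x, h x}"
   have hx: "h x \<in> S" "h x \<noteq> x" "h (h x) = x" using less x by auto
   have sub: "{x, h x} \<subseteq> S" using x hx by auto
   have c: "card S = card T + 2"
    using card_Diff_subset[OF _ sub] card_mono[OF less(2) sub] hx by (simp add: T_def)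
   have "h y \<in> T" if "y \<in> T" for y
    using that less(3,4) hx unfolding T_def by (metis Diff_iff insert_iff singletonD)
   then have "even (card T)"
    using less c by (intro less(1)) (auto simp: T_def)
   then show ?thesis using c by simp
  qed simp
qed

text \<open>A face of the boundary of the N-dimensional cross-polytope: a nonempty partial
  assignment of signs to coordinates, stored as its graph.\<close>

definition signvec :: "nat \<Rightarrow> (nat \<times> bool) set \<Rightarrow> bool" where
  "signvec N X \<longleftrightarrow> X \<noteq> {} \<and> X \<subseteq> {..<N} \<times> UNIV \<and> inj_on fst X"

definition flip :: "nat \<times> bool \<Rightarrow> nat \<times> bool" where
  "flip z = (fst z, \<not> snd z)"

lemma flip_flip [simp]: "flip (flip z) = z" and fst_flip [simp]: "fst (flip z) = fst z"
  and snd_flip [simp]: "snd (flip z) = (\<not> snd z)" and flip_neq [simp]: "flip z \<noteq> z"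
  by (auto simp: flip_def prod_eq_iff)

text \<open>A maximal chain of faces of the d-dimensional cross-polytope, encoded by the order in
  which the signed coordinates are added; its prefixes form the chain. For d = 0 there is just the
  empty list, which starts the induction on the dimension.\<close>

definition flags :: "nat \<Rightarrow> (nat \<times> bool) list set" where
  "flags d = {xs. length xs = d \<and> distinct (map fst xs) \<and> fst ` set xs = {..<d}}"

text \<open>Maximal simplices of the upper hemisphere of the d-sphere, where coordinate d is
  positive. The equator is the sphere triangulated by \<open>flags d\<close>.\<close>

definition hemi :: "nat \<Rightarrow> (nat \<times> bool) list set" where
  "hemi d = {xs \<in> flags (Suc d). (d, True) \<in> set xs}"

definition labels :: "((nat \<times> bool) set \<Rightarrow> int) \<Rightarrow> (nat \<times> bool) list \<Rightarrow> int list" where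
  "labels lam xs = map (\<lambda>i. lam (set (take (Suc i) xs))) [0..<length xs]"

lemma length_labels [simp]: "length (labels lam xs) = length xs"
  by (simp add: labels_def)

lemma finite_flags [simp]: "finite (flags d)"
proof (rule finite_subset)
  show "flags d \<subseteq> {xs. set xs \<subseteq> {..<d} \<times> UNIV \<and> length xs = d}"
   unfolding flags_def by (force simp: image_subset_iff)
  show "finite {xs. set xs \<subseteq> {..<d} \<times> (UNIV :: bool set) \<and> length xs = d}"
   by (rule finite_lists_length_eq) auto
qed

lemma finite_hemi [simp]: "finite (hemi d)"
  by (rule finite_subset[OF _ finite_flags[of "Suc d"]]) (auto simp: hemi_def)

lemma delnth_labels_cong:
  assumes "length xs = length ys" "\<And>j. j < length xs \<Longrightarrow> j \<noteq> i \<Longrightarrow> set (take (Suc j) xs) = set (take (Suc j) ys)"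
  shows "delnth i (labels lam xs) = delnth i (labels lam ys)"
proof (rule nth_equalityI)
  show "length (delnth i (labels lam xs)) = length (delnth i (labels lam ys))"
   using assms(1) by (simp add: delnth_def)
  fix j assume "j < length (delnth i (labels lam xs))"
  then show "delnth i (labels lam xs) ! j = delnth i (labels lam ys) ! j"
   using assms by (auto simp: delnth_def nth_append labels_def min_def split: if_splits)
qed

definition swap_adj :: "nat \<Rightarrow> 'a list \<Rightarrow> 'a list" where
  "swap_adj i xs = xs[i := xs ! Suc i, Suc i := xs ! i]"

lemma set_take_swap_adj:
  assumes "Suc i < length xs" "j \<noteq> i"
  shows "set (take (Suc j) (swap_adj i xs)) = set (take (Suc j) xs)"
proof (cases "j < i")
  case True
  then show ?thesis by (simp add: swap_adj_def take_update_cancel)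
next
  case False
  with assms have "Suc i < Suc j" by simp
  then have "mset (take (Suc j) (swap_adj i xs)) = mset (take (Suc j) xs)"
  proof -
   have "take (Suc j) (swap_adj i xs) = (take (Suc j) xs)[i := take (Suc j) xs ! Suc i, Suc i := take (Suc j) xs ! i]"
    using \<open>Suc i < Suc j\<close> by (simp add: swap_adj_def take_update_swap)
   also have "mset \<dots> = mset (take (Suc j) xs)"
    using \<open>Suc i < Suc j\<close> assms by (intro mset_swap) auto
   finally show ?thesis .
  qed
  then show ?thesis by (metis set_mset_mset)
qed

lemma swap_adj_props:
  assumes "Suc i < length xs"
  shows "mset (swap_adj i xs) = mset xs" "length (swap_adj i xs) = length xs"
   "swap_adj i (swap_adj i xs) = xs"
proof -
  show "mset (swap_adj i xs) = mset xs" using assms by (simp add: swap_adj_def mset_swap)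
  show "length (swap_adj i xs) = length xs" by (simp add: swap_adj_def)
  show "swap_adj i (swap_adj i xs) = xs"
   using assms by (intro nth_equalityI) (auto simp: swap_adj_def nth_list_update)
qed

lemma flags_mset: "mset xs = mset ys \<Longrightarrow> xs \<in> flags d \<longleftrightarrow> ys \<in> flags d"
proof -
  assume m: "mset xs = mset ys"
  then have "mset (map fst xs) = mset (map fst ys)" by (metis mset_map)
  then have "distinct (map fst xs) = distinct (map fst ys)" by (rule mset_eq_imp_distinct_iff)
  moreover have "length xs = length ys" "set xs = set ys"
   using m by (auto dest: mset_eq_length mset_eq_setD)
  ultimately show ?thesis by (simp add: flags_def)
qed

lemma hemi_mset: "mset xs = mset ys \<Longrightarrow> xs \<in> hemi d \<longleftrightarrow> ys \<in> hemi d"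
  unfolding hemi_def using flags_mset mset_eq_setD by blast

lemma signvec_prefix:
  assumes "xs \<in> flags d" "d \<le> N" "j < d"
  shows "signvec N (set (take (Suc j) xs))"
proof -
  have len: "length xs = d" and dist: "distinct (map fst xs)" and im: "fst ` set xs = {..<d}"
   using assms(1) by (auto simp: flags_def)
  have "take (Suc j) xs \<noteq> []" using len assms(3) by auto
  moreover have "set xs \<subseteq> {..<N} \<times> UNIV"
  proof
   fix z assume "z \<in> set xs"
   then have "fst z \<in> {..<d}" using im by blast
   then show "z \<in> {..<N} \<times> UNIV" using assms(2) by (simp add: mem_Times_iff)
  qed
  moreover have "inj_on fst (set xs)" using dist by (simp add: distinct_map)
  ultimately show ?thesis
   unfolding signvec_def using set_take_subset[of "Suc j" xs] by (meson inj_on_subset order_trans set_empty)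
qed

context
  fixes N :: nat and lam :: "(nat \<times> bool) set \<Rightarrow> int"
  assumes anti: "\<And>X. signvec N X \<Longrightarrow> lam (flip ` X) = - lam X"
   and nz: "\<And>X. signvec N X \<Longrightarrow> lam X \<noteq> 0"
   and compl: "\<And>X Y. signvec N X \<Longrightarrow> signvec N Y \<Longrightarrow> X \<subseteq> Y \<Longrightarrow> lam X \<noteq> - lam Y"
begin

definition cnt :: "nat \<Rightarrow> nat" where
  "cnt d = card {xs \<in> flags d. palt True (labels lam xs)}"

definition hcnt :: "nat \<Rightarrow> bool \<Rightarrow> nat" where
  "hcnt d b = card {xs \<in> hemi d. palt b (labels lam xs)}"

lemma map_flip_flags: "map flip xs \<in> flags d \<longleftrightarrow> xs \<in> flags d"
  by (simp add: flags_def image_image comp_def)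

lemma labels_flip:
  assumes "xs \<in> flags d" "d \<le> N"
  shows "labels lam (map flip xs) = map uminus (labels lam xs)"
proof -
  have "lam (set (take (Suc i) (map flip xs))) = - lam (set (take (Suc i) xs))" if "i < length xs" for i
   using anti[OF signvec_prefix[OF assms, of i]] that assms(1) by (simp add: take_map flags_def)
  then show ?thesis by (simp add: labels_def)
qed

lemma labels_nz: "xs \<in> flags d \<Longrightarrow> d \<le> N \<Longrightarrow> 0 \<notin> set (labels lam xs)"
  using nz[OF signvec_prefix] by (force simp: labels_def flags_def)

lemma alt_map_not: "alt b (map Not xs) = alt (\<not> b) xs"
  by (induction xs arbitrary: b) auto

lemma labels_no_compl:
  assumes "xs \<in> flags d" "d \<le> N" "x \<in> set (labels lam xs)"
  shows "- x \<notin> set (labels lam xs)"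
proof
  assume "- x \<in> set (labels lam xs)"
  then obtain i j where ij: "i < d" "j < d" "x = lam (set (take (Suc i) xs))" "- x = lam (set (take (Suc j) xs))"
   using assms by (auto simp: labels_def flags_def)
  have sv: "signvec N (set (take (Suc i) xs))" "signvec N (set (take (Suc j) xs))"
   using ij assms signvec_prefix by auto
  have "set (take (Suc i) xs) \<subseteq> set (take (Suc j) xs) \<or> set (take (Suc j) xs) \<subseteq> set (take (Suc i) xs)"
   using set_take_subset_set_take[of "Suc i" "Suc j" xs] set_take_subset_set_take[of "Suc j" "Suc i" xs]
   by (meson nat_le_linear)
  then show False using compl[OF sv] compl[OF sv(2,1)] ij by fastforce
qed

text \<open>Negation could reverse the order only of two labels y and -y, which do not occur
  together. So the sorted list is negated entrywise and only its first sign changes.\<close>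

lemma palt_uminus:
  assumes "0 \<notin> set ys" "\<And>y. y \<in> set ys \<Longrightarrow> - y \<notin> set ys"
  shows "palt b (map uminus ys) \<longleftrightarrow> palt (\<not> b) ys"
proof -
  define zs where "zs = sort_key lkey ys"
  have "sorted (map lkey (map uminus zs))"
   unfolding map_map sorted_map
  proof (rule sorted_wrt_mono_rel)
   show "sorted_wrt (\<lambda>x y. lkey x \<le> lkey y) zs"
    using sorted_sort_key[of lkey ys] unfolding sorted_map by (simp add: zs_def)
   fix x y assume "x \<in> set zs" "y \<in> set zs" "lkey x \<le> lkey y"
   then have "x \<in> set ys" "y \<in> set ys" by (simp_all add: zs_def)
   then have "x \<noteq> - y" "x \<noteq> 0" "y \<noteq> 0" using assms by auto
   with \<open>lkey x \<le> lkey y\<close> show "(lkey \<circ> uminus) x \<le> (lkey \<circ> uminus) y"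
    by (auto simp: lkey_def split: if_splits)
  qed
  then have "sort_key lkey (map uminus ys) = map uminus zs"
   by (intro sort_key_inj_key_eq) (auto simp: inj_lkey zs_def)
  moreover have "map (\<lambda>y. y > 0) (map uminus zs) = map Not (map (\<lambda>y. y > 0) zs)"
   using assms(1) by (auto simp: zs_def) (metis linorder_neqE_linordered_idom)+
  ultimately show ?thesis by (simp add: palt_def alt_map_not zs_def del: map_map)
qed

text \<open>The flip of all signs maps the lower hemisphere onto the upper one and, by antipodality,
  exchanges the two kinds of alternation. So positive alternation on the whole sphere amounts to
  alternation of either kind on the upper hemisphere.\<close>

lemma cnt_hcnt:
  assumes "Suc d \<le> N"
  shows "cnt (Suc d) = hcnt d True + hcnt d False"
proof -
  define A where "A = {xs \<in> hemi d. palt True (labels lam xs)}"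
  define B where "B = {xs \<in> hemi d. palt False (labels lam xs)}"
  have uminus_labels: "palt b (map uminus (labels lam xs)) \<longleftrightarrow> palt (\<not> b) (labels lam xs)"
   if "xs \<in> flags (Suc d)" for xs b
   using labels_nz[OF that assms] labels_no_compl[OF that assms] by (rule palt_uminus)
  have mem: "(d, True) \<in> set xs \<longleftrightarrow> (d, False) \<notin> set xs" if "xs \<in> flags (Suc d)" for xs
  proof -
   have "d \<in> fst ` set xs" and inj: "inj_on fst (set xs)"
    using that by (auto simp: flags_def distinct_map)
   then obtain b where "(d, b) \<in> set xs" by auto
   then show ?thesis using inj by (cases b) (auto dest: inj_onD[of fst "set xs" "(d, True)" "(d, False)"])
  qed
  have eq: "{xs \<in> flags (Suc d). palt True (labels lam xs)} = A \<union> map flip ` B"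
  proof (intro equalityI subsetI)
   fix xs assume xs: "xs \<in> {xs \<in> flags (Suc d). palt True (labels lam xs)}"
   show "xs \<in> A \<union> map flip ` B"
   proof (cases "(d, True) \<in> set xs")
    case True
    then show ?thesis using xs by (auto simp: A_def hemi_def)
   next
    case False
    define ys where "ys = map flip xs"
    have "(d, False) \<in> set xs" using mem xs False by auto
    then have "(d, True) \<in> set ys" by (force simp: ys_def flip_def)
    moreover have "ys \<in> flags (Suc d)" using xs by (simp add: ys_def map_flip_flags)
    moreover have "palt False (labels lam ys)"
     using xs labels_flip[of xs "Suc d"] assms uminus_labels[of xs] by (simp add: ys_def)
    moreover have "xs = map flip ys" by (simp add: ys_def comp_def)
    ultimately show ?thesis by (auto simp: B_def hemi_def)
   qed
  next
   fix xs assume "xs \<in> A \<union> map flip ` B"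
   then consider "xs \<in> A" | ys where "ys \<in> B" "xs = map flip ys" by auto
   then show "xs \<in> {xs \<in> flags (Suc d). palt True (labels lam xs)}"
   proof cases
    case 1
    then show ?thesis by (auto simp: A_def hemi_def)
   next
    case 2
    then show ?thesis
     using labels_flip[of ys "Suc d"] assms uminus_labels[of ys]
     by (simp add: B_def hemi_def map_flip_flags)
   qed
  qed
  have "A \<inter> map flip ` B = {}"
  proof -
   have "(d, True) \<in> set xs" if "xs \<in> A" for xs using that by (simp add: A_def hemi_def)
   moreover have "(d, False) \<in> set xs" if "xs \<in> map flip ` B" for xs
    using that by (force simp: B_def hemi_def flip_def)
   ultimately show ?thesis using mem by (fastforce simp: A_def hemi_def)
  qed
  then have "card (A \<union> map flip ` B) = card A + card (map flip ` B)"
   by (intro card_Un_disjoint) (auto simp: A_def B_def)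
  also have "card (map flip ` B) = card B"
  proof -
   have "inj flip" by (rule injI) (metis flip_flip)
   then have "inj (map flip)" by simp
   then show ?thesis by (meson card_image inj_on_subset subset_UNIV)
  qed
  finally show ?thesis by (simp add: cnt_def hcnt_def eq A_def B_def)
qed

text \<open>Incidences of a maximal simplex of the hemisphere with a facet of it, obtained by
  dropping level i, whose labels alternate starting with a positive one. Counting them by simplices
  and by facets gives the parity argument.\<close>

definition pairs :: "nat \<Rightarrow> ((nat \<times> bool) list \<times> nat) set" where
  "pairs d = {(xs, i). xs \<in> hemi d \<and> i < Suc d \<and> palt True (delnth i (labels lam xs))}"

lemma pairs_eq: "pairs d = Sigma (hemi d) (\<lambda>xs. {i. i < Suc d \<and> palt True (delnth i (labels lam xs))})"
  by (auto simp: pairs_def)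

lemma finite_pairs [simp]: "finite (pairs d)"
  unfolding pairs_eq by auto

text \<open>The count by simplices: by \<open>odd_palt_deletions\<close> a simplex lies in an odd
  number of incidences exactly when its own labels alternate, with either first sign.\<close>

lemma odd_pairs_hcnt: "odd (card (pairs d)) \<longleftrightarrow> odd (hcnt d True + hcnt d False)"
proof -
  have "odd (card (pairs d)) \<longleftrightarrow>
    odd (\<Sum>xs\<in>hemi d. card {i. i < Suc d \<and> palt True (delnth i (labels lam xs))})"
   unfolding pairs_eq by (subst card_SigmaI) auto
  also have "\<dots> \<longleftrightarrow> odd (card {xs \<in> hemi d. odd (card {i. i < Suc d \<and> palt True (delnth i (labels lam xs))})})"
   by (simp add: even_sum_iff)
  also have "{xs \<in> hemi d. odd (card {i. i < Suc d \<and> palt True (delnth i (labels lam xs))})}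
   = {xs \<in> hemi d. palt True (labels lam xs)} \<union> {xs \<in> hemi d. palt False (labels lam xs)}"
  proof -
   have "odd (card {i. i < Suc d \<and> palt True (delnth i (labels lam xs))}) \<longleftrightarrow>
     palt True (labels lam xs) \<or> palt False (labels lam xs)" if "xs \<in> hemi d" for xs
   proof -
    have "length (labels lam xs) = Suc d" using that by (simp add: hemi_def flags_def)
    then have "labels lam xs \<noteq> []" by (metis list.size(3) nat.distinct(1))
    from odd_palt_deletions[OF this, of True] show ?thesis
     using \<open>length (labels lam xs) = Suc d\<close> by simp
   qed
   then show ?thesis by auto
  qed
  also have "card \<dots> = hcnt d True + hcnt d False"
  proof -
   have "{xs \<in> hemi d. palt True (labels lam xs)} \<inter> {xs \<in> hemi d. palt False (labels lam xs)} = {}"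
   proof -
    have "\<not> palt False (labels lam xs)" if "xs \<in> hemi d" "palt True (labels lam xs)" for xs
    proof -
     have "length (labels lam xs) = Suc d" using that by (simp add: hemi_def flags_def)
     then have "labels lam xs \<noteq> []" by (metis list.size(3) nat.distinct(1))
     from palt_exclusive[OF this that(2)] show ?thesis by simp
    qed
    then show ?thesis by auto
   qed
   then show ?thesis unfolding hcnt_def by (intro card_Un_disjoint) auto
  qed
  finally show ?thesis .
qed

text \<open>The facets in the equator: the last entry added is (d, True), and dropping the top level
  leaves a maximal chain in the first d coordinates.\<close>

definition ends :: "nat \<Rightarrow> ((nat \<times> bool) list \<times> nat) set" where
  "ends d = (\<lambda>xs. (xs @ [(d, True)], d)) ` {xs \<in> flags d. palt True (labels lam xs)}"

lemma labels_snoc: "labels lam (xs @ [z]) = labels lam xs @ [lam (set (xs @ [z]))]"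
  by (simp add: labels_def)

lemma delnth_last: "delnth (length xs) (xs @ [z]) = xs"
  by (simp add: delnth_def)

lemma snoc_flags: "xs @ [(d, b)] \<in> flags (Suc d) \<longleftrightarrow> xs \<in> flags d"
proof
  assume a: "xs @ [(d, b)] \<in> flags (Suc d)"
  then have len: "length xs = d" and dist: "distinct (map fst xs)" and nd: "d \<notin> fst ` set xs"
   and im: "insert d (fst ` set xs) = {..<Suc d}"
   by (auto simp: flags_def)
  from im nd have "fst ` set xs = {..<d}" by (auto simp: lessThan_Suc)
  with len dist show "xs \<in> flags d" by (simp add: flags_def)
next
  assume "xs \<in> flags d"
  then show "xs @ [(d, b)] \<in> flags (Suc d)" by (auto simp: flags_def lessThan_Suc)
qed

lemma ends_subset: "ends d \<subseteq> pairs d"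
proof
  fix z assume "z \<in> ends d"
  then obtain xs where xs: "z = (xs @ [(d, True)], d)" "xs \<in> flags d" "palt True (labels lam xs)"
   by (auto simp: ends_def)
  then have "delnth d (labels lam (xs @ [(d, True)])) = labels lam xs"
   using delnth_last[of "labels lam xs"] by (simp add: labels_snoc flags_def)
  then show "z \<in> pairs d" using xs by (simp add: pairs_def hemi_def snoc_flags)
qed

lemma card_ends: "card (ends d) = cnt d"
  unfolding ends_def cnt_def by (intro card_image inj_onI) auto

text \<open>Two maximal flags of a hemisphere that share all but one level: they differ by an adjacent
  transposition, or by the sign of the last entry. Only the flags in \<open>ends\<close> lie on the boundary.\<close>

definition partner :: "nat \<Rightarrow> (nat \<times> bool) list \<times> nat \<Rightarrow> (nat \<times> bool) list \<times> nat" where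
  "partner d = (\<lambda>(xs, i). if i < d then (swap_adj i xs, i) else (xs[d := flip (xs ! d)], d))"

lemma partner_props:
  assumes z: "z \<in> pairs d - ends d"
  shows "partner d z \<in> pairs d - ends d \<and> partner d (partner d z) = z \<and> partner d z \<noteq> z"
proof -
  obtain xs i where zi: "z = (xs, i)" by fastforce
  have xs: "xs \<in> hemi d" and i: "i < Suc d" and pa: "palt True (delnth i (labels lam xs))"
   using z by (auto simp: zi pairs_def)
  have len: "length xs = Suc d" and dist: "distinct (map fst xs)"
   using xs by (auto simp: hemi_def flags_def)
  show ?thesis
  proof (cases "i < d")
   case True
   have sl: "Suc i < length xs" using True len by simp
   have "swap_adj i xs \<in> hemi d" using xs hemi_mset swap_adj_props(1)[OF sl] by blast
   moreover have "delnth i (labels lam (swap_adj i xs)) = delnth i (labels lam xs)"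
    using set_take_swap_adj[OF sl] swap_adj_props(2)[OF sl] by (intro delnth_labels_cong) auto
   moreover have "swap_adj i xs \<noteq> xs"
   proof
    assume "swap_adj i xs = xs"
    then have "xs ! i = xs ! Suc i"
     using sl by (metis swap_adj_def Suc_lessD length_list_update n_not_Suc_n nth_list_update_eq nth_list_update_neq)
    then show False using dist sl by (metis Suc_lessD distinct_map n_not_Suc_n nth_eq_iff_index_eq)
   qed
   ultimately show ?thesis
    using True pa swap_adj_props(3)[OF sl] i by (auto simp: partner_def zi pairs_def ends_def)
  next
   case False
   then have id: "i = d" using i by simp
   define ys where "ys = butlast xs"
   have xsy: "xs = ys @ [xs ! d]" using len by (metis ys_def append_butlast_last_id diff_Suc_1 last_conv_nth length_0_conv nat.distinct(1))
   have ly: "length ys = d" using len by (simp add: ys_def)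
   have del: "delnth d (labels lam (ys @ [w])) = labels lam ys" for w
    using delnth_last[of "labels lam ys"] ly by (simp add: labels_snoc)
   \<comment> \<open>A last entry (d, True) would put the facet into the equator, the case removed
     with \<open>ends\<close>.\<close>
   have nl: "xs ! d \<noteq> (d, True)"
   proof
    assume a: "xs ! d = (d, True)"
    then have "ys \<in> flags d" using xs xsy snoc_flags[of ys d True] by (simp add: hemi_def)
    moreover have "palt True (labels lam ys)" using pa del[of "xs ! d"] xsy id by simp
    ultimately have "z \<in> ends d" using a xsy id by (auto simp: ends_def zi)
    then show False using z by simp
   qed
   \<comment> \<open>Coordinate d has its positive sign somewhere before the last place, so the sign
     of the last entry can be changed without leaving the hemisphere.\<close>
   have f: "fst (xs ! d) \<noteq> d"
   proof
    assume a: "fst (xs ! d) = d"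
    have "(d, True) \<in> set xs" using xs by (simp add: hemi_def)
    moreover have "xs ! d \<in> set xs" using len by simp
    moreover have "inj_on fst (set xs)" using dist by (simp add: distinct_map)
    ultimately have "xs ! d = (d, True)" using a by (metis inj_onD fst_conv)
    then show False using nl by simp
   qed
   define xs' where "xs' = xs[d := flip (xs ! d)]"
   have xs': "xs' = ys @ [flip (xs ! d)]"
    unfolding xs'_def using ly by (subst xsy) (simp only: list_update_append, simp)
   have "map fst xs = map fst (ys @ [xs ! d])" by (rule arg_cong[OF xsy])
   then have mf: "map fst xs' = map fst xs" by (simp add: xs')
   have "xs' \<in> flags (Suc d)"
   proof -
    have "length xs' = Suc d" "fst ` set xs' = fst ` set xs"
     using len mf by (simp_all add: xs'_def flip: set_map)
    then show ?thesis using xs dist mf by (simp add: hemi_def flags_def)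
   qed
   moreover have "(d, True) \<in> set xs'"
   proof -
    have "(d, True) \<in> set (ys @ [xs ! d])" using xs xsy by (simp add: hemi_def)
    then show ?thesis using nl by (auto simp: xs')
   qed
   moreover have "palt True (delnth d (labels lam xs'))"
    using pa del[of "xs ! d"] del[of "flip (xs ! d)"] xsy xs' id by simp
   ultimately have "(xs', d) \<in> pairs d" by (simp add: pairs_def hemi_def)
   moreover have "xs' ! d = flip (xs ! d)" using len by (simp add: xs'_def)
   moreover have "(xs', d) \<notin> ends d"
   proof
    assume "(xs', d) \<in> ends d"
    then have "flip (xs ! d) = (d, True)" by (auto simp: ends_def xs')
    then show False using f by (metis fst_conv fst_flip)
   qed
   moreover have "xs'[d := flip (xs' ! d)] = xs" using len by (simp add: xs'_def)
   moreover have "xs' \<noteq> xs" using calculation(2) by (metis flip_neq)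
   ultimately show ?thesis by (simp add: partner_def zi id xs'_def[symmetric])
  qed
qed

text \<open>Facets off the equator lie in exactly two simplices and cancel modulo 2; those in the
  equator are counted by \<open>cnt d\<close>. Hence cnt (Suc d), the count over the hemisphere and
  cnt d agree modulo 2, and the induction starts with the single empty chain.\<close>

lemma odd_cnt: "d \<le> N \<Longrightarrow> odd (cnt d)"
proof (induction d)
  case 0
  have "{xs \<in> flags 0. palt True (labels lam xs)} = {[]}"
   by (auto simp: flags_def palt_def labels_def)
  then show ?case by (simp add: cnt_def)
next
  case (Suc d)
  have "even (card (pairs d - ends d))"
   using partner_props by (intro even_card_involution[of _ "partner d"]) auto
  then have "odd (card (pairs d)) \<longleftrightarrow> odd (card (ends d))"
   using ends_subset card_Diff_subset[of "ends d" "pairs d"] card_mono[OF finite_pairs ends_subset]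
   by (metis finite_pairs even_diff_nat finite_subset even_add le_add_diff_inverse)
  then show ?case
   using Suc odd_pairs_hcnt[of d] cnt_hcnt[of d] by (simp add: card_ends)
qed

text \<open>A chain with alternating labels exists, since the number of such chains is odd.
  Neighbours in the order of absolute value have opposite signs, so equal absolute values would give
  a complementary pair within a chain. The N absolute values therefore increase strictly, and the
  last is at least N.\<close>

theorem octahedral_Tucker:
  assumes bound: "\<And>X. signvec N X \<Longrightarrow> \<bar>lam X\<bar> \<le> int m"
  shows "N \<le> m"
proof -
  have "cnt N \<noteq> 0" using odd_cnt[of N] by (metis even_zero order_refl)
  then obtain xs where xs: "xs \<in> flags N" "palt True (labels lam xs)"
   unfolding cnt_def by (metis (no_types, lifting) card.empty empty_Collect_eq)
  define zs where "zs = sort_key lkey (labels lam xs)"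
  have len: "length zs = N" using xs by (simp add: zs_def flags_def)
  have set: "set zs = set (labels lam xs)" by (simp add: zs_def)
  have sorted: "sorted (map lkey zs)" by (simp add: zs_def)
  have al: "alt True (map (\<lambda>y. y > 0) zs)" using xs by (simp add: palt_def zs_def)
  have step: "\<bar>zs ! i\<bar> < \<bar>zs ! Suc i\<bar>" if i: "Suc i < N" for i
  proof -
   have le: "lkey (zs ! i) \<le> lkey (zs ! Suc i)"
    using sorted i len sorted_nth_mono[of "map lkey zs" i "Suc i"] by simp
   have ne: "(zs ! i > 0) \<noteq> (zs ! Suc i > 0)"
    using alt_nth[OF al, of i] i len by simp
   have mem: "zs ! i \<in> set (labels lam xs)" "zs ! Suc i \<in> set (labels lam xs)"
    using i len set by (metis Suc_lessD nth_mem)+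
   have "zs ! Suc i \<noteq> - (zs ! i)" using labels_no_compl[OF xs(1) _ mem(1)] mem(2) by auto
   moreover have "zs ! i \<noteq> 0" "zs ! Suc i \<noteq> 0" using labels_nz[OF xs(1)] mem by auto
   ultimately show ?thesis using le ne by (auto simp: lkey_def split: if_splits)
  qed
  have ge: "int i < \<bar>zs ! i\<bar>" if "i < N" for i
   using that
  proof (induction i)
   case 0
   then have "zs ! 0 \<in> set (labels lam xs)" using len set by (metis nth_mem)
   then show ?case using labels_nz[OF xs(1)] by force
  next
   case (Suc i)
   then show ?case using step[of i] by linarith
  qed
  show ?thesis
  proof (cases "N = 0")
   case False
   then have "zs ! (N - 1) \<in> set (labels lam xs)" using len set by (metis diff_less less_one nat_neq_iff nth_mem not_less0)
   then obtain j where j: "j < N" "zs ! (N - 1) = lam (set (take (Suc j) xs))"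
    using xs by (auto simp: labels_def flags_def)
   have "signvec N (set (take (Suc j) xs))" using signvec_prefix[OF xs(1) _ j(1)] by simp
   then show ?thesis using bound[of "set (take (Suc j) xs)"] ge[of "N - 1"] j(2) False by simp
  qed simp
qed

end

section \<open>Chromatic number and size of the family of r-stable sets\<close>

section \<open>Stable Kneser hypergraphs\<close>

text \<open>Stability on a line: no condition links the last point with the first.\<close>

definition stable :: "nat \<Rightarrow> nat set \<Rightarrow> bool" where
  "stable r S \<longleftrightarrow> (\<forall>x\<in>S. \<forall>y\<in>S. x < y \<longrightarrow> x + r \<le> y)"

definition stab :: "nat \<Rightarrow> nat \<Rightarrow> nat \<Rightarrow> nat set set" where
  "stab r N k = {S \<in> ksub {..<N} k. stable r S}"

definition alts :: "(nat \<times> bool) set \<Rightarrow> (nat \<times> bool) list \<Rightarrow> bool" where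
  "alts X zs \<longleftrightarrow> sorted_wrt (<) (map fst zs) \<and> set zs \<subseteq> X \<and> (\<exists>b. alt b (map snd zs))"

definition altlen :: "(nat \<times> bool) set \<Rightarrow> nat" where
  "altlen X = Max (length ` {zs. alts X zs})"

definition first_sign :: "(nat \<times> bool) set \<Rightarrow> bool" where
  "first_sign X \<longleftrightarrow> (Min (fst ` X), True) \<in> X"

lemma alt_nth_eq: "alt b xs \<Longrightarrow> i < length xs \<Longrightarrow> xs ! i = (if even i then b else \<not> b)"
proof (induction b xs arbitrary: i rule: alt.induct)
  case (2 b x xs)
  then show ?case by (cases i) auto
qed simp

lemma signvec_finite: "signvec N X \<Longrightarrow> finite X"
  unfolding signvec_def by (meson finite_SigmaI finite_lessThan finite_subset finite)

lemma alts_length_le: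
  assumes "signvec N X" "alts X zs"
  shows "length zs \<le> card X"
proof -
  have "distinct (map fst zs)" using assms(2) strict_sorted_iff by (auto simp: alts_def)
  then have "distinct zs" by (simp add: distinct_map)
  then have "length zs = card (set zs)" by (simp add: distinct_card)
  also have "\<dots> \<le> card X" using assms signvec_finite by (intro card_mono) (auto simp: alts_def)
  finally show ?thesis .
qed

lemma altlen_props:
  assumes "signvec N X"
  shows "alts X zs \<Longrightarrow> length zs \<le> altlen X" "\<exists>zs. alts X zs \<and> length zs = altlen X"
proof -
  have fin: "finite (length ` {zs. alts X zs})"
   by (rule finite_subset[OF _ finite_atMost[of "card X"]]) (use alts_length_le[OF assms] in auto)
  show "alts X zs \<Longrightarrow> length zs \<le> altlen X"
   unfolding altlen_def by (rule Max_ge[OF fin]) blast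
  have "alts X []" by (simp add: alts_def)
  then have "length ` {zs. alts X zs} \<noteq> {}" by blast
  from Max_in[OF fin this] have "altlen X \<in> length ` {zs. alts X zs}" by (simp only: altlen_def)
  then show "\<exists>zs. alts X zs \<and> length zs = altlen X" by (auto simp only: image_iff mem_Collect_eq)
qed

lemma signvec_sign: "signvec N X \<Longrightarrow> x \<in> fst ` X \<Longrightarrow> (x, b) \<in> X \<longleftrightarrow> (x, \<not> b) \<notin> X"
proof -
  assume a: "signvec N X" "x \<in> fst ` X"
  then obtain b' where b': "(x, b') \<in> X" by auto
  have inj: "inj_on fst X" using a by (simp add: signvec_def)
  have "\<not> ((x, b) \<in> X \<and> (x, \<not> b) \<in> X)" using inj by (auto dest: inj_onD[of fst X "(x, b)" "(x, \<not> b)"])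
  moreover have "(x, b) \<in> X \<or> (x, \<not> b) \<in> X" using b' by (cases "b' = b") auto
  ultimately show ?thesis by blast
qed

lemma first_sign_mem: "signvec N X \<Longrightarrow> (Min (fst ` X), first_sign X) \<in> X"
proof -
  assume a: "signvec N X"
  then have "Min (fst ` X) \<in> fst ` X"
   using signvec_finite[OF a] by (intro Min_in) (auto simp: signvec_def)
  from signvec_sign[OF a this, of True] show ?thesis
   by (cases "first_sign X") (auto simp: first_sign_def)
qed

text \<open>Otherwise the first entry of X could be put in front. So every longest alternating
  subsequence starts with the sign \<open>first_sign X\<close>.\<close>

lemma alts_hd:
  assumes X: "signvec N X" and zs: "alts X zs" "zs \<noteq> []" and ne: "snd (hd zs) \<noteq> first_sign X"
  shows "length zs < altlen X"
proof -
  define z where "z = (Min (fst ` X), first_sign X)"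
  obtain y ys where y: "zs = y # ys" using zs(2) by (cases zs) auto
  have yX: "y \<in> X" using zs(1) y by (auto simp: alts_def)
  have "fst y \<noteq> fst z"
  proof
   assume "fst y = fst z"
   moreover have "z \<in> X" using first_sign_mem[OF X] by (simp add: z_def)
   ultimately have "y = z" using X yX by (auto simp: signvec_def dest: inj_onD)
   then show False using ne y by (simp add: z_def)
  qed
  moreover have "fst z \<le> fst y" using yX signvec_finite[OF X] by (simp add: z_def)
  ultimately have lt: "fst z < fst y" by simp
  have "alts X (z # zs)"
  proof -
   have "sorted_wrt (<) (map fst (z # zs))"
    using zs(1) lt y by (auto simp: alts_def)
   moreover have "set (z # zs) \<subseteq> X" using zs(1) first_sign_mem[OF X] by (auto simp: alts_def z_def)
   moreover have "alt (snd z) (map snd (z # zs))"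
    using zs(1) ne y by (auto simp: alts_def z_def)
   ultimately show ?thesis unfolding alts_def by blast
  qed
  from altlen_props(1)[OF X this] show ?thesis by simp
qed

lemma altlen_pos: "signvec N X \<Longrightarrow> altlen X \<ge> 1"
proof -
  assume a: "signvec N X"
  obtain z where "z \<in> X" using a by (auto simp: signvec_def)
  then have "alts X [z]" by (auto simp: alts_def)
  from altlen_props(1)[OF a this] show ?thesis by simp
qed

lemma altlen_mono:
  assumes "signvec N X" "signvec N Y" "X \<subseteq> Y"
  shows "altlen X \<le> altlen Y"
proof -
  obtain zs where zs: "alts X zs" "length zs = altlen X" using altlen_props(2)[OF assms(1)] by auto
  then have "alts Y zs" using assms(3) by (auto simp: alts_def)
  from altlen_props(1)[OF assms(2) this] zs show ?thesis by simp
qed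

text \<open>A longest alternating subsequence of X is also longest in Y, and its head carries both
  first signs. This excludes complementary labels among sign vectors of small alternation.\<close>

lemma first_sign_eq:
  assumes X: "signvec N X" and Y: "signvec N Y" and "X \<subseteq> Y" "altlen X = altlen Y"
  shows "first_sign X = first_sign Y"
proof -
  obtain zs where zs: "alts X zs" "length zs = altlen X" using altlen_props(2)[OF X] by auto
  then have ne: "zs \<noteq> []" using altlen_pos[OF X] by auto
  have Y': "alts Y zs" using zs(1) assms(3) by (auto simp: alts_def)
  have "snd (hd zs) = first_sign X" using alts_hd[OF X zs(1) ne] zs(2) by fastforce
  moreover have "snd (hd zs) = first_sign Y" using alts_hd[OF Y Y' ne] zs(2) assms(4) by fastforce
  ultimately show ?thesis by simp
qed

lemma alts_flip: "alts X zs \<Longrightarrow> alts (flip ` X) (map flip zs)"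
proof -
  assume a: "alts X zs"
  then obtain b where "alt b (map snd zs)" by (auto simp: alts_def)
  then have "alt (\<not> b) (map snd (map flip zs))"
  proof (induction zs arbitrary: b)
   case (Cons z zs)
   then have "alt b (map snd (map flip zs))" using Cons.IH[of "\<not> b"] by simp
   then show ?case using Cons.prems by simp
  qed simp
  then show ?thesis using a by (auto simp: alts_def comp_def)
qed

lemma flip_image_flip: "flip ` flip ` X = X"
  by (simp add: image_image)

lemma altlen_flip: "altlen (flip ` X) = altlen X"
proof -
  have "length ` {zs. alts (flip ` X) zs} = length ` {zs. alts X zs}"
  proof -
   have "length ` {zs. alts X zs} \<subseteq> length ` {zs. alts (flip ` X) zs}" for X
   proof
    fix n assume "n \<in> length ` {zs. alts X zs}"
    then obtain zs where "alts X zs" "n = length zs" by auto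
    then have "alts (flip ` X) (map flip zs)" "n = length (map flip zs)" using alts_flip by auto
    then show "n \<in> length ` {zs. alts (flip ` X) zs}" by blast
   qed
   from this[of X] this[of "flip ` X"] show ?thesis by (simp add: flip_image_flip)
  qed
  then show ?thesis by (simp add: altlen_def)
qed

lemma first_sign_flip: "signvec N X \<Longrightarrow> first_sign (flip ` X) = (\<not> first_sign X)"
proof -
  assume a: "signvec N X"
  have "fst ` flip ` X = fst ` X" by (simp add: image_image)
  moreover have "(x, b) \<in> flip ` X \<longleftrightarrow> (x, \<not> b) \<in> X" for x b
   by (force simp: flip_def)
  moreover have "Min (fst ` X) \<in> fst ` X"
   using signvec_finite[OF a] a by (intro Min_in) (auto simp: signvec_def)
  ultimately show ?thesis
   using signvec_sign[OF a, of "Min (fst ` X)" True] by (simp add: first_sign_def)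
qed

text \<open>Take every second entry of a longest alternating subsequence: all these have the same
  sign, and each skipped entry leaves a gap of two. This uses 2k-1 entries.\<close>

lemma stable_of_alts:
  assumes X: "signvec N X" and k: "k \<ge> 1" and le: "2 * (k - 1) < altlen X"
  shows "\<exists>b S. S \<in> stab 2 N k \<and> S \<times> {b} \<subseteq> X"
proof -
  obtain zs where zs: "alts X zs" "length zs = altlen X" using altlen_props(2)[OF X] by auto
  obtain b where b: "alt b (map snd zs)" using zs by (auto simp: alts_def)
  define g where "g = (\<lambda>i. fst (zs ! (2 * i)))"
  have lt: "fst (zs ! i) < fst (zs ! j)" if "i < j" "j < length zs" for i j
   using zs(1) that sorted_wrt_nth_less[of "(<)" "map fst zs" i j] by (simp add: alts_def)
  have idx: "2 * i < length zs" if "i < k" for i using that le zs(2) k by linarith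
  have step: "g i + 2 \<le> g j" if "i < j" "j < k" for i j
   using lt[of "2 * i" "2 * i + 1"] lt[of "2 * i + 1" "2 * j"] idx[OF that(2)] that by (simp add: g_def)
  have inj: "inj_on g {..<k}"
  proof (rule inj_onI)
   fix i j assume "i \<in> {..<k}" "j \<in> {..<k}" "g i = g j"
   then show "i = j" using step[of i j] step[of j i] by (cases i j rule: linorder_cases) auto
  qed
  have mem: "(g i, b) \<in> X" if "i < k" for i
  proof -
   have "snd (zs ! (2 * i)) = b" using alt_nth_eq[OF b, of "2 * i"] idx[OF that] by simp
   moreover have "zs ! (2 * i) \<in> X" using zs(1) idx[OF that] by (auto simp: alts_def)
   moreover have "zs ! (2 * i) = (g i, snd (zs ! (2 * i)))" by (simp add: g_def)
   ultimately show ?thesis by simp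
  qed
  have "g ` {..<k} \<in> stab 2 N k"
  proof -
   have "g ` {..<k} \<subseteq> {..<N}" using mem X by (auto simp: signvec_def)
   moreover have "card (g ` {..<k}) = k" using inj by (simp add: card_image)
   moreover have "x + 2 \<le> y" if "x \<in> g ` {..<k}" "y \<in> g ` {..<k}" "x < y" for x y
   proof -
    from that obtain i j where ij: "i < k" "j < k" "x = g i" "y = g j" by auto
    then have "i < j" using that(3) step[of j i] by (cases i j rule: linorder_cases) auto
    then show ?thesis using step ij by auto
   qed
   ultimately show ?thesis by (auto simp: stab_def ksub_def stable_def)
  qed
  moreover have "g ` {..<k} \<times> {b} \<subseteq> X" using mem by auto
  ultimately show ?thesis by blast
qed

text \<open>Tucker's lemma for labels in two ranges. Sign vectors with alternation at most 2(k-1)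
  get this length, signed by their first sign. The others get the smallest colour of a stable k-set
  inside one of their two sign classes, shifted by 2(k-1)+1 and signed by the class. A complementary
  pair in the upper range would yield two disjoint stable sets of equal colour; in the lower range
  it contradicts \<open>first_sign_eq\<close>. So N would be at most 2(k-1)+m.\<close>

theorem stable_kneser_two:
  assumes k: "k \<ge> 1" and N: "N \<ge> 2 * (k - 1) + m + 1"
   and c: "\<And>S. S \<in> stab 2 N k \<Longrightarrow> c S < m"
  shows "\<exists>S\<in>stab 2 N k. \<exists>T\<in>stab 2 N k. disjnt S T \<and> c S = c T"
proof (rule ccontr)
  assume neg: "\<not> ?thesis"
  define cols where "cols = (\<lambda>(b::bool) X. {c S |S. S \<in> stab 2 N k \<and> S \<times> {b} \<subseteq> X})"
  define mc where "mc = (\<lambda>X. Min (cols True X \<union> cols False X))"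
  define lam where "lam = (\<lambda>X. if altlen X \<le> 2 * (k - 1)
    then (if first_sign X then int (altlen X) else - int (altlen X))
    else (if mc X \<in> cols True X then int (2 * (k - 1) + 1 + mc X) else - int (2 * (k - 1) + 1 + mc X)))"
  have fin: "finite (cols b X)" for b X
   by (rule finite_subset[OF _ finite_lessThan[of m]]) (use c in \<open>auto simp: cols_def\<close>)
  have excl: "x \<notin> cols (\<not> b) Y" if X: "signvec N X" "signvec N Y" "X \<subseteq> Y" and x: "x \<in> cols b X" for x b X Y
  proof
   assume "x \<in> cols (\<not> b) Y"
   with x obtain S T where ST: "S \<in> stab 2 N k" "T \<in> stab 2 N k" "S \<times> {b} \<subseteq> X" "T \<times> {\<not> b} \<subseteq> Y" "c S = c T"
    unfolding cols_def by force
   have "disjnt S T"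
   proof -
    have "z \<notin> T" if "z \<in> S" for z
    proof
     assume "z \<in> T"
     then have "(z, b) \<in> Y" "(z, \<not> b) \<in> Y" using that ST X(3) by auto
     then show False using X(2) by (auto simp: signvec_def dest: inj_onD[of fst Y "(z, b)" "(z, \<not> b)"])
    qed
    then show ?thesis by (auto simp: disjnt_iff)
   qed
   then show False using neg ST by blast
  qed
  have mc: "mc X \<in> cols True X \<union> cols False X" if X: "signvec N X" and h: "\<not> altlen X \<le> 2 * (k - 1)" for X
  proof -
   obtain b S where S: "S \<in> stab 2 N k" "S \<times> {b} \<subseteq> X" using stable_of_alts[OF X k] h by (meson not_le)
   then have "c S \<in> cols b X" unfolding cols_def by blast
   then have "cols True X \<union> cols False X \<noteq> {}" by (cases b) auto
   then show ?thesis unfolding mc_def using fin by (intro Min_in) auto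
  qed
  have colsflip: "cols b (flip ` X) = cols (\<not> b) X" for b X
  proof -
   have "(x, b) \<in> flip ` X \<longleftrightarrow> (x, \<not> b) \<in> X" for x by (force simp: flip_def)
   moreover have "S \<times> {b'} \<subseteq> Z \<longleftrightarrow> (\<forall>x\<in>S. (x, b') \<in> Z)" for S b' and Z :: "(nat \<times> bool) set" by auto
   ultimately have "S \<times> {b} \<subseteq> flip ` X \<longleftrightarrow> S \<times> {\<not> b} \<subseteq> X" for S by (simp only:)
   then show ?thesis by (simp add: cols_def)
  qed
  have mcflip: "mc (flip ` X) = mc X" for X by (simp add: mc_def colsflip Un_commute)
  have "N \<le> 2 * (k - 1) + m"
  proof (rule octahedral_Tucker[of N lam])
   fix X assume X: "signvec N X"
   show "lam (flip ` X) = - lam X"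
   proof (cases "altlen X \<le> 2 * (k - 1)")
    case True
    then show ?thesis by (simp add: lam_def altlen_flip first_sign_flip[OF X])
   next
    case False
    have "mc X \<in> cols False X \<longleftrightarrow> mc X \<notin> cols True X"
     using mc[OF X False] excl[OF X X subset_refl, of "mc X" True] by auto
    then show ?thesis using False by (simp add: lam_def altlen_flip mcflip colsflip)
   qed
   show "lam X \<noteq> 0" using altlen_pos[OF X] by (auto simp: lam_def)
   show "\<bar>lam X\<bar> \<le> int (2 * (k - 1) + m)"
   proof (cases "altlen X \<le> 2 * (k - 1)")
    case True
    then show ?thesis by (simp add: lam_def)
   next
    case False
    then have "mc X < m" using mc[OF X False] c by (auto simp: cols_def)
    then show ?thesis using False by (auto simp: lam_def)
   qed
   fix Y assume Y: "signvec N Y" and XY: "X \<subseteq> Y"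
   show "lam X \<noteq> - lam Y"
   proof
    assume eq: "lam X = - lam Y"
    have mono: "altlen X \<le> altlen Y" by (rule altlen_mono[OF X Y XY])
    show False
    proof (cases "altlen X \<le> 2 * (k - 1)")
     case True
     have y: "altlen Y \<le> 2 * (k - 1)" using eq True by (auto simp: lam_def split: if_splits)
     then have "altlen X = altlen Y" using eq True by (auto simp: lam_def split: if_splits)
     then show False
      using first_sign_eq[OF X Y XY] eq True altlen_pos[OF X] by (auto simp: lam_def split: if_splits)
    next
     case False
     then have F: "\<not> altlen Y \<le> 2 * (k - 1)" using mono by simp
     have "mc X = mc Y" using eq False F by (auto simp: lam_def split: if_splits)
     moreover have "mc X \<in> cols True X \<longleftrightarrow> mc Y \<notin> cols True Y"
      using eq False F by (auto simp: lam_def split: if_splits)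
     ultimately show False
      using mc[OF X False] mc[OF Y F] excl[OF X Y XY, of "mc X" True] excl[OF X Y XY, of "mc X" False] by auto
    qed
   qed
  qed
  with N show False by simp
qed

definition nth_elt :: "nat set \<Rightarrow> nat \<Rightarrow> nat" where
  "nth_elt A i = sorted_list_of_set A ! i"

lemma nth_elt_image: "finite A \<Longrightarrow> nth_elt A ` {..<card A} = A"
proof -
  assume "finite A"
  then have "set (sorted_list_of_set A) = A" "length (sorted_list_of_set A) = card A" by auto
  then show ?thesis unfolding nth_elt_def by (metis atLeast_upt image_set map_nth set_map)
qed

lemma nth_elt_less: "finite A \<Longrightarrow> i < j \<Longrightarrow> j < card A \<Longrightarrow> nth_elt A i < nth_elt A j"
  unfolding nth_elt_def
  by (rule sorted_wrt_nth_less[OF strict_sorted_list_of_set]) auto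

lemma nth_elt_gap:
  assumes "finite A" "stable r A" "i + t < card A"
  shows "nth_elt A i + r * t \<le> nth_elt A (i + t)"
  using assms(3)
proof (induction t)
  case (Suc t)
  have "nth_elt A (i + t) < nth_elt A (i + Suc t)" using Suc by (intro nth_elt_less assms) auto
  moreover have "nth_elt A (i + t) \<in> A" "nth_elt A (i + Suc t) \<in> A"
   using nth_elt_image[OF assms(1)] Suc by auto
  ultimately have "nth_elt A (i + t) + r \<le> nth_elt A (i + Suc t)"
   using assms(2) by (simp add: stable_def)
  then show ?case using Suc by simp
qed simp

lemma stable_nth_elt_image:
  assumes A: "A \<in> stab r N n1" and S: "S \<in> stab 2 n1 k"
  shows "nth_elt A ` S \<in> stab (2 * r) N k"
proof -
  have fin: "finite A" and cA: "card A = n1" and st: "stable r A" and AN: "A \<subseteq> {..<N}"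
   using A by (auto simp: stab_def ksub_def intro: finite_subset)
  have Sn: "S \<subseteq> {..<n1}" and cS: "card S = k" and sS: "stable 2 S"
   using S by (auto simp: stab_def ksub_def)
  have less: "nth_elt A i < nth_elt A j" if "i < j" "j < n1" for i j
   using nth_elt_less[OF fin] that cA by simp
  have inj: "inj_on (nth_elt A) {..<n1}"
  proof (rule inj_onI)
   fix i j assume "i \<in> {..<n1}" "j \<in> {..<n1}" "nth_elt A i = nth_elt A j"
   then show "i = j" using less[of i j] less[of j i] by (cases i j rule: linorder_cases) auto
  qed
  have "nth_elt A ` S \<subseteq> A" using nth_elt_image[OF fin] Sn cA by blast
  moreover have "card (nth_elt A ` S) = k" using inj_on_subset[OF inj Sn] cS by (simp add: card_image)
  moreover have "x + 2 * r \<le> y" if xy: "x \<in> nth_elt A ` S" "y \<in> nth_elt A ` S" "x < y" for x y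
  proof -
   obtain i j where ij: "i \<in> S" "j \<in> S" "x = nth_elt A i" "y = nth_elt A j" using xy by auto
   have lt: "i < n1" "j < n1" using ij Sn by auto
   have "i < j" using xy(3) ij lt less[of j i] by (cases i j rule: linorder_cases) auto
   then have "i + 2 \<le> j" using sS ij by (simp add: stable_def)
   then obtain t where t: "j = i + (2 + t)" by (metis le_Suc_ex add.assoc)
   have "nth_elt A i + r * (2 + t) \<le> nth_elt A j"
    using nth_elt_gap[OF fin st, of i "2 + t"] lt cA t by simp
   then show ?thesis using ij by (simp add: algebra_simps)
  qed
  ultimately show ?thesis using AN by (auto simp: stab_def ksub_def stable_def)
qed

text \<open>Composition doubles the uniformity. Inside an r'-stable set A of size n1 the graph case,
  applied to positions, gives two disjoint equally coloured k-sets; their positions are 2-stable, so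
  as sets they are 2r'-stable. Their colour is given to A. An r'-edge of equally coloured sets A
  then unfolds into 2r' k-sets.\<close>

theorem stable_kneser_pow2:
  assumes "k \<ge> 1" "r = 2 ^ q" "N \<ge> r * (k - 1) + (r - 1) * m + 1"
   "\<And>S. S \<in> stab r N k \<Longrightarrow> c S < m"
  shows "\<exists>e\<in>kedges r (stab r N k). \<exists>x. \<forall>S\<in>e. c S = x"
  using assms
proof (induction q arbitrary: r k c)
  case 0
  then have "{..<k} \<in> stab r N k" by (auto simp: stab_def ksub_def stable_def)
  then have "{{..<k}} \<in> kedges r (stab r N k)" using 0 by (simp add: kedges_def)
  then show ?case by blast
next
  case (Suc q)
  define r' :: nat where "r' = 2 ^ q"
  have r: "r = 2 * r'" "r' \<ge> 1" using Suc by (auto simp: r'_def)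
  \<comment> \<open>Just large enough for the graph case with m colours to apply inside A.\<close>
  define n1 where "n1 = 2 * (k - 1) + m + 1"
  define good where "good = (\<lambda>A x S T. S \<in> stab r N k \<and> T \<in> stab r N k \<and> S \<subseteq> A \<and> T \<subseteq> A \<and>
   disjnt S T \<and> c S = x \<and> c T = x)"
  have ex: "\<exists>x S T. good A x S T" if A: "A \<in> stab r' N n1" for A
  proof -
   have fin: "finite A" and cA: "card A = n1" using A by (auto simp: stab_def ksub_def intro: finite_subset)
   have sub: "nth_elt A ` S \<in> stab r N k \<and> nth_elt A ` S \<subseteq> A" if "S \<in> stab 2 n1 k" for S
    using stable_nth_elt_image[OF A that] r nth_elt_image[OF fin] cA that
    by (auto simp: stab_def ksub_def)
   obtain S T where ST: "S \<in> stab 2 n1 k" "T \<in> stab 2 n1 k" "disjnt S T"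
     "c (nth_elt A ` S) = c (nth_elt A ` T)"
    using stable_kneser_two[of k m n1 "\<lambda>S. c (nth_elt A ` S)"] Suc.prems sub by (auto simp: n1_def)
   have inj: "inj_on (nth_elt A) {..<n1}"
    using nth_elt_image[OF fin] cA by (intro eq_card_imp_inj_on) auto
   have "disjnt (nth_elt A ` S) (nth_elt A ` T)"
   proof -
    have "S \<union> T \<subseteq> {..<n1}" using ST by (auto simp: stab_def ksub_def)
    then show ?thesis
     using ST(3) inj unfolding disjnt_def by (metis Un_subset_iff image_Int image_empty inj_on_image_Int)
   qed
   then show ?thesis unfolding good_def using sub ST by blast
  qed
  then obtain c' S T where cST: "\<And>A. A \<in> stab r' N n1 \<Longrightarrow> good A (c' A) (S A) (T A)" by metis
  \<comment> \<open>With r = 2r' the two bounds coincide: r'(n1 - 1) + (r' - 1)m = r(k - 1) + (r -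
    1)m.\<close>
  have "N \<ge> r' * (n1 - 1) + (r' - 1) * m + 1"
  proof -
   obtain s where s: "r' = Suc s" using r(2) by (metis Suc_le_D One_nat_def)
   show ?thesis using Suc.prems(3) unfolding n1_def r(1) s by (simp add: algebra_simps)
  qed
  moreover have "c' A < m" if "A \<in> stab r' N n1" for A
   using cST[OF that] Suc.prems(4)[of "S A"] by (auto simp: good_def)
  ultimately obtain e x where e: "e \<in> kedges r' (stab r' N n1)" "\<forall>A\<in>e. c' A = x"
   using Suc.IH[of n1 r' c'] by (auto simp: r'_def n1_def)
  have esub: "e \<subseteq> stab r' N n1" and ce: "card e = r'" and dis: "pairwise disjnt e"
   using e by (auto simp: kedges_def)
  have fe: "finite e" using ce r(2) card.infinite by fastforce
  have gd: "good A x (S A) (T A)" if "A \<in> e" for A using cST[of A] esub e(2) that by (metis subsetD)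
  have ne: "B \<noteq> {}" if "B \<in> stab r N k" for B using that Suc.prems(1) by (auto simp: stab_def ksub_def)
  have dSS: "disjnt (S A) (S B)" "disjnt (T A) (T B)" "disjnt (S A) (T B)"
   if "A \<in> e" "B \<in> e" "A \<noteq> B" for A B
   using gd[OF that(1)] gd[OF that(2)] dis that unfolding good_def pairwise_def
   by (meson disjnt_subset1 disjnt_subset2)+
  have dST: "disjnt (S A) (T A)" if "A \<in> e" for A using gd[OF that] by (simp add: good_def)
  have neS: "S A \<noteq> {}" "T A \<noteq> {}" if "A \<in> e" for A using gd[OF that] ne by (auto simp: good_def)
  have injS: "inj_on S e" "inj_on T e"
   using dSS neS by (auto intro!: inj_onI) (metis disjnt_self_iff_empty)+
  have "S ` e \<inter> T ` e = {}"
  proof -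
   have "S A \<noteq> T B" if "A \<in> e" "B \<in> e" for A B
    using dSS(3)[OF that] dST neS[OF that(2)] that by (metis disjnt_self_iff_empty)
   then show ?thesis by auto
  qed
  then have "card (S ` e \<union> T ` e) = r"
   using fe injS ce r by (simp add: card_Un_disjoint card_image)
  moreover have "pairwise disjnt (S ` e \<union> T ` e)"
  proof (rule pairwiseI)
   fix X Y assume "X \<in> S ` e \<union> T ` e" "Y \<in> S ` e \<union> T ` e" "X \<noteq> Y"
   then show "disjnt X Y" using dSS dST by (auto) (metis disjnt_sym)+
  qed
  moreover have "S ` e \<union> T ` e \<subseteq> stab r N k" using gd by (auto simp: good_def)
  ultimately have "S ` e \<union> T ` e \<in> kedges r (stab r N k)" by (simp add: kedges_def)
  moreover have "\<forall>B\<in>S ` e \<union> T ` e. c B = x" using gd by (auto simp: good_def)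
  ultimately show ?case by blast
qed

lemma stab_nonempty_bound:
  assumes "S \<in> stab r N (Suc j)"
  shows "r * j < N"
proof -
  have fin: "finite S" and c: "card S = Suc j" and st: "stable r S" and SN: "S \<subseteq> {..<N}"
   using assms by (auto simp: stab_def ksub_def intro: finite_subset)
  have "nth_elt S 0 + r * j \<le> nth_elt S (0 + j)" using c by (intro nth_elt_gap[OF fin st]) auto
  moreover have "nth_elt S j \<in> S" using nth_elt_image[OF fin] c by auto
  ultimately show ?thesis using SN by auto
qed

lemma finite_stab [simp]: "finite (stab r N k)"
  by (rule finite_subset[of _ "ksub {..<N} k"]) (auto simp: stab_def)

text \<open>The binomial is what results from shrinking each gap by r - 1. The induction follows
  Pascal's rule, splitting by whether the top point N belongs to S; if it does, the rest of S lies
  below N + 1 - r.\<close>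

lemma card_stab_le:
  assumes "r \<ge> 1"
  shows "card (stab r (m + (r - 1) * j) (Suc j)) \<le> m choose Suc j"
proof (induction m arbitrary: j)
  case 0
  have "stab r ((r - 1) * j) (Suc j) = {}"
  proof (rule ccontr)
   assume "\<not> ?thesis"
   then obtain S where "S \<in> stab r ((r - 1) * j) (Suc j)" by auto
   from stab_nonempty_bound[OF this] have "r * j < (r - 1) * j" .
   moreover have "(r - 1) * j \<le> r * j" by (intro mult_right_mono) auto
   ultimately show False by linarith
  qed
  then show ?case by simp
next
  case (Suc m)
  show ?case
  proof (cases j)
   case 0
   have "card (stab r (Suc m) 1) \<le> card (ksub {..<Suc m} 1)"
    by (intro card_mono) (auto simp: stab_def)
   then show ?thesis using 0 by (simp add: card_ksub)
  next
   case (Suc i)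
   define N where "N = m + (r - 1) * Suc i"
   define N' where "N' = m + (r - 1) * i"
   have N': "N' + r = Suc N" using assms by (simp add: N_def N'_def)
   have "stab r (Suc N) (Suc j) \<subseteq> stab r N (Suc j) \<union> insert N ` stab r N' (Suc i)"
   proof
    fix S assume S: "S \<in> stab r (Suc N) (Suc j)"
    have fin: "finite S" using S by (auto simp: stab_def ksub_def intro: finite_subset)
    show "S \<in> stab r N (Suc j) \<union> insert N ` stab r N' (Suc i)"
    proof (cases "N \<in> S")
     case False
     have "S \<subseteq> {..<N}"
     proof
      fix x assume "x \<in> S"
      then have "x < Suc N" "x \<noteq> N" using S False by (auto simp: stab_def ksub_def)
      then show "x \<in> {..<N}" by simp
     qed
     then show ?thesis using S by (auto simp: stab_def ksub_def)
    next
     case True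
     have "x < N'" if "x \<in> S - {N}" for x
     proof -
      have "x < N" using that S by (force simp: stab_def ksub_def)
      then have "x + r \<le> N" using S that True by (auto simp: stab_def stable_def)
      then show ?thesis using N' by simp
     qed
     then have "S - {N} \<in> stab r N' (Suc i)"
      using S True fin Suc by (auto simp: stab_def ksub_def stable_def)
     then show ?thesis using True by (metis UnI2 image_eqI insert_Diff)
    qed
   qed
   then have "card (stab r (Suc N) (Suc j)) \<le> card (stab r N (Suc j) \<union> insert N ` stab r N' (Suc i))"
    by (intro card_mono) auto
   also have "\<dots> \<le> card (stab r N (Suc j)) + card (stab r N' (Suc i))"
    by (intro card_Un_le[THEN order_trans] add_mono order.refl card_image_le) auto
   also have "\<dots> \<le> (m choose Suc j) + (m choose Suc i)"
    using Suc.IH[of j] Suc.IH[of i] Suc by (intro add_mono) (auto simp: N_def N'_def)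
   finally show ?thesis using Suc by (simp add: N_def)
  qed
qed

section \<open>Spare capacity of colours and deletion of dominated points\<close>

section \<open>Colourings of a sub-universe\<close>

text \<open>Both the universe and the palette vary, since deleting kernels shrinks the two
  together.\<close>

definition tcol :: "nat \<Rightarrow> nat set \<Rightarrow> nat \<Rightarrow> nat set \<Rightarrow> bool" where
  "tcol r T d C \<longleftrightarrow> (\<exists>g. g ` ksub T d \<subseteq> C \<and> (\<forall>c\<in>C. kedges r {A \<in> ksub T d. g A = c} = {}))"

lemma colorable_tcol: "colorable r n d m \<longleftrightarrow> tcol r {1..n} d {..<m}"
  unfolding colorable_def tcol_def by (simp only: Ball_def lessThan_iff)

lemma kedges_empty_card_le:
  assumes "kedges (Suc s) F = {}" "e \<subseteq> F" "pairwise disjnt e" "finite e"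
  shows "card e \<le> s"
proof (rule ccontr)
  assume "\<not> card e \<le> s"
  then obtain e' where e': "e' \<subseteq> e" "card e' = Suc s"
   using obtain_subset_with_card_n[of "Suc s" e] by (metis not_less_eq_eq)
  then have "e' \<in> kedges (Suc s) F" using assms unfolding kedges_def by (auto intro: pairwise_subset)
  then show False using assms(1) by simp
qed

text \<open>Spare capacity of a colour class can be used up by stars.\<close>

lemma tcol_absorb:
  assumes r: "r \<ge> 1" and fin: "finite T" "finite C" and Y: "Y \<subseteq> T"
   and g: "g ` ksub (T - Y) d \<subseteq> C"
   and s: "\<And>c. c \<in> C \<Longrightarrow> s c \<le> r - 1"
   and cls: "\<And>c. c \<in> C \<Longrightarrow> kedges (Suc (s c)) {A \<in> ksub (T - Y) d. g A = c} = {}"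
   and le: "card Y \<le> (\<Sum>c\<in>C. r - 1 - s c)"
  shows "tcol r T d C"
proof -
  \<comment> \<open>One slot for each unit of spare capacity. The injection \<open>i\<close> gives
    the points of Y distinct slots, and \<open>h y\<close> is the colour owning the slot of
    y.\<close>
  define S where "S = Sigma C (\<lambda>c. {..<r - 1 - s c})"
  have finY: "finite Y" using Y fin finite_subset by blast
  have finS: "finite S" using fin by (simp add: S_def)
  have "card Y \<le> card S" using le fin by (simp add: S_def)
  then obtain i where i: "i ` Y \<subseteq> S" "inj_on i Y"
   using card_le_inj[OF finY finS] by auto
  define h where "h = fst \<circ> i"
  have hC: "h y \<in> C" if "y \<in> Y" for y using i(1) that by (force simp: h_def S_def)
  have fib: "card {y \<in> Y. h y = c} \<le> r - 1 - s c" for c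
  proof -
   have "inj_on (snd \<circ> i) {y \<in> Y. h y = c}"
    using i(2) by (auto simp: inj_on_def h_def prod_eq_iff)
   moreover have "(snd \<circ> i) ` {y \<in> Y. h y = c} \<subseteq> {..<r - 1 - s c}"
    using i(1) by (force simp: h_def S_def)
   ultimately show ?thesis using card_inj_on_le[of "snd \<circ> i" _ "{..<r - 1 - s c}"] by simp
  qed
  \<comment> \<open>A set meeting Y joins the star of one of its points in Y. Disjoint sets join
    different stars, so a colour gains at most as many pairwise disjoint sets as it has spare
    slots.\<close>
  define y where "y = (\<lambda>A. SOME y. y \<in> A \<inter> Y)"
  have y: "y A \<in> A \<inter> Y" if "A \<inter> Y \<noteq> {}" for A
  proof -
   have "\<exists>y. y \<in> A \<inter> Y" using that by blast
   then show ?thesis unfolding y_def by (rule someI_ex)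
  qed
  define G where "G = (\<lambda>A. if A \<inter> Y = {} then g A else h (y A))"
  have sub: "A \<in> ksub (T - Y) d" if "A \<in> ksub T d" "A \<inter> Y = {}" for A
   using that by (auto simp: ksub_def)
  have "G A \<in> C" if A: "A \<in> ksub T d" for A
  proof (cases "A \<inter> Y = {}")
   case True
   then show ?thesis using sub[OF A True] g by (auto simp: G_def)
  next
   case False
   then show ?thesis using y[OF False] hC by (simp add: G_def)
  qed
  then have "G ` ksub T d \<subseteq> C" by blast
  moreover have "kedges r {A \<in> ksub T d. G A = c} = {}" if c: "c \<in> C" for c
  proof (rule ccontr)
   assume "kedges r {A \<in> ksub T d. G A = c} \<noteq> {}"
   then obtain e where e: "e \<subseteq> {A \<in> ksub T d. G A = c}" "card e = r" "pairwise disjnt e"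
    by (auto simp: kedges_def)
   have fe: "finite e" using e(2) r card.infinite by fastforce
   define e1 where "e1 = {A \<in> e. A \<inter> Y = {}}"
   define e2 where "e2 = {A \<in> e. A \<inter> Y \<noteq> {}}"
   have "card e1 \<le> s c"
   proof (rule kedges_empty_card_le[OF cls[OF c]])
    show "e1 \<subseteq> {A \<in> ksub (T - Y) d. g A = c}" using e(1) sub by (auto simp: e1_def G_def)
    show "pairwise disjnt e1" using e(3) by (rule pairwise_subset) (auto simp: e1_def)
    show "finite e1" using fe by (simp add: e1_def)
   qed
   moreover have "card e2 \<le> r - 1 - s c"
   proof -
    have "inj_on y e2"
    proof (rule inj_onI)
     fix A B assume AB: "A \<in> e2" "B \<in> e2" "y A = y B"
     then have "y A \<in> A \<inter> B" using y[of A] y[of B] by (simp add: e2_def)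
     then show "A = B" using e(3) AB by (auto simp: pairwise_def disjnt_def e2_def)
    qed
    moreover have "y ` e2 \<subseteq> {z \<in> Y. h z = c}"
    proof
     fix z assume "z \<in> y ` e2"
     then obtain A where A: "A \<in> e" "A \<inter> Y \<noteq> {}" "z = y A" by (auto simp: e2_def)
     then have "G A = c" using e(1) by blast
     then show "z \<in> {z \<in> Y. h z = c}" using A y[OF A(2)] by (simp add: G_def)
    qed
    ultimately have "card e2 \<le> card {z \<in> Y. h z = c}"
     using finY by (intro card_inj_on_le[of y]) auto
    then show ?thesis using fib[of c] by simp
   qed
   moreover have "card e = card e1 + card e2"
   proof -
    have "e = e1 \<union> e2" "e1 \<inter> e2 = {}" by (auto simp: e1_def e2_def)
    then show ?thesis using fe card_Un_disjoint[of e1 e2] by (simp add: e1_def e2_def)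
   qed
   ultimately show False using e(2) s[OF c] r by linarith
  qed
  ultimately show ?thesis unfolding tcol_def by blast
qed

text \<open>Everything is absorbed: with Y = T and all capacity unspent, each colour takes the stars
  of r - 1 points.\<close>

lemma tcol_stars:
  assumes "r \<ge> 1" "d \<ge> 1" "finite T" "finite C" "card T \<le> (r - 1) * card C"
  shows "tcol r T d C"
proof (rule tcol_absorb[where Y = T and s = "\<lambda>_. 0" and g = "\<lambda>_. 0"])
  have "ksub (T - T) d = {}" using assms(2) by (auto simp: ksub_def)
  then show "(\<lambda>_. 0) ` ksub (T - T) d \<subseteq> C"
   "kedges (Suc 0) {A \<in> ksub (T - T) d. 0 = c} = {}" for c
   by (auto simp: kedges_def)
  show "card T \<le> (\<Sum>c\<in>C. r - 1 - 0)" using assms by (simp add: mult.commute)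
qed (use assms in auto)

text \<open>If the kernel of c contains a set X of r - 1 points, then by \<open>ex\<close> colour c
  does not occur off X. Drop X from the universe and c from the palette: a colouring of the rest
  would extend, c taking the stars of the points of X. As \<open>ker\<close> may depend on the
  current universe, this is repeated until all kernels are small.\<close>

lemma reduce_universe:
  fixes ker :: "nat set \<Rightarrow> nat \<Rightarrow> nat set" and f :: "nat set \<Rightarrow> nat"
  assumes r: "r \<ge> 2" and d: "d \<ge> 1" and fin: "finite T0" "finite C0"
   and nt: "\<not> tcol r T0 d C0" and fC: "f ` ksub T0 k \<subseteq> C0"
   and ex: "\<And>T c X v. T \<subseteq> T0 \<Longrightarrow> c \<in> C0 \<Longrightarrow> X \<subseteq> ker T c \<Longrightarrow> card X = r - 1 \<Longrightarrow>
     v \<in> ksub (T - X) k \<Longrightarrow> f v \<noteq> c"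
   and ker: "\<And>T c. ker T c \<subseteq> T"
  obtains T C where "T \<subseteq> T0" "C \<subseteq> C0" "\<not> tcol r T d C" "f ` ksub T k \<subseteq> C"
   "(r - 1) * card C < card T" "\<And>c. c \<in> C \<Longrightarrow> card (ker T c) \<le> r - 2"
proof -
  have "\<exists>T' C'. T' \<subseteq> T0 \<and> C' \<subseteq> C0 \<and> \<not> tcol r T' d C' \<and> f ` ksub T' k \<subseteq> C' \<and>
    (\<forall>c\<in>C'. card (ker T' c) \<le> r - 2)"
   if "T \<subseteq> T0" "C \<subseteq> C0" "\<not> tcol r T d C" "f ` ksub T k \<subseteq> C" for T C
   using that
  proof (induction "card T" arbitrary: T C rule: less_induct)
   case less
   show ?case
   proof (cases "\<forall>c\<in>C. card (ker T c) \<le> r - 2")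
    case False
    then obtain c where c: "c \<in> C" "r - 1 \<le> card (ker T c)" using r by force
    then obtain X where X: "X \<subseteq> ker T c" "card X = r - 1"
     using obtain_subset_with_card_n by metis
    have fT: "finite T" "finite C"
     using finite_subset[OF less(2) fin(1)] finite_subset[OF less(3) fin(2)] by auto
    have XT: "X \<subseteq> T" using X ker by blast
    have "X \<noteq> {}" using X(2) r by auto
    then have lt: "card (T - X) < card T" using XT fT by (intro psubset_card_mono) auto
    have "\<not> tcol r (T - X) d (C - {c})"
    proof
     assume "tcol r (T - X) d (C - {c})"
     then obtain g where g: "g ` ksub (T - X) d \<subseteq> C - {c}"
      "\<forall>c'\<in>C - {c}. kedges r {A \<in> ksub (T - X) d. g A = c'} = {}"
      by (auto simp: tcol_def)
     have "tcol r T d C"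
     proof (rule tcol_absorb[where s = "\<lambda>c'. if c' = c then 0 else r - 1" and g = g and Y = X])
      fix c' assume c': "c' \<in> C"
      show "kedges (Suc (if c' = c then 0 else r - 1)) {A \<in> ksub (T - X) d. g A = c'} = {}"
      proof (cases "c' = c")
       case True
       then have em: "{A \<in> ksub (T - X) d. g A = c'} = {}" using g by blast
       show ?thesis unfolding em using True by (auto simp: kedges_def)
      next
       case False
       then show ?thesis using g c' r by auto
      qed
     next
      have "(\<Sum>c'\<in>C. r - 1 - (if c' = c then 0 else r - 1)) = (\<Sum>c'\<in>C. if c' = c then r - 1 else 0)"
       by (intro sum.cong) auto
      then show "card X \<le> (\<Sum>c'\<in>C. r - 1 - (if c' = c then 0 else r - 1))"
       using X c fT by simp
     qed (use g XT fT r in auto)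
     then show False using less(4) by simp
    qed
    moreover have "f ` ksub (T - X) k \<subseteq> C - {c}"
    proof -
     have "f v \<noteq> c" if "v \<in> ksub (T - X) k" for v
      using ex[OF less(2) _ X that] c less(3) by blast
     then show ?thesis using less(5) ksub_mono[of "T - X" T] by blast
    qed
    ultimately show ?thesis using less(1)[OF lt, of "C - {c}"] less(2,3) by blast
   next
    case True
    then show ?thesis using less(2-5) by blast
   qed
  qed
  from this[OF subset_refl subset_refl nt fC] obtain T C where TC: "T \<subseteq> T0" "C \<subseteq> C0" "\<not> tcol r T d C"
    "f ` ksub T k \<subseteq> C" "\<forall>c\<in>C. card (ker T c) \<le> r - 2" by auto
  have "(r - 1) * card C < card T"
  proof (rule ccontr)
   assume "\<not> ?thesis"
   then have "tcol r T d C"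
    using r d finite_subset[OF TC(1) fin(1)] finite_subset[OF TC(2) fin(2)] by (intro tcol_stars) auto
   then show False using TC(3) by simp
  qed
  then show ?thesis using that[OF TC(1-4)] TC(5) by blast
qed

section \<open>Lower bounds for the number of edges spanned by a family\<close>

section \<open>Counting edges\<close>

lemma card_lists_ge:
  fixes Q :: "'a list \<Rightarrow> bool" and x :: "nat \<Rightarrow> real"
  assumes fin: "finite S" and Q0: "Q []" and x: "\<And>j. x j \<ge> 0"
   and ext: "\<And>xs. set xs \<subseteq> S \<Longrightarrow> length xs < r \<Longrightarrow> Q xs \<Longrightarrow> x (length xs) \<le> card {v \<in> S. Q (xs @ [v])}"
  shows "(\<Prod>j<r. x j) \<le> card {xs. set xs \<subseteq> S \<and> length xs = r \<and> Q xs}"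
  using ext
proof (induction r)
  case 0
  have "{xs. set xs \<subseteq> S \<and> length xs = 0 \<and> Q xs} = {[]}" using Q0 by auto
  then show ?case by simp
next
  case (Suc r)
  define L where "L = {xs. set xs \<subseteq> S \<and> length xs = r \<and> Q xs}"
  have finL: "finite {xs. set xs \<subseteq> S \<and> length xs = n \<and> Q xs}" for n
   by (rule finite_subset[OF _ finite_lists_length_eq[OF fin, of n]]) auto
  define h where "h = (\<lambda>(xs::'a list, v). xs @ [v])"
  define Z where "Z = Sigma L (\<lambda>xs. {v \<in> S. Q (xs @ [v])})"
  have "(\<Prod>j<Suc r. x j) = (\<Prod>j<r. x j) * x r" by simp
  also have "\<dots> \<le> card L * x r"
   unfolding L_def using Suc x by (intro mult_right_mono) auto
  also have "\<dots> = (\<Sum>xs\<in>L. x r)" by simp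
  also have "\<dots> \<le> (\<Sum>xs\<in>L. real (card {v \<in> S. Q (xs @ [v])}))"
   using Suc.prems by (intro sum_mono) (force simp: L_def)
  also have "\<dots> = card Z"
   unfolding Z_def using finL fin by (subst card_SigmaI) (auto simp: L_def)
  also have "card Z = card (h ` Z)"
   by (rule card_image[symmetric]) (auto simp: inj_on_def h_def)
  also have "real (card (h ` Z)) \<le> card {xs. set xs \<subseteq> S \<and> length xs = Suc r \<and> Q xs}"
   by (intro of_nat_mono card_mono finL) (auto simp: h_def Z_def L_def)
  finally show ?case .
qed

lemma card_lists_le_edges:
  assumes fin: "finite E" and L: "\<And>xs. xs \<in> L \<Longrightarrow> length xs = r \<and> set xs \<in> E"
   and E: "\<And>e. e \<in> E \<Longrightarrow> card e = r" and r: "r \<ge> 1"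
  shows "card L \<le> card E * r ^ r"
proof -
  have fe: "finite e" if "e \<in> E" for e using E[OF that] r card.infinite by fastforce
  have "L \<subseteq> (\<Union>e\<in>E. {xs. set xs \<subseteq> e \<and> length xs = r})" using L by auto
  then have "card L \<le> card (\<Union>e\<in>E. {xs. set xs \<subseteq> e \<and> length xs = r})"
   using fin fe by (intro card_mono) (auto intro!: finite_lists_length_eq)
  also have "\<dots> \<le> (\<Sum>e\<in>E. card {xs. set xs \<subseteq> e \<and> length xs = r})"
   by (rule card_UN_le[OF fin])
  also have "\<dots> = (\<Sum>e\<in>E. r ^ r)"
   using E fe by (intro sum.cong) (auto simp: card_lists_length_eq)
  finally show ?thesis by simp
qed

text \<open>A quantitative way of saying that G has no small cover off J: whatever R points are
  deleted, a fraction x of G survives.\<close>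

definition spread :: "nat \<Rightarrow> real \<Rightarrow> nat set \<Rightarrow> nat set set \<Rightarrow> bool" where
  "spread R x J G \<longleftrightarrow> (\<forall>U. finite U \<longrightarrow> card U \<le> R \<longrightarrow> U \<inter> J = {} \<longrightarrow>
   x * card G \<le> card {A \<in> G. A \<inter> U = {}})"

text \<open>Choose one member of each \<open>G j\<close> in turn. To be avoided are the points of
  the members already chosen and of the later cores \<open>J\<close>, at most r k in all; avoiding
  the later cores keeps \<open>spread\<close> applicable to the later choices. Each edge arises from
  at most r^r lists.\<close>

lemma spread_edges:
  fixes G :: "nat \<Rightarrow> nat set set"
  assumes k: "k \<ge> 1" and r: "r \<ge> 1" and fin: "\<And>j. j < r \<Longrightarrow> finite (G j)"
   and G: "\<And>j A. j < r \<Longrightarrow> A \<in> G j \<Longrightarrow> J j \<subseteq> A \<and> card A = k"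
   and dJ: "\<And>i j. i < r \<Longrightarrow> j < r \<Longrightarrow> i \<noteq> j \<Longrightarrow> J i \<inter> J j = {}"
   and cJ: "\<And>j. j < r \<Longrightarrow> finite (J j) \<and> card (J j) \<le> k"
   and sp: "\<And>j. j < r \<Longrightarrow> spread (r * k) (x j) (J j) (G j)" and x: "\<And>j. x j \<ge> 0"
  shows "(\<Prod>j<r. x j * card (G j)) \<le> card (kedges r (\<Union>j<r. G j)) * r ^ r"
proof -
  define S where "S = (\<Union>j<r. G j)"
  define Q where "Q = (\<lambda>xs. length xs \<le> r \<and>
   (\<forall>i<length xs. xs ! i \<in> G i \<and> (\<forall>j<r. j \<noteq> i \<longrightarrow> xs ! i \<inter> J j = {})) \<and>
   (\<forall>i<length xs. \<forall>j<length xs. i \<noteq> j \<longrightarrow> xs ! i \<inter> xs ! j = {}))"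
  have finS: "finite S" using fin by (simp add: S_def)
  have "(\<Prod>j<r. x j * card (G j)) \<le> card {xs. set xs \<subseteq> S \<and> length xs = r \<and> Q xs}"
  proof (rule card_lists_ge[OF finS])
   show "Q []" by (simp add: Q_def)
   show "0 \<le> x j * card (G j)" for j using x by simp
   fix xs assume xs: "set xs \<subseteq> S" "length xs < r" "Q xs"
   define l where "l = length xs"
   define U where "U = (\<Union>i<l. xs ! i) \<union> (\<Union>i\<in>{l<..<r}. J i)"
   have cx: "card (xs ! i) = k" "finite (xs ! i)" if "i < l" for i
   proof -
    have i: "i < r" "xs ! i \<in> G i" using that xs by (auto simp: Q_def l_def)
    show "card (xs ! i) = k" using G[OF i] by simp
    then show "finite (xs ! i)" using k card.infinite by fastforce
   qed
   have fU: "finite U" using cx cJ by (auto simp: U_def)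
   have "card U \<le> card (\<Union>i<l. xs ! i) + card (\<Union>i\<in>{l<..<r}. J i)"
    unfolding U_def by (rule card_Un_le)
   also have "\<dots> \<le> (\<Sum>i<l. card (xs ! i)) + (\<Sum>i\<in>{l<..<r}. card (J i))"
    by (intro add_mono card_UN_le) auto
   also have "\<dots> \<le> (\<Sum>i<l. k) + (\<Sum>i\<in>{l<..<r}. k)"
    using cx cJ by (intro add_mono sum_mono) auto
   also have "\<dots> = (l + (r - Suc l)) * k" by (simp add: algebra_simps)
   also have "\<dots> \<le> r * k" using xs(2) by (intro mult_right_mono) (auto simp: l_def)
   finally have cU: "card U \<le> r * k" .
   have UJ: "U \<inter> J l = {}"
   proof -
    have "xs ! i \<inter> J l = {}" if "i < l" for i using that xs by (auto simp: Q_def l_def)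
    moreover have "J i \<inter> J l = {}" if "i \<in> {l<..<r}" for i using dJ[of i l] that by auto
    ultimately show ?thesis unfolding U_def by blast
   qed
   have l: "l < r" using xs(2) by (simp add: l_def)
   have "x l * card (G l) \<le> card {A \<in> G l. A \<inter> U = {}}"
    using sp[OF l] fU cU UJ unfolding spread_def by blast
   also have "{A \<in> G l. A \<inter> U = {}} \<subseteq> {v \<in> S. Q (xs @ [v])}"
   proof
    fix A assume "A \<in> {A \<in> G l. A \<inter> U = {}}"
    then have A: "A \<in> G l" "A \<inter> U = {}" by auto
    have J1: "A \<inter> J j = {}" if "j < r" "j \<noteq> l" for j
    proof (cases "j < l")
     case True
     then have "J j \<subseteq> xs ! j" using G[OF that(1), of "xs ! j"] xs by (auto simp: Q_def l_def)
     then show ?thesis using A True by (auto simp: U_def)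
    next
     case False
     then show ?thesis using A that by (auto simp: U_def)
    qed
    have X1: "A \<inter> xs ! i = {}" if "i < l" for i using A that by (auto simp: U_def)
    have "Q (xs @ [A])"
     using xs l A J1 X1 unfolding Q_def l_def[symmetric]
     by (auto simp: nth_append less_Suc_eq l_def[symmetric] Int_commute)
    then show "A \<in> {v \<in> S. Q (xs @ [v])}" using A l by (auto simp: S_def)
   qed
   then have "card {A \<in> G l. A \<inter> U = {}} \<le> card {v \<in> S. Q (xs @ [v])}"
    using finS by (intro card_mono) auto
   finally show "x (length xs) * card (G (length xs)) \<le> card {v \<in> S. Q (xs @ [v])}"
    by (simp add: l_def)
  qed
  also have "card {xs. set xs \<subseteq> S \<and> length xs = r \<and> Q xs} \<le> card (kedges r S) * r ^ r"
  proof (rule card_lists_le_edges[OF finite_kedges[OF finS] _ _ r])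
   show "e \<in> kedges r S \<Longrightarrow> card e = r" for e by (simp add: kedges_def)
   fix xs assume "xs \<in> {xs. set xs \<subseteq> S \<and> length xs = r \<and> Q xs}"
   then have xs: "set xs \<subseteq> S" "length xs = r" "Q xs" by auto
   have ne: "xs ! i \<noteq> {}" if "i < r" for i
    using G[OF that, of "xs ! i"] xs that k by (auto simp: Q_def)
   have dis: "xs ! i \<inter> xs ! j = {}" if "i < r" "j < r" "i \<noteq> j" for i j
    using xs that by (auto simp: Q_def)
   have "distinct xs"
    unfolding distinct_conv_nth using ne dis xs(2) by (metis Int_absorb)
   then have "card (set xs) = r" using xs(2) by (simp add: distinct_card)
   moreover have "pairwise disjnt (set xs)"
   proof (rule pairwiseI)
    fix A B assume "A \<in> set xs" "B \<in> set xs" "A \<noteq> B"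
    then show "disjnt A B" using dis xs(2) unfolding in_set_conv_nth disjnt_def by metis
   qed
   ultimately show "length xs = r \<and> set xs \<in> kedges r S" using xs by (simp add: kedges_def)
  qed
  finally show ?thesis by (simp add: S_def)
qed

definition transversals :: "nat \<Rightarrow> (nat \<Rightarrow> nat set set) \<Rightarrow> nat set set set" where
  "transversals r F = (\<lambda>u. u ` {..<r}) ` PiE {..<r} F"

lemma transversals_props:
  assumes k: "k \<ge> 1" and F: "\<And>j. j < r \<Longrightarrow> F j \<subseteq> ksub (D j) k"
   and D: "\<And>i j. i < r \<Longrightarrow> j < r \<Longrightarrow> i \<noteq> j \<Longrightarrow> D i \<inter> D j = {}"
  shows "transversals r F \<subseteq> kedges r (\<Union>j<r. F j)"
   "card (transversals r F) = (\<Prod>j<r. card (F j))"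
proof -
  have u: "u i \<subseteq> D i \<and> u i \<noteq> {}" if "u \<in> PiE {..<r} F" "i < r" for u i
  proof -
   have "u i \<in> ksub (D i) k" using that F by (auto simp: PiE_def Pi_def)
   then show ?thesis using k by (auto simp: ksub_def)
  qed
  have neq: "u i \<noteq> u' j" if "u \<in> PiE {..<r} F" "u' \<in> PiE {..<r} F" "i < r" "j < r" "i \<noteq> j" for u u' i j
   using u[OF that(1,3)] u[OF that(2,4)] D[OF that(3-5)] by blast
  show "transversals r F \<subseteq> kedges r (\<Union>j<r. F j)"
  proof
   fix e assume "e \<in> transversals r F"
   then obtain w where w: "w \<in> PiE {..<r} F" "e = w ` {..<r}" by (auto simp: transversals_def)
   have "inj_on w {..<r}" using neq[OF w(1) w(1)] by (auto simp: inj_on_def)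
   then have "card e = r" using w by (simp add: card_image)
   moreover have "pairwise disjnt e"
   proof (rule pairwiseI)
    fix A B assume "A \<in> e" "B \<in> e" "A \<noteq> B"
    then obtain i j where ij: "i < r" "j < r" "A = w i" "B = w j" "i \<noteq> j" using w by auto
    have "A \<subseteq> D i" "B \<subseteq> D j" using u[OF w(1)] ij by simp_all
    moreover have "D i \<inter> D j = {}" using D ij by simp
    ultimately show "disjnt A B" by (metis disjnt_def disjnt_subset1 disjnt_subset2)
   qed
   moreover have "e \<subseteq> (\<Union>j<r. F j)" using w by (auto simp: PiE_def Pi_def)
   ultimately show "e \<in> kedges r (\<Union>j<r. F j)" by (simp add: kedges_def)
  qed
  have "inj_on (\<lambda>u. u ` {..<r}) (PiE {..<r} F)"
  proof (rule inj_onI)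
   fix v w assume vw: "v \<in> PiE {..<r} F" "w \<in> PiE {..<r} F" "v ` {..<r} = w ` {..<r}"
   have "v i = w i" if i: "i < r" for i
   proof -
    have "v i \<in> w ` {..<r}" using vw(3) i by blast
    then obtain j where "j < r" "v i = w j" by auto
    then show ?thesis using neq[OF vw(1,2) i, of j] by (cases "i = j") auto
   qed
   then show "v = w" using vw by (intro PiE_ext[OF vw(1,2)]) auto
  qed
  then show "card (transversals r F) = (\<Prod>j<r. card (F j))"
   unfolding transversals_def by (simp add: card_image card_PiE)
qed

section \<open>Hosts with a common popular colour, and the events they produce\<close>

section \<open>Popular colours\<close>

definition popcount :: "(nat set \<Rightarrow> nat) \<Rightarrow> nat \<Rightarrow> nat \<Rightarrow> nat set \<Rightarrow> nat" where
  "popcount f k c A = card {v \<in> ksub A k. f v = c}"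

lemma sum_popcount:
  assumes "finite A" "finite C" "f ` ksub A k \<subseteq> C"
  shows "(\<Sum>c\<in>C. popcount f k c A) = card A choose k"
proof -
  have "(\<Sum>c\<in>C. popcount f k c A) = card (\<Union>c\<in>C. {v \<in> ksub A k. f v = c})"
   unfolding popcount_def using assms by (subst card_UN_disjoint) auto
  also have "(\<Union>c\<in>C. {v \<in> ksub A k. f v = c}) = ksub A k" using assms by auto
  finally show ?thesis using assms by (simp add: card_ksub)
qed

lemma popular_colour:
  assumes "finite A" "finite C" "f ` ksub A k \<subseteq> C" "(t - 1) * card C < card A choose k"
  obtains c where "c \<in> C" "t \<le> popcount f k c A"
proof -
  have "\<exists>c\<in>C. t \<le> popcount f k c A"
  proof (rule ccontr)
   assume "\<not> ?thesis"
   then have "popcount f k c A \<le> t - 1" if "c \<in> C" for c using that by force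
   then have "(\<Sum>c\<in>C. popcount f k c A) \<le> (\<Sum>c\<in>C. t - 1)" by (rule sum_mono)
   then show False using sum_popcount[OF assms(1-3)] assms(4) by (simp add: mult.commute)
  qed
  then show ?thesis using that by blast
qed

lemma choose_le_pow: "n choose t \<le> (n::nat) ^ t"
  by (cases "t \<le> n") (auto simp: binomial_le_pow binomial_eq_0)

text \<open>Only t of the popular k-subsets of each host are recorded. They suffice for t^r edges
  and cost t logarithms instead of a description of the whole colour class. The size condition holds
  for the families that arise from pairwise disjoint hosts.\<close>

definition hostev :: "nat \<Rightarrow> nat \<Rightarrow> nat set set \<Rightarrow> nat \<Rightarrow> nat set set set set" where
  "hostev r k V t = {transversals r F |F.
   F \<in> PiE {..<r} (\<lambda>_. {G. \<exists>A\<in>V. G \<subseteq> ksub A k \<and> card G = t}) \<and>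
   real (t ^ r) \<le> card (transversals r F)}"

lemma card_subfamilies:
  assumes "finite V" "\<And>A. A \<in> V \<Longrightarrow> finite A \<and> card A choose k \<le> K"
  shows "card {G. \<exists>A\<in>V. G \<subseteq> ksub A k \<and> card G = t} \<le> card V * K ^ t"
   "finite {G. \<exists>A\<in>V. G \<subseteq> ksub A k \<and> card G = t}"
proof -
  have eq: "{G. \<exists>A\<in>V. G \<subseteq> ksub A k \<and> card G = t} = (\<Union>A\<in>V. {G. G \<subseteq> ksub A k \<and> card G = t})" by auto
  have c: "card {G. G \<subseteq> ksub A k \<and> card G = t} \<le> K ^ t" if "A \<in> V" for A
  proof -
   have "card {G. G \<subseteq> ksub A k \<and> card G = t} = (card A choose k) choose t"
    using assms(2)[OF that] by (simp add: n_subsets card_ksub)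
   also have "\<dots> \<le> (card A choose k) ^ t"
    by (rule choose_le_pow)
   also have "\<dots> \<le> K ^ t" using assms(2)[OF that] by (intro power_mono) auto
   finally show ?thesis .
  qed
  show "card {G. \<exists>A\<in>V. G \<subseteq> ksub A k \<and> card G = t} \<le> card V * K ^ t"
  proof -
   have "card (\<Union>A\<in>V. {G. G \<subseteq> ksub A k \<and> card G = t}) \<le> (\<Sum>A\<in>V. card {G. G \<subseteq> ksub A k \<and> card G = t})"
    by (rule card_UN_le[OF assms(1)])
   also have "\<dots> \<le> (\<Sum>A\<in>V. K ^ t)" using c by (rule sum_mono)
   finally show ?thesis unfolding eq by simp
  qed
  have "finite {G. G \<subseteq> ksub A k \<and> card G = t}" if "A \<in> V" for A
   by (rule finite_subset[of _ "Pow (ksub A k)"]) (use assms(2)[OF that] in auto)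
  then show "finite {G. \<exists>A\<in>V. G \<subseteq> ksub A k \<and> card G = t}"
   unfolding eq using assms(1) by blast
qed

text \<open>exp (L n) bounds the number of hosts and \<open>K n\<close> the number of k-subsets of
  one host. So r (L + t ln K) bounds the logarithm of the number of events, to be paid by the t^r
  edges of each. \<open>ok\<close> selects those n for which the deterministic argument asks for an
  event.\<close>

lemma hostev_negligible:
  assumes p: "0 < p" "p < 1"
   and V: "\<And>n. finite (V n)" "\<And>n A. A \<in> V n \<Longrightarrow> finite A \<and> card A choose k n \<le> K n"
   and K: "\<And>n. K n \<ge> 1"
   and ev: "\<forall>\<^sub>F n in sequentially. ok n \<longrightarrow> real (card (V n)) \<le> exp (L n) \<and>
    r * (L n + t n * ln (K n)) + ln n \<le> - ln (1 - p) * real (t n ^ r)"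
  shows "negligible p (\<lambda>n. if ok n then hostev r (k n) (V n) (t n) else {})"
proof -
  define P where "P = (\<lambda>n. {G. \<exists>A\<in>V n. G \<subseteq> ksub A (k n) \<and> card G = t n})"
  define W :: "nat \<Rightarrow> nat" where "W = (\<lambda>n. if ok n then 1 else 0)"
  have P: "card (P n) \<le> card (V n) * K n ^ t n" "finite (P n)" for n
   unfolding P_def by (rule card_subfamilies[OF V(1) V(2)], assumption)+
  have "negligible p (\<lambda>n. \<Union>w\<in>{1..W n}. {transversals r F |F.
    F \<in> PiE {..<r} (\<lambda>_. P n) \<and> real (t n ^ r) \<le> card (transversals r F)})"
  proof (rule negligibleI[OF p, where x = "\<lambda>n. ln (real n)" and a = "\<lambda>n w. r * (L n + t n * ln (K n))"])
   show "finite (PiE {..<r} (\<lambda>_. P n))" for n using P by (intro finite_PiE) auto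
   show "filterlim (\<lambda>n. ln (real n)) at_top sequentially" by real_asymp
   show "\<forall>\<^sub>F n in sequentially. \<forall>w\<in>{1..W n}.
    real (card (PiE {..<r} (\<lambda>_. P n))) \<le> exp (r * (L n + t n * ln (K n))) \<and>
    r * (L n + t n * ln (K n)) + w * ln n \<le> - ln (1 - p) * real (t n ^ r)"
    using ev
   proof eventually_elim
    case (elim n)
    show ?case
    proof (intro ballI conjI)
     fix w assume w: "w \<in> {1..W n}"
     then have ok: "ok n" "w = 1" by (auto simp: W_def split: if_splits)
     show "r * (L n + t n * ln (K n)) + w * ln n \<le> - ln (1 - p) * real (t n ^ r)"
      using elim ok by simp
     have "real (card (P n)) \<le> real (card (V n) * K n ^ t n)" using P(1) by (intro of_nat_mono)
     also have "\<dots> \<le> exp (L n) * real (K n) ^ t n"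
      using elim ok by (simp add: mult_right_mono)
     also have "real (K n) ^ t n = exp (t n * ln (K n))"
      using K[of n] by (simp add: exp_of_nat_mult)
     finally have "real (card (P n)) \<le> exp (L n + t n * ln (K n))" by (simp add: exp_add)
     then have "real (card (P n)) ^ r \<le> exp (L n + t n * ln (K n)) ^ r" by (intro power_mono) auto
     then show "real (card (PiE {..<r} (\<lambda>_. P n))) \<le> exp (r * (L n + t n * ln (K n)))"
      by (simp add: card_PiE exp_of_nat_mult)
    qed
   qed
  qed
  moreover have "(\<Union>w\<in>{1..W n}. {transversals r F |F.
    F \<in> PiE {..<r} (\<lambda>_. P n) \<and> real (t n ^ r) \<le> card (transversals r F)})
   = (if ok n then hostev r (k n) (V n) (t n) else {})" for n
   by (auto simp: W_def hostev_def P_def)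
  ultimately show ?thesis by simp
qed

lemma hostev_hit:
  assumes k: "k \<ge> 1" and e: "card e = r" "pairwise disjnt e" "finite e"
   and V: "\<And>D. D \<in> e \<Longrightarrow> \<exists>A\<in>V. D \<subseteq> A" and U: "\<And>D. D \<in> e \<Longrightarrow> D \<subseteq> U"
   and t: "\<And>D. D \<in> e \<Longrightarrow> t \<le> popcount f k c D"
  shows "\<exists>E\<in>hostev r k V t. E \<subseteq> kedges r (ksub U k) \<and> (\<forall>x\<in>E. mono_edge f x)"
proof -
  obtain D where D: "bij_betw D {..<r} e"
   using e by (metis ex_bij_betw_nat_finite lessThan_atLeast0)
  have De: "D i \<in> e" if "i < r" for i using D that by (auto simp: bij_betw_def)
  have "\<exists>G. G \<subseteq> {v \<in> ksub (D i) k. f v = c} \<and> card G = t" if "i < r" for i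
   by (rule obtain_subset_with_card_n[OF t[OF De[OF that], unfolded popcount_def]]) blast
  then obtain G where G: "\<And>i. i < r \<Longrightarrow> G i \<subseteq> {v \<in> ksub (D i) k. f v = c} \<and> card (G i) = t"
   by metis
  define F where "F = restrict G {..<r}"
  have F: "F i \<subseteq> ksub (D i) k" "card (F i) = t" if "i < r" for i
   using G[OF that] that by (auto simp: F_def)
  have dis: "D i \<inter> D j = {}" if "i < r" "j < r" "i \<noteq> j" for i j
  proof -
   have "D i \<noteq> D j" using D that by (auto simp: bij_betw_def inj_on_def)
   then show ?thesis using e(2) De that unfolding pairwise_def disjnt_def by blast
  qed
  note tr = transversals_props[of k r F D, OF k F(1) dis]
  have "card (transversals r F) = t ^ r" using tr(2) F(2) by simp
  moreover have "F \<in> PiE {..<r} (\<lambda>_. {G. \<exists>A\<in>V. G \<subseteq> ksub A k \<and> card G = t})"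
  proof (rule PiE_I)
   fix i assume i: "i \<in> {..<r}"
   then obtain A where "A \<in> V" "D i \<subseteq> A" using V De by (meson lessThan_iff)
   then show "F i \<in> {G. \<exists>A\<in>V. G \<subseteq> ksub A k \<and> card G = t}"
    using F[of i] i ksub_mono[of "D i" A k] by blast
  qed (simp add: F_def)
  ultimately have "transversals r F \<in> hostev r k V t" unfolding hostev_def by auto
  moreover have "transversals r F \<subseteq> kedges r (ksub U k)"
  proof -
   have "(\<Union>j<r. F j) \<subseteq> ksub U k" using F U De by (fastforce simp: ksub_def)
   then show ?thesis using tr(1) kedges_mono by blast
  qed
  moreover have "\<forall>x\<in>transversals r F. mono_edge f x"
  proof
   fix x assume "x \<in> transversals r F"
   then obtain u where u: "u \<in> PiE {..<r} F" "x = u ` {..<r}" by (auto simp: transversals_def)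
   have "f (u i) = c" if "i < r" for i
   proof -
    have "u i \<in> G i" using u(1) that by (auto simp: F_def PiE_def Pi_def)
    then show ?thesis using G[OF that] by blast
   qed
   then show "mono_edge f x" using u(2) by (auto simp: mono_edge_def)
  qed
  ultimately show ?thesis by blast
qed

lemma popular_hosts:
  assumes k: "k \<ge> 1" and r: "r \<ge> 1" and T: "T \<subseteq> U" "finite U" and C: "finite C" and nt: "\<not> tcol r T d C"
   and pop: "\<And>A. A \<in> ksub T d \<Longrightarrow> \<exists>c\<in>C. t \<le> popcount f k c A"
   and V: "\<And>A. A \<in> ksub T d \<Longrightarrow> \<exists>B\<in>V. A \<subseteq> B"
  shows "\<exists>E\<in>hostev r k V t. E \<subseteq> kedges r (ksub U k) \<and> (\<forall>x\<in>E. mono_edge f x)"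
proof -
  obtain g where g: "\<And>A. A \<in> ksub T d \<Longrightarrow> g A \<in> C \<and> t \<le> popcount f k (g A) A"
   using pop by metis
  have "g ` ksub T d \<subseteq> C" using g by auto
  then obtain c where c: "c \<in> C" "kedges r {A \<in> ksub T d. g A = c} \<noteq> {}"
   using nt unfolding tcol_def by blast
  then obtain e where e: "e \<subseteq> {A \<in> ksub T d. g A = c}" "card e = r" "pairwise disjnt e"
   by (auto simp: kedges_def)
  show ?thesis
  proof (rule hostev_hit[OF k e(2,3), where c = c])
   show "finite e" using e(2) r card.infinite by fastforce
   fix D assume "D \<in> e"
   then have D: "D \<in> ksub T d" "g D = c" using e(1) by auto
   show "\<exists>A\<in>V. D \<subseteq> A" using V D by simp
   show "D \<subseteq> U" using D T by (auto simp: ksub_def)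
   show "t \<le> popcount f k c D" using g[OF D(1)] D(2) by simp
  qed
qed

text \<open>The standard colouring: all colours but one take the stars of r - 1 points each, and the
  last one colours the d-sets of the remaining fewer than r d points, no r of which are
  disjoint.\<close>

lemma not_tcol_bound:
  assumes r: "r \<ge> 1" and d: "d \<ge> 1" and fin: "finite T" "finite C" and C: "C \<noteq> {}" and nt: "\<not> tcol r T d C"
  shows "(r - 1) * (card C - 1) + r * d \<le> card T"
proof (rule ccontr)
  assume "\<not> ?thesis"
  then have less: "card T < (r - 1) * (card C - 1) + r * d" by simp
  obtain c0 where c0: "c0 \<in> C" using C by auto
  show False
  proof (cases "card T \<le> (r - 1) * (card C - 1)")
   case True
   moreover have "(r - 1) * (card C - 1) \<le> (r - 1) * card C" by (intro mult_left_mono) auto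
   ultimately have "card T \<le> (r - 1) * card C" by (rule order_trans)
   then have "tcol r T d C" using r d fin by (intro tcol_stars)
   then show False using nt by simp
  next
   case False
   then obtain Y where Y: "Y \<subseteq> T" "card Y = (r - 1) * (card C - 1)"
    by (metis nle_le obtain_subset_with_card_n)
   have "card (T - Y) < r * d"
   proof -
    have "card (T - Y) = card T - card Y" using Y(1) fin by (simp add: card_Diff_subset finite_subset)
    then show ?thesis using Y(2) less False by linarith
   qed
   have "tcol r T d C"
   proof (rule tcol_absorb[OF r fin Y(1), where g = "\<lambda>_. c0" and s = "\<lambda>c. if c = c0 then r - 1 else 0"])
    fix c
    show "kedges (Suc (if c = c0 then r - 1 else 0)) {A \<in> ksub (T - Y) d. c0 = c} = {}"
    proof (cases "c = c0")
     case True
     have "False" if e: "e \<in> kedges r (ksub (T - Y) d)" for e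
     proof -
      have e': "e \<subseteq> ksub (T - Y) d" "card e = r" "pairwise disjnt e" using e by (auto simp: kedges_def)
      have fe: "finite e" using e'(2) r card.infinite by fastforce
      have ce: "card A = d" "finite A" if "A \<in> e" for A
       using e'(1) that d fin by (auto simp: ksub_def intro: finite_subset[of A T])
      have "card (\<Union>e) = (\<Sum>A\<in>e. card A)"
       using e'(3) ce by (intro card_Union_disjoint) auto
      also have "\<dots> = r * d" using ce e'(2) by simp
      finally have "card (\<Union>e) = r * d" .
      moreover have "card (\<Union>e) \<le> card (T - Y)"
       using e'(1) fin by (intro card_mono) (auto simp: ksub_def)
      ultimately show False using \<open>card (T - Y) < r * d\<close> by simp
     qed
     then show ?thesis using True r by auto
    qed (auto simp: kedges_def)
   next
    have "(\<Sum>c\<in>C. r - 1 - (if c = c0 then r - 1 else 0)) = (\<Sum>c\<in>C - {c0}. r - 1)"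
     using fin c0 by (subst sum.remove[of C c0]) auto
    then show "card Y \<le> (\<Sum>c\<in>C. r - 1 - (if c = c0 then r - 1 else 0))"
     using Y fin c0 by (simp add: mult.commute)
   qed (use c0 in auto)
   then show False using nt by simp
  qed
qed

lemma not_colorable_bound:
  assumes r: "r \<ge> 2" and d: "d \<ge> 1" "k \<le> d" and nc: "\<not> colorable r n d m" and f: "f ` ksub {1..n} k \<subseteq> {..<m}"
  shows "m \<ge> 1" "(r - 1) * (m - 1) + r * d \<le> n" "(r - 1) * m < n" "m < n"
proof -
  have nt: "\<not> tcol r {1..n} d {..<m}" using nc by (simp add: colorable_tcol)
  \<comment> \<open>Without colours there is no k-set, hence no d-set, and the empty colouring would
    be proper.\<close>
  show m: "m \<ge> 1"
  proof (rule ccontr)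
   assume "\<not> m \<ge> 1"
   then have "ksub {1..n} k = {}" using f by auto
   then have "n choose k = 0" using card_ksub[of "{1..n}" k] by simp
   then have "n < d" using d by simp
   then have "ksub {1..n} d = {}"
   proof -
    have "finite (ksub {1..n} d)" "card (ksub {1..n} d) = 0"
     using \<open>n < d\<close> card_ksub[of "{1..n}" d] by (simp_all add: binomial_eq_0)
    then show ?thesis by (metis card_eq_0_iff)
   qed
   then show False using nt unfolding tcol_def by (auto simp: kedges_def) (use r in auto)
  qed
  show b: "(r - 1) * (m - 1) + r * d \<le> n"
   using not_tcol_bound[OF _ d(1) _ _ _ nt] r m by (simp add: lessThan_empty_iff)
  have "r * d \<ge> r" using d by simp
  obtain s where s: "r = Suc (Suc s)" using r by (metis le_Suc_ex add_2_eq_Suc)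
  obtain m' where m': "m = Suc m'" using m by (cases m) auto
  show "(r - 1) * m < n" using b \<open>r * d \<ge> r\<close> unfolding s m' by (simp add: algebra_simps)
  moreover have "m \<le> (r - 1) * m" using s by simp
  ultimately show "m < n" by linarith
qed

section \<open>Statement (c)\<close>

section \<open>Sparse random Kneser graphs with fixed k\<close>

lemma choose_ge_pow: "real ((k + l) choose k) \<ge> (real l / real k) ^ k"
proof -
  have "(real l / real k) ^ k \<le> (real (k + l) / real k) ^ k"
   by (intro power_mono divide_right_mono) auto
  also have "\<dots> \<le> real ((k + l) choose k)" by (rule binomial_ge_n_over_k_pow_k) simp
  finally show ?thesis .
qed

lemma nat_ceiling_props:
  assumes "x > 0"
  shows "real (nat \<lceil>x\<rceil>) \<ge> x" "nat \<lceil>x\<rceil> \<ge> 1" "real (nat \<lceil>x\<rceil> - 1) < x" "real (nat \<lceil>x\<rceil>) \<le> x + 1"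
  using assms by linarith+

lemma powr_root_power: "x \<ge> 0 \<Longrightarrow> k \<ge> 1 \<Longrightarrow> (x powr (1 / real k)) ^ k = x"
  by (cases "x = 0") (auto simp: powr_power)

text \<open>Fewer than n colours share the k-subsets of a (k+l)-set, of which there are at least q n
  ln n, so some colour occurs q ln n times. As k is fixed, {1..n} itself serves as the only host: t
  k-sets cost about k t ln n, against t^2 edges.\<close>

lemma graph_fixed_k:
  fixes p :: real
  assumes p: "0 < p" "p < 1" and k: "k \<ge> 2"
  shows "\<exists>C>0. \<forall>l::nat \<Rightarrow> nat. (\<forall>n. l n \<ge> 2) \<and>
    (\<forall>\<^sub>F n in sequentially. real (l n) \<ge> C * (real n * ln (real n)) powr (1 / real k)) \<longrightarrow>
    aas_chromatic_bound 2 p (\<lambda>_. k) l"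
proof -
  define b where "b = - ln (1 - p)"
  have b: "b > 0" using p by (simp add: b_def)
  \<comment> \<open>Solves b q = 2k + 1: two families of t k-sets cost 2kt ln n, and a further ln n
    makes the sum tend to 0.\<close>
  define q where "q = (2 * real k + 1) / b"
  have q: "q > 0" using b by (simp add: q_def)
  define C where "C = real k * (q + 1)"
  have "C > 0" using k q by (simp add: C_def)
  moreover have "aas_chromatic_bound 2 p (\<lambda>_. k) l"
   if l2: "\<forall>n. l n \<ge> 2" and lC: "\<forall>\<^sub>F n in sequentially. real (l n) \<ge> C * (real n * ln (real n)) powr (1 / real k)"
   for l :: "nat \<Rightarrow> nat"
  proof -
   define t where "t = (\<lambda>n::nat. nat \<lceil>q * ln (real n)\<rceil>)"
   have big: "\<forall>\<^sub>F n in sequentially. ln (real n) > 0" by real_asymp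
   have X: "negligible p (\<lambda>n. if True then hostev 2 k {{1..n}} (t n) else {})"
   proof (rule hostev_negligible[OF p, where L = "\<lambda>_. 0" and K = "\<lambda>n. max 1 (n ^ k)"])
    fix n :: nat and A assume "A \<in> {{1..n}}"
    then show "finite A \<and> card A choose k \<le> max 1 (n ^ k)"
     using choose_le_pow[of n k] by auto
   next
    show "\<forall>\<^sub>F n in sequentially. True \<longrightarrow> real (card {{1..n}}) \<le> exp 0 \<and>
     real 2 * (0 + real (t n) * ln (real (max 1 (n ^ k)))) + ln (real n) \<le> - ln (1 - p) * real (t n ^ 2)"
     using big eventually_ge_at_top[of 1]
    proof eventually_elim
     case (elim n)
     have tq: "real (t n) \<ge> q * ln n" "real (t n) \<ge> 1"
      using nat_ceiling_props[of "q * ln n"] q elim by (auto simp: t_def)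
     have "ln (real (max 1 (n ^ k))) = k * ln n" using elim by (simp add: max_def ln_realpow)
     moreover have "2 * (t n * (k * ln n)) + ln n \<le> b * real (t n ^ 2)"
     proof -
      have "2 * (t n * (k * ln n)) + ln n \<le> 2 * (t n * (k * ln n)) + t n * ln n"
       using tq elim mult_right_mono[of 1 "real (t n)" "ln n"] by simp
      also have "\<dots> = b * (t n * (q * ln n))" using b by (simp add: q_def field_simps)
      also have "\<dots> \<le> b * (t n * t n)" using tq b by (intro mult_left_mono) auto
      finally show ?thesis by (simp add: power2_eq_square)
     qed
     ultimately show ?case by (simp add: b_def)
    qed
   qed auto
   show ?thesis
   proof (rule aas_chromatic_boundI[OF p _ X])
    show "\<forall>\<^sub>F n in sequentially. \<forall>m f. \<not> colorable 2 n (k + l n) m \<longrightarrow> f ` ksub {1..n} k \<subseteq> {..<m} \<longrightarrow>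
     (\<exists>E\<in>if True then hostev 2 k {{1..n}} (t n) else {}. E \<subseteq> kedges 2 (ksub {1..n} k) \<and> (\<forall>e\<in>E. mono_edge f e))"
     using big lC
    proof eventually_elim
     case (elim n)
     show ?case
     proof (intro allI impI)
      fix m f assume nc: "\<not> colorable 2 n (k + l n) m" and f: "f ` ksub {1..n} k \<subseteq> {..<m}"
      have mn: "m < n" using not_colorable_bound(4)[OF _ _ _ nc f] k by simp
      have Kbig: "q * (n * ln n) \<le> real ((k + l n) choose k)"
      proof -
       have "q * (n * ln n) \<le> (q + 1) ^ k * (n * ln n)"
       proof (intro mult_right_mono)
        have "q \<le> q + 1" by simp
        also have "\<dots> \<le> (q + 1) ^ k" using q k by (intro self_le_power) auto
        finally show "q \<le> (q + 1) ^ k" .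
       qed (use elim in auto)
       also have "\<dots> = ((q + 1) * (real n * ln n) powr (1 / k)) ^ k"
        using elim k by (simp add: power_mult_distrib powr_root_power)
       also have "\<dots> \<le> (real (l n) / real k) ^ k"
        using elim k q by (intro power_mono) (auto simp: C_def field_simps)
       also have "\<dots> \<le> real ((k + l n) choose k)" by (rule choose_ge_pow)
       finally show ?thesis .
      qed
      show "\<exists>E\<in>if True then hostev 2 k {{1..n}} (t n) else {}. E \<subseteq> kedges 2 (ksub {1..n} k) \<and> (\<forall>e\<in>E. mono_edge f e)"
       unfolding if_True
      proof (rule popular_hosts[where T = "{1..n}" and d = "k + l n" and C = "{..<m}"])
       show "\<not> tcol 2 {1..n} (k + l n) {..<m}" using nc by (simp add: colorable_tcol)
       fix A assume A: "A \<in> ksub {1..n} (k + l n)"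
       have finA: "finite A" and cA: "card A = k + l n" using A by (auto simp: ksub_def intro: finite_subset)
       have "(t n - 1) * card {..<m} < card A choose k"
       proof -
        have "real ((t n - 1) * m) \<le> q * ln n * m"
         using nat_ceiling_props(3)[of "q * ln n"] q elim by (simp add: t_def mult_right_mono)
        also have "\<dots> < q * ln n * n" using q elim mn by (intro mult_strict_left_mono) auto
        also have "\<dots> \<le> real ((k + l n) choose k)" using Kbig by (simp add: mult_ac)
        finally have "(t n - 1) * m < (k + l n) choose k" by (simp only: of_nat_less_iff)
        then show ?thesis using cA by simp
       qed
       moreover have "f ` ksub A k \<subseteq> {..<m}" using f A ksub_mono[of A "{1..n}" k] by (auto simp: ksub_def)
       ultimately obtain c where "c \<in> {..<m}" "t n \<le> popcount f k c A"
        using popular_colour[OF finA, of "{..<m}" f k "t n"] by auto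
       then show "\<exists>c\<in>{..<m}. t n \<le> popcount f k c A" by blast
      qed (use k in \<open>auto simp: ksub_def\<close>)
     qed
    qed
   qed simp
  qed
  ultimately show ?thesis by blast
qed

section \<open>Statement (a)\<close>

section \<open>The range n - rk small\<close>

definition shifted_stab :: "nat \<Rightarrow> nat \<Rightarrow> nat \<Rightarrow> nat set set" where
  "shifted_stab r n d = image Suc ` stab r n d"

lemma shifted_stab_props:
  "finite (shifted_stab r n d)" "shifted_stab r n d \<subseteq> ksub {1..n} d"
  "card (shifted_stab r n d) = card (stab r n d)"
proof -
  show "finite (shifted_stab r n d)" by (simp add: shifted_stab_def)
  show "shifted_stab r n d \<subseteq> ksub {1..n} d"
   by (fastforce simp: shifted_stab_def stab_def ksub_def card_image)
  have "inj (image Suc)" by (rule injI) (simp add: inj_image_eq_iff)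
  then show "card (shifted_stab r n d) = card (stab r n d)"
   unfolding shifted_stab_def by (meson card_image inj_on_subset subset_UNIV)
qed

text \<open>The binomial from \<open>card_stab_le\<close> is read from its other end: for n = m +
  (r-1)k the complementary index m - (k+1) is less than n - rk, which is small in this
  range.\<close>

lemma card_shifted_stab_le:
  assumes "r \<ge> 1" "r * (k + 1) \<le> n"
  shows "card (shifted_stab r n (k + 1)) \<le> n ^ (n - r * k)"
proof -
  obtain s where s: "r = Suc s" using assms(1) by (cases r) auto
  define m where "m = n - s * k"
  have n: "n = m + (r - 1) * k" and mk: "k + 1 \<le> m" and mr: "m - (k + 1) \<le> n - r * k"
   using assms(2) by (auto simp: m_def s algebra_simps)
  have n1: "n \<ge> 1" using mk n by simp
  have "card (shifted_stab r n (k + 1)) \<le> m choose (Suc k)"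
   using card_stab_le[OF assms(1), of m k] n by (simp add: shifted_stab_props)
  also have "\<dots> = m choose (m - (k + 1))" using mk by (subst binomial_symmetric) auto
  also have "\<dots> \<le> m ^ (m - (k + 1))" by (rule choose_le_pow)
  also have "\<dots> \<le> n ^ (m - (k + 1))" using n by (intro power_mono) auto
  also have "\<dots> \<le> n ^ (n - r * k)" using mr n1 by (intro power_increasing) auto
  finally show ?thesis .
qed

text \<open>Near the threshold the (k+1)-sets are too numerous to serve as hosts in a union bound.
  All of them are coloured by popular colours, but the stable theorem finds r disjoint hosts of
  equal colour already among the shifted stable sets. Non-colourability gives m \<le> n - rk, whence
  the popularity t.\<close>

lemma pow2_deterministic:
  assumes r: "r = 2 ^ q" "r \<ge> 2" and k: "k \<ge> 1" and nc: "\<not> colorable r n (k + 1) m"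
   and f: "f ` ksub {1..n} k \<subseteq> {..<m}" and t: "(t - 1) * (n - r * k) < k + 1"
  shows "\<exists>E\<in>hostev r k (shifted_stab r n (k + 1)) t. E \<subseteq> kedges r (ksub {1..n} k) \<and> (\<forall>e\<in>E. mono_edge f e)"
proof -
  have m: "m \<ge> 1" "(r - 1) * (m - 1) + r * (k + 1) \<le> n"
   using not_colorable_bound(1,2)[OF r(2) _ _ nc f] by auto
  obtain s where s: "r = Suc (Suc s)" using r(2) by (metis le_Suc_ex add_2_eq_Suc)
  obtain m' where m': "m = Suc m'" using m(1) by (cases m) auto
  have n1: "r * k + (r - 1) * m + 1 \<le> n" using m(2) unfolding s m' by (simp add: algebra_simps)
  have "m \<le> (r - 1) * m" using s by simp
  then have mn: "m \<le> n - r * k" using n1 by linarith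
  have pop: "\<exists>c<m. t \<le> popcount f k c A" if A: "A \<in> ksub {1..n} (k + 1)" for A
  proof -
   have finA: "finite A" and cA: "card A = k + 1" using A by (auto simp: ksub_def intro: finite_subset)
   have "f ` ksub A k \<subseteq> {..<m}" using f A ksub_mono[of A "{1..n}" k] by (auto simp: ksub_def)
   moreover have "(t - 1) * card {..<m} < card A choose k"
   proof -
    have "(t - 1) * m \<le> (t - 1) * (n - r * k)" using mn by (rule mult_le_mono2)
    then have "(t - 1) * m < k + 1" using t by (rule le_less_trans)
    then show ?thesis using cA by simp
   qed
   ultimately show ?thesis using popular_colour[OF finA, of "{..<m}" f k t] by (metis finite_lessThan lessThan_iff)
  qed
  then obtain g where g: "\<And>A. A \<in> ksub {1..n} (k + 1) \<Longrightarrow> g A < m \<and> t \<le> popcount f k (g A) A"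
   by metis
  have sub: "Suc ` S \<in> ksub {1..n} (k + 1)" if "S \<in> stab r n (k + 1)" for S
   using that shifted_stab_props(2)[of r n "k + 1"] by (auto simp: shifted_stab_def)
  obtain e x where e: "e \<in> kedges r (stab r n (k + 1))" "\<forall>S\<in>e. g (Suc ` S) = x"
   using stable_kneser_pow2[of "k + 1" r q m n "\<lambda>S. g (Suc ` S)"] r n1 g sub by auto
  have e': "e \<subseteq> stab r n (k + 1)" "card e = r" "pairwise disjnt e" using e by (auto simp: kedges_def)
  define e1 where "e1 = image Suc ` e"
  have "inj (image Suc)" by (rule injI) (simp add: inj_image_eq_iff)
  then have c1: "card e1 = r" unfolding e1_def using e'(2) by (metis card_image inj_on_subset subset_UNIV)
  show ?thesis
  proof (rule hostev_hit[OF k c1, where c = x])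
   show "pairwise disjnt e1"
   proof (rule pairwiseI)
    fix A B assume "A \<in> e1" "B \<in> e1" "A \<noteq> B"
    then obtain S S' where "S \<in> e" "S' \<in> e" "A = Suc ` S" "B = Suc ` S'" "S \<noteq> S'" by (auto simp: e1_def)
    then show "disjnt A B" using e'(3) by (auto simp: pairwise_def disjnt_def)
   qed
   show "finite e1" using c1 r(2) card.infinite by fastforce
   fix D assume "D \<in> e1"
   then obtain S where S: "S \<in> e" "D = Suc ` S" by (auto simp: e1_def)
   show "\<exists>A\<in>shifted_stab r n (k + 1). D \<subseteq> A" using S e'(1) by (auto simp: shifted_stab_def)
   have D: "D \<in> ksub {1..n} (k + 1)" using S e'(1) sub by auto
   then show "D \<subseteq> {1..n}" by (simp add: ksub_def)
   show "t \<le> popcount f k x D" using g[OF D] e(2) S by auto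
  qed
qed

text \<open>With s = n - rk the hosts cost s ln n, and t is about k/s with k of order n. The cost is
  covered if s^(r+1) ln n is small against n^r, which is the assumption. The cost t ln n is covered
  because t is at least a constant times a positive power of n.\<close>

lemma near_extremal:
  fixes p :: real
  assumes p: "0 < p" "p < 1" and r: "r = 2 ^ q" "r \<ge> 2"
  shows "\<exists>C::real. C > 0 \<and> (\<forall>k :: nat \<Rightarrow> nat. (\<forall>n. k n \<ge> 1) \<and>
   (\<forall>\<^sub>F n in sequentially. C * (real n - real r * real (k n))
     \<le> real n powr (real r / (real r + 1)) * ln (real n) powr (- 1 / (real r + 1))) \<longrightarrow>
   aas_chromatic_bound r p k (\<lambda>_. 1))"
proof -
  define b where "b = - ln (1 - p)"
  have b: "b > 0" using p by (simp add: b_def)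
  \<comment> \<open>Chosen so that (r+1) s ln n equals b/2 times D s^(r+1) ln n / (2rs)^r. The other
    half of b pays for the t ln n term.\<close>
  define D where "D = 2 * (real r + 1) * (2 * real r) ^ r / b"
  define C where "C = 2 + D"
  have D: "D > 0" using b r(2) by (simp add: D_def)
  have "C > 0" using D by (simp add: C_def)
  moreover have "aas_chromatic_bound r p k (\<lambda>_. 1)"
   if k1: "\<forall>n. k n \<ge> 1" and kC: "\<forall>\<^sub>F n in sequentially. C * (real n - real r * real (k n))
     \<le> real n powr (real r / (real r + 1)) * ln (real n) powr (- 1 / (real r + 1))"
   for k :: "nat \<Rightarrow> nat"
  proof -
   define s where "s = (\<lambda>n. n - r * k n)"
   define t where "t = (\<lambda>n. nat \<lceil>real (k n + 1) / real (s n)\<rceil>)"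
   \<comment> \<open>Non-colourability on (k+1)-sets forces this inequality, so for the other n the
     list of events can be empty.\<close>
   define ok where "ok = (\<lambda>n. r * (k n + 1) \<le> n)"
   define a where "a = 1 / (real r + 1)"
   have a: "a > 0" by (simp add: a_def)
   have big1: "\<forall>\<^sub>F n in sequentially. ln (real n) \<ge> 1" by real_asymp
   have big2: "\<forall>\<^sub>F n in sequentially. 2 * r / b * ln (real n) \<le> real n powr a / (2 * r)"
    using a b r by real_asymp
   have sr: "real (s n) = real n - real r * real (k n)" "real (s n) \<ge> 1" if "ok n" for n
   proof -
    have "r * k n + 1 \<le> n" using that r(2) by (auto simp: ok_def)
    then have "s n \<ge> 1" "r * k n + s n = n" by (auto simp: s_def)
    then show "real (s n) = real n - real r * real (k n)" "real (s n) \<ge> 1"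
     by (metis add_diff_cancel_left' of_nat_add of_nat_mult, simp)
   qed
   have X: "negligible p (\<lambda>n. if ok n then hostev r (k n) (shifted_stab r n (k n + 1)) (t n) else {})"
   proof (rule hostev_negligible[OF p, where L = "\<lambda>n. s n * ln n" and K = "\<lambda>n. max 1 n"])
    fix n A assume "A \<in> shifted_stab r n (k n + 1)"
    then have "A \<in> ksub {1..n} (k n + 1)" using shifted_stab_props(2) by blast
    then have A: "A \<subseteq> {1..n}" "card A = k n + 1" by (auto simp: ksub_def)
    then have "card A \<le> n" using card_mono[of "{1..n}" A] by simp
    then show "finite A \<and> card A choose k n \<le> max 1 n"
     using A finite_subset by auto
   next
    show "\<forall>\<^sub>F n in sequentially. ok n \<longrightarrow>
     real (card (shifted_stab r n (k n + 1))) \<le> exp (s n * ln n) \<and>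
     real r * (s n * ln n + real (t n) * ln (real (max 1 n))) + ln (real n) \<le> - ln (1 - p) * real (t n ^ r)"
     using big1 big2 kC eventually_ge_at_top[of 1]
    proof eventually_elim
     case (elim n)
     show ?case
     proof (intro impI)
      assume ok: "ok n"
      note sr = sr[OF ok]
      have sC: "C * s n \<le> real n powr (real r * a) * ln n powr (- a)"
       using elim(3) by (simp add: sr a_def)
      also have "\<dots> \<le> real n powr (real r * a) * 1"
      proof (rule mult_left_mono)
       have "ln n powr (- a) \<le> ln n powr 0" using elim(1) a by (intro powr_mono) auto
       then show "ln n powr (- a) \<le> 1" using elim(1) by simp
      qed simp
      finally have sC1: "C * s n \<le> real n powr (real r * a)" by simp
      have ra: "real r * a + a = 1" by (simp add: a_def field_simps)
      have "real n powr (real r * a) \<le> real n powr 1"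
       using elim(4) ra a by (intro powr_mono) auto
      \<comment> \<open>At least half of n remains for rk, whence k + 1 \<ge> n/(2r).\<close>
      then have "2 * real (s n) \<le> n" using sC1 D sr(2) by (simp add: C_def algebra_simps)
       (smt (verit) mult_nonneg_nonneg of_nat_0_le_iff)
      then have "real n \<le> 2 * (real r * real (k n)) + 2 * real r" using sr(1) of_nat_0_le_iff[of r] by linarith
      then have "real n \<le> 2 * r * (k n + 1)" by (simp add: algebra_simps)
      then have kn: "real n / (2 * r) \<le> k n + 1" using r(2) by (simp add: field_simps)
      have tn: "real (t n) \<ge> real (k n + 1) / s n" "t n \<ge> 1"
       using nat_ceiling_props(1,2)[of "real (k n + 1) / s n"] sr(2) by (auto simp: t_def)
      define u where "u = real n / (2 * r * s n)"
      have ut: "u \<le> t n"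
      proof -
       have "u = real n / (2 * r) / s n" by (simp add: u_def)
       also have "\<dots> \<le> real (k n + 1) / s n" using kn sr(2) by (intro divide_right_mono) auto
       finally show ?thesis using tn by simp
      qed
      have u0: "u \<ge> 0" by (simp add: u_def)
      have one: "real r * (s n * ln n) + ln n \<le> b / 2 * real (t n ^ r)"
      proof -
       have "(C * s n) ^ (r + 1) \<le> (real n powr (real r * a) * ln n powr (- a)) ^ (r + 1)"
        using sC D by (intro power_mono) (auto simp: C_def)
       also have "\<dots> = real n ^ r / ln n"
       proof -
        have "(real n powr (real r * a)) ^ (r + 1) = real n powr (real (r + 1) * (real r * a))"
         by (rule powr_power) (use elim in auto)
        also have "real (r + 1) * (real r * a) = real r" by (simp add: a_def field_simps)
        finally have 1: "(real n powr (real r * a)) ^ (r + 1) = real n ^ r"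
         using elim(4) by (simp add: powr_realpow)
        have "(ln n powr (- a)) ^ (r + 1) = ln n powr (real (r + 1) * (- a))"
         by (rule powr_power) (use elim in auto)
        also have "real (r + 1) * (- a) = - 1" by (simp add: a_def field_simps)
        finally have 2: "(ln n powr (- a)) ^ (r + 1) = inverse (ln n)"
         using elim(1) by (simp add: powr_minus)
        show ?thesis unfolding power_mult_distrib 1 2 by (simp add: field_simps)
       qed
       finally have P: "C ^ (r + 1) * real (s n) ^ (r + 1) * ln n \<le> real n ^ r"
        using elim(1) by (simp add: power_mult_distrib field_simps)
       have "D \<le> C ^ (r + 1)"
       proof -
        have "D \<le> C" by (simp add: C_def)
        also have "\<dots> \<le> C ^ (r + 1)" using D by (intro self_le_power) (auto simp: C_def)
        finally show ?thesis .
       qed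
       then have "D * (real (s n) ^ (r + 1) * ln n) \<le> C ^ (r + 1) * (real (s n) ^ (r + 1) * ln n)"
        using elim(1) by (intro mult_right_mono) auto
       then have P': "D * (real (s n) ^ (r + 1) * ln n) \<le> real n ^ r" using P by (simp add: mult_ac)
       have "real r * (s n * ln n) + ln n \<le> (real r + 1) * (s n * ln n)"
        using sr(2) elim(1) mult_right_mono[of 1 "real (s n)" "ln n"] by (simp add: algebra_simps)
       also have "\<dots> = b / 2 * (D * (real (s n) ^ (r + 1) * ln n)) / (2 * r * s n) ^ r"
        using b r(2) sr(2) by (simp add: D_def power_mult_distrib field_simps)
       also have "\<dots> \<le> b / 2 * real n ^ r / (2 * r * s n) ^ r"
        using P' b by (intro divide_right_mono mult_left_mono) auto
       also have "\<dots> = b / 2 * u ^ r" by (simp add: u_def power_divide)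
       also have "\<dots> \<le> b / 2 * real (t n) ^ r"
        using ut u0 b by (intro mult_left_mono power_mono) auto
       finally show ?thesis by simp
      qed
      have two: "real r * (t n * ln n) \<le> b / 2 * real (t n ^ r)"
      proof -
       have "real n powr a / (2 * r) \<le> u"
       proof -
        have "real n powr a * (C * s n) \<le> real n powr a * real n powr (real r * a)"
         using sC1 by (intro mult_left_mono) auto
        also have "\<dots> = real n" using ra elim(4) by (simp flip: powr_add add: add.commute)
        finally have "real n powr a * (C * s n) \<le> n" .
        moreover have "real n powr a * real (s n) \<le> real n powr a * (C * real (s n))"
        proof (rule mult_left_mono)
         have "1 * real (s n) \<le> C * real (s n)" using D by (intro mult_right_mono) (auto simp: C_def)
         then show "real (s n) \<le> C * real (s n)" by simp
        qed simp
        ultimately have "real n powr a * s n \<le> n" by simp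
        then show ?thesis using sr(2) r(2) by (simp add: u_def field_simps)
       qed
       then have "2 * r / b * ln n \<le> t n" using elim(2) ut by linarith
       also have "real (t n) \<le> real (t n) ^ (r - 1)" using tn r by (intro self_le_power) auto
       finally have "real r * ln n \<le> b / 2 * real (t n) ^ (r - 1)" using b by (simp add: field_simps)
       then have "real (t n) * (real r * ln n) \<le> real (t n) * (b / 2 * real (t n) ^ (r - 1))"
        by (intro mult_left_mono) auto
       also have "\<dots> = b / 2 * (real (t n) * real (t n) ^ (r - 1))" by (simp add: mult_ac)
       also have "real (t n) * real (t n) ^ (r - 1) = real (t n) ^ r"
        using r(2) by (metis One_nat_def Suc_pred not_gr_zero not_numeral_le_zero power_Suc)
       finally show ?thesis by (simp add: mult_ac)
      qed
      have "real (card (shifted_stab r n (k n + 1))) \<le> real (n ^ s n)"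
       unfolding s_def using card_shifted_stab_le[of r "k n" n] ok r by (intro of_nat_mono) (auto simp: ok_def)
      also have "\<dots> = exp (s n * ln n)" using elim(4) by (simp add: exp_of_nat_mult)
      finally show "real (card (shifted_stab r n (k n + 1))) \<le> exp (s n * ln n) \<and>
       real r * (s n * ln n + real (t n) * ln (real (max 1 n))) + ln (real n) \<le> - ln (1 - p) * real (t n ^ r)"
       using one two elim(4) by (simp add: b_def max_def algebra_simps)
     qed
    qed
   qed (simp_all add: shifted_stab_props)
   show ?thesis
   proof (rule aas_chromatic_boundI[OF p r(2) X])
    show "\<forall>\<^sub>F n in sequentially. \<forall>m f. \<not> colorable r n (k n + 1) m \<longrightarrow> f ` ksub {1..n} (k n) \<subseteq> {..<m} \<longrightarrow>
     (\<exists>E\<in>if ok n then hostev r (k n) (shifted_stab r n (k n + 1)) (t n) else {}.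
      E \<subseteq> kedges r (ksub {1..n} (k n)) \<and> (\<forall>e\<in>E. mono_edge f e))"
    proof (intro always_eventually allI impI)
     fix n m f assume nc: "\<not> colorable r n (k n + 1) m" and f: "f ` ksub {1..n} (k n) \<subseteq> {..<m}"
     have "(r - 1) * (m - 1) + r * (k n + 1) \<le> n"
      using not_colorable_bound(2)[OF r(2) _ _ nc f] by simp
     then have ok: "ok n" by (simp add: ok_def)
     have "real (t n - 1) < real (k n + 1) / s n"
      using nat_ceiling_props(3)[of "real (k n + 1) / s n"] sr(2)[OF ok] by (simp add: t_def)
     then have "real ((t n - 1) * s n) < real (k n + 1)" using sr(2)[OF ok] by (simp add: field_simps)
     then have "(t n - 1) * s n < k n + 1" by (simp only: of_nat_less_iff)
     then show "\<exists>E\<in>if ok n then hostev r (k n) (shifted_stab r n (k n + 1)) (t n) else {}.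
      E \<subseteq> kedges r (ksub {1..n} (k n)) \<and> (\<forall>e\<in>E. mono_edge f e)"
      using pow2_deterministic[OF r _ nc f] k1 ok by (simp add: s_def)
    qed
   qed
  qed
  ultimately show ?thesis by blast
qed

section \<open>Degrees in families of k-sets and the spread condition\<close>

section \<open>Stars and links\<close>

lemma card_link_le:
  assumes "finite T" "finite J"
  shows "card {v \<in> ksub T k. J \<subseteq> v} \<le> card T ^ (k - card J)"
proof -
  have "inj_on (\<lambda>v. v - J) {v \<in> ksub T k. J \<subseteq> v}"
   by (rule inj_onI) (metis (mono_tags, lifting) Diff_partition mem_Collect_eq)
  moreover have "(\<lambda>v. v - J) ` {v \<in> ksub T k. J \<subseteq> v} \<subseteq> ksub T (k - card J)"
   using assms by (auto simp: ksub_def card_Diff_subset)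
  ultimately have "card {v \<in> ksub T k. J \<subseteq> v} \<le> card (ksub T (k - card J))"
   using assms by (intro card_inj_on_le) auto
  also have "\<dots> \<le> card T ^ (k - card J)" using assms by (simp add: card_ksub choose_le_pow)
  finally show ?thesis .
qed

lemma card_star_le: "finite T \<Longrightarrow> card {v \<in> ksub T k. x \<in> v} \<le> card T ^ (k - 1)"
  using card_link_le[of T "{x}" k] by simp

lemma card_stars_le:
  assumes "finite T" "finite X"
  shows "card {v \<in> ksub T k. v \<inter> X \<noteq> {}} \<le> card X * card T ^ (k - 1)"
proof -
  have "{v \<in> ksub T k. v \<inter> X \<noteq> {}} = (\<Union>x\<in>X. {v \<in> ksub T k. x \<in> v})" by auto
  then have "card {v \<in> ksub T k. v \<inter> X \<noteq> {}} \<le> (\<Sum>x\<in>X. card {v \<in> ksub T k. x \<in> v})"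
   using card_UN_le[OF assms(2)] by simp
  also have "\<dots> \<le> (\<Sum>x\<in>X. card T ^ (k - 1))" using card_star_le[OF assms(1)] by (intro sum_mono)
  finally show ?thesis by simp
qed

lemma spread_if_small_stars:
  assumes fin: "finite G" and small: "\<And>u. u \<notin> J \<Longrightarrow> real (card {A \<in> G. u \<in> A}) \<le> y"
   and y0: "y \<ge> 0" and y: "real R * y \<le> card G / 2"
  shows "spread R (1/2) J G"
  unfolding spread_def
proof (intro allI impI)
  fix U :: "nat set" assume U: "finite U" "card U \<le> R" "U \<inter> J = {}"
  have "{A \<in> G. A \<inter> U \<noteq> {}} = (\<Union>u\<in>U. {A \<in> G. u \<in> A})" by auto
  then have "real (card {A \<in> G. A \<inter> U \<noteq> {}}) \<le> (\<Sum>u\<in>U. real (card {A \<in> G. u \<in> A}))"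
   using card_UN_le[OF U(1), of "\<lambda>u. {A \<in> G. u \<in> A}"] by (simp only: of_nat_sum[symmetric] of_nat_le_iff)
  also have "\<dots> \<le> (\<Sum>u\<in>U. y)" using small U by (intro sum_mono) auto
  also have "\<dots> = card U * y" by simp
  also have "\<dots> \<le> R * y" using U y0 by (auto intro: mult_right_mono)
  finally have hit: "real (card {A \<in> G. A \<inter> U \<noteq> {}}) \<le> card G / 2" using y by simp
  have "{A \<in> G. A \<inter> U = {}} = G - {A \<in> G. A \<inter> U \<noteq> {}}" by auto
  then have "card {A \<in> G. A \<inter> U = {}} = card G - card {A \<in> G. A \<inter> U \<noteq> {}}"
   using fin by (simp add: card_Diff_subset)
  moreover have "card {A \<in> G. A \<inter> U \<noteq> {}} \<le> card G" using fin by (intro card_mono) auto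
  ultimately show "1 / 2 * real (card G) \<le> real (card {A \<in> G. A \<inter> U = {}})"
   using hit by (simp add: of_nat_diff)
qed

lemma spread_self: "spread R 1 B {B}"
proof -
  have "{A \<in> {B}. A \<inter> U = {}} = {B}" if "U \<inter> B = {}" for U using that by auto
  then show ?thesis unfolding spread_def by simp
qed

text \<open>Each of the |C| kernels has at most r - 2 points, while |T| > (r-1)|C|. So more than |C|
  points survive, and they make up more than the fraction 1/(r-1) of T.\<close>

lemma universe_minus_kernels:
  fixes X :: "nat set"
  assumes r: "r \<ge> 3" and fin: "finite T" "finite C" and lt: "(r - 1) * card C < card T"
   and X: "X = (\<Union>c\<in>C. K c)" and K: "\<And>c. c \<in> C \<Longrightarrow> K c \<subseteq> T \<and> card (K c) \<le> r - 2"
  shows "card C < card (T - X)" "card T < (r - 1) * card (T - X)"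
proof -
  define s where "s = r - 2"
  have s: "r = Suc (Suc s)" "s > 0" using r by (auto simp: s_def)
  have "card X \<le> (\<Sum>c\<in>C. card (K c))" unfolding X by (rule card_UN_le[OF fin(2)])
  also have "\<dots> \<le> (\<Sum>c\<in>C. r - 2)" using K by (intro sum_mono) auto
  finally have cX: "card X \<le> s * card C" by (simp add: s(1) mult.commute)
  have XT: "X \<subseteq> T" using K X by blast
  have c1: "card (T - X) + card X = card T"
   using XT fin by (metis add.commute card_Diff_subset card_mono finite_subset le_add_diff_inverse)
  have lt': "card C + s * card C < card T" using lt s(1) by simp
  then show a: "card C < card (T - X)" using c1 cX by linarith
  have "s * card C < s * card (T - X)" using a s by simp
  then show "card T < (r - 1) * card (T - X)" using c1 cX a unfolding s(1) diff_Suc_1 mult_Suc by linarith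
qed

section \<open>Statements (e) and (g)\<close>

section \<open>Hypergraphs with fixed k\<close>

text \<open>Stars at r - 1 points together with one further k-set B. Requiring the other sets to
  meet X lowers the logarithm of the number of families from order |T|^k to order |T|^(k-1), which
  the |T|^((k-1)(r-1)) edges of this event can pay for.\<close>

definition star_families :: "nat \<Rightarrow> nat \<Rightarrow> nat set \<Rightarrow> nat set set set" where
  "star_families r k T = (\<Union>X\<in>ksub T (r - 1). (\<lambda>(B, H). insert B H) ` (ksub T k \<times> Pow {v \<in> ksub T k. v \<inter> X \<noteq> {}}))"

text \<open>A kernel point of c is one whose star of colour c has positive density. Hypothesis
  \<open>one\<close> excludes r - 1 kernel points together with a set of colour c off them, which
  drives \<open>reduce_universe\<close>. If T stayed large, then off all kernels the pigeonhole
  would give a class of at least phi |T|^(k-1) sets with all stars below del |T|^(k-1). Such a class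
  is spread and spans a constant times |T|^((k-1)r) edges, against \<open>two\<close>.\<close>

lemma fixed_k_reduction:
  fixes f :: "nat set \<Rightarrow> nat" and N0 :: real
  assumes r: "r \<ge> 3" and k: "k \<ge> 2" and d: "d \<ge> k" and nc: "\<not> colorable r n d m"
   and f: "f ` ksub {1..n} k \<subseteq> {..<m}"
   and phi: "phi = 1 / (real r * real k) ^ k" and del: "del = phi / (2 * real r * real k)"
   and N0: "N0 \<ge> 2 * real r * real k / del"
   and one: "\<And>T W c. T \<subseteq> {1..n} \<Longrightarrow> N0 \<le> card T \<Longrightarrow> W \<in> star_families r k T \<Longrightarrow> (\<forall>v\<in>W. f v = c) \<Longrightarrow>
     card (kedges r W) * real r ^ r < (del / 2) ^ (r - 1) * real (card T) ^ ((k - 1) * (r - 1))"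
   and two: "\<And>T W c. T \<subseteq> {1..n} \<Longrightarrow> N0 \<le> card T \<Longrightarrow> W \<subseteq> ksub T k \<Longrightarrow> (\<forall>v\<in>W. f v = c) \<Longrightarrow>
     card (kedges r W) * real r ^ r < (phi / 2) ^ r * real (card T) ^ ((k - 1) * r)"
  obtains T C where "T \<subseteq> {1..n}" "C \<subseteq> {..<m}" "\<not> tcol r T d C" "f ` ksub T k \<subseteq> C"
   "card C < card T" "real (card T) < N0"
proof -
  have rk: "real r \<ge> 3" "real k \<ge> 2" using r k by auto
  have phi0: "phi > 0" using rk by (simp add: phi)
  have del0: "del > 0" using phi0 rk by (simp add: del)
  \<comment> \<open>Below size N0 no kernel is declared, so that \<open>one\<close> and
    \<open>two\<close> are invoked for large universes only.\<close>
  define ker where "ker = (\<lambda>T c. if N0 \<le> real (card T)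
   then {x \<in> T. real (card {v \<in> ksub T k. f v = c \<and> x \<in> v}) \<ge> del * real (card T) ^ (k - 1)} else {})"
  have nt: "\<not> tcol r {1..n} d {..<m}" using nc by (simp add: colorable_tcol)
  have ex: "f B \<noteq> c" if T: "T \<subseteq> {1..n}" and X: "X \<subseteq> ker T c" "card X = r - 1" and B: "B \<in> ksub (T - X) k" for T c X B
  proof
   assume fB: "f B = c"
   have N: "N0 \<le> card T" using X r by (cases "N0 \<le> real (card T)") (auto simp: ker_def)
   define t where "t = card T"
   have finT: "finite T" using T finite_subset by blast
   have XT: "X \<subseteq> T" using X by (auto simp: ker_def split: if_splits)
   have finX: "finite X" using XT finT finite_subset by blast
   define S where "S = (\<lambda>x. {v \<in> ksub T k. f v = c \<and> x \<in> v})"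
   have S: "real (card (S x)) \<ge> del * real t ^ (k - 1)" if "x \<in> X" for x
    using that X(1) N by (auto simp: ker_def S_def t_def)
   obtain h where h: "bij_betw h {..<r - 1} X" using X(2) finX by (metis ex_bij_betw_nat_finite lessThan_atLeast0)
   define G where "G = (\<lambda>j. if j < r - 1 then S (h j) else {B})"
   define J where "J = (\<lambda>j. if j < r - 1 then {h j} else B)"
   define y where "y = (\<lambda>j::nat. if j < r - 1 then 1/2 else 1 :: real)"
   have hX: "h j \<in> X" if "j < r - 1" for j using h that by (auto simp: bij_betw_def)
   have BT: "B \<in> ksub T k" "B \<inter> X = {}" using B by (auto simp: ksub_def)
   have "(\<Prod>j<r. y j * card (G j)) \<le> card (kedges r (\<Union>j<r. G j)) * r ^ r"
   proof (rule spread_edges[where k = k and J = J])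
    show "finite (G j)" for j using finT by (simp add: G_def S_def)
    show "J j \<subseteq> A \<and> card A = k" if "A \<in> G j" for j A
     using that BT by (auto simp: G_def J_def S_def ksub_def split: if_splits)
    show "J i \<inter> J j = {}" if "i < r" "j < r" "i \<noteq> j" for i j
     using that BT hX h by (auto simp: J_def bij_betw_def inj_on_def)
    show "finite (J j) \<and> card (J j) \<le> k" if "j < r" for j
     using BT k finT by (auto simp: J_def ksub_def intro: finite_subset)
    show "spread (r * k) (y j) (J j) (G j)" if "j < r" for j
    proof (cases "j < r - 1")
     case True
     have "spread (r * k) (1/2) {h j} (S (h j))"
     proof (rule spread_if_small_stars)
      show "finite (S (h j))" using finT by (simp add: S_def)
      show "0 \<le> real t ^ (k - 2)" by simp
      fix u assume u: "u \<notin> {h j}"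
      have "card {A \<in> S (h j). u \<in> A} \<le> card {v \<in> ksub T k. {h j, u} \<subseteq> v}"
       using finT by (intro card_mono) (auto simp: S_def)
      also have "\<dots> \<le> t ^ (k - 2)" using card_link_le[OF finT, of "{h j, u}" k] u by (auto simp: t_def numeral_2_eq_2)
      finally show "real (card {A \<in> S (h j). u \<in> A}) \<le> real t ^ (k - 2)"
       by (metis of_nat_mono of_nat_power)
     next
      \<comment> \<open>At most |T|^(k-2) sets contain two given points, so a star of positive
        density is spread off its centre as soon as |T| is at least 2rk/del.\<close>
      have "2 * real r * real k / del \<le> t" using N0 N by (simp add: t_def)
      then have "2 * (real (r * k)) \<le> del * t" using del0 by (simp add: field_simps)
      then have "2 * real (r * k) * real t ^ (k - 2) \<le> del * t * real t ^ (k - 2)" by (intro mult_right_mono) auto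
      also have "\<dots> = del * real t ^ (k - 1)"
      proof -
       have "k - 1 = Suc (k - 2)" using k by simp
       then show ?thesis by simp
      qed
      also have "\<dots> \<le> card (S (h j))" using S hX True by simp
      finally show "real (r * k) * real t ^ (k - 2) \<le> real (card (S (h j))) / 2" by simp
     qed
     then show ?thesis using True by (simp add: y_def J_def G_def)
    next
     case False
     then show ?thesis using spread_self by (simp add: y_def J_def G_def)
    qed
   qed (use r k in \<open>auto simp: y_def\<close>)
   moreover have "(\<Prod>j<r. y j * card (G j)) = (\<Prod>j<r - 1. 1/2 * card (S (h j)))"
   proof -
    have r1: "r = Suc (r - 1)" using r by simp
    have "(\<Prod>j<Suc (r - 1). y j * card (G j)) = (\<Prod>j<r - 1. y j * card (G j))"
     by (simp add: y_def G_def)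
    then show ?thesis using r1 by (simp add: y_def G_def)
   qed
   moreover have "(\<Prod>j<r - 1. 1/2 * card (S (h j))) \<ge> (\<Prod>j<r - 1. del / 2 * real t ^ (k - 1))"
    using S hX del0 by (intro prod_mono) auto
   moreover have "(\<Prod>j<r - 1. del / 2 * real t ^ (k - 1)) = (del / 2) ^ (r - 1) * real t ^ ((k - 1) * (r - 1))"
    by (simp only: prod_constant card_lessThan power_mult_distrib power_mult)
   ultimately have ge: "(del / 2) ^ (r - 1) * real t ^ ((k - 1) * (r - 1)) \<le> card (kedges r (\<Union>j<r. G j)) * real r ^ r"
    by (simp only: of_nat_mult of_nat_power)
   have W: "(\<Union>j<r. G j) = insert B (\<Union>x\<in>X. S x)"
   proof -
    have "{..<r} = insert (r - 1) {..<r - 1}" using r by auto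
    moreover have "{..<r - 1} \<inter> {x. x < r - 1} = {..<r - 1}" by auto
    ultimately have "(\<Union>j<r. G j) = insert B (\<Union>j<r - 1. S (h j))" by (simp add: G_def)
    also have "(\<Union>j<r - 1. S (h j)) = (\<Union>x\<in>X. S x)" using h by (force simp: bij_betw_def)
    finally show ?thesis .
   qed
   have "(\<Union>j<r. G j) \<in> star_families r k T"
   proof -
    have "(\<Union>x\<in>X. S x) \<in> Pow {v \<in> ksub T k. v \<inter> X \<noteq> {}}" by (auto simp: S_def)
    moreover have "X \<in> ksub T (r - 1)" using XT X(2) by (simp add: ksub_def)
    ultimately show ?thesis unfolding W star_families_def using BT(1) by force
   qed
   moreover have "\<forall>v\<in>(\<Union>j<r. G j). f v = c" unfolding W using fB by (auto simp: S_def)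
   ultimately show False using one[OF T N] ge by (fastforce simp: t_def)
  qed
  obtain T C where TC: "T \<subseteq> {1..n}" "C \<subseteq> {..<m}" "\<not> tcol r T d C" "f ` ksub T k \<subseteq> C"
   "(r - 1) * card C < card T" "\<And>c. c \<in> C \<Longrightarrow> card (ker T c) \<le> r - 2"
  proof (rule reduce_universe[of r d "{1..n}" "{..<m}" f k ker])
   show "ker T c \<subseteq> T" for T c by (auto simp: ker_def)
   show "f v \<noteq> c" if "T \<subseteq> {1..n}" "c \<in> {..<m}" "X \<subseteq> ker T c" "card X = r - 1" "v \<in> ksub (T - X) k" for T c X v
    using ex that by blast
  qed (use r k d nt f in auto)
  have finT: "finite T" "finite C" using TC(1,2) finite_subset by blast+
  have CT: "card C < card T"
  proof -
   have "1 * card C \<le> (r - 1) * card C" using r by (intro mult_right_mono) auto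
   then show ?thesis using TC(5) by linarith
  qed
  have "real (card T) < N0"
  proof (rule ccontr)
   assume "\<not> ?thesis"
   then have N: "N0 \<le> card T" by simp
   define X where "X = (\<Union>c\<in>C. ker T c)"
   define T2 where "T2 = T - X"
   have c2: "card C < card T2" "card T < (r - 1) * card T2"
    unfolding T2_def using universe_minus_kernels[OF _ finT TC(5) X_def] TC(6) r by (auto simp: ker_def)
   have finT2: "finite T2" using finT by (simp add: T2_def)
   have tT2: "real (card T) \<le> r * card T2"
   proof -
    have "card T \<le> r * card T2" using c2(2) by (metis less_imp_le_nat mult_le_mono1 diff_le_self order_trans)
    then show ?thesis by (metis of_nat_mono of_nat_mult)
   qed
   have big: "real (card T) \<ge> r * k"
   proof -
    have "del \<le> 1"
    proof -
     have "phi \<le> 1" using rk unfolding phi by (simp add: one_le_power mult_ge1_I)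
     moreover have "2 * real r * real k \<ge> 1" using rk by (simp add: mult_ge1_I)
     ultimately show ?thesis using phi0 unfolding del by (intro divide_le_eq_1_pos[THEN iffD2]) linarith+
    qed
    then have "2 * real r * real k \<le> 2 * real r * real k / del" using del0 rk by (simp add: le_divide_eq mult_left_le)
    moreover have "0 \<le> real r * real k" by simp
    ultimately show ?thesis using N N0 unfolding of_nat_mult by linarith
   qed
   have kT2: "k \<le> card T2"
   proof -
    have "real r * real k \<le> real r * real (card T2)" using big tT2 by simp
    then show ?thesis using rk by (simp add: mult_le_cancel_left)
   qed
   define F where "F = (\<lambda>c. {v \<in> ksub T2 k. f v = c})"
   have fT2: "f ` ksub T2 k \<subseteq> C" using TC(4) ksub_mono[of T2 T k] by (auto simp: T2_def)
   have "\<exists>c\<in>C. real (card T2 choose k) \<le> card (F c) * real (card C)"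
   proof (rule ccontr)
    assume "\<not> ?thesis"
    then have less: "card (F c) * real (card C) < real (card T2 choose k)" if "c \<in> C" for c using that by force
    have "C \<noteq> {}"
    proof
     assume "C = {}"
     then have "ksub T2 k = {}" using fT2 by auto
     then have "card T2 choose k = 0" using card_ksub[OF finT2, of k] by simp
     then show False using kT2 by simp
    qed
    then have "(\<Sum>c\<in>C. card (F c) * real (card C)) < (\<Sum>c\<in>C. real (card T2 choose k))"
     using less finT by (intro sum_strict_mono) auto
    moreover have "(\<Sum>c\<in>C. card (F c)) = card T2 choose k"
     using sum_popcount[OF finT2 finT(2) fT2] by (simp add: F_def popcount_def)
    moreover have "(\<Sum>c\<in>C. card (F c) * real (card C)) = real (\<Sum>c\<in>C. card (F c)) * card C"
     by (simp add: sum_distrib_right)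
    ultimately show False by (simp add: mult.commute)
   qed
   then obtain c where c: "c \<in> C" "real (card T2 choose k) \<le> card (F c) * real (card C)" by auto
   \<comment> \<open>Fewer than |T2| colours share the k-subsets of T2, and |T2| \<ge> |T|/r. This
     is the origin of phi.\<close>
   have Fbig: "phi * real (card T) ^ (k - 1) \<le> card (F c)"
   proof -
    define z where "z = real (card T2)"
    have z: "z > 0" using c2 by (auto simp: z_def)
    have "(z / k) ^ k \<le> real (card T2 choose k)"
     unfolding z_def by (rule binomial_ge_n_over_k_pow_k[OF kT2])
    also have "\<dots> \<le> card (F c) * real (card C)" by (rule c(2))
    also have "\<dots> \<le> card (F c) * z" using c2 by (intro mult_left_mono) (auto simp: z_def)
    finally have "(z / k) ^ k / z \<le> card (F c)" using z by (simp add: divide_le_eq)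
    moreover have "(z / k) ^ k / z = z ^ (k - 1) / real k ^ k"
    proof -
     have "z ^ k = z * z ^ (k - 1)" using k by (metis Suc_diff_1 power_Suc zero_less_numeral order_less_le_trans)
     then show ?thesis using z by (simp add: power_divide)
    qed
    moreover have "phi * real (card T) ^ (k - 1) \<le> z ^ (k - 1) / real k ^ k"
    proof -
     have "phi * real (card T) ^ (k - 1) \<le> phi * (r * z) ^ (k - 1)"
      using tT2 phi0 by (intro mult_left_mono power_mono) (auto simp: z_def)
     also have "\<dots> = z ^ (k - 1) / (real k ^ k * real r)"
     proof -
      have "real r ^ k = real r * real r ^ (k - 1)" using k by (metis Suc_diff_1 power_Suc zero_less_numeral order_less_le_trans)
      then show ?thesis using rk by (simp add: phi power_mult_distrib)
     qed
     also have "\<dots> \<le> z ^ (k - 1) / real k ^ k"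
      using rk z by (intro divide_left_mono) (auto simp: mult_ge1_I)
     finally show ?thesis .
    qed
    ultimately show ?thesis by linarith
   qed
   have sp: "spread (r * k) (1/2) {} (F c)"
   proof (rule spread_if_small_stars)
    show "finite (F c)" using finT2 by (simp add: F_def)
    show "0 \<le> del * real (card T) ^ (k - 1)" using del0 by simp
    fix u :: nat
    show "real (card {A \<in> F c. u \<in> A}) \<le> del * real (card T) ^ (k - 1)"
    proof (cases "u \<in> T2")
     case True
     then have "u \<notin> ker T c" using c(1) by (auto simp: T2_def X_def)
     then have "real (card {v \<in> ksub T k. f v = c \<and> u \<in> v}) < del * real (card T) ^ (k - 1)"
      using True N by (auto simp: ker_def T2_def)
     moreover have "card {A \<in> F c. u \<in> A} \<le> card {v \<in> ksub T k. f v = c \<and> u \<in> v}"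
      using finT ksub_mono[of T2 T k] by (intro card_mono) (auto simp: F_def T2_def)
     ultimately show ?thesis by linarith
    next
     case False
     then have "{A \<in> F c. u \<in> A} = {}" by (auto simp: F_def ksub_def)
     then show ?thesis using del0 by (simp only: card.empty) simp
    qed
   next
    \<comment> \<open>Any rk points meet at most half of the class, by the choice of del.\<close>
    have "real (r * k) * (del * real (card T) ^ (k - 1)) = phi * real (card T) ^ (k - 1) / 2"
    proof -
     have "phi = del * (2 * real r * real k)" using rk by (simp add: del)
     then show ?thesis by simp
    qed
    then show "real (r * k) * (del * real (card T) ^ (k - 1)) \<le> card (F c) / 2" using Fbig by linarith
   qed
   have "(\<Prod>j<r. 1/2 * card (F c)) \<le> card (kedges r (\<Union>j<r. F c)) * r ^ r"
    by (rule spread_edges[where k = k and J = "\<lambda>_. {}"]) (use sp finT2 r k in \<open>auto simp: F_def ksub_def\<close>)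
   moreover have "(\<Union>j<r. F c) = F c" using r by (simp add: lessThan_empty_iff)
   moreover have "(\<Prod>j<r. 1/2 * card (F c)) \<ge> (\<Prod>j<r. phi / 2 * real (card T) ^ (k - 1))"
    using Fbig phi0 by (intro prod_mono) auto
   moreover have "(\<Prod>j<r. phi / 2 * real (card T) ^ (k - 1)) = (phi / 2) ^ r * real (card T) ^ ((k - 1) * r)"
    by (simp only: prod_constant card_lessThan power_mult_distrib power_mult)
   ultimately have "(phi / 2) ^ r * real (card T) ^ ((k - 1) * r) \<le> card (kedges r (F c)) * real r ^ r"
    by (simp only: of_nat_mult of_nat_power)
   moreover have "F c \<subseteq> ksub T k" using ksub_mono[of T2 T k] by (auto simp: F_def T2_def)
   moreover have "\<forall>v\<in>F c. f v = c" by (simp add: F_def)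
   ultimately show False using two[OF TC(1) N, of "F c" c] by linarith
  qed
  then show ?thesis using that TC CT by blast
qed

text \<open>Choosing T of size t costs t ln n, choosing W within T costs a t^s, and the gain is kap
  t^s' edges. The first cost is paid by a factor t^e of at least a multiple of ln n, the second by a
  factor t of at least a constant; hence the conditions on s' and \<open>ev\<close>.\<close>

lemma class_negligible:
  fixes fam :: "nat set \<Rightarrow> nat set set set" and N0 :: "nat \<Rightarrow> real"
  assumes p: "0 < p" "p < 1" and kap: "kap > 0" and a: "a \<ge> 0"
   and fam: "\<And>T. finite T \<Longrightarrow> finite (fam T)"
    "\<And>T. finite T \<Longrightarrow> card T \<ge> 1 \<Longrightarrow> real (card (fam T)) \<le> exp (a * real (card T) ^ s)"
   and s: "s + 1 \<le> s'" "e + 1 \<le> s'"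
   and ev: "\<forall>\<^sub>F n in sequentially. \<forall>t. N0 n \<le> real t \<longrightarrow> (a + 2) / (- ln (1 - p) * kap) \<le> t \<and>
    (a + 2) / (- ln (1 - p) * kap) * ln n \<le> real t ^ e"
  shows "negligible p (\<lambda>n. {kedges r W |T W. T \<subseteq> {1..n} \<and> T \<noteq> {} \<and> N0 n \<le> card T \<and> W \<in> fam T \<and>
   kap * real (card T) ^ s' \<le> card (kedges r W)})"
proof -
  define b where "b = - ln (1 - p)"
  have b: "b > 0" using p by (simp add: b_def)
  define I where "I = (\<lambda>n t. if N0 n \<le> real t then Sigma (ksub {1..n} t) fam else {})"
  define A where "A = (\<lambda>n t. if N0 n \<le> real t then real t * ln (real n) + a * real t ^ s else 0)"
  \<comment> \<open>Below N0 there are no events; the value there only satisfies the inequality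
    demanded by \<open>negligibleI\<close>.\<close>
  define g where "g = (\<lambda>n t. if N0 n \<le> real t then kap * real t ^ s' else real t * ln (real n) / b)"
  have fT: "finite T" if "T \<in> ksub {1..n} t" for T n t
  proof -
   have "T \<subseteq> {1..n}" using that by (simp add: ksub_def)
   then show ?thesis by (rule finite_subset) simp
  qed
  have "negligible p (\<lambda>n. \<Union>t\<in>{1..n}. {kedges r (snd i) |i. i \<in> I n t \<and> g n t \<le> real (card (kedges r (snd i)))})"
  proof (rule negligibleI[OF p, where x = "\<lambda>n. ln (real n)" and a = A])
   fix n t
   show "finite (I n t)" unfolding I_def using fam(1)[OF fT] by (auto intro!: finite_SigmaI)
  next
   show "\<forall>\<^sub>F n in sequentially. \<forall>t\<in>{1..n}. real (card (I n t)) \<le> exp (A n t) \<and>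
     A n t + real t * ln (real n) \<le> - ln (1 - p) * g n t"
    using ev eventually_ge_at_top[of 1]
   proof eventually_elim
    case (elim n)
    show ?case
    proof (intro ballI)
     fix t assume t: "t \<in> {1..n}"
     show "real (card (I n t)) \<le> exp (A n t) \<and> A n t + real t * ln (real n) \<le> - ln (1 - p) * g n t"
     proof (cases "N0 n \<le> real t")
      case False
      then show ?thesis using b by (simp add: I_def A_def g_def b_def[symmetric])
     next
      case True
      have Q: "(a + 2) / (b * kap) \<le> t" "(a + 2) / (b * kap) * ln n \<le> real t ^ e"
       using elim(1) True by (auto simp: b_def)
      have t1: "real t \<ge> 1" using t by auto
      have "real (card (Sigma (ksub {1..n} t) fam)) = (\<Sum>T\<in>ksub {1..n} t. real (card (fam T)))"
       using fam(1)[OF fT] by (subst card_SigmaI) auto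
      also have "\<dots> \<le> (\<Sum>T\<in>ksub {1..n} t. exp (a * real t ^ s))"
      proof (intro sum_mono)
       fix T assume T: "T \<in> ksub {1..n} t"
       then have "card T = t" by (simp add: ksub_def)
       then show "real (card (fam T)) \<le> exp (a * real t ^ s)" using fam(2)[OF fT[OF T]] t by simp
      qed
      also have "\<dots> = real (n choose t) * exp (a * real t ^ s)" by (simp add: card_ksub)
      also have "\<dots> \<le> real n ^ t * exp (a * real t ^ s)"
       using choose_le_pow[of n t] by (intro mult_right_mono) (auto simp flip: of_nat_power)
      also have "real n ^ t = exp (t * ln n)"
       using elim(2) by (simp add: exp_of_nat_mult)
      finally have c: "real (card (I n t)) \<le> exp (A n t)" using True by (simp add: I_def A_def exp_add)
      have q1: "(a + 2) * ln n \<le> b * kap * real t ^ e" "a + 2 \<le> b * kap * t"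
       using Q b kap by (simp_all add: divide_le_eq mult_ac)
      have ln0: "ln (real n) \<ge> 0" using elim(2) by simp
      have "2 * real t * ln n \<le> (2 / (a + 2)) * (b * kap * real t ^ s')"
      proof -
       have "(a + 2) * (real t * ln n) \<le> t * (b * kap * real t ^ e)"
        using mult_left_mono[OF q1(1), of "real t"] by (simp add: mult_ac)
       also have "\<dots> = b * kap * real t ^ (e + 1)" by simp
       also have "\<dots> \<le> b * kap * real t ^ s'"
        using s t1 b kap by (intro mult_left_mono power_increasing) auto
       finally show ?thesis using a by (simp add: field_simps)
      qed
      moreover have "a * real t ^ s \<le> (a / (a + 2)) * (b * kap * real t ^ s')"
      proof -
       have "(a + 2) * real t ^ s \<le> b * kap * t * real t ^ s"
        using q1(2) by (intro mult_right_mono) auto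
       also have "\<dots> = b * kap * real t ^ (s + 1)" by simp
       also have "\<dots> \<le> b * kap * real t ^ s'"
        using s t1 b kap by (intro mult_left_mono power_increasing) auto
       finally have "a * ((a + 2) * real t ^ s) \<le> a * (b * kap * real t ^ s')" using a by (rule mult_left_mono)
       then show ?thesis using a by (simp add: field_simps)
      qed
      moreover have "(2 / (a + 2)) * (b * kap * real t ^ s') + (a / (a + 2)) * (b * kap * real t ^ s') = b * kap * real t ^ s'"
      proof -
       have "2 / (a + 2) + a / (a + 2) = 1" using a by (simp add: add_divide_distrib[symmetric])
       then show ?thesis by (metis distrib_right mult_1)
      qed
      ultimately have "A n t + real t * ln (real n) \<le> b * g n t"
       using True by (simp add: A_def g_def mult.assoc)
      then show ?thesis using c by (simp add: b_def)
     qed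
    qed
   qed
  next
   show "filterlim (\<lambda>n. ln (real n)) at_top sequentially" by real_asymp
  qed
  moreover have "(\<Union>t\<in>{1..n}. {kedges r (snd i) |i. i \<in> I n t \<and> g n t \<le> real (card (kedges r (snd i)))})
   = {kedges r W |T W. T \<subseteq> {1..n} \<and> T \<noteq> {} \<and> N0 n \<le> card T \<and> W \<in> fam T \<and>
   kap * real (card T) ^ s' \<le> card (kedges r W)}" (is "?L = ?R") for n
  proof
   show "?L \<subseteq> ?R"
   proof
    fix E assume "E \<in> ?L"
    then obtain t i where ti: "t \<in> {1..n}" "E = kedges r (snd i)" "i \<in> I n t" "g n t \<le> real (card (kedges r (snd i)))"
     by blast
    obtain T W where i: "i = (T, W)" by fastforce
    have N: "N0 n \<le> real t" using ti(3) by (auto simp: I_def split: if_splits)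
    then have T: "T \<subseteq> {1..n}" "card T = t" "W \<in> fam T" using ti(3) i by (auto simp: I_def ksub_def)
    have "T \<noteq> {}" using T(2) ti(1) by auto
    moreover have "kap * real (card T) ^ s' \<le> card (kedges r W)" using ti(4) N T(2) i by (simp add: g_def)
    moreover have "E = kedges r W" using ti(2) i by simp
    ultimately show "E \<in> ?R" using T N by blast
   qed
   show "?R \<subseteq> ?L"
   proof
    fix E assume "E \<in> ?R"
    then obtain T W where TW: "E = kedges r W" "T \<subseteq> {1..n}" "T \<noteq> {}" "N0 n \<le> card T" "W \<in> fam T"
     "kap * real (card T) ^ s' \<le> card (kedges r W)" by blast
    have "finite T" using TW(2) finite_subset by blast
    then have "card T \<in> {1..n}" using TW(2,3) card_mono[of "{1..n}" T] by (simp add: Suc_le_eq card_gt_0_iff)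
    moreover have "(T, W) \<in> I n (card T)" using TW by (simp add: I_def ksub_def)
    moreover have "g n (card T) \<le> card (kedges r W)" using TW by (simp add: g_def)
    ultimately have "E \<in> {kedges r (snd i) |i. i \<in> I n (card T) \<and> g n (card T) \<le> real (card (kedges r (snd i)))}"
     using TW(1) by (intro CollectI exI[of _ "(T, W)"]) simp
    then show "E \<in> ?L" using \<open>card T \<in> {1..n}\<close> by blast
   qed
  qed
  ultimately show ?thesis by simp
qed

lemma card_star_families:
  assumes fin: "finite T" and t: "card T \<ge> 1" and k: "k \<ge> 2" and r: "r \<ge> 2"
  shows "finite (star_families r k T)"
   "real (card (star_families r k T)) \<le> exp ((real k + 2 * real r) * real (card T) ^ (k - 1))"
proof -
  define t where "t = card T"
  define S where "S = (\<lambda>X. ksub T k \<times> Pow {v \<in> ksub T k. v \<inter> X \<noteq> {}})"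
  have fS: "finite (S X)" for X using fin by (simp add: S_def)
  have eq: "star_families r k T = (\<Union>X\<in>ksub T (r - 1). (\<lambda>(B, H). insert B H) ` S X)"
   by (simp add: star_families_def S_def)
  show "finite (star_families r k T)" unfolding eq using fin fS by (intro finite_UN_I finite_imageI) auto
  have t1: "real t \<ge> 1" using t by (simp add: t_def)
  have c: "card (S X) \<le> t ^ k * 2 ^ (r * t ^ (k - 1))" if X: "X \<in> ksub T (r - 1)" for X
  proof -
   have fX: "finite X" "card X = r - 1" using X fin by (auto simp: ksub_def intro: finite_subset)
   have "card {v \<in> ksub T k. v \<inter> X \<noteq> {}} \<le> (r - 1) * t ^ (k - 1)"
    using card_stars_le[OF fin fX(1), of k] fX(2) by (simp add: t_def)
   also have "\<dots> \<le> r * t ^ (k - 1)" by simp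
   finally have "(2::nat) ^ card {v \<in> ksub T k. v \<inter> X \<noteq> {}} \<le> 2 ^ (r * t ^ (k - 1))"
    by (intro power_increasing) auto
   moreover have "card (ksub T k) \<le> t ^ k" using fin by (simp add: card_ksub choose_le_pow t_def)
   ultimately show ?thesis unfolding S_def using fin by (simp add: card_Pow mult_le_mono)
  qed
  have "card (star_families r k T) \<le> (\<Sum>X\<in>ksub T (r - 1). card ((\<lambda>(B, H). insert B H) ` S X))"
   unfolding eq by (rule card_UN_le) (use fin in simp)
  also have "\<dots> \<le> (\<Sum>X\<in>ksub T (r - 1). t ^ k * 2 ^ (r * t ^ (k - 1)))"
   by (intro sum_mono order_trans[OF card_image_le[OF fS] c])
  also have "\<dots> = (t choose (r - 1)) * (t ^ k * 2 ^ (r * t ^ (k - 1)))" using fin by (simp add: card_ksub t_def)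
  also have "\<dots> \<le> t ^ r * (t ^ k * 2 ^ (r * t ^ (k - 1)))"
  proof (intro mult_right_mono)
   have "t choose (r - 1) \<le> t ^ (r - 1)" by (rule choose_le_pow)
   also have "\<dots> \<le> t ^ r" using t by (intro power_increasing) (auto simp: t_def)
   finally show "t choose (r - 1) \<le> t ^ r" .
  qed auto
  finally have "real (card (star_families r k T)) \<le> real (t ^ r * (t ^ k * 2 ^ (r * t ^ (k - 1))))"
   by (rule of_nat_mono)
  also have "\<dots> = real t ^ (r + k) * 2 ^ (r * t ^ (k - 1))" by (simp add: power_add)
  also have "\<dots> \<le> exp (real (r + k) * real t ^ (k - 1)) * exp (real r * real t ^ (k - 1))"
  proof (rule mult_mono)
   have "real t \<le> real t ^ (k - 1)" using t1 k by (intro self_le_power) auto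
   then have "real t \<le> exp (real t ^ (k - 1))"
    using exp_ge_add_one_self[of "real t ^ (k - 1)"] by linarith
   then have "real t ^ (r + k) \<le> exp (real t ^ (k - 1)) ^ (r + k)" by (intro power_mono) auto
   then show "real t ^ (r + k) \<le> exp (real (r + k) * real t ^ (k - 1))" by (simp only: exp_of_nat_mult)
   have "(2::real) ^ (r * t ^ (k - 1)) \<le> exp 1 ^ (r * t ^ (k - 1))"
    using exp_ge_add_one_self[of 1] by (intro power_mono) auto
   also have "\<dots> = exp (real (r * t ^ (k - 1)))" by (simp flip: exp_of_nat_mult)
   finally show "(2::real) ^ (r * t ^ (k - 1)) \<le> exp (real r * real t ^ (k - 1))" by simp
  qed auto
  also have "\<dots> = exp ((real k + 2 * real r) * real t ^ (k - 1))" unfolding exp_add[symmetric] by (simp add: algebra_simps)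
  finally show "real (card (star_families r k T)) \<le> exp ((real k + 2 * real r) * real (card T) ^ (k - 1))"
   by (simp add: t_def)
qed

lemma card_Pow_ksub:
  assumes fin: "finite T"
  shows "finite (Pow (ksub T k))" "real (card (Pow (ksub T k))) \<le> exp (1 * real (card T) ^ k)"
proof -
  show "finite (Pow (ksub T k))" using fin by simp
  have "card (Pow (ksub T k)) = 2 ^ (card T choose k)" using fin by (simp add: card_Pow card_ksub)
  also have "\<dots> \<le> 2 ^ (card T ^ k)" by (intro power_increasing choose_le_pow) auto
  finally have "real (card (Pow (ksub T k))) \<le> real (2 ^ (card T ^ k))" by (rule of_nat_mono)
  also have "\<dots> \<le> exp 1 ^ (card T ^ k)"
   using exp_ge_add_one_self[of 1] by (simp only: of_nat_power of_nat_numeral) (intro power_mono, auto)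
  also have "\<dots> = exp (real (card T ^ k))" by (simp flip: exp_of_nat_mult)
  finally show "real (card (Pow (ksub T k))) \<le> exp (1 * real (card T) ^ k)" by simp
qed

text \<open>Cutting the universe at size l^rho leaves popular colours of multiplicity l^(k-rho), and
  hosts cost l ln n, so l^(r(k-rho)-1) has to reach the order of ln n. For rho = r/(r-1) this
  exponent is \<open>th\<close>. The two universe events are covered as well, since l^(rho e) =
  l^(th+1).\<close>

lemma hypergraph_fixed_k:
  fixes p :: real and r k :: nat
  assumes p: "0 < p" "p < 1" and r: "r \<ge> 3" and k: "k \<ge> 2"
   and th: "th = real r * (real k - 1) - (2 * real r - 1) / (real r - 1)"
  shows "\<exists>C>0. \<forall>l::nat \<Rightarrow> nat. (\<forall>n. l n \<ge> 2) \<and>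
    (\<forall>\<^sub>F n in sequentially. real (l n) \<ge> C * ln (real n) powr (1 / th)) \<longrightarrow>
    aas_chromatic_bound r p (\<lambda>_. k) l"
proof -
  define b where "b = - ln (1 - p)"
  have b: "b > 0" using p by (simp add: b_def)
  have rk: "real r \<ge> 3" "real k \<ge> 2" using r k by auto
  define rho where "rho = real r / (real r - 1)"
  have rho: "rho \<ge> 1" "rho \<le> 3/2" using rk by (simp_all add: rho_def field_simps)
  have th1: "th + 1 = real r * (real k - 1) - rho" "th + 1 = real r * (real k - rho)"
   using rk by (simp_all add: th rho_def field_simps)
  have th0: "th > 0"
  proof -
   have "3 * 1 \<le> real r * (real k - 1)" using rk by (intro mult_mono) auto
   then show ?thesis using th1(1) rho by linarith
  qed
  define phi where "phi = 1 / (real r * real k) ^ k"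
  define del where "del = phi / (2 * real r * real k)"
  have phi0: "phi > 0" and del0: "del > 0" using rk by (auto simp: phi_def del_def)
  define C0 where "C0 = max 1 (2 * real r * real k / del)"
  define N0 where "N0 = (\<lambda>l::nat. C0 * real l powr rho)"
  define k1 where "k1 = (del / 2) ^ (r - 1) / real r ^ r"
  define k2 where "k2 = (phi / 2) ^ r / real r ^ r"
  have k12: "k1 > 0" "k2 > 0" using phi0 del0 rk by (auto simp: k1_def k2_def)
  \<comment> \<open>The star event has t^(e+1) edges up to a constant; one power of t is spent on
    choosing the t points of T.\<close>
  define e where "e = (k - 1) * (r - 1) - 1"
  have e: "e \<ge> 1" "e + 1 = (k - 1) * (r - 1)"
  proof -
   have "1 * 2 \<le> (k - 1) * (r - 1)" using k r by (intro mult_le_mono) auto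
   then show "e \<ge> 1" "e + 1 = (k - 1) * (r - 1)" by (auto simp: e_def)
  qed
  have re: "rho * real e = th + 1"
  proof -
   have "real (e + 1) = real ((k - 1) * (r - 1))" unfolding e(2) ..
   then have E: "real e = (real k - 1) * (real r - 1) - 1" using k r by (simp add: of_nat_diff)
   have "rho * real e = (rho * (real r - 1)) * (real k - 1) - rho" unfolding E by (simp add: algebra_simps)
   moreover have "rho * (real r - 1) = real r" using rk by (simp add: rho_def)
   ultimately show ?thesis using th1(1) by simp
  qed
  define a1 where "a1 = real k + 2 * real r"
  define Q where "Q = max ((a1 + 2) / (b * k1)) ((1 + 2) / (b * k2))"
  have Q0: "Q > 0" using b k12 by (simp add: Q_def less_max_iff_disj)
  define kap where "kap = 1 / (real k ^ k * C0)"
  have C0: "C0 \<ge> 1" by (simp add: C0_def)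
  have kap0: "kap > 0" using C0 rk by (simp add: kap_def)
  define D where "D = max 1 (2 * (real r * (real k + 1) + 1) / (b * kap ^ r))"
  define C where "C = D powr (1 / th)"
  have D: "D \<ge> 1" by (simp add: D_def)
  have "C > 0" using D by (simp add: C_def)
  moreover have "aas_chromatic_bound r p (\<lambda>_. k) l"
   if l2: "\<forall>n. l n \<ge> 2" and lC: "\<forall>\<^sub>F n in sequentially. real (l n) \<ge> C * ln (real n) powr (1 / th)"
   for l :: "nat \<Rightarrow> nat"
  proof -
   have l1: "real (l n) \<ge> 2" for n using l2 by (metis of_nat_le_iff of_nat_numeral)
   have linf: "filterlim (\<lambda>n. real (l n)) at_top sequentially"
   proof (rule filterlim_at_top_mono[OF _ lC])
    show "filterlim (\<lambda>n. C * ln (real n) powr (1 / th)) at_top sequentially"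
     using \<open>C > 0\<close> th0 by real_asymp
   qed
   have lth: "\<forall>\<^sub>F n in sequentially. D * ln n \<le> real (l n) powr th"
    using lC eventually_ge_at_top[of 1]
   proof eventually_elim
    case (elim n)
    have "(C * ln (real n) powr (1 / th)) powr th \<le> real (l n) powr th"
     using elim th0 \<open>C > 0\<close> by (intro powr_mono2) auto
    moreover have "(C * ln (real n) powr (1 / th)) powr th = D * ln n"
     using elim th0 D by (simp add: C_def powr_mult powr_powr)
    ultimately show ?case by simp
   qed
   have key: "\<forall>\<^sub>F n in sequentially. \<forall>t. N0 (l n) \<le> real t \<longrightarrow> Q \<le> t \<and> Q * ln n \<le> real t ^ e"
    using lth filterlim_at_top[THEN iffD1, OF linf, rule_format, of Q] eventually_ge_at_top[of 1]
   proof eventually_elim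
    case (elim n)
    show ?case
    proof (intro allI impI)
     fix t assume t: "N0 (l n) \<le> real t"
     have "real (l n) powr 1 \<le> real (l n) powr rho" using l1[of n] rho by (intro powr_mono) auto
     then have "real (l n) \<le> real (l n) powr rho" using l1[of n] by simp
     moreover have "real (l n) powr rho \<le> C0 * real (l n) powr rho" using C0 by (simp add: mult_le_cancel_right1)
     ultimately have tl: "real (l n) powr rho \<le> t" "real (l n) \<le> t" using t by (auto simp: N0_def)
     have ln0: "ln (real n) \<ge> 0" using elim by simp
     have "Q * ln n \<le> real (l n) * (D * ln n)"
      using elim D ln0 mult_mono[of Q "real (l n)" "ln n" "D * ln n"] Q0 by (simp add: mult_le_cancel_right1)
     also have "\<dots> \<le> real (l n) * real (l n) powr th" using elim by (intro mult_left_mono) auto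
     also have "\<dots> = real (l n) powr (th + 1)" using l1[of n] by (simp add: powr_add)
     also have "\<dots> = (real (l n) powr rho) ^ e"
      unfolding re[symmetric] using l1[of n] by (simp add: powr_powr[symmetric] powr_realpow)
     also have "\<dots> \<le> real t ^ e" using tl by (intro power_mono) auto
     finally show "Q \<le> t \<and> Q * ln n \<le> real t ^ e" using tl elim by linarith
    qed
   qed
   define X1 where "X1 = (\<lambda>n. {kedges r W |T W. T \<subseteq> {1..n} \<and> T \<noteq> {} \<and> N0 (l n) \<le> card T \<and> W \<in> star_families r k T \<and>
   k1 * real (card T) ^ ((k - 1) * (r - 1)) \<le> card (kedges r W)})"
   define X2 where "X2 = (\<lambda>n. {kedges r W |T W. T \<subseteq> {1..n} \<and> T \<noteq> {} \<and> N0 (l n) \<le> card T \<and> W \<in> Pow (ksub T k) \<and>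
   k2 * real (card T) ^ ((k - 1) * r) \<le> card (kedges r W)})"
   have X1: "negligible p X1" unfolding X1_def
   proof (rule class_negligible[OF p k12(1), where a = a1 and s = "k - 1" and e = e])
    show "finite T \<Longrightarrow> finite (star_families r k T)" for T
     by (simp add: star_families_def)
    show "k - 1 + 1 \<le> (k - 1) * (r - 1)"
    proof -
     have "(k - 1) * 2 \<le> (k - 1) * (r - 1)" using r by (intro mult_left_mono) auto
     then show ?thesis using k by linarith
    qed
    show "\<forall>\<^sub>F n in sequentially. \<forall>t. N0 (l n) \<le> real t \<longrightarrow> (a1 + 2) / (- ln (1 - p) * k1) \<le> t \<and>
     (a1 + 2) / (- ln (1 - p) * k1) * ln n \<le> real t ^ e"
     using key eventually_ge_at_top[of 1]
    proof eventually_elim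
     case (elim n)
     have q: "(a1 + 2) / (- ln (1 - p) * k1) \<le> Q" by (simp add: Q_def b_def)
     have "(a1 + 2) / (- ln (1 - p) * k1) * ln n \<le> Q * ln n" using q elim by (intro mult_right_mono) auto
     then show ?case using elim q by (meson order_trans)
    qed
   qed (use card_star_families k r e in \<open>auto simp: a1_def\<close>)
   have X2: "negligible p X2" unfolding X2_def
   proof (rule class_negligible[OF p k12(2), where a = 1 and s = k and e = e])
    have "(k - 1) * r = (k - 1) * (r - 1) + (k - 1)" using r by (cases r) auto
    then show "k + 1 \<le> (k - 1) * r" "e + 1 \<le> (k - 1) * r" using e k by linarith+
    show "\<forall>\<^sub>F n in sequentially. \<forall>t. N0 (l n) \<le> real t \<longrightarrow> (1 + 2) / (- ln (1 - p) * k2) \<le> t \<and>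
     (1 + 2) / (- ln (1 - p) * k2) * ln n \<le> real t ^ e"
     using key eventually_ge_at_top[of 1]
    proof eventually_elim
     case (elim n)
     have q: "(1 + 2) / (- ln (1 - p) * k2) \<le> Q" unfolding Q_def b_def by (rule max.cobounded2)
     have "(1 + 2) / (- ln (1 - p) * k2) * ln n \<le> Q * ln n" using q elim by (intro mult_right_mono) auto
     then show ?case using elim q by (meson order_trans)
    qed
   qed (use card_Pow_ksub in auto)
   \<comment> \<open>Popularity: the k-subsets of a host are shared by fewer than N0
     colours.\<close>
   define tau where "tau = (\<lambda>n. nat \<lceil>real ((k + l n) choose k) / N0 (l n)\<rceil>)"
   have N00: "N0 (l n) > 0" for n using l1[of n] C0 by (simp add: N0_def)
   have tau0: "real ((k + l n) choose k) / N0 (l n) > 0" for n using N00 by simp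
   note tau = nat_ceiling_props[OF tau0, folded tau_def]
   have taul: "kap * real (l n) powr (real k - rho) \<le> tau n" for n
   proof -
    have "kap * real (l n) powr (real k - rho) = (real (l n) / real k) ^ k / N0 (l n)"
     using l1[of n] by (simp add: kap_def N0_def powr_diff powr_realpow power_divide)
    also have "\<dots> \<le> real ((k + l n) choose k) / N0 (l n)"
     using N00[of n] choose_ge_pow by (intro divide_right_mono) auto
    finally show ?thesis using tau(1)[of n] unfolding tau_def by linarith
   qed
   have lnev: "\<forall>\<^sub>F n in sequentially. real r * real k * (ln (real k + 1) + ln (real (l n))) \<le> b / 2 * kap ^ (r - 1) * real (l n)"
   proof -
    have "\<forall>\<^sub>F x in at_top. real r * real k * (ln (real k + 1) + ln x) \<le> b / 2 * kap ^ (r - 1) * x"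
     using b kap0 rk by real_asymp
    then show ?thesis using linf by (rule eventually_compose_filterlim)
   qed
   have X3: "negligible p (\<lambda>n. if True then hostev r k (ksub {1..n} (k + l n)) (tau n) else {})"
   proof (rule hostev_negligible[OF p, where L = "\<lambda>n. (k + l n) * ln n" and K = "\<lambda>n. (k + l n) ^ k"])
    fix n A assume "A \<in> ksub {1..n} (k + l n)"
    then show "finite A \<and> card A choose k \<le> (k + l n) ^ k"
     using choose_le_pow[of "k + l n" k] by (auto simp: ksub_def intro: finite_subset)
   next
    show "\<forall>\<^sub>F n in sequentially. True \<longrightarrow> real (card (ksub {1..n} (k + l n))) \<le> exp ((k + l n) * ln n) \<and>
     real r * ((k + l n) * ln n + real (tau n) * ln (real ((k + l n) ^ k))) + ln (real n) \<le> - ln (1 - p) * real (tau n ^ r)"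
     using lth lnev eventually_ge_at_top[of 1]
    proof eventually_elim
     case (elim n)
     define L where "L = real (l n)"
     have L: "L \<ge> 2" using l1 by (simp add: L_def)
     have ln0: "ln (real n) \<ge> 0" using elim by simp
     have "real (card (ksub {1..n} (k + l n))) \<le> real n ^ (k + l n)"
      using choose_le_pow[of n "k + l n"] by (simp add: card_ksub flip: of_nat_power)
     also have "\<dots> = exp ((k + l n) * ln n)" using elim(3) by (simp only: exp_of_nat_mult) simp
     finally have A: "real (card (ksub {1..n} (k + l n))) \<le> exp ((k + l n) * ln n)" .
     have d: "real (k + l n) \<le> (real k + 1) * L"
     proof -
      have "real k * 1 \<le> real k * L" using L by (intro mult_left_mono) auto
      then show ?thesis by (simp add: L_def algebra_simps)
     qed
     have lnK: "ln (real ((k + l n) ^ k)) \<le> k * (ln (real k + 1) + ln L)"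
     proof -
      have "ln (real ((k + l n) ^ k)) = k * ln (real (k + l n))" using k by (simp add: ln_realpow)
      also have "\<dots> \<le> k * ln ((real k + 1) * L)"
       using d k L by (intro mult_left_mono ln_mono) auto
      finally show ?thesis using L by (simp add: ln_mult)
     qed
     have tr: "kap ^ r * (L * L powr th) \<le> real (tau n) ^ r"
     proof -
      have "kap ^ r * (L * L powr th) = kap ^ r * L powr (th + 1)" using L by (simp add: powr_add)
      also have "\<dots> = (kap * L powr (real k - rho)) ^ r"
       using L r unfolding th1(2) by (simp add: power_mult_distrib powr_power mult.commute)
      also have "\<dots> \<le> real (tau n) ^ r" using taul kap0 by (intro power_mono) (auto simp: L_def)
      finally show ?thesis .
     qed
     have tr1: "kap ^ (r - 1) * L \<le> real (tau n) ^ (r - 1)"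
     proof -
      have "real (r - 1) * (real k - rho) \<ge> 1"
      proof -
       have "(real r - 1) * (real k - rho) = (real r - 1) * real k - real r"
        using rk by (simp add: rho_def field_simps)
       moreover have "(real r - 1) * real k \<ge> (real r - 1) * 2" using rk by (intro mult_left_mono) auto
       ultimately show ?thesis using rk r by (simp add: of_nat_diff)
      qed
      then have "L powr 1 \<le> L powr (real (r - 1) * (real k - rho))" using L by (intro powr_mono) linarith+
      then have "kap ^ (r - 1) * L \<le> kap ^ (r - 1) * L powr (real (r - 1) * (real k - rho))"
       using kap0 L by simp
      also have "\<dots> = (kap * L powr (real k - rho)) ^ (r - 1)"
       using L r by (simp add: power_mult_distrib powr_power mult.commute)
      also have "\<dots> \<le> real (tau n) ^ (r - 1)" using taul kap0 by (intro power_mono) (auto simp: L_def)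
      finally show ?thesis .
     qed
     have e1: "real r * ((k + l n) * ln n) + ln n \<le> b / 2 * real (tau n) ^ r"
     proof -
      have "real r * ((k + l n) * ln n) + ln n \<le> real r * ((real k + 1) * L * ln n) + L * ln n"
       using d ln0 L rk by (intro add_mono mult_left_mono mult_right_mono) (auto simp: mult_le_cancel_right1)
      also have "\<dots> = (real r * (real k + 1) + 1) * (L * ln n)" by (simp add: algebra_simps)
      also have "\<dots> \<le> (D * (b / 2 * kap ^ r)) * (L * ln n)"
      proof (rule mult_right_mono)
       have "2 * (real r * (real k + 1) + 1) / (b * kap ^ r) \<le> D" by (simp add: D_def)
       then have "2 * (real r * (real k + 1) + 1) \<le> D * (b * kap ^ r)"
        using b kap0 by (simp add: divide_le_eq)
       then show "real r * (real k + 1) + 1 \<le> D * (b / 2 * kap ^ r)" by simp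
      qed (use ln0 L in auto)
      also have "\<dots> = b / 2 * (kap ^ r * (L * (D * ln n)))" by simp
      also have "\<dots> \<le> b / 2 * (kap ^ r * (L * L powr th))"
       using elim(1) b kap0 L by (intro mult_left_mono) (auto simp: L_def)
      also have "\<dots> \<le> b / 2 * real (tau n) ^ r" using tr b by (intro mult_left_mono) auto
      finally show ?thesis .
     qed
     have e2: "real r * (real (tau n) * ln (real ((k + l n) ^ k))) \<le> b / 2 * real (tau n) ^ r"
     proof -
      have "real r * (real (tau n) * ln (real ((k + l n) ^ k))) \<le> real r * (real (tau n) * (k * (ln (real k + 1) + ln L)))"
       using lnK by (intro mult_left_mono) auto
      also have "\<dots> = real (tau n) * (real r * real k * (ln (real k + 1) + ln L))" by simp
      also have "\<dots> \<le> real (tau n) * (b / 2 * kap ^ (r - 1) * L)"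
       using elim(2) by (intro mult_left_mono) (auto simp: L_def)
      also have "\<dots> = b / 2 * (real (tau n) * (kap ^ (r - 1) * L))" by simp
      also have "\<dots> \<le> b / 2 * (real (tau n) * real (tau n) ^ (r - 1))"
       using tr1 b by (intro mult_left_mono) auto
      also have "real (tau n) * real (tau n) ^ (r - 1) = real (tau n) ^ r"
       using r by (metis power_eq_if not_numeral_le_zero)
      finally show ?thesis .
     qed
     have "real r * ((k + l n) * ln n + real (tau n) * ln (real ((k + l n) ^ k))) + ln (real n) \<le> b * real (tau n) ^ r"
      using e1 e2 by (simp add: distrib_left)
     then show ?case using A by (simp add: b_def)
    qed
   qed (use k in auto)
   show ?thesis
   proof (rule aas_chromatic_boundI[OF p _ negligible_Un[OF negligible_Un[OF X1 X2 p(2)] X3 p(2)]])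
    show "\<forall>\<^sub>F n in sequentially. \<forall>m f. \<not> colorable r n (k + l n) m \<longrightarrow> f ` ksub {1..n} k \<subseteq> {..<m} \<longrightarrow>
     (\<exists>E\<in>X1 n \<union> X2 n \<union> (if True then hostev r k (ksub {1..n} (k + l n)) (tau n) else {}).
      E \<subseteq> kedges r (ksub {1..n} k) \<and> (\<forall>e\<in>E. mono_edge f e))"
    proof (intro always_eventually allI impI)
     fix n m f assume nc: "\<not> colorable r n (k + l n) m" and f: "f ` ksub {1..n} k \<subseteq> {..<m}"
     show "\<exists>E\<in>X1 n \<union> X2 n \<union> (if True then hostev r k (ksub {1..n} (k + l n)) (tau n) else {}).
      E \<subseteq> kedges r (ksub {1..n} k) \<and> (\<forall>e\<in>E. mono_edge f e)"
     proof (rule ccontr)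
      assume no: "\<not> ?thesis"
      have good: "E \<subseteq> kedges r (ksub {1..n} k) \<and> (\<forall>e\<in>E. mono_edge f e)"
       if "E = kedges r W" "W \<subseteq> ksub {1..n} k" "\<forall>v\<in>W. f v = c" for E W c
      proof -
       have "kedges r W \<subseteq> kedges r (ksub {1..n} k)" using that by (intro kedges_mono) auto
       moreover have "mono_edge f e" if "e \<in> kedges r W" for e
        using that \<open>\<forall>v\<in>W. f v = c\<close> by (auto simp: kedges_def mono_edge_def)
       ultimately show ?thesis using that by auto
      qed
      have N01: "N0 (l n) \<ge> C0"
      proof -
       have "(1::real) = 1 powr rho" by simp
       also have "\<dots> \<le> real (l n) powr rho" using l1[of n] rho by (intro powr_mono2) auto
       finally show ?thesis using C0 by (simp add: N0_def mult_le_cancel_left1)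
      qed
      obtain T C' where TC: "T \<subseteq> {1..n}" "C' \<subseteq> {..<m}" "\<not> tcol r T (k + l n) C'" "f ` ksub T k \<subseteq> C'"
       "card C' < card T" "real (card T) < N0 (l n)"
      proof (rule fixed_k_reduction[OF r k _ nc f phi_def del_def, of "N0 (l n)"])
       show "N0 (l n) \<ge> 2 * real r * real k / del" using N01 by (simp add: C0_def)
      next
       fix T W c assume T: "T \<subseteq> {1..n}" "N0 (l n) \<le> card T" "W \<in> star_families r k T" "\<forall>v\<in>W. f v = c"
       have "T \<noteq> {}" using T(2) N00[of n] by auto
       have "W \<subseteq> ksub T k" using T(3) by (auto simp: star_families_def)
       then have "W \<subseteq> ksub {1..n} k" using T(1) ksub_mono by blast
       then have "kedges r W \<notin> X1 n" using no good[OF refl _ T(4)] by blast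
       moreover have "kedges r W \<in> X1 n" if "\<not> card (kedges r W) < k1 * real (card T) ^ ((k - 1) * (r - 1))"
        unfolding X1_def using T \<open>T \<noteq> {}\<close> that
        by (intro CollectI exI[of _ T] exI[of _ W]) (simp add: not_less)
       ultimately have "card (kedges r W) < k1 * real (card T) ^ ((k - 1) * (r - 1))" by blast
       then show "card (kedges r W) * real r ^ r < (del / 2) ^ (r - 1) * real (card T) ^ ((k - 1) * (r - 1))"
        using rk by (simp add: k1_def less_divide_eq)
      next
       fix T W c assume T: "T \<subseteq> {1..n}" "N0 (l n) \<le> card T" "W \<subseteq> ksub T k" "\<forall>v\<in>W. f v = c"
       have "T \<noteq> {}" using T(2) N00[of n] by auto
       have "W \<subseteq> ksub {1..n} k" using T(1,3) ksub_mono by blast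
       then have "kedges r W \<notin> X2 n" using no good[OF refl _ T(4)] by blast
       moreover have "kedges r W \<in> X2 n" if "\<not> card (kedges r W) < k2 * real (card T) ^ ((k - 1) * r)"
        unfolding X2_def using T \<open>T \<noteq> {}\<close> that
        by (intro CollectI exI[of _ T] exI[of _ W]) (simp add: not_less)
       ultimately have "card (kedges r W) < k2 * real (card T) ^ ((k - 1) * r)" by blast
       then show "card (kedges r W) * real r ^ r < (phi / 2) ^ r * real (card T) ^ ((k - 1) * r)"
        using rk by (simp add: k2_def less_divide_eq)
      qed auto
      have finT: "finite T" "finite C'" using TC(1,2) finite_subset by blast+
      have "\<exists>E\<in>hostev r k (ksub {1..n} (k + l n)) (tau n). E \<subseteq> kedges r (ksub {1..n} k) \<and> (\<forall>x\<in>E. mono_edge f x)"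
      proof (rule popular_hosts[where T = T and d = "k + l n" and C = C'])
       fix A assume A: "A \<in> ksub T (k + l n)"
       have finA: "finite A" and cA: "card A = k + l n" using A finT by (auto simp: ksub_def intro: finite_subset)
       have "(tau n - 1) * card C' < card A choose k"
       proof -
        have "real (tau n - 1) * card C' \<le> real (tau n - 1) * N0 (l n)"
         using TC by (intro mult_left_mono) auto
        also have "\<dots> < real ((k + l n) choose k) / N0 (l n) * N0 (l n)"
         using tau(3)[of n] N00[of n] unfolding tau_def by (intro mult_strict_right_mono)
        also have "\<dots> = real ((k + l n) choose k)" using N00[of n] by simp
        finally show ?thesis by (simp only: of_nat_less_iff cA flip: of_nat_mult)
       qed
       moreover have "f ` ksub A k \<subseteq> C'" using TC(4) A ksub_mono[of A T k] by (auto simp: ksub_def)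
       ultimately obtain c where "c \<in> C'" "tau n \<le> popcount f k c A"
        using popular_colour[OF finA finT(2), of f k "tau n"] by auto
       then show "\<exists>c\<in>C'. tau n \<le> popcount f k c A" by blast
       show "\<exists>B\<in>ksub {1..n} (k + l n). A \<subseteq> B" using A TC(1) ksub_mono by blast
      qed (use k r TC finT in auto)
      then show False using no by auto
     qed
    qed
   qed (use r in simp)
  qed
  ultimately show ?thesis by blast
qed

section \<open>Short descriptions of families of similar sets\<close>

section \<open>Covering by nearly connected lists\<close>

definition near :: "nat \<Rightarrow> nat set \<Rightarrow> nat set \<Rightarrow> bool" where
  "near l u v \<longleftrightarrow> card (u - v) \<le> l \<and> card (v - u) \<le> l"

text \<open>The number of runs of consecutive near sets. A set near its neighbour is described by
  O(l) elements, a set after a jump by all k of them.\<close>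

fun jumps :: "nat \<Rightarrow> (nat set \<times> nat) list \<Rightarrow> nat" where
  "jumps l [] = 0"
| "jumps l [x] = 1"
| "jumps l (x # y # L) = (if near l (fst x) (fst y) then 0 else 1) + jumps l (y # L)"

lemma near_sym: "near l u v \<Longrightarrow> near l v u"
  by (simp add: near_def)

text \<open>The detour x, u, x adds a near set without a jump, at the price of two places in the
  list.\<close>

lemma jumps_insert:
  assumes "near l (fst x) (fst u)"
  shows "jumps l (L1 @ x # u # x # L2) = jumps l (L1 @ x # L2)"
proof (induction L1)
  case Nil
  then show ?case using assms near_sym by auto
next
  case (Cons a L1)
  then show ?case by (cases L1) auto
qed

lemma jumps_Cons_le: "jumps l (x # L) \<le> Suc (jumps l L)"
  by (cases L) auto

lemma extend_by_block:
  assumes "finite P" "x \<in> set L" "\<And>y. y \<in> P \<Longrightarrow> near l (fst x) (fst y)"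
  shows "\<exists>L'. set L' = set L \<union> P \<and> length L' = length L + 2 * card (P - set L) \<and> jumps l L' = jumps l L"
  using assms
proof (induction P rule: finite_induct)
  case (insert u P)
  then obtain L' where L': "set L' = set L \<union> P" "length L' = length L + 2 * card (P - set L)" "jumps l L' = jumps l L"
   by auto
  show ?case
  proof (cases "u \<in> set L")
   case True
   then have "insert u P - set L = P - set L" by auto
   then show ?thesis using L' True by (intro exI[of _ L']) auto
  next
   case False
   obtain L1 L2 where L12: "L' = L1 @ x # L2" using insert.prems(1) L'(1) by (metis UnCI split_list)
   have "insert u P - set L = insert u (P - set L)" using False by auto
   then have c: "card (insert u P - set L) = Suc (card (P - set L))" using insert.hyps by simp
   show ?thesis
   proof (intro exI[of _ "L1 @ x # u # x # L2"] conjI)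
    show "set (L1 @ x # u # x # L2) = set L \<union> insert u P" using L'(1) unfolding L12 by auto
    show "length (L1 @ x # u # x # L2) = length L + 2 * card (insert u P - set L)"
     using L'(2) unfolding L12 c by simp
    show "jumps l (L1 @ x # u # x # L2) = jumps l L"
     using jumps_insert[of l x u L1 L2] insert.prems(2) L'(3) L12 by simp
   qed
  qed
qed (intro exI[of _ L], auto)

text \<open>Members of one block are pairwise near. A block that meets the list is added by detours
  without a jump. A block disjoint from it costs one jump but brings at least q new members, so the
  jumps stay below a fraction 1/q of the size.\<close>

lemma near_cover:
  assumes "finite G" "\<And>A. A \<in> G \<Longrightarrow> finite (P A) \<and> q \<le> card (P A)" "q \<ge> 1"
   and "\<And>A x y. A \<in> G \<Longrightarrow> x \<in> P A \<Longrightarrow> y \<in> P A \<Longrightarrow> near l (fst x) (fst y)"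
  shows "\<exists>L. set L = (\<Union>A\<in>G. P A) \<and> length L \<le> 2 * card (set L) \<and> jumps l L * q \<le> card (set L)"
  using assms
proof (induction G rule: finite_induct)
  case (insert A G)
  have "\<exists>L. set L = (\<Union>A\<in>G. P A) \<and> length L \<le> 2 * card (set L) \<and> jumps l L * q \<le> card (set L)"
  proof (rule insert.IH)
   show "finite (P X) \<and> q \<le> card (P X)" if "X \<in> G" for X using insert.prems(1) that by blast
   show "near l (fst x) (fst y)" if "X \<in> G" "x \<in> P X" "y \<in> P X" for X x y using insert.prems(3) that by blast
  qed (rule insert.prems(2))
  then obtain L where L: "set L = (\<Union>A\<in>G. P A)" "length L \<le> 2 * card (set L)" "jumps l L * q \<le> card (set L)"
   by blast
  have fA: "finite (P A)" "q \<le> card (P A)" using insert.prems(1) by auto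
  have cU: "card (set L \<union> P A) = card (set L) + card (P A - set L)"
  proof -
   have "card (set L \<union> (P A - set L)) = card (set L) + card (P A - set L)"
    by (rule card_Un_disjoint) (use fA in auto)
   then show ?thesis by simp
  qed
  show ?case
  proof (cases "P A \<inter> set L = {}")
   case False
   then obtain x where x: "x \<in> P A" "x \<in> set L" by auto
   obtain L' where L': "set L' = set L \<union> P A" "length L' = length L + 2 * card (P A - set L)" "jumps l L' = jumps l L"
    using extend_by_block[OF fA(1) x(2), of l] insert.prems(3)[of A x] x(1) by auto
   show ?thesis using L L' cU by (intro exI[of _ L']) auto
  next
   case True
   have "P A \<noteq> {}" using fA insert.prems(2) by auto
   then obtain x where x: "x \<in> P A" by auto
   then have xL: "x \<notin> set L" using True by auto
   obtain L' where L': "set L' = set (x # L) \<union> P A" "length L' = length (x # L) + 2 * card (P A - set (x # L))"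
     "jumps l L' = jumps l (x # L)"
    using extend_by_block[OF fA(1), of x "x # L" l] insert.prems(3)[of A x] x by auto
   have ins: "P A - set L = insert x (P A - set (x # L))" using x xL by auto
   have c: "card (P A - set L) = Suc (card (P A - set (x # L)))"
    unfolding ins by (rule card_insert_disjoint) (use fA in auto)
   have c2: "card (P A - set L) = card (P A)" using True by (metis Diff_triv)
   have s: "set L' = set L \<union> P A" using L'(1) x by auto
   have "jumps l L' * q \<le> Suc (jumps l L) * q" using L'(3) jumps_Cons_le by (intro mult_right_mono) auto
   then have "jumps l L' * q \<le> card (set L')" using L(3) fA(2) c2 cU s by simp
   moreover have "length L' \<le> 2 * card (set L')" using L(2) L'(2) c cU s by simp
   ultimately show ?thesis using s L(1) by (intro exI[of _ L']) auto
  qed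
qed (intro exI[of _ "[]"], auto)

text \<open>Lists grow at the front: a set near its successor has at most D choices, any other set
  has at most N but uses up a jump, and the colour has M. The factor 2 per step covers the two
  cases.\<close>

lemma card_jump_lists:
  assumes V: "finite V" "card V \<le> N" and D: "D \<ge> 1" "\<And>v. v \<in> V \<Longrightarrow> card {u \<in> V. near l u v} \<le> D"
  shows "card {L. set L \<subseteq> V \<times> {..<M} \<and> length L = s \<and> jumps l L = j} \<le> (2 * D * M) ^ s * N ^ j"
proof (induction s arbitrary: j)
  case 0
  have "{L. set L \<subseteq> V \<times> {..<M} \<and> length L = 0 \<and> jumps l L = j} = (if j = 0 then {[]} else {})" by auto
  then show ?case by (simp only:) simp
next
  case (Suc s)
  define S where "S = (\<lambda>s j. {L. set L \<subseteq> V \<times> {..<M} \<and> length L = s \<and> jumps l L = j})"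
  have fS: "finite (S s j)" for s j
   unfolding S_def by (rule finite_subset[OF _ finite_lists_length_eq[of "V \<times> {..<M}" s]]) (use V in auto)
  define c where "c = (\<lambda>(L :: (nat set \<times> nat) list, x). x # L)"
  define A1 where "A1 = Sigma (S s j) (\<lambda>L. if L = [] then {} else {u \<in> V. near l u (fst (hd L))} \<times> {..<M})"
  define A2 where "A2 = (if j = 0 then {} else S s (j - 1)) \<times> (V \<times> {..<M})"
  have fin: "finite A1" "finite A2" using fS V by (auto simp: A1_def A2_def)
  have "S (Suc s) j \<subseteq> c ` A1 \<union> c ` A2"
  proof
   fix X assume X: "X \<in> S (Suc s) j"
   then obtain x L where xL: "X = x # L" by (auto simp: S_def length_Suc_conv)
   have L: "set L \<subseteq> V \<times> {..<M}" "length L = s" "fst x \<in> V" "snd x < M" using X xL by (auto simp: S_def)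
   show "X \<in> c ` A1 \<union> c ` A2"
   proof (cases "L \<noteq> [] \<and> near l (fst x) (fst (hd L))")
    case True
    then have "jumps l L = j" using X xL by (cases L) (auto simp: S_def)
    then have "(L, x) \<in> A1" using L True by (cases x) (auto simp: A1_def S_def)
    then have "c (L, x) \<in> c ` A1" by (rule imageI)
    then show ?thesis using xL by (simp add: c_def)
   next
    case False
    then have "Suc (jumps l L) = j" using X xL by (cases L) (auto simp: S_def split: if_splits)
    then have "(L, x) \<in> A2" using L by (cases x) (auto simp: A2_def S_def)
    then have "c (L, x) \<in> c ` A2" by (rule imageI)
    then show ?thesis using xL by (simp add: c_def)
   qed
  qed
  then have "card (S (Suc s) j) \<le> card (c ` A1 \<union> c ` A2)" using fin by (intro card_mono) auto
  also have "\<dots> \<le> card (c ` A1) + card (c ` A2)" by (rule card_Un_le)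
  also have "\<dots> \<le> card A1 + card A2" using fin by (intro add_mono card_image_le)
  finally have le: "card (S (Suc s) j) \<le> card A1 + card A2" .
  have "card A1 = (\<Sum>L\<in>S s j. card (if L = [] then {} else {u \<in> V. near l u (fst (hd L))} \<times> {..<M}))"
   unfolding A1_def using fS V by (intro card_SigmaI) auto
  also have "\<dots> \<le> (\<Sum>L\<in>S s j. D * M)"
  proof (intro sum_mono)
   fix L assume L: "L \<in> S s j"
   show "card (if L = [] then {} else {u \<in> V. near l u (fst (hd L))} \<times> {..<M}) \<le> D * M"
   proof (cases "L = []")
    case False
    then have "hd L \<in> set L" by simp
    then have "fst (hd L) \<in> V" using L by (force simp: S_def)
    then show ?thesis using False D(2)[of "fst (hd L)"] by (simp add: card_cartesian_product)
   qed simp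
  qed
  also have "\<dots> = card (S s j) * (D * M)" by simp
  also have "\<dots> \<le> ((2 * D * M) ^ s * N ^ j) * (D * M)"
   using Suc.IH[of j] by (intro mult_right_mono) (auto simp: S_def)
  finally have a1: "card A1 \<le> D * M * ((2 * D * M) ^ s * N ^ j)" by (simp add: mult_ac)
  have a2: "card A2 \<le> D * M * ((2 * D * M) ^ s * N ^ j)"
  proof (cases "j = 0")
   case False
   then obtain i where i: "j = Suc i" by (cases j) auto
   have "card A2 = card (S s i) * (card V * M)" by (simp add: A2_def i card_cartesian_product)
   also have "\<dots> \<le> ((2 * D * M) ^ s * N ^ i) * (N * M)"
    using Suc.IH[of i] V(2) by (intro mult_mono) (auto simp: S_def)
   also have "\<dots> = 1 * (M * ((2 * D * M) ^ s * N ^ j))" by (simp add: i)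
   also have "\<dots> \<le> D * (M * ((2 * D * M) ^ s * N ^ j))" using D(1) by (intro mult_right_mono) auto
   finally show ?thesis by (simp add: mult.assoc)
  qed (simp add: A2_def)
  have "card (S (Suc s) j) \<le> 2 * (D * M * ((2 * D * M) ^ s * N ^ j))" using le a1 a2 by linarith
  then show ?case by (simp add: S_def mult_ac)
qed

lemma card_small_subsets: "card {X. X \<subseteq> {1..n} \<and> card X \<le> l} \<le> (n + 1) ^ l"
proof -
  let ?A = "{xs. set xs \<subseteq> {0..n} \<and> length xs = l}"
  have "{X. X \<subseteq> {1..n} \<and> card X \<le> l} \<subseteq> (\<lambda>xs. set xs - {0}) ` ?A"
  proof
   fix X assume X: "X \<in> {X. X \<subseteq> {1..n} \<and> card X \<le> l}"
   then have fX: "finite X" by (auto intro: finite_subset)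
   define xs where "xs = sorted_list_of_set X @ replicate (l - card X) 0"
   have "xs \<in> ?A" using X fX by (auto simp: xs_def)
   moreover have "set xs - {0} = X" using X fX by (auto simp: xs_def)
   ultimately show "X \<in> (\<lambda>xs. set xs - {0}) ` ?A" by blast
  qed
  then have "card {X. X \<subseteq> {1..n} \<and> card X \<le> l} \<le> card ?A"
   by (rule surj_card_le[rotated]) (rule finite_lists_length_eq, simp)
  also have "\<dots> = (n + 1) ^ l" by (simp add: card_lists_length_eq)
  finally show ?thesis .
qed

lemma card_near_le:
  assumes "v \<in> ksub {1..n} k"
  shows "card {u \<in> ksub {1..n} k. near l u v} \<le> (n + 1) ^ (2 * l)"
proof -
  let ?S = "{X. X \<subseteq> {1..n} \<and> card X \<le> l}"
  have "inj_on (\<lambda>u. (u - v, v - u)) {u \<in> ksub {1..n} k. near l u v}"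
   by (rule inj_onI) blast
  moreover have "(\<lambda>u. (u - v, v - u)) ` {u \<in> ksub {1..n} k. near l u v} \<subseteq> ?S \<times> ?S"
   using assms by (auto simp: ksub_def near_def)
  ultimately have "card {u \<in> ksub {1..n} k. near l u v} \<le> card (?S \<times> ?S)"
   by (intro card_inj_on_le) auto
  also have "\<dots> = card ?S * card ?S" by (rule card_cartesian_product)
  also have "\<dots> \<le> (n + 1) ^ l * (n + 1) ^ l" by (intro mult_mono card_small_subsets) auto
  also have "\<dots> = (n + 1) ^ (2 * l)" by (simp add: mult_2 power_add)
  finally show ?thesis .
qed

section \<open>Statement (b)\<close>

section \<open>Random Kneser graphs with fixed l\<close>

text \<open>Suppose that every nonempty subfamily had a host with a popular colour c shared by no
  disjoint host of the subfamily. Peeling off such hosts one by one and giving each its c would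
  colour all d-sets properly. So some subfamily is closed under finding mates.\<close>

lemma popular_core:
  assumes d: "d \<ge> 1" and nc: "\<not> colorable 2 n d m"
   and pop: "\<And>A. A \<in> ksub {1..n} d \<Longrightarrow> \<exists>c<m. pop A c"
  obtains G where "G \<subseteq> ksub {1..n} d" "G \<noteq> {}"
   "\<And>A c. A \<in> G \<Longrightarrow> c < m \<Longrightarrow> pop A c \<Longrightarrow> \<exists>B\<in>G. A \<inter> B = {} \<and> pop B c"
proof (rule ccontr)
  assume no: "\<not> thesis"
  note that' = that
  have core: "\<exists>A\<in>G. \<exists>c<m. pop A c \<and> (\<forall>B\<in>G. A \<inter> B = {} \<longrightarrow> \<not> pop B c)"
   if "G \<subseteq> ksub {1..n} d" "G \<noteq> {}" for G
  proof (rule ccontr)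
   assume "\<not> ?thesis"
   then show False using that'[OF that] no by blast
  qed
  have "\<exists>g. \<forall>A\<in>G. g A < m \<and> pop A (g A) \<and> (\<forall>B\<in>G. A \<noteq> B \<longrightarrow> A \<inter> B = {} \<longrightarrow> g A \<noteq> g B)"
   if "finite G" "G \<subseteq> ksub {1..n} d" for G
   using that
  proof (induction G rule: finite_psubset_induct)
   case (psubset G)
   show ?case
   proof (cases "G = {}")
    case False
    obtain A c where A: "A \<in> G" "c < m" "pop A c" "\<forall>B\<in>G. A \<inter> B = {} \<longrightarrow> \<not> pop B c"
     using core[OF psubset.prems False] by blast
    have "G - {A} \<subset> G" using A(1) by blast
    then obtain g where g: "\<forall>X\<in>G - {A}. g X < m \<and> pop X (g X) \<and> (\<forall>B\<in>G - {A}. X \<noteq> B \<longrightarrow> X \<inter> B = {} \<longrightarrow> g X \<noteq> g B)"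
     using psubset.IH[of "G - {A}"] psubset.prems by auto
    show ?thesis
    proof (intro exI[of _ "g(A := c)"] ballI conjI impI)
     fix X assume X: "X \<in> G"
     show "(g(A := c)) X < m" "pop X ((g(A := c)) X)" using X A g by auto
     fix Y assume Y: "Y \<in> G" "X \<noteq> Y" "X \<inter> Y = {}"
     show "(g(A := c)) X \<noteq> (g(A := c)) Y"
     proof (cases "X = A \<or> Y = A")
      case True
      then show ?thesis
      proof
       assume "X = A"
       then have "Y \<in> G - {A}" "\<not> pop Y c" using X Y A by auto
       then have "g Y \<noteq> c" using g by auto
       then show ?thesis using \<open>X = A\<close> Y by auto
      next
       assume "Y = A"
       then have "X \<in> G - {A}" "\<not> pop X c" using X Y A by (auto simp: Int_commute)
       then have "g X \<noteq> c" using g by auto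
       then show ?thesis using \<open>Y = A\<close> Y by auto
      qed
     next
      case False
      then show ?thesis using X Y g by auto
     qed
    qed
   qed simp
  qed
  from this[of "ksub {1..n} d"] obtain g where g: "\<forall>A\<in>ksub {1..n} d. g A < m \<and> pop A (g A) \<and>
    (\<forall>B\<in>ksub {1..n} d. A \<noteq> B \<longrightarrow> A \<inter> B = {} \<longrightarrow> g A \<noteq> g B)" by (auto simp del: One_nat_def)
  have "kedges 2 {A \<in> ksub {1..n} d. g A = c} = {}" for c
  proof (rule ccontr)
   assume "kedges 2 {A \<in> ksub {1..n} d. g A = c} \<noteq> {}"
   then obtain e where e: "e \<subseteq> {A \<in> ksub {1..n} d. g A = c}" "card e = 2" "pairwise disjnt e"
    by (auto simp: kedges_def)
   obtain A B where AB: "e = {A, B}" "A \<noteq> B" using e(2) by (auto simp: card_2_iff)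
   have "A \<inter> B = {}" using e(3) AB by (auto simp: pairwise_def disjnt_def)
   then show False using g e(1) AB by auto
  qed
  then have "tcol 2 {1..n} d {..<m}" unfolding tcol_def using g by (intro exI[of _ g]) auto
  then show False using nc by (simp add: colorable_tcol)
qed

text \<open>The colour is stored beside each k-set, so that the list alone determines which pairs
  are monochromatic.\<close>

definition list_edges :: "(nat set \<times> nat) list \<Rightarrow> nat set set set" where
  "list_edges L = {{u, v} |u v c. (u, c) \<in> set L \<and> (v, c) \<in> set L \<and> u \<inter> v = {}}"

lemma finite_list_edges: "finite (list_edges L)"
proof -
  have "list_edges L \<subseteq> Pow (fst ` set L)" unfolding list_edges_def by force
  then show ?thesis by (rule finite_subset) simp
qed

text \<open>Count pairs of a listed set and a disjoint mate: each listed set has at least K/(2n)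
  mates, and an edge accounts for at most four ordered pairs.\<close>

lemma card_list_edges:
  assumes ne: "\<And>x. x \<in> set L \<Longrightarrow> fst x \<noteq> {}" and fn: "\<And>u c c'. (u, c) \<in> set L \<Longrightarrow> (u, c') \<in> set L \<Longrightarrow> c = c'"
   and mates: "\<And>u c. (u, c) \<in> set L \<Longrightarrow> K \<le> 2 * n * card {v. (v, c) \<in> set L \<and> u \<inter> v = {}}"
  shows "card (set L) * K \<le> 8 * n * card (list_edges L)"
proof -
  define S where "S = Sigma (set L) (\<lambda>x. {v. (v, snd x) \<in> set L \<and> fst x \<inter> v = {}})"
  have fm: "finite {v. (v, c) \<in> set L \<and> u \<inter> v = {}}" for c u
   by (rule finite_subset[of _ "fst ` set L"]) force+
  have "card (set L) * K = (\<Sum>x\<in>set L. K)" by simp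
  also have "\<dots> \<le> (\<Sum>x\<in>set L. 2 * n * card {v. (v, snd x) \<in> set L \<and> fst x \<inter> v = {}})"
   using mates by (intro sum_mono) auto
  also have "\<dots> = 2 * n * card S"
   unfolding S_def using fm by (subst card_SigmaI) (auto simp: sum_distrib_left)
  finally have 1: "card (set L) * K \<le> 2 * n * card S" .
  define h where "h = (\<lambda>(x::nat set \<times> nat, v::nat set). [fst x, v])"
  have "inj_on h S"
   using fn by (fastforce simp: inj_on_def h_def S_def)
  then have "card S = card (h ` S)" by (simp add: card_image)
  also have "\<dots> \<le> card (list_edges L) * 2 ^ 2"
  proof (rule card_lists_le_edges[OF finite_list_edges])
   fix xs assume "xs \<in> h ` S"
   then show "length xs = 2 \<and> set xs \<in> list_edges L"
    unfolding h_def S_def list_edges_def by force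
  next
   fix e assume "e \<in> list_edges L"
   then obtain u v c where e: "e = {u, v}" "(u, c) \<in> set L" "u \<inter> v = {}" by (auto simp: list_edges_def)
   then have "u \<noteq> v" using ne by force
   then show "card e = 2" using e by simp
  qed simp
  finally have "2 * n * card S \<le> 2 * n * (card (list_edges L) * 4)" by simp
  then show ?thesis using 1 by linarith
qed

definition jump_lists :: "nat \<Rightarrow> nat \<Rightarrow> nat \<Rightarrow> nat \<Rightarrow> (nat set \<times> nat) list set" where
  "jump_lists n k l w = {L. set L \<subseteq> ksub {1..n} k \<times> {..<n} \<and> length L \<le> 2 * w \<and> jumps l L * k \<le> 2 * w}"

text \<open>The w members cost O(l ln n) each instead of k ln n: there are at most 2w places, near
  steps cost O(l ln n), and at most 2w/k jumps of cost k ln n add O(w ln n) in total.\<close>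

lemma card_jump_lists_le:
  assumes n: "n \<ge> 3" and k: "k \<ge> 1"
  shows "finite (jump_lists n k l w)" "real (card (jump_lists n k l w)) \<le> exp (real w * (8 * real l + 10) * ln n)"
proof -
  define S where "S = (\<lambda>s j. {L. set L \<subseteq> ksub {1..n} k \<times> {..<n} \<and> length L = s \<and> jumps l L = j})"
  have fS: "finite (S s j)" for s j
   unfolding S_def by (rule finite_subset[OF _ finite_lists_length_eq[of "ksub {1..n} k \<times> {..<n}" s]]) auto
  define D where "D = (n + 1) ^ (2 * l)"
  define J where "J = {j. j * k \<le> 2 * w}"
  have J: "J \<subseteq> {..2 * w}"
  proof
   fix j assume "j \<in> J"
   then have "j * k \<le> 2 * w" by (simp add: J_def)
   moreover have "j * 1 \<le> j * k" using k by (intro mult_left_mono) auto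
   ultimately have "j \<le> 2 * w" by linarith
   then show "j \<in> {..2 * w}" by simp
  qed
  then have fJ: "finite J" by (rule finite_subset) simp
  have sub: "jump_lists n k l w = (\<Union>s\<in>{..2 * w}. \<Union>j\<in>J. S s j)"
   by (auto simp: jump_lists_def S_def J_def)
  show "finite (jump_lists n k l w)" unfolding sub using fS fJ by blast
  have nD: "2 * D * n \<le> n ^ (4 * l + 2)"
  proof -
   have "n + 1 \<le> n ^ 2"
   proof -
    have "n * 2 \<le> n * n" using n by (intro mult_left_mono) auto
    then show ?thesis using n unfolding power2_eq_square by linarith
   qed
   then have "D \<le> (n ^ 2) ^ (2 * l)" unfolding D_def by (intro power_mono) auto
   then have "D \<le> n ^ (4 * l)" by (simp add: power_mult[symmetric])
   moreover have "2 * n \<le> n ^ 2" using n by (simp add: power2_eq_square)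
   ultimately have "D * (2 * n) \<le> n ^ (4 * l) * n ^ 2" by (intro mult_mono) auto
   then show ?thesis unfolding power_add by (simp only: mult_ac)
  qed
  have c: "card (S s j) \<le> n ^ ((4 * l + 2) * (2 * w) + 2 * w)" if "s \<le> 2 * w" "j \<in> J" for s j
  proof -
   have "card (S s j) \<le> (2 * D * n) ^ s * (n ^ k) ^ j"
    unfolding S_def
   proof (rule card_jump_lists)
    show "card (ksub {1..n} k) \<le> n ^ k" by (simp add: card_ksub choose_le_pow)
    show "1 \<le> D" by (simp add: D_def)
   qed (use card_near_le in \<open>auto simp: D_def\<close>)
   also have "\<dots> \<le> (n ^ (4 * l + 2)) ^ (2 * w) * n ^ (2 * w)"
   proof (rule mult_mono)
    have "(2 * D * n) ^ s \<le> (n ^ (4 * l + 2)) ^ s" using nD by (rule power_mono) simp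
    also have "\<dots> \<le> (n ^ (4 * l + 2)) ^ (2 * w)" using that n by (intro power_increasing) auto
    finally show "(2 * D * n) ^ s \<le> (n ^ (4 * l + 2)) ^ (2 * w)" .
    have "k * j \<le> 2 * w" using that by (simp add: J_def mult.commute)
    then show "(n ^ k) ^ j \<le> n ^ (2 * w)"
     using n unfolding power_mult[symmetric] by (intro power_increasing) auto
   qed auto
   also have "\<dots> = n ^ ((4 * l + 2) * (2 * w) + 2 * w)" by (simp only: power_add power_mult)
   finally show ?thesis .
  qed
  have "card (jump_lists n k l w) \<le> (\<Sum>s\<in>{..2 * w}. card (\<Union>j\<in>J. S s j))"
   unfolding sub by (rule card_UN_le) simp
  also have "\<dots> \<le> (\<Sum>s\<in>{..2 * w}. (2 * w + 1) * n ^ ((4 * l + 2) * (2 * w) + 2 * w))"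
  proof (intro sum_mono)
   fix s assume s: "s \<in> {..2 * w}"
   have "card (\<Union>j\<in>J. S s j) \<le> (\<Sum>j\<in>J. card (S s j))" by (rule card_UN_le[OF fJ])
   also have "\<dots> \<le> (\<Sum>j\<in>J. n ^ ((4 * l + 2) * (2 * w) + 2 * w))" using c s by (intro sum_mono) auto
   also have "\<dots> = card J * n ^ ((4 * l + 2) * (2 * w) + 2 * w)" by simp
   also have "\<dots> \<le> (2 * w + 1) * n ^ ((4 * l + 2) * (2 * w) + 2 * w)"
    using card_mono[OF _ J] by (intro mult_right_mono) auto
   finally show "card (\<Union>j\<in>J. S s j) \<le> (2 * w + 1) * n ^ ((4 * l + 2) * (2 * w) + 2 * w)" .
  qed
  also have "\<dots> = (2 * w + 1) * (2 * w + 1) * n ^ ((4 * l + 2) * (2 * w) + 2 * w)"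
   by (simp only: sum_constant card_atMost Suc_eq_plus1 mult.assoc of_nat_id)
  also have "\<dots> \<le> n ^ (2 * w) * n ^ (2 * w) * n ^ ((4 * l + 2) * (2 * w) + 2 * w)"
  proof -
   have "2 * w < 2 ^ (2 * w)" by (rule less_exp)
   then have "2 * w + 1 \<le> 2 ^ (2 * w)" by (simp only: Suc_leI Suc_eq_plus1[symmetric])
   also have "\<dots> \<le> n ^ (2 * w)" using n by (intro power_mono) auto
   finally have "2 * w + 1 \<le> n ^ (2 * w)" .
   then show ?thesis by (intro mult_mono) auto
  qed
  also have "\<dots> = n ^ (w * (8 * l + 10))"
  proof -
   have "2 * w + (2 * w + ((4 * l + 2) * (2 * w) + 2 * w)) = w * (8 * l + 10)" by (simp add: algebra_simps)
   then show ?thesis by (metis power_add mult.assoc)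
  qed
  finally have "real (card (jump_lists n k l w)) \<le> real (n ^ (w * (8 * l + 10)))" by (rule of_nat_mono)
  also have "\<dots> = exp (real (w * (8 * l + 10)) * ln n)"
   using n by (simp only: exp_of_nat_mult) simp
  finally show "real (card (jump_lists n k l w)) \<le> exp (real w * (8 * real l + 10) * ln n)" by simp
qed

text \<open>A colour is popular on A if it occurs at least K/(2n) times. Unpopular colours cover at
  most half of the k-subsets of A, so each host of the core contributes a block of at least K/2
  k-sets with popular colours, any two of which are near. The union of the blocks is listed, and
  closure of the core gives each member K/(2n) disjoint mates of its colour.\<close>

lemma graph_core_list:
  assumes k: "k \<ge> 1" and l: "l \<ge> 1" and n: "n \<ge> 1" and nc: "\<not> colorable 2 n (k + l) m"
   and f: "f ` ksub {1..n} k \<subseteq> {..<m}"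
  obtains w L where "w \<in> {1..n choose k}" "L \<in> jump_lists n k l w"
   "w * (k + l choose k) \<le> 8 * n * card (list_edges L)" "list_edges L \<subseteq> kedges 2 (ksub {1..n} k)"
   "\<forall>e\<in>list_edges L. mono_edge f e"
proof -
  define K where "K = (k + l choose k)"
  define d where "d = k + l"
  have mn: "m < n" using not_colorable_bound(4)[OF _ _ _ nc f] k by simp
  have Kk: "K \<ge> k + 1"
  proof -
   have "k + 1 = (k + 1 choose k)" by simp
   also have "\<dots> \<le> K" unfolding K_def using l by (intro binomial_right_mono) auto
   finally show ?thesis .
  qed
  define pop where "pop = (\<lambda>A c. K \<le> 2 * n * popcount f k c A)"
  define Q where "Q = (\<lambda>A. {v \<in> ksub A k. pop A (f v)})"
  define P where "P = (\<lambda>A. (\<lambda>v. (v, f v)) ` Q A)"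
  \<comment> \<open>Half of K, rounded up. From K \<ge> k + 1 one gets k \<le> 2q, so the bound on
    jumps can be stated with k.\<close>
  define q where "q = (K + 1) div 2"
  have q: "q \<ge> 1" "k \<le> 2 * q" using Kk by (auto simp: q_def)
  have hosts: "finite A" "card A = d" "ksub A k \<subseteq> ksub {1..n} k" "f ` ksub A k \<subseteq> {..<m}" if "A \<in> ksub {1..n} d" for A
  proof -
   show "finite A" "card A = d" using that by (auto simp: ksub_def intro: finite_subset)
   show s: "ksub A k \<subseteq> ksub {1..n} k" using that ksub_mono[of A "{1..n}" k] by (auto simp: ksub_def)
   then show "f ` ksub A k \<subseteq> {..<m}" using f by blast
  qed
  have fQ: "finite (Q A)" if "A \<in> ksub {1..n} d" for A using hosts(1)[OF that] by (simp add: Q_def)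
  have cQ: "q \<le> card (Q A)" if A: "A \<in> ksub {1..n} d" for A
  proof -
   have fin: "finite (ksub A k)" using hosts(1)[OF A] by simp
   have "ksub A k - Q A \<subseteq> (\<Union>c\<in>{c. c < m \<and> \<not> pop A c}. {v \<in> ksub A k. f v = c})"
    using hosts(4)[OF A] by (auto simp: Q_def)
   then have "card (ksub A k - Q A) \<le> card (\<Union>c\<in>{c. c < m \<and> \<not> pop A c}. {v \<in> ksub A k. f v = c})"
    using fin by (intro card_mono) auto
   also have "\<dots> \<le> (\<Sum>c\<in>{c. c < m \<and> \<not> pop A c}. popcount f k c A)"
    unfolding popcount_def by (rule card_UN_le) simp
   finally have "2 * n * card (ksub A k - Q A) \<le> 2 * n * (\<Sum>c\<in>{c. c < m \<and> \<not> pop A c}. popcount f k c A)"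
    by (rule mult_le_mono2)
   also have "\<dots> = (\<Sum>c\<in>{c. c < m \<and> \<not> pop A c}. 2 * n * popcount f k c A)" by (simp add: sum_distrib_left)
   also have "\<dots> \<le> (\<Sum>c\<in>{c. c < m \<and> \<not> pop A c}. K)" by (intro sum_mono) (auto simp: pop_def)
   also have "\<dots> = card {c. c < m \<and> \<not> pop A c} * K" by simp
   also have "\<dots> \<le> n * K"
   proof (intro mult_right_mono)
    have "card {c. c < m \<and> \<not> pop A c} \<le> card {..<m}" by (intro card_mono) auto
    then show "card {c. c < m \<and> \<not> pop A c} \<le> n" using mn by simp
   qed simp
   finally have "n * (2 * card (ksub A k - Q A)) \<le> n * K" by (simp add: mult_ac)
   then have a: "2 * card (ksub A k - Q A) \<le> K" using n by simp
   have "card (ksub A k) = K" using hosts(1,2)[OF A] by (simp add: card_ksub K_def d_def)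
   moreover have "Q A \<subseteq> ksub A k" by (auto simp: Q_def)
   then have "card (ksub A k - Q A) = card (ksub A k) - card (Q A)" "card (Q A) \<le> card (ksub A k)"
    using fin by (auto intro: card_mono card_Diff_subset finite_subset)
   ultimately show ?thesis using a by (simp add: q_def)
  qed
  have ex: "\<exists>c<m. pop A c" if A: "A \<in> ksub {1..n} d" for A
  proof -
   have "card (Q A) \<noteq> 0" using cQ[OF A] q by simp
   then obtain v where "v \<in> Q A" by (metis card.empty equals0I)
   then show ?thesis using hosts(4)[OF A] by (auto simp: Q_def)
  qed
  obtain G where G: "G \<subseteq> ksub {1..n} d" "G \<noteq> {}"
   "\<And>A c. A \<in> G \<Longrightarrow> c < m \<Longrightarrow> pop A c \<Longrightarrow> \<exists>B\<in>G. A \<inter> B = {} \<and> pop B c"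
   using popular_core[of d n m pop] nc ex k by (auto simp: d_def)
  have finG: "finite G" using G(1) finite_subset by fastforce
  have injP: "inj_on (\<lambda>v. (v, f v)) X" for X by (auto simp: inj_on_def)
  have cP: "finite (P A) \<and> q \<le> card (P A)" if "A \<in> G" for A
   using that G(1) cQ fQ injP by (auto simp: P_def card_image)
  have "\<exists>L. set L = (\<Union>A\<in>G. P A) \<and> length L \<le> 2 * card (set L) \<and> jumps l L * q \<le> card (set L)"
  proof (rule near_cover[OF finG cP q(1)])
   fix A x y assume A: "A \<in> G" "x \<in> P A" "y \<in> P A"
   have nr: "card (u - v) \<le> l" if "u \<in> ksub A k" "v \<in> ksub A k" for u v
   proof -
    have fA: "finite A" "card A = k + l" using A G(1) hosts by (auto simp: d_def)
    have uv: "u \<subseteq> A" "v \<subseteq> A" "card v = k" using that by (auto simp: ksub_def)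
    have "card (u - v) \<le> card (A - v)" using uv fA by (intro card_mono) auto
    also have "\<dots> = l" using uv fA by (simp add: card_Diff_subset finite_subset)
    finally show ?thesis .
   qed
   show "near l (fst x) (fst y)" using A nr by (auto simp: P_def Q_def near_def)
  qed
  then obtain L where L: "set L = (\<Union>A\<in>G. P A)" "length L \<le> 2 * card (set L)" "jumps l L * q \<le> card (set L)"
   by blast
  define w where "w = card (set L)"
  have LV: "\<And>v c. (v, c) \<in> set L \<Longrightarrow> v \<in> ksub {1..n} k \<and> c = f v"
   using L(1) G(1) hosts(3) by (fastforce simp: P_def Q_def)
  have LM: "\<And>v c. (v, c) \<in> set L \<Longrightarrow> c < m" using LV f by blast
  have sub: "set L \<subseteq> ksub {1..n} k \<times> {..<n}" using LV LM mn by fastforce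
  show thesis
  proof (rule that)
   have "w \<le> n choose k"
   proof -
    have "set L \<subseteq> (\<lambda>v. (v, f v)) ` ksub {1..n} k" using LV by force
    then have "w \<le> card (ksub {1..n} k)" unfolding w_def
     by (rule surj_card_le[rotated]) simp
    then show ?thesis by (simp add: card_ksub)
   qed
   moreover have "w \<ge> 1"
   proof -
    obtain A where A: "A \<in> G" using G(2) by auto
    have "P A \<subseteq> set L" using A L(1) by blast
    then have "card (P A) \<le> w" unfolding w_def by (rule card_mono[rotated]) simp
    then show ?thesis using cP[OF A] q by linarith
   qed
   ultimately show "w \<in> {1..n choose k}" by simp
   have "jumps l L * k \<le> jumps l L * (2 * q)" using q by (intro mult_left_mono) auto
   then have "jumps l L * k \<le> 2 * w" using L(3) unfolding w_def by linarith
   then show "L \<in> jump_lists n k l w" using L(2) sub by (simp add: jump_lists_def w_def)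
   show "w * (k + l choose k) \<le> 8 * n * card (list_edges L)"
    unfolding w_def K_def[symmetric]
   proof (rule card_list_edges)
    fix x assume "x \<in> set L"
    then have "fst x \<in> ksub {1..n} k" using sub by force
    then show "fst x \<noteq> {}" using k by (auto simp: ksub_def)
   next
    fix u c assume uc: "(u, c) \<in> set L"
    then obtain A where A: "A \<in> G" "u \<in> Q A" "c = f u" using L(1) by (auto simp: P_def)
    have "pop A c" "c < m" using A LM[OF uc] by (auto simp: Q_def)
    then obtain B where B: "B \<in> G" "A \<inter> B = {}" "pop B c" using G(3)[OF A(1)] by blast
    have "{v \<in> ksub B k. f v = c} \<subseteq> {v. (v, c) \<in> set L \<and> u \<inter> v = {}}"
    proof
     fix v assume v: "v \<in> {v \<in> ksub B k. f v = c}"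
     then have "(v, c) \<in> P B" using B(3) by (auto simp: P_def Q_def)
     moreover have "u \<inter> v = {}" using v A(2) B(2) by (auto simp: Q_def ksub_def)
     ultimately show "v \<in> {v. (v, c) \<in> set L \<and> u \<inter> v = {}}" using L(1) B(1) by auto
    qed
    then have "popcount f k c B \<le> card {v. (v, c) \<in> set L \<and> u \<inter> v = {}}"
     unfolding popcount_def
     by (rule card_mono[rotated]) (rule finite_subset[of _ "fst ` set L"], force+)
    then have "2 * n * popcount f k c B \<le> 2 * n * card {v. (v, c) \<in> set L \<and> u \<inter> v = {}}"
     by (rule mult_le_mono2)
    then show "K \<le> 2 * n * card {v. (v, c) \<in> set L \<and> u \<inter> v = {}}"
     using B(3) unfolding pop_def by linarith
   qed (use LV in auto)
   have e: "e \<in> kedges 2 (ksub {1..n} k) \<and> mono_edge f e" if e: "e \<in> list_edges L" for e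
   proof -
    obtain u v c where uv: "e = {u, v}" "(u, c) \<in> set L" "(v, c) \<in> set L" "u \<inter> v = {}"
     using e by (auto simp: list_edges_def)
    have V: "u \<in> ksub {1..n} k" "v \<in> ksub {1..n} k" "f u = c" "f v = c" using LV uv by auto
    then have "u \<noteq> v" using uv(4) k by (auto simp: ksub_def)
    then show ?thesis using V uv by (auto simp: kedges_def mono_edge_def pairwise_insert disjnt_def)
   qed
   show "list_edges L \<subseteq> kedges 2 (ksub {1..n} k)" "\<forall>e\<in>list_edges L. mono_edge f e" using e by auto
  qed
qed

text \<open>A listed member costs (8l+11) ln n, including the surplus for the series over w, and
  accounts for K/(8n) edges. K \<ge> q n ln n balances the two.\<close>

lemma graph_fixed_l:
  fixes p :: real
  assumes p: "0 < p" "p < 1" and l: "l \<ge> 2"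
  shows "\<exists>C>0. \<forall>k::nat \<Rightarrow> nat. (\<forall>n. k n \<ge> 2) \<and>
    (\<forall>\<^sub>F n in sequentially. real (k n) \<ge> C * (real n * ln (real n)) powr (1 / real l)) \<longrightarrow>
    aas_chromatic_bound 2 p k (\<lambda>_. l)"
proof -
  define b where "b = - ln (1 - p)"
  have b: "b > 0" using p by (simp add: b_def)
  define q where "q = 8 * (8 * real l + 11) / b"
  have q: "q > 0" using b by (simp add: q_def)
  define C where "C = real l * (q + 1)"
  have "C > 0" using l q by (simp add: C_def)
  moreover have "aas_chromatic_bound 2 p k (\<lambda>_. l)"
   if k2: "\<forall>n. k n \<ge> 2" and kC: "\<forall>\<^sub>F n in sequentially. real (k n) \<ge> C * (real n * ln (real n)) powr (1 / real l)"
   for k :: "nat \<Rightarrow> nat"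
  proof -
   define g where "g = (\<lambda>n w::nat. real w * real (k n + l choose k n) / (8 * real n))"
   define X where "X = (\<lambda>n. \<Union>w\<in>{1..n choose k n}. {list_edges L |L.
    L \<in> (if n \<ge> 3 then jump_lists n (k n) l w else {}) \<and> g n w \<le> real (card (list_edges L))})"
   have k1: "k n \<ge> 1" for n using k2 by (metis one_le_numeral order_trans)
   have X: "negligible p X"
    unfolding X_def
   proof (rule negligibleI[OF p, where x = "\<lambda>n. ln (real n)" and a = "\<lambda>n w. real w * (8 * real l + 10) * ln n"])
    show "finite (if n \<ge> 3 then jump_lists n (k n) l w else {})" for n w
     using card_jump_lists_le(1) k1 by simp
    show "filterlim (\<lambda>n. ln (real n)) at_top sequentially" by real_asymp
    show "\<forall>\<^sub>F n in sequentially. \<forall>w\<in>{1..n choose k n}.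
      real (card (if n \<ge> 3 then jump_lists n (k n) l w else {})) \<le> exp (real w * (8 * real l + 10) * ln n) \<and>
      real w * (8 * real l + 10) * ln n + real w * ln n \<le> - ln (1 - p) * g n w"
     using kC eventually_ge_at_top[of 3]
    proof eventually_elim
     case (elim n)
     have ln0: "ln (real n) \<ge> 0" using elim by simp
     have "q * (n * ln n) \<le> (q + 1) ^ l * (n * ln n)"
     proof (intro mult_right_mono)
      have "q \<le> q + 1" by simp
      also have "\<dots> \<le> (q + 1) ^ l" using q l by (intro self_le_power) auto
      finally show "q \<le> (q + 1) ^ l" .
     qed (use ln0 in auto)
     also have "\<dots> = ((q + 1) * (real n * ln n) powr (1 / l)) ^ l"
      using ln0 l by (simp add: power_mult_distrib powr_root_power)
     also have "\<dots> \<le> (real (k n) / real l) ^ l"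
      using elim l q by (intro power_mono) (auto simp: C_def field_simps)
     also have "\<dots> \<le> real ((l + k n) choose l)" by (rule choose_ge_pow)
     also have "(l + k n) choose l = (k n + l choose k n)"
      using binomial_symmetric[of l "l + k n"] by (simp add: add.commute)
     finally have K: "q * (n * ln n) \<le> real (k n + l choose k n)" .
     show ?case
     proof (intro ballI conjI)
      fix w
      show "real (card (if n \<ge> 3 then jump_lists n (k n) l w else {})) \<le> exp (real w * (8 * real l + 10) * ln n)"
       using card_jump_lists_le(2)[OF elim(2) k1] elim(2) by simp
      have "real w * (8 * real l + 10) * ln n + real w * ln n = w * ((8 * real l + 11) * ln n)"
       by (simp add: algebra_simps)
      also have "(8 * real l + 11) * ln n = b * (q * (n * ln n) / (8 * n))"
       using b elim(2) by (simp add: q_def)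
      also have "w * (b * (q * (n * ln n) / (8 * n))) \<le> w * (b * (real (k n + l choose k n) / (8 * n)))"
       using K b by (intro mult_left_mono divide_right_mono) auto
      also have "\<dots> = b * g n w" by (simp add: g_def)
      finally show "real w * (8 * real l + 10) * ln n + real w * ln n \<le> - ln (1 - p) * g n w"
       by (simp add: b_def)
     qed
    qed
   qed
   show ?thesis
   proof (rule aas_chromatic_boundI[OF p _ X])
    show "\<forall>\<^sub>F n in sequentially. \<forall>m f. \<not> colorable 2 n (k n + l) m \<longrightarrow> f ` ksub {1..n} (k n) \<subseteq> {..<m} \<longrightarrow>
     (\<exists>E\<in>X n. E \<subseteq> kedges 2 (ksub {1..n} (k n)) \<and> (\<forall>e\<in>E. mono_edge f e))"
     using eventually_ge_at_top[of 3]
    proof eventually_elim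
     case (elim n)
     show ?case
     proof (intro allI impI)
      fix m f assume nc: "\<not> colorable 2 n (k n + l) m" and f: "f ` ksub {1..n} (k n) \<subseteq> {..<m}"
      obtain w L where L: "w \<in> {1..n choose k n}" "L \<in> jump_lists n (k n) l w"
        "w * (k n + l choose k n) \<le> 8 * n * card (list_edges L)" "list_edges L \<subseteq> kedges 2 (ksub {1..n} (k n))"
        "\<forall>e\<in>list_edges L. mono_edge f e"
       by (rule graph_core_list[OF k1 _ _ nc f]) (use l elim in auto)
      have "real (w * (k n + l choose k n)) \<le> real (8 * n * card (list_edges L))"
       using L(3) by (rule of_nat_mono)
      then have "g n w \<le> card (list_edges L)"
       using elim by (simp add: g_def divide_le_eq mult_ac)
      then have "list_edges L \<in> X n" unfolding X_def using L(1,2) elim by auto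
      then show "\<exists>E\<in>X n. E \<subseteq> kedges 2 (ksub {1..n} (k n)) \<and> (\<forall>e\<in>E. mono_edge f e)"
       using L(4,5) by blast
     qed
    qed
   qed simp
  qed
  ultimately show ?thesis by blast
qed

section \<open>Random 2k-sets avoiding given subsets\<close>

section \<open>Obstacle-free sets\<close>

text \<open>This bounds by (s/N)^o' the probability that a random s-subset of an N-set contains o'
  given elements, cleared of denominators.\<close>

lemma choose_ratio_le:
  assumes "s \<le> N" "o' \<le> s"
  shows "real ((N - o') choose (s - o')) * real N ^ o' \<le> real s ^ o' * real (N choose s)"
  using assms(2)
proof (induction o')
  case (Suc i)
  define a b where "a = N - Suc i" and "b = s - Suc i"
  have ab: "N - i = Suc a" "s - i = Suc b" using Suc.prems assms(1) by (auto simp: a_def b_def)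
  have "Suc b * (Suc a choose Suc b) = Suc a * (a choose b)" by (rule Suc_times_binomial)
  moreover have "Suc b * N \<le> s * Suc a"
  proof -
   have "real (Suc b) * N \<le> s * real (Suc a)"
   proof -
    have "real (Suc b) = real s - i" "real (Suc a) = real N - i"
     using ab Suc.prems assms(1) by (auto simp: of_nat_diff[symmetric])
    moreover have "(real s - i) * N \<le> s * (real N - i)"
     using mult_left_mono[of "real s" "real N" "real i"] assms(1) by (simp add: algebra_simps)
    ultimately show ?thesis by simp
   qed
   then show ?thesis by (simp only: of_nat_le_iff flip: of_nat_mult)
  qed
  ultimately have "Suc a * ((a choose b) * N) \<le> Suc a * (s * (Suc a choose Suc b))"
   using mult_right_mono[of "Suc b * N" "s * Suc a" "Suc a choose Suc b"] by (metis mult.assoc mult.commute zero_le)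
  then have "(a choose b) * N \<le> s * (Suc a choose Suc b)" by (simp only: mult_le_cancel1)
  then have "real ((a choose b) * N) \<le> real (s * (Suc a choose Suc b))" by (rule of_nat_mono)
  then have "real (a choose b) * N \<le> real s * real (Suc a choose Suc b)" by simp
  then have "real (a choose b) * N * real N ^ i \<le> real s * real (Suc a choose Suc b) * real N ^ i"
   by (rule mult_right_mono) simp
  also have "\<dots> \<le> real s * (real s ^ i * real (N choose s))"
   using Suc.IH Suc.prems unfolding ab by (simp add: mult.assoc mult_left_mono)
  finally show ?case by (simp add: a_def b_def mult_ac)
qed simp

lemma card_supersets:
  assumes "finite S" "X \<subseteq> S" "card X \<le> s"
  shows "card {I \<in> ksub S s. X \<subseteq> I} = (card S - card X) choose (s - card X)"
proof -
  have fX: "finite X" using assms finite_subset by blast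
  have "bij_betw (\<lambda>I. I - X) {I \<in> ksub S s. X \<subseteq> I} (ksub (S - X) (s - card X))"
  proof (rule bij_betwI[where g = "\<lambda>I. I \<union> X"])
   show "(\<lambda>I. I - X) \<in> {I \<in> ksub S s. X \<subseteq> I} \<rightarrow> ksub (S - X) (s - card X)"
    using fX by (auto simp: ksub_def card_Diff_subset)
   show "(\<lambda>I. I \<union> X) \<in> ksub (S - X) (s - card X) \<rightarrow> {I \<in> ksub S s. X \<subseteq> I}"
   proof
    fix I assume I: "I \<in> ksub (S - X) (s - card X)"
    then have "finite I" "I \<inter> X = {}" using assms(1) by (auto simp: ksub_def intro: finite_subset)
    then have "card (I \<union> X) = s" using I fX assms(3) by (simp add: card_Un_disjoint ksub_def)
    then show "I \<union> X \<in> {I \<in> ksub S s. X \<subseteq> I}" using I assms(2) by (auto simp: ksub_def)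
   qed
  qed (auto simp: ksub_def)
  then have "card {I \<in> ksub S s. X \<subseteq> I} = card (ksub (S - X) (s - card X))" by (rule bij_betw_same_card)
  also have "\<dots> = (card S - card X) choose (s - card X)"
   using assms fX by (simp add: card_ksub card_Diff_subset)
  finally show ?thesis .
qed

text \<open>A random 2k-set contains fewer than k obstacles with probability at least 1/2; deleting one
  element of each leaves an obstacle-free k-set.\<close>

lemma many_obstacle_free:
  assumes fin: "finite S" "finite I" and k: "k \<ge> 1" "2 * k \<le> card S"
   and ob: "\<And>i. i \<in> I \<Longrightarrow> ob i \<subseteq> S \<and> ob i \<noteq> {}"
   and sm: "(\<Sum>i\<in>I. (2 * real k / card S) ^ card (ob i)) \<le> k / 2"
  shows "real (card S choose k) \<le> 2 * 4 ^ k * card {v \<in> ksub S k. \<forall>i\<in>I. \<not> ob i \<subseteq> v}"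
proof -
  define N where "N = card S"
  define s where "s = 2 * k"
  have sN: "s \<le> N" "N > 0" using k by (auto simp: s_def N_def)
  define cnt where "cnt = (\<lambda>Z. card {i \<in> I. ob i \<subseteq> Z})"
  define Good where "Good = {Z \<in> ksub S s. cnt Z < k}"
  define Fr where "Fr = {v \<in> ksub S k. \<forall>i\<in>I. \<not> ob i \<subseteq> v}"
  have fks: "finite (ksub S s)" "finite (ksub S k)" using fin by auto
  have cs: "real (card {Z \<in> ksub S s. ob i \<subseteq> Z}) \<le> (real s / N) ^ card (ob i) * (N choose s)" if i: "i \<in> I" for i
  proof (cases "card (ob i) \<le> s")
   case True
   have "real (card {Z \<in> ksub S s. ob i \<subseteq> Z}) = real ((N - card (ob i)) choose (s - card (ob i)))"
    using card_supersets[OF fin(1) _ True] ob[OF i] by (simp add: N_def)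
   also have "\<dots> = real ((N - card (ob i)) choose (s - card (ob i))) * real N ^ card (ob i) / real N ^ card (ob i)"
    using sN by simp
   also have "\<dots> \<le> real s ^ card (ob i) * real (N choose s) / real N ^ card (ob i)"
    by (intro divide_right_mono choose_ratio_le[OF sN(1) True]) simp
   finally show ?thesis by (simp add: power_divide)
  next
   case False
   have "{Z \<in> ksub S s. ob i \<subseteq> Z} = {}"
   proof (rule ccontr)
    assume "{Z \<in> ksub S s. ob i \<subseteq> Z} \<noteq> {}"
    then obtain Z where Z: "Z \<subseteq> S" "card Z = s" "ob i \<subseteq> Z" by (auto simp: ksub_def)
    then have "card (ob i) \<le> s" using card_mono[of Z "ob i"] fin finite_subset by metis
    then show False using False by simp
   qed
   then show ?thesis by (simp only: card.empty) simp
  qed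
  have "(\<Sum>Z\<in>ksub S s. cnt Z) = (\<Sum>i\<in>I. card {Z \<in> ksub S s. ob i \<subseteq> Z})"
   unfolding cnt_def by (rule sum_multicount_gen[OF fks(1) fin(2)]) auto
  then have "real (\<Sum>Z\<in>ksub S s. cnt Z) = (\<Sum>i\<in>I. real (card {Z \<in> ksub S s. ob i \<subseteq> Z}))"
   by (simp only: of_nat_sum)
  also have "\<dots> \<le> (\<Sum>i\<in>I. (real s / N) ^ card (ob i) * (N choose s))" by (intro sum_mono cs)
  also have "\<dots> = (\<Sum>i\<in>I. (real s / N) ^ card (ob i)) * (N choose s)" by (simp add: sum_distrib_right)
  also have "\<dots> \<le> k / 2 * (N choose s)" using sm by (intro mult_right_mono) (auto simp: s_def N_def)
  finally have E: "real (\<Sum>Z\<in>ksub S s. cnt Z) \<le> k / 2 * (N choose s)" .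
  \<comment> \<open>Markov's inequality: the mean number of obstacles inside a random 2k-set is at
    most k/2.\<close>
  have "real k * card (ksub S s - Good) \<le> real (\<Sum>Z\<in>ksub S s - Good. cnt Z)"
  proof -
   have "(\<Sum>Z\<in>ksub S s - Good. k) \<le> (\<Sum>Z\<in>ksub S s - Good. cnt Z)"
    by (intro sum_mono) (auto simp: Good_def)
   then have "card (ksub S s - Good) * k \<le> (\<Sum>Z\<in>ksub S s - Good. cnt Z)" by simp
   then have "real (card (ksub S s - Good) * k) \<le> real (\<Sum>Z\<in>ksub S s - Good. cnt Z)" by (rule of_nat_mono)
   then show ?thesis by (simp add: mult.commute)
  qed
  also have "\<dots> \<le> real (\<Sum>Z\<in>ksub S s. cnt Z)" by (intro of_nat_mono sum_mono2 fks) auto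
  finally have "real k * card (ksub S s - Good) \<le> real k * ((N choose s) / 2)" using E by simp
  then have b: "real (card (ksub S s - Good)) \<le> (N choose s) / 2" using k by simp
  have "card (ksub S s) = N choose s" using fin by (simp add: card_ksub N_def)
  moreover have "card (ksub S s) = card (ksub S s - Good) + card Good"
  proof -
   have "Good \<subseteq> ksub S s" by (auto simp: Good_def)
   then show ?thesis using fks(1) by (metis add.commute card_Diff_subset card_mono finite_subset le_add_diff_inverse)
  qed
  ultimately have G: "real (N choose s) \<le> 2 * card Good" using b by linarith
  \<comment> \<open>Each obstacle-free k-set lies in (N-k choose k) sets of size 2k. Comparison with
    (N choose 2k)(2k choose k) = (N choose k)(N-k choose k) loses only the factor (2k choose k)
    \<le> 4^k.\<close>
  have "Good \<subseteq> (\<Union>v\<in>Fr. {Z \<in> ksub S s. v \<subseteq> Z})"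
  proof
   fix Z assume Z: "Z \<in> Good"
   then have Z': "Z \<subseteq> S" "card Z = s" "cnt Z < k" by (auto simp: Good_def ksub_def)
   define x where "x = (\<lambda>i. SOME y. y \<in> ob i)"
   have x: "x i \<in> ob i" if "i \<in> I" for i using ob[OF that] unfolding x_def by (metis some_in_eq)
   define B where "B = x ` {i \<in> I. ob i \<subseteq> Z}"
   have "card B \<le> cnt Z" unfolding B_def cnt_def using fin by (intro card_image_le) auto
   then have "k \<le> card Z - card B" using Z' by (simp add: s_def)
   also have "\<dots> \<le> card (Z - B)" by (intro diff_card_le_card_Diff) (use fin B_def in auto)
   finally obtain v where v: "v \<subseteq> Z - B" "card v = k" by (metis obtain_subset_with_card_n)
   have "\<not> ob i \<subseteq> v" if i: "i \<in> I" for i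
   proof
    assume o: "ob i \<subseteq> v"
    then have "x i \<in> B" using v i by (auto simp: B_def)
    then show False using x[OF i] o v by auto
   qed
   then have "v \<in> Fr" using v Z' by (auto simp: Fr_def ksub_def)
   then show "Z \<in> (\<Union>v\<in>Fr. {Z \<in> ksub S s. v \<subseteq> Z})" using Z v by (auto simp: Good_def)
  qed
  then have "card Good \<le> card (\<Union>v\<in>Fr. {Z \<in> ksub S s. v \<subseteq> Z})"
   using fks by (intro card_mono) (auto simp: Fr_def)
  also have "\<dots> \<le> (\<Sum>v\<in>Fr. card {Z \<in> ksub S s. v \<subseteq> Z})" using fks by (intro card_UN_le) (auto simp: Fr_def)
  also have "\<dots> = (\<Sum>v\<in>Fr. (N - k) choose k)"
   using card_supersets[OF fin(1)] by (intro sum.cong) (auto simp: Fr_def ksub_def N_def s_def)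
  finally have "card Good \<le> card Fr * ((N - k) choose k)" by simp
  then have "real (card Good) \<le> real (card Fr * ((N - k) choose k))" by (rule of_nat_mono)
  then have 1: "real (N choose s) \<le> 2 * (real (card Fr) * real ((N - k) choose k))" using G by simp
  have "(N choose s) * (s choose k) = (N choose k) * ((N - k) choose (s - k))"
   using choose_mult[of k s N] sN by (simp add: s_def)
  then have "real (N choose s) * real (s choose k) = real (N choose k) * real ((N - k) choose k)"
   by (simp add: s_def flip: of_nat_mult)
  then have "real (N choose k) * real ((N - k) choose k) \<le> 2 * (real (card Fr) * real ((N - k) choose k)) * real (s choose k)"
   using 1 by (metis mult_right_mono of_nat_0_le_iff)
  moreover have "real (s choose k) \<le> 4 ^ k"
  proof -
   have "s choose k \<le> 2 ^ s" by (rule binomial_le_pow2)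
   then have "real (s choose k) \<le> real (2 ^ s)" by (rule of_nat_mono)
   then show ?thesis by (simp add: s_def power_mult)
  qed
  moreover have "2 * (real (card Fr) * real ((N - k) choose k)) * real (s choose k) \<le> 2 * (real (card Fr) * real ((N - k) choose k)) * 4 ^ k"
   using calculation(2) by (intro mult_left_mono) auto
  ultimately have "real (N choose k) * real ((N - k) choose k) \<le> (2 * 4 ^ k * real (card Fr)) * real ((N - k) choose k)"
   by (simp add: mult_ac)
  moreover have "real ((N - k) choose k) > 0" using sN by (simp add: s_def zero_less_binomial_iff)
  ultimately have "real (N choose k) \<le> 2 * 4 ^ k * real (card Fr)" by (rule mult_right_le_imp_le)
  then show ?thesis by (simp add: N_def Fr_def)
qed

section \<open>Robust sunflower cores in a sparse class\<close>

section \<open>Kernels\<close>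

text \<open>A robust sunflower core: a fraction of the witnesses G through J survives the deletion
  of the stars of any R points off J.\<close>

definition kernel :: "nat \<Rightarrow> real \<Rightarrow> real \<Rightarrow> nat set set \<Rightarrow> nat set \<Rightarrow> bool" where
  "kernel R x y F J \<longleftrightarrow> (\<exists>G. G \<subseteq> {v \<in> F. J \<subseteq> v} \<and> y \<le> card G \<and> spread R x J G)"

lemma kernel_mono: "kernel R x y F J \<Longrightarrow> F \<subseteq> F' \<Longrightarrow> kernel R x y F' J"
  unfolding kernel_def by blast

text \<open>Kernels r - 1 in number together with a further disjoint member would span too many edges.\<close>

lemma kernels_hit:
  fixes M :: real
  assumes r: "r \<ge> 3" and k: "k \<ge> 1" and F: "finite F" "\<And>v. v \<in> F \<Longrightarrow> finite v \<and> card v = k"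
   and x: "0 < x" "x \<le> 1" and y: "y \<ge> 1" "real r ^ (r + 1) * M \<le> x ^ (r - 1) * y" and M: "M > 0"
   and sparse: "\<And>W. W \<subseteq> F \<Longrightarrow> W \<noteq> {} \<Longrightarrow> card (kedges r W) < M * card W"
   and J: "\<And>j. j < r - 1 \<Longrightarrow> kernel (r * k) x y F (J j)"
   and dJ: "\<And>i j. i < r - 1 \<Longrightarrow> j < r - 1 \<Longrightarrow> i \<noteq> j \<Longrightarrow> J i \<inter> J j = {}"
   and B: "B \<in> F"
  shows "\<exists>j<r - 1. J j \<inter> B \<noteq> {}"
proof (rule ccontr)
  assume no: "\<not> ?thesis"
  have "\<forall>j<r - 1. \<exists>G. G \<subseteq> {v \<in> F. J j \<subseteq> v} \<and> y \<le> card G \<and> spread (r * k) x (J j) G"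
   using J by (simp add: kernel_def)
  then obtain G0 where G0: "\<And>j. j < r - 1 \<Longrightarrow> G0 j \<subseteq> {v \<in> F. J j \<subseteq> v}" "\<And>j. j < r - 1 \<Longrightarrow> y \<le> card (G0 j)"
   "\<And>j. j < r - 1 \<Longrightarrow> spread (r * k) x (J j) (G0 j)" by metis
  define G where "G = (\<lambda>j. if j < r - 1 then G0 j else {B})"
  define JJ where "JJ = (\<lambda>j. if j < r - 1 then J j else B)"
  define xx where "xx = (\<lambda>j::nat. if j < r - 1 then x else 1)"
  define W where "W = (\<Union>j<r. G j)"
  \<comment> \<open>The largest witness family, of size m, carries the estimate: W has at most r m
    members but at least x^(r-1) m y / r^r edges, too many for the sparsity M by the choice of
    y.\<close>
  define m where "m = Max ((\<lambda>j. card (G0 j)) ` {..<r - 1})"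
  have r0: "{..<r - 1} \<noteq> {}" using r by (simp add: lessThan_empty_iff)
  have "m \<in> (\<lambda>j. card (G0 j)) ` {..<r - 1}" unfolding m_def using r0 by (intro Max_in) auto
  then obtain i where i: "i < r - 1" "m = card (G0 i)" by auto
  have mj: "card (G0 j) \<le> m" if "j < r - 1" for j unfolding m_def using that by (intro Max_ge) auto
  have ym: "y \<le> m" using G0(2) i by simp
  have GF: "G j \<subseteq> F" for j using G0(1) B by (cases "j < r - 1") (auto simp: G_def)
  then have WF: "W \<subseteq> F" by (auto simp: W_def)
  have BW: "B \<in> W" unfolding W_def G_def using r by (intro UN_I[of "r - 1"]) auto
  have ff: "finite (J j) \<and> card (J j) \<le> k" if j: "j < r - 1" for j
  proof -
   have "card (G0 j) \<noteq> 0" using G0(2)[OF j] y by auto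
   then obtain v where "v \<in> G0 j" by (metis card.empty equals0I)
   then have "J j \<subseteq> v" "finite v" "card v = k" using G0(1)[OF j] F(2) by auto
   then show ?thesis using card_mono finite_subset by metis
  qed
  have "(\<Prod>j<r. xx j * card (G j)) \<le> card (kedges r (\<Union>j<r. G j)) * r ^ r"
  proof (rule spread_edges[where k = k and J = JJ])
   show "finite (G j)" for j using GF F(1) finite_subset by blast
   show "JJ j \<subseteq> A \<and> card A = k" if "A \<in> G j" for j A
    using that G0(1)[of j] F(2) B by (auto simp: G_def JJ_def split: if_splits)
   show "JJ a \<inter> JJ b = {}" if "a < r" "b < r" "a \<noteq> b" for a b
    using that dJ no by (auto simp: JJ_def)
   show "finite (JJ j) \<and> card (JJ j) \<le> k" for j
    using ff F(2)[OF B] by (auto simp: JJ_def)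
   show "spread (r * k) (xx j) (JJ j) (G j)" for j
    using G0(3) spread_self by (auto simp: xx_def JJ_def G_def)
  qed (use r k x in \<open>auto simp: xx_def\<close>)
  then have le: "(\<Prod>j<r. xx j * card (G j)) \<le> real (card (kedges r W)) * real r ^ r"
   by (simp add: W_def)
  have "(\<Prod>j<r. xx j * card (G j)) = (\<Prod>j<r - 1. x * card (G0 j))"
  proof -
   have r1: "r = Suc (r - 1)" using r by simp
   have "(\<Prod>j<Suc (r - 1). xx j * card (G j)) = (\<Prod>j<r - 1. xx j * card (G j))"
    by (simp add: xx_def G_def)
   then show ?thesis using r1 by (simp add: xx_def G_def)
  qed
  also have "\<dots> = x ^ (r - 1) * (\<Prod>j<r - 1. real (card (G0 j)))" by (simp add: prod.distrib)
  also have "(\<Prod>j<r - 1. real (card (G0 j))) = m * (\<Prod>j\<in>{..<r - 1} - {i}. real (card (G0 j)))"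
   using i by (subst prod.remove[of _ i]) auto
  finally have eq: "(\<Prod>j<r. xx j * card (G j)) = x ^ (r - 1) * (m * (\<Prod>j\<in>{..<r - 1} - {i}. real (card (G0 j))))" .
  have "y \<le> (\<Prod>j\<in>{..<r - 1} - {i}. real (card (G0 j)))"
  proof -
   have "y ^ 1 \<le> y ^ (r - 2)" using y r by (intro power_increasing) auto
   also have "\<dots> = (\<Prod>j\<in>{..<r - 1} - {i}. y)" using i by (simp add: card_Diff_subset numeral_2_eq_2)
   also have "\<dots> \<le> (\<Prod>j\<in>{..<r - 1} - {i}. real (card (G0 j)))" using G0(2) y by (intro prod_mono) auto
   finally show ?thesis by simp
  qed
  then have "x ^ (r - 1) * (m * y) \<le> real (card (kedges r W)) * real r ^ r"
   using le eq x by (smt (verit) mult_left_mono of_nat_0_le_iff zero_le_power)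
  also have "\<dots> < M * card W * real r ^ r"
   using sparse[OF WF] BW r by (intro mult_strict_right_mono) auto
  also have "\<dots> \<le> M * (r * m) * real r ^ r"
  proof -
   have "card W \<le> (\<Sum>j<r. card (G j))" unfolding W_def by (rule card_UN_le) simp
   also have "\<dots> \<le> (\<Sum>j<r. m)"
   proof (intro sum_mono)
    have "real m \<ge> 1" using ym y by linarith
    then show "card (G j) \<le> m" for j using mj by (auto simp: G_def)
   qed
   finally have "card W \<le> r * m" by simp
   then have "real (card W) \<le> real (r * m)" by (rule of_nat_mono)
   then show ?thesis using M by (intro mult_right_mono mult_left_mono) auto
  qed
  also have "\<dots> = (real r ^ (r + 1) * M) * m" by simp
  also have "\<dots> \<le> (x ^ (r - 1) * y) * m" using y by (intro mult_right_mono) auto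
  finally show False by (simp add: mult_ac)
qed

section \<open>Search trees that find kernels or long paths in the members of a class\<close>

section \<open>Branching\<close>

text \<open>If P is not a kernel of F, then few members of F contain P, or most of them meet a bounded set U P.\<close>

locale branching =
  fixes R :: nat and x y :: real and F :: "nat set set" and S :: "nat set"
  assumes finF: "finite F" and FS: "\<And>v. v \<in> F \<Longrightarrow> v \<subseteq> S" and x0: "x \<ge> 0" and y0: "y \<ge> 0" and R1: "R \<ge> 2"
begin

definition above :: "nat set \<Rightarrow> nat set set" where "above P = {v \<in> F. P \<subseteq> v}"

definition ker :: "nat set \<Rightarrow> bool" where "ker P = kernel R x y F P"

text \<open>The default is the empty set, so that branching stops at kernels and at sets P with few
  members above them.\<close>

definition U :: "nat set \<Rightarrow> nat set" where
  "U P = (if ker P \<or> card (above P) < y then {} else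
   (SOME U. finite U \<and> card U \<le> R \<and> U \<inter> P = {} \<and> card {A \<in> above P. A \<inter> U = {}} < x * card (above P)))"

lemma U_props: "finite (U P)" "card (U P) \<le> R" "U P \<inter> P = {}"
  "\<not> ker P \<Longrightarrow> y \<le> card (above P) \<Longrightarrow> card {A \<in> above P. A \<inter> U P = {}} \<le> x * card (above P)"
proof -
  have "finite (U P) \<and> card (U P) \<le> R \<and> U P \<inter> P = {} \<and>
   (\<not> ker P \<longrightarrow> y \<le> card (above P) \<longrightarrow> card {A \<in> above P. A \<inter> U P = {}} \<le> x * card (above P))"
  proof (cases "ker P \<or> card (above P) < y")
   case False
   then have "\<not> spread R x P (above P)" unfolding ker_def kernel_def above_def by force
   then have "\<exists>V. finite V \<and> card V \<le> R \<and> V \<inter> P = {} \<and> card {A \<in> above P. A \<inter> V = {}} < x * card (above P)"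
    unfolding spread_def by (simp add: not_le)
   from someI_ex[OF this] show ?thesis using False by (simp add: U_def)
  next
   case True
   then have "U P = {}" by (simp add: U_def)
   then show ?thesis using True by auto
  qed
  then show "finite (U P)" "card (U P) \<le> R" "U P \<inter> P = {}"
   "\<not> ker P \<Longrightarrow> y \<le> card (above P) \<Longrightarrow> card {A \<in> above P. A \<inter> U P = {}} \<le> x * card (above P)" by blast+
qed

text \<open>The paths of length i in the search tree; from a node P one branches on the points of
  \<open>U P\<close>. Ordered lists keep the count at R^i.\<close>

fun level :: "nat \<Rightarrow> nat list set" where
  "level 0 = {[]}"
| "level (Suc i) = {xs @ [u] |xs u. xs \<in> level i \<and> u \<in> U (set xs) \<inter> S}"

lemma level_Suc_image: "level (Suc i) = (\<lambda>(xs, u). xs @ [u]) ` Sigma (level i) (\<lambda>xs. U (set xs) \<inter> S)"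
  by auto

lemma finite_level: "finite (level i)"
proof (induction i)
  case (Suc i)
  then show ?case unfolding level_Suc_image using U_props(1) by (intro finite_imageI finite_SigmaI) auto
qed simp

lemma level_props: "xs \<in> level i \<Longrightarrow> length xs = i \<and> distinct xs \<and> set xs \<subseteq> S"
proof (induction i arbitrary: xs)
  case (Suc i)
  then obtain ys u where ys: "xs = ys @ [u]" "ys \<in> level i" "u \<in> U (set ys)" "u \<in> S" by auto
  then show ?case using Suc.IH[OF ys(2)] U_props(3)[of "set ys"] by auto
qed simp

lemma card_level_le: "card (level i) \<le> R ^ i"
proof (induction i)
  case (Suc i)
  have "card (level (Suc i)) \<le> card (Sigma (level i) (\<lambda>xs. U (set xs) \<inter> S))"
   unfolding level_Suc_image using finite_level U_props(1) by (intro card_image_le finite_SigmaI) auto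
  also have "\<dots> = (\<Sum>xs\<in>level i. card (U (set xs) \<inter> S))"
   using finite_level U_props(1) by (intro card_SigmaI) auto
  also have "\<dots> \<le> (\<Sum>xs\<in>level i. R)"
  proof (intro sum_mono)
   fix xs
   have "card (U (set xs) \<inter> S) \<le> card (U (set xs))" using U_props(1) by (intro card_mono) auto
   then show "card (U (set xs) \<inter> S) \<le> R" using U_props(2)[of "set xs"] by linarith
  qed
  also have "\<dots> \<le> R ^ i * R" using Suc.IH by simp
  finally show ?case by (simp add: mult.commute)
qed simp

text \<open>A path meets Y at one of i places in one of |Y| points, and each other step has R
  choices. Multiplying by R avoids the exponent i - 1.\<close>

lemma card_level_hit_le:
  assumes Y: "finite Y"
  shows "card {xs \<in> level i. set xs \<inter> Y \<noteq> {}} * R \<le> i * card Y * R ^ i"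
proof (induction i)
  case 0
  have "{xs \<in> level 0. set xs \<inter> Y \<noteq> {}} = {}" by auto
  then show ?case by (simp only: card.empty)
next
  case (Suc i)
  define H where "H = {xs \<in> level i. set xs \<inter> Y \<noteq> {}}"
  have fH: "finite H" using finite_level by (simp add: H_def)
  have "{xs \<in> level (Suc i). set xs \<inter> Y \<noteq> {}} \<subseteq>
    (\<lambda>(xs, u). xs @ [u]) ` Sigma H (\<lambda>xs. U (set xs)) \<union> (\<lambda>(xs, u). xs @ [u]) ` (level i \<times> Y)"
  proof
   fix zs assume "zs \<in> {xs \<in> level (Suc i). set xs \<inter> Y \<noteq> {}}"
   then have zs: "zs \<in> level (Suc i)" "set zs \<inter> Y \<noteq> {}" by auto
   from zs(1) obtain xs u where xs: "zs = xs @ [u]" "xs \<in> level i" "u \<in> U (set xs)" by auto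
   show "zs \<in> (\<lambda>(xs, u). xs @ [u]) ` Sigma H (\<lambda>xs. U (set xs)) \<union> (\<lambda>(xs, u). xs @ [u]) ` (level i \<times> Y)"
   proof (cases "u \<in> Y")
    case True
    then have "(xs, u) \<in> level i \<times> Y" using xs by simp
    then show ?thesis using xs(1) by (intro UnI2 image_eqI[of _ _ "(xs, u)"]) auto
   next
    case False
    then have "(xs, u) \<in> Sigma H (\<lambda>xs. U (set xs))" using xs zs(2) by (auto simp: H_def)
    then show ?thesis using xs(1) by (intro UnI1 image_eqI[of _ _ "(xs, u)"]) auto
   qed
  qed
  then have "card {xs \<in> level (Suc i). set xs \<inter> Y \<noteq> {}} \<le>
    card ((\<lambda>(xs, u). xs @ [u]) ` Sigma H (\<lambda>xs. U (set xs)) \<union> (\<lambda>(xs, u). xs @ [u]) ` (level i \<times> Y))"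
   using fH U_props(1) finite_level Y by (intro card_mono finite_UnI finite_imageI finite_SigmaI) auto
  also have "\<dots> \<le> card ((\<lambda>(xs, u). xs @ [u]) ` Sigma H (\<lambda>xs. U (set xs))) + card ((\<lambda>(xs, u). xs @ [u]) ` (level i \<times> Y))"
   by (rule card_Un_le)
  also have "\<dots> \<le> card (Sigma H (\<lambda>xs. U (set xs))) + card (level i \<times> Y)"
   using fH U_props(1) finite_level Y by (intro add_mono card_image_le finite_SigmaI) auto
  also have "card (Sigma H (\<lambda>xs. U (set xs))) = (\<Sum>xs\<in>H. card (U (set xs)))"
   using fH U_props(1) by (intro card_SigmaI) auto
  also have "\<dots> \<le> (\<Sum>xs\<in>H. R)" by (intro sum_mono U_props(2))
  also have "(\<Sum>xs\<in>H. R) = card H * R" by simp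
  also have "card (level i \<times> Y) = card (level i) * card Y" by (rule card_cartesian_product)
  finally have "card {xs \<in> level (Suc i). set xs \<inter> Y \<noteq> {}} \<le> card H * R + card (level i) * card Y" by simp
  also have "\<dots> \<le> i * card Y * R ^ i + R ^ i * card Y"
   using Suc.IH card_level_le by (intro add_mono mult_right_mono) (auto simp: H_def)
  also have "\<dots> = Suc i * card Y * R ^ i" by (simp add: algebra_simps)
  finally have "card {xs \<in> level (Suc i). set xs \<inter> Y \<noteq> {}} * R \<le> Suc i * card Y * R ^ i * R"
   by (rule mult_right_mono) simp
  then show ?case by (simp add: mult_ac)
qed

definition lost :: "nat \<Rightarrow> nat set set" where
  "lost j = {v \<in> F. \<exists>i<j. \<exists>xs\<in>level i. set xs \<subseteq> v \<and> \<not> ker (set xs) \<and>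
   (card (above (set xs)) < y \<or> v \<inter> U (set xs) = {})}"

text \<open>Follow v down the tree: unless v is lost, every non-kernel node inside v has a child
  inside v.\<close>

lemma traced:
  assumes v: "v \<in> F" "v \<notin> lost j"
  shows "(\<exists>i<j. \<exists>xs\<in>level i. set xs \<subseteq> v \<and> ker (set xs)) \<or> (\<exists>xs\<in>level j. set xs \<subseteq> v)"
proof -
  have "(\<exists>i<m. \<exists>xs\<in>level i. set xs \<subseteq> v \<and> ker (set xs)) \<or> (\<exists>xs\<in>level m. set xs \<subseteq> v)" if "m \<le> j" for m
   using that
  proof (induction m)
   case (Suc m)
   show ?case
   proof (cases "\<exists>i<Suc m. \<exists>xs\<in>level i. set xs \<subseteq> v \<and> ker (set xs)")
    case False
    then obtain xs where xs: "xs \<in> level m" "set xs \<subseteq> v" "\<not> ker (set xs)"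
     using Suc by (meson Suc_leD less_Suc_eq)
    moreover have "m < j" using Suc.prems by simp
    ultimately have "v \<inter> U (set xs) \<noteq> {}" using v unfolding lost_def by blast
    then obtain u where "u \<in> v" "u \<in> U (set xs)" by auto
    then have "xs @ [u] \<in> level (Suc m)" "set (xs @ [u]) \<subseteq> v" using xs FS[OF v(1)] by auto
    then show ?thesis by blast
   qed blast
  qed simp
  then show ?thesis by blast
qed

text \<open>At a non-kernel node either fewer than y members lie above it, or at most a fraction x
  of those above miss its branching set. There are at most R^j nodes before level j, as R \<ge>
  2.\<close>

lemma card_lost_le: "card (lost j) \<le> real R ^ j * (y + x * card F)"
proof -
  define L where "L = (\<lambda>xs. {v \<in> above (set xs). \<not> ker (set xs) \<and> (card (above (set xs)) < y \<or> v \<inter> U (set xs) = {})})"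
  have fL: "finite (L xs)" for xs using finF by (simp add: L_def above_def)
  have L: "card (L xs) \<le> y + x * card F" for xs
  proof (cases "ker (set xs)")
   case True
   then have "L xs = {}" by (simp add: L_def)
   then show ?thesis using x0 y0 by simp
  next
   case nk: False
   show ?thesis
   proof (cases "card (above (set xs)) < y")
    case True
    have "card (L xs) \<le> card (above (set xs))" using finF by (intro card_mono) (auto simp: L_def above_def)
    then have "real (card (L xs)) \<le> y" using True by linarith
    then show ?thesis using x0 by (simp add: add_increasing2)
   next
    case False
    have "L xs = {A \<in> above (set xs). A \<inter> U (set xs) = {}}" using nk False by (auto simp: L_def)
    then have "card (L xs) \<le> x * card (above (set xs))" using U_props(4)[OF nk] False by simp
    also have "\<dots> \<le> x * card F"
     using x0 finF by (intro mult_left_mono of_nat_mono card_mono) (auto simp: above_def)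
    finally show ?thesis using y0 by simp
   qed
  qed
  have "lost j \<subseteq> (\<Union>i<j. \<Union>xs\<in>level i. L xs)" by (auto simp: lost_def L_def above_def)
  then have "card (lost j) \<le> card (\<Union>i<j. \<Union>xs\<in>level i. L xs)"
   using finite_level fL by (intro card_mono) auto
  also have "\<dots> \<le> (\<Sum>i<j. card (\<Union>xs\<in>level i. L xs))" by (rule card_UN_le) simp
  also have "\<dots> \<le> (\<Sum>i<j. \<Sum>xs\<in>level i. card (L xs))" by (intro sum_mono card_UN_le finite_level)
  finally have "real (card (lost j)) \<le> (\<Sum>i<j. \<Sum>xs\<in>level i. real (card (L xs)))"
   by (simp only: of_nat_sum[symmetric] of_nat_le_iff)
  also have "\<dots> \<le> (\<Sum>i<j. \<Sum>xs\<in>level i. y + x * card F)" by (intro sum_mono L)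
  also have "\<dots> = (\<Sum>i<j. real (card (level i))) * (y + x * card F)" by (simp add: sum_distrib_right)
  also have "\<dots> \<le> real R ^ j * (y + x * card F)"
  proof (rule mult_right_mono)
   have "(\<Sum>i<j. real (card (level i))) \<le> (\<Sum>i<j. real (R ^ i))" by (intro sum_mono of_nat_mono card_level_le)
   also have "\<dots> \<le> real R ^ j"
   proof (induction j)
    case (Suc j)
    have "real R ^ j * 2 \<le> real R ^ j * real R" using R1 by (intro mult_left_mono) auto
    then show ?case using Suc.IH by (simp add: mult.commute)
   qed simp
   finally show "(\<Sum>i<j. real (card (level i))) \<le> real R ^ j" .
  qed (use x0 y0 in simp)
  finally show ?thesis .
qed

end

lemma maximal_disjoint_subfamily:
  assumes "finite K"
  obtains D where "D \<subseteq> K" "pairwise disjnt D" "\<And>X. X \<in> K \<Longrightarrow> X \<noteq> {} \<Longrightarrow> X \<inter> \<Union>D \<noteq> {}"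
proof -
  let ?A = "{D. D \<subseteq> K \<and> pairwise disjnt D}"
  have "finite ?A" using assms by simp
  moreover have "{} \<in> ?A" by simp
  ultimately obtain D where D: "D \<in> ?A" "\<forall>B\<in>?A. D \<subseteq> B \<longrightarrow> D = B"
   using finite_has_maximal[of ?A] by blast
  have "X \<inter> \<Union>D \<noteq> {}" if X: "X \<in> K" "X \<noteq> {}" for X
  proof
   assume e: "X \<inter> \<Union>D = {}"
   then have "insert X D \<in> ?A" using D(1) X by (auto simp: pairwise_insert disjnt_def)
   then have "X \<in> D" using D(2) by blast
   then show False using e X(2) by blast
  qed
  then show ?thesis using that D(1) by blast
qed

text \<open>By spread, the last core has a member B through it that avoids the other r - 1 cores,
  and \<open>kernels_hit\<close> excludes such a B.\<close>

lemma no_disjoint_kernels: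
  fixes M :: real
  assumes r: "r \<ge> 3" and k: "k \<ge> 1" and F: "finite F" "\<And>v. v \<in> F \<Longrightarrow> finite v \<and> card v = k"
   and x: "0 < x" "x \<le> 1" and y: "y \<ge> 1" "real r ^ (r + 1) * M \<le> x ^ (r - 1) * y" and M: "M > 0"
   and sparse: "\<And>W. W \<subseteq> F \<Longrightarrow> W \<noteq> {} \<Longrightarrow> card (kedges r W) < M * card W"
   and J: "\<And>j. j < r \<Longrightarrow> kernel (r * k) x y F (J j)"
   and dJ: "\<And>i j. i < r \<Longrightarrow> j < r \<Longrightarrow> i \<noteq> j \<Longrightarrow> J i \<inter> J j = {}"
  shows False
proof -
  have fJ: "finite (J j) \<and> card (J j) \<le> k" if j: "j < r" for j
  proof -
   obtain G where G: "G \<subseteq> {v \<in> F. J j \<subseteq> v}" "y \<le> card G" using J[OF j] by (auto simp: kernel_def)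
   have "card G \<noteq> 0" using G y by auto
   then obtain v where "v \<in> G" by (metis card.empty equals0I)
   then have "J j \<subseteq> v" "finite v" "card v = k" using G F(2) by auto
   then show ?thesis using card_mono finite_subset by metis
  qed
  define U where "U = (\<Union>j<r - 1. J j)"
  obtain G where G: "G \<subseteq> {v \<in> F. J (r - 1) \<subseteq> v}" "y \<le> card G" "spread (r * k) x (J (r - 1)) G"
   using J[of "r - 1"] r by (auto simp: kernel_def)
  have "card U \<le> (\<Sum>j<r - 1. card (J j))" unfolding U_def by (rule card_UN_le) simp
  also have "\<dots> \<le> (\<Sum>j<r - 1. k)" using fJ by (intro sum_mono) auto
  also have "\<dots> \<le> r * k" by simp
  finally have cU: "card U \<le> r * k" .
  have "finite U" using fJ by (auto simp: U_def)
  moreover have "J i \<inter> J (r - 1) = {}" if "i < r - 1" for i using dJ[of i "r - 1"] that r by auto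
  then have "U \<inter> J (r - 1) = {}" unfolding U_def by blast
  ultimately have "x * card G \<le> card {A \<in> G. A \<inter> U = {}}" using G(3) cU unfolding spread_def by blast
  moreover have "x * card G > 0" using x G(2) y by simp
  ultimately have "card {A \<in> G. A \<inter> U = {}} \<noteq> 0" by linarith
  then have "{A \<in> G. A \<inter> U = {}} \<noteq> {}" by (metis card.empty)
  then obtain B where B: "B \<in> G" "B \<inter> U = {}" by blast
  have "\<exists>j<r - 1. J j \<inter> B \<noteq> {}"
   by (rule kernels_hit[OF r k F x y M sparse]) (use J dJ B G in auto)
  then show False using B by (auto simp: U_def)
qed

text \<open>Obstacles are the kernels met at levels 2 to j - 1 and all paths of length j; every
  member that is not lost contains one. As no r kernels are disjoint, those of size i all meet a set
  of at most r i points, so there are at most r i^2 / R times R^i of them. Levels 0 and 1 are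
  excluded by \<open>ne\<close> and \<open>ns\<close>.\<close>

lemma (in branching) obstacles:
  fixes z :: real
  assumes z: "z \<ge> 0" and ne: "\<not> ker {}" and ns: "\<And>u. u \<in> S \<Longrightarrow> \<not> ker {u}"
   and disj: "\<And>J. (\<And>i. i < r \<Longrightarrow> ker (J i)) \<Longrightarrow> (\<And>i j. i < r \<Longrightarrow> j < r \<Longrightarrow> i \<noteq> j \<Longrightarrow> J i \<inter> J j = {}) \<Longrightarrow> False"
   and j: "j \<ge> 1"
  shows "\<exists>I. finite I \<and> (\<forall>xs\<in>I. set xs \<subseteq> S \<and> xs \<noteq> []) \<and> (\<forall>v\<in>F. v \<notin> lost j \<longrightarrow> (\<exists>xs\<in>I. set xs \<subseteq> v)) \<and>
   (\<Sum>xs\<in>I. z ^ card (set xs)) \<le> (\<Sum>i\<in>{2..<j}. (real r * real i ^ 2 / R) * (R * z) ^ i) + (R * z) ^ j"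
proof -
  define Kl where "Kl = (\<lambda>i. {xs \<in> level i. ker (set xs)})"
  define I where "I = (\<Union>i\<in>{2..<j}. Kl i) \<union> level j"
  have fK: "finite (Kl i)" for i using finite_level by (simp add: Kl_def)
  have lp: "length xs = i" "card (set xs) = i" "set xs \<subseteq> S" if "xs \<in> level i" for xs i
   using level_props[OF that] by (auto simp: distinct_card)
  have cK: "real (card (Kl i)) \<le> (real r * real i ^ 2 / R) * real R ^ i" if i: "i \<ge> 1" for i
  proof -
   obtain D where D: "D \<subseteq> set ` Kl i" "pairwise disjnt D" "\<And>X. X \<in> set ` Kl i \<Longrightarrow> X \<noteq> {} \<Longrightarrow> X \<inter> \<Union>D \<noteq> {}"
    using maximal_disjoint_subfamily[of "set ` Kl i"] fK by blast
   have fD: "finite D" using D(1) fK finite_subset by blast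
   have "card D < r"
   proof (rule ccontr)
    assume "\<not> card D < r"
    then obtain D' where D': "D' \<subseteq> D" "card D' = r" by (meson not_less obtain_subset_with_card_n)
    have fD': "finite D'" using D'(1) fD finite_subset by blast
    obtain h where h: "bij_betw h {..<r} D'" using D'(2) fD' by (metis ex_bij_betw_nat_finite lessThan_atLeast0)
    have hD: "h i \<in> D" if "i < r" for i using h that D' by (auto simp: bij_betw_def)
    show False
    proof (rule disj[of h])
     show "ker (h i)" if "i < r" for i using hD[OF that] D(1) by (auto simp: Kl_def)
     fix a b assume ab: "a < r" "b < r" "a \<noteq> b"
     then have "h a \<noteq> h b" using h by (auto simp: bij_betw_def inj_on_def)
     then show "h a \<inter> h b = {}" using hD ab D(2) by (auto simp: pairwise_def disjnt_def)
    qed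
   qed
   define Y where "Y = \<Union>D"
   have cm: "card X = i \<and> finite X" if "X \<in> D" for X using that D(1) lp by (auto simp: Kl_def)
   have "card Y \<le> (\<Sum>X\<in>D. card X)" unfolding Y_def using card_UN_le[OF fD, of id] by simp
   also have "\<dots> = card D * i" using cm by simp
   also have "\<dots> \<le> r * i" using \<open>card D < r\<close> by (intro mult_right_mono) auto
   finally have cY: "card Y \<le> r * i" .
   have fY: "finite Y" using fD cm by (auto simp: Y_def)
   have "Kl i \<subseteq> {xs \<in> level i. set xs \<inter> Y \<noteq> {}}"
   proof
    fix xs assume xs: "xs \<in> Kl i"
    then have "set xs \<noteq> {}" using lp(1)[of xs i] i by (auto simp: Kl_def)
    then show "xs \<in> {xs \<in> level i. set xs \<inter> Y \<noteq> {}}" using D(3)[of "set xs"] xs by (auto simp: Kl_def Y_def)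
   qed
   then have "card (Kl i) \<le> card {xs \<in> level i. set xs \<inter> Y \<noteq> {}}" using finite_level by (intro card_mono) auto
   then have "card (Kl i) * R \<le> card {xs \<in> level i. set xs \<inter> Y \<noteq> {}} * R" by (rule mult_right_mono) simp
   also have "\<dots> \<le> i * card Y * R ^ i" by (rule card_level_hit_le[OF fY])
   also have "\<dots> \<le> i * (r * i) * R ^ i" using cY by (intro mult_right_mono mult_left_mono) auto
   finally have "real (card (Kl i) * R) \<le> real (i * (r * i) * R ^ i)" by (rule of_nat_mono)
   then have "real (card (Kl i)) * R \<le> real r * real i ^ 2 * real R ^ i" by (simp add: power2_eq_square mult_ac)
   then show ?thesis using R1 by (simp add: field_simps)
  qed
  have fI: "finite I" unfolding I_def using fK finite_level by auto
  have "(\<Sum>xs\<in>I. z ^ card (set xs)) \<le> (\<Sum>xs\<in>(\<Union>i\<in>{2..<j}. Kl i). z ^ card (set xs)) + (\<Sum>xs\<in>level j. z ^ card (set xs))"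
  proof -
   have "finite (\<Union>i\<in>{2..<j}. Kl i)" using fK by blast
   then have "(\<Sum>xs\<in>I. z ^ card (set xs)) + (\<Sum>xs\<in>(\<Union>i\<in>{2..<j}. Kl i) \<inter> level j. z ^ card (set xs)) =
     (\<Sum>xs\<in>(\<Union>i\<in>{2..<j}. Kl i). z ^ card (set xs)) + (\<Sum>xs\<in>level j. z ^ card (set xs))"
    unfolding I_def using finite_level by (rule sum.union_inter)
   moreover have "0 \<le> (\<Sum>xs\<in>(\<Union>i\<in>{2..<j}. Kl i) \<inter> level j. z ^ card (set xs))"
    using z by (intro sum_nonneg) auto
   ultimately show ?thesis by linarith
  qed
  also have "\<dots> \<le> (\<Sum>i\<in>{2..<j}. (real r * real i ^ 2 / R) * (R * z) ^ i) + (R * z) ^ j"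
  proof (rule add_mono)
   have "(\<Sum>xs\<in>(\<Union>i\<in>{2..<j}. Kl i). z ^ card (set xs)) = (\<Sum>i\<in>{2..<j}. \<Sum>xs\<in>Kl i. z ^ card (set xs))"
   proof (rule sum.UNION_disjoint)
    have "Kl a \<inter> Kl b = {}" if "a \<noteq> b" for a b using lp(1)[of _ a] lp(1)[of _ b] that by (auto simp: Kl_def)
    then show "\<forall>a\<in>{2..<j}. \<forall>b\<in>{2..<j}. a \<noteq> b \<longrightarrow> Kl a \<inter> Kl b = {}" by blast
   qed (use fK in auto)
   also have "\<dots> = (\<Sum>i\<in>{2..<j}. card (Kl i) * z ^ i)"
   proof (rule sum.cong[OF refl])
    fix i
    have "(\<Sum>xs\<in>Kl i. z ^ card (set xs)) = (\<Sum>xs\<in>Kl i. z ^ i)"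
     using lp(2) by (intro sum.cong) (auto simp: Kl_def)
    then show "(\<Sum>xs\<in>Kl i. z ^ card (set xs)) = card (Kl i) * z ^ i" by simp
   qed
   also have "\<dots> \<le> (\<Sum>i\<in>{2..<j}. (real r * real i ^ 2 / R) * real R ^ i * z ^ i)"
    using cK z by (intro sum_mono mult_right_mono) auto
   finally show "(\<Sum>xs\<in>(\<Union>i\<in>{2..<j}. Kl i). z ^ card (set xs)) \<le> (\<Sum>i\<in>{2..<j}. (real r * real i ^ 2 / R) * (R * z) ^ i)"
    by (simp only: power_mult_distrib mult.assoc)
   have "(\<Sum>xs\<in>level j. z ^ card (set xs)) = card (level j) * z ^ j" using lp(2) by simp
   also have "\<dots> \<le> real (R ^ j) * z ^ j" using card_level_le z by (intro mult_right_mono of_nat_mono) auto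
   finally show "(\<Sum>xs\<in>level j. z ^ card (set xs)) \<le> (R * z) ^ j" by (simp add: power_mult_distrib)
  qed
  finally have sm: "(\<Sum>xs\<in>I. z ^ card (set xs)) \<le> (\<Sum>i\<in>{2..<j}. (real r * real i ^ 2 / R) * (R * z) ^ i) + (R * z) ^ j" .
  have cov: "\<exists>xs\<in>I. set xs \<subseteq> v" if v: "v \<in> F" "v \<notin> lost j" for v
   using traced[OF v]
  proof
   assume "\<exists>i<j. \<exists>xs\<in>level i. set xs \<subseteq> v \<and> ker (set xs)"
   then obtain i xs where i: "i < j" "xs \<in> level i" "set xs \<subseteq> v" "ker (set xs)" by blast
   have "i \<noteq> 0" using i ne by (cases i) auto
   moreover have "i \<noteq> 1"
   proof
    assume "i = 1"
    then obtain u where "xs = [u]" "u \<in> S" using lp(1,3)[OF i(2)] by (auto simp: length_Suc_conv)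
    then show False using i(4) ns by simp
   qed
   ultimately have "xs \<in> I" using i by (auto simp: I_def Kl_def)
   then show ?thesis using i by blast
  qed (auto simp: I_def)
  have str: "set xs \<subseteq> S \<and> xs \<noteq> []" if "xs \<in> I" for xs
  proof -
   have "xs \<in> level j \<or> (\<exists>i\<in>{2..<j}. xs \<in> level i)" using that unfolding I_def Kl_def by blast
   then obtain i where "xs \<in> level i" "i \<ge> 1" using j by (metis atLeastLessThan_iff numeral_2_eq_2 Suc_leD One_nat_def)
   then show ?thesis using lp(1,3)[of xs i] by auto
  qed
  show ?thesis by (rule exI[of _ I]) (intro conjI ballI impI fI sm cov str[THEN conjunct1] str[THEN conjunct2])
qed

text \<open>With X = 2rk^2/N and r fixed, the term i = 2 dominates and is of order k^3/N, below k/4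
  once N is a large multiple of k^2. The factor i^2/k, due to the lack of disjoint kernels, saves
  one power of k here. The last term is small because X^(j-1) \<le> 1/2^(j-1) and 2^(j-1) \<ge>
  8rk.\<close>

lemma obstacle_weight:
  fixes N :: real
  assumes r: "r \<ge> 1" and k: "k \<ge> 1" and N: "N \<ge> 128 * real r ^ 2 * real k ^ 2" and j: "8 * real r * real k \<le> 2 ^ (j - 1)" "j \<ge> 1"
   and X: "X = 2 * real r * real k ^ 2 / N"
  shows "N * ((\<Sum>i\<in>{2..<j}. real i ^ 2 / k * X ^ i) + X ^ j) \<le> k / 2"
proof -
  have rk: "real r \<ge> 1" "real k \<ge> 1" using r k by auto
  have N0: "N > 0"
  proof -
   have "128 * real r ^ 2 * real k ^ 2 > 0" using rk by simp
   then show ?thesis using N by linarith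
  qed
  have X0: "X \<ge> 0" using N0 by (simp add: X)
  have X1: "X \<le> 1 / (64 * real r)"
  proof -
   have "X \<le> 2 * real r * real k ^ 2 / (128 * real r ^ 2 * real k ^ 2)"
    unfolding X using N N0 rk by (intro divide_left_mono) auto
   also have "\<dots> = 1 / (64 * real r)" using rk by (simp add: power2_eq_square field_simps)
   finally show ?thesis .
  qed
  also have "\<dots> \<le> 1 / 64" using rk by (simp add: field_simps)
  finally have X2: "X \<le> 1 / 64" .
  have NX: "N * X = 2 * real r * real k ^ 2" using N0 by (simp add: X)
  have q: "real i ^ 2 * X ^ i \<le> (4 * X) ^ i / 4" if i: "i \<ge> 2" for i
  proof -
   have "real i ^ 2 * 4 \<le> 4 ^ i"
    using i
   proof (induction i rule: dec_induct)
    case (step i)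
    have "real (Suc i) ^ 2 \<le> 4 * real i ^ 2"
    proof -
     have "real (Suc i) \<le> 2 * real i" using step by simp
     then have "real (Suc i) ^ 2 \<le> (2 * real i) ^ 2" by (intro power_mono) auto
     then show ?thesis by (simp add: power_mult_distrib)
    qed
    then show ?case using step.IH by simp
   qed simp
   then have "real i ^ 2 * 4 * X ^ i \<le> 4 ^ i * X ^ i" using X0 by (intro mult_right_mono) auto
   then show ?thesis by (simp add: power_mult_distrib)
  qed
  have geo: "(\<Sum>i\<in>{2..<j}. w ^ i) \<le> 2 * w ^ 2" if w: "0 \<le> w" "w \<le> 1 / 2" for w :: real
  proof -
   have "(\<Sum>i\<in>{2..<m}. w ^ i) \<le> 2 * w ^ 2 - (if m \<ge> 2 then 2 * w ^ m else 0)" for m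
   proof (induction m)
    case (Suc m)
    show ?case
    proof (cases "m \<ge> 2")
     case True
     have "2 * w ^ Suc m \<le> w ^ m" using w mult_right_mono[of w "1/2" "w ^ m"] by simp
     then show ?thesis using Suc True by simp
    next
     case False
     then show ?thesis
     proof (cases "m = 1")
      case True
      then show ?thesis by (simp add: numeral_2_eq_2)
     next
      case False
      then have "m = 0" using \<open>\<not> m \<ge> 2\<close> by simp
      then show ?thesis using w by simp
     qed
    qed
   qed (use w in simp)
   from this[of j] show ?thesis using w by (smt (verit) zero_le_power)
  qed
  have "(\<Sum>i\<in>{2..<j}. real i ^ 2 / k * X ^ i) = (\<Sum>i\<in>{2..<j}. real i ^ 2 * X ^ i) / k"
   by (simp add: sum_divide_distrib)
  also have "\<dots> \<le> (\<Sum>i\<in>{2..<j}. (4 * X) ^ i / 4) / k" using q rk by (intro divide_right_mono sum_mono) auto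
  also have "\<dots> = (\<Sum>i\<in>{2..<j}. (4 * X) ^ i) / 4 / k" by (simp add: sum_divide_distrib)
  also have "\<dots> \<le> (2 * (4 * X) ^ 2) / 4 / k" using geo[of "4 * X"] X0 X2 by (intro divide_right_mono) auto
  also have "\<dots> = 8 * X ^ 2 / k" by (simp add: power_mult_distrib)
  finally have "N * (\<Sum>i\<in>{2..<j}. real i ^ 2 / k * X ^ i) \<le> N * (8 * X ^ 2 / k)"
   using N0 by (intro mult_left_mono) auto
  also have "\<dots> = 8 * (N * X) * X / k" by (simp add: power2_eq_square)
  also have "\<dots> = 16 * real r * real k * X" using rk unfolding NX by (simp add: power2_eq_square)
  also have "\<dots> \<le> 16 * real r * real k * (1 / (64 * real r))" using X1 rk by (intro mult_left_mono) auto
  also have "\<dots> = k / 4" using rk by simp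
  finally have A: "N * (\<Sum>i\<in>{2..<j}. real i ^ 2 / k * X ^ i) \<le> k / 4" .
  have "N * X ^ j = N * X * X ^ (j - 1)" using j(2) by (cases j) auto
  also have "\<dots> \<le> 2 * real r * real k ^ 2 * (1 / 2) ^ (j - 1)"
   unfolding NX using X0 X2 by (intro mult_left_mono power_mono) auto
  also have "\<dots> = 2 * real r * real k ^ 2 / 2 ^ (j - 1)" by (simp add: power_divide)
  also have "\<dots> \<le> 2 * real r * real k ^ 2 / (8 * real r * real k)" using j(1) rk by (intro divide_left_mono) auto
  also have "\<dots> = k / 4" using rk by (simp add: power2_eq_square)
  finally show ?thesis using A by (simp add: distrib_left)
qed

text \<open>Suppose that T stays large and remove all one-point kernels, leaving S of size N. The
  fewer than N colours have obstacles of total weight at most k/2, so at least a fraction 1/(2 *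
  4^k) of the k-subsets of S contains no obstacle of any colour. Each of these must be lost for its
  own colour, but \<open>x\<close> and \<open>big\<close> make the lost sets fewer.\<close>

lemma small_universe:
  fixes f :: "nat set \<Rightarrow> nat" and M x y :: real
  assumes r: "r \<ge> 3" and k: "k \<ge> 1" and d: "d \<ge> 1" and nc: "\<not> colorable r n d m"
   and f: "f ` ksub {1..n} k \<subseteq> {..<m}"
   and x: "x = 1 / (4 ^ (k + 1) * real (r * k) ^ j)"
   and y: "y \<ge> 1" "real r ^ (r + 1) * M \<le> x ^ (r - 1) * y" and M: "M > 0"
   and j: "8 * real r * real k \<le> 2 ^ (j - 1)" "j \<ge> 1"
   and sparse: "\<And>W c. W \<subseteq> ksub {1..n} k \<Longrightarrow> (\<forall>v\<in>W. f v = c) \<Longrightarrow> W \<noteq> {} \<Longrightarrow> card (kedges r W) < M * card W"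
   and big: "\<And>N::nat. 128 * real r ^ 2 * real k ^ 2 \<le> N \<Longrightarrow> 4 ^ (k + 1) * real N * real (r * k) ^ j * y < real (N choose k)"
  obtains T C where "T \<subseteq> {1..n}" "C \<subseteq> {..<m}" "\<not> tcol r T d C" "f ` ksub T k \<subseteq> C"
   "(r - 1) * card C < card T" "real (card T) < 128 * real r ^ 3 * real k ^ 2"
proof -
  define R where "R = r * k"
  have rk: "real r \<ge> 3" "real k \<ge> 1" using r k by auto
  have R2: "R \<ge> 2"
  proof -
   have "3 * 1 \<le> r * k" using r k by (intro mult_le_mono) auto
   then show ?thesis by (simp add: R_def)
  qed
  have den: "4 ^ (k + 1) * real R ^ j \<ge> 1"
   using R2 by (intro mult_ge1_I one_le_power) auto
  have x0: "0 < x" "x \<le> 1"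
  proof -
   have "4 ^ (k + 1) * real R ^ j > 0" using den by linarith
   then show "0 < x" unfolding x R_def[symmetric] by (intro divide_pos_pos) auto
   show "x \<le> 1" unfolding x R_def[symmetric]
    using \<open>4 ^ (k + 1) * real R ^ j > 0\<close> den by (intro divide_le_eq_1_pos[THEN iffD2])
  qed
  define F where "F = (\<lambda>T c. {v \<in> ksub T k. f v = c})"
  have finT: "finite T" if "T \<subseteq> {1..n}" for T using that finite_subset by blast
  have F: "finite (F T c)" "\<And>v. v \<in> F T c \<Longrightarrow> finite v \<and> card v = k" if "T \<subseteq> {1..n}" for T c
   using finT[OF that] by (auto simp: F_def ksub_def intro: finite_subset)
  have spF: "card (kedges r W) < M * card W" if "T \<subseteq> {1..n}" "W \<subseteq> F T c" "W \<noteq> {}" for T c W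
  proof (rule sparse[of W c])
   show "W \<subseteq> ksub {1..n} k" using that(2) ksub_mono[OF that(1), of k] by (auto simp: F_def simp del: One_nat_def)
   show "\<forall>v\<in>W. f v = c" using that(2) by (auto simp: F_def)
  qed (rule that(3))
  \<comment> \<open>Only one-point kernels enter the reduction; larger ones become
    obstacles.\<close>
  define ker where "ker = (\<lambda>T c. {u \<in> T. kernel R x y (F T c) {u}})"
  have nt: "\<not> tcol r {1..n} d {..<m}" using nc by (simp add: colorable_tcol)
  obtain T C where TC: "T \<subseteq> {1..n}" "C \<subseteq> {..<m}" "\<not> tcol r T d C" "f ` ksub T k \<subseteq> C"
   "(r - 1) * card C < card T" "\<And>c. c \<in> C \<Longrightarrow> card (ker T c) \<le> r - 2"
  proof (rule reduce_universe[of r d "{1..n}" "{..<m}" f k ker])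
   show "ker T c \<subseteq> T" for T c by (auto simp: ker_def)
   fix T c X v assume T: "T \<subseteq> {1..n}" and X: "X \<subseteq> ker T c" "card X = r - 1" and v: "v \<in> ksub (T - X) k"
   show "f v \<noteq> c"
   proof
    assume fv: "f v = c"
    have fX: "finite X" using X r by (metis card.infinite diff_is_0_eq not_numeral_le_zero le_trans numeral_le_one_iff semiring_norm(70))
    obtain h where h: "bij_betw h {..<r - 1} X" using X(2) fX by (metis ex_bij_betw_nat_finite lessThan_atLeast0)
    have hX: "h i \<in> X" if "i < r - 1" for i using h that by (auto simp: bij_betw_def)
    have vF: "v \<in> F T c" using v fv by (auto simp: F_def ksub_def)
    have "\<exists>i<r - 1. {h i} \<inter> v \<noteq> {}"
    proof (rule kernels_hit[OF r k F[OF T] x0 y M spF[OF T] _ _ vF])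
     show "kernel (r * k) x y (F T c) {h i}" if "i < r - 1" for i
      using hX[OF that] X(1) by (auto simp: ker_def R_def)
     show "{h a} \<inter> {h b} = {}" if "a < r - 1" "b < r - 1" "a \<noteq> b" for a b
      using h that by (auto simp: bij_betw_def inj_on_def)
    qed
    then show False using hX v by (auto simp: ksub_def)
   qed
  qed (use r d nt f in auto)
  have "real (card T) < 128 * real r ^ 3 * real k ^ 2"
  proof (rule ccontr)
   assume "\<not> ?thesis"
   then have Tbig: "128 * real r ^ 3 * real k ^ 2 \<le> card T" by simp
   have fin: "finite T" "finite C" using TC(1,2) finite_subset by blast+
   define X where "X = (\<Union>c\<in>C. ker T c)"
   define S where "S = T - X"
   define N where "N = card S"
   have cS: "card C < N" "card T < (r - 1) * N"
    unfolding N_def S_def using universe_minus_kernels[OF r fin TC(5) X_def] TC(6) by (auto simp: ker_def)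
   have S: "S \<subseteq> {1..n}" "S \<subseteq> T" "finite S" using TC(1) fin by (auto simp: S_def)
   have Nbig: "128 * real r ^ 2 * real k ^ 2 \<le> N"
   proof -
    have "card T \<le> r * N" using cS(2) by (meson diff_le_self less_imp_le_nat mult_le_mono1 order_trans)
    then have "real (card T) \<le> real (r * N)" by (rule of_nat_mono)
    then have "real r * (128 * real r ^ 2 * real k ^ 2) \<le> real r * real N"
     using Tbig by (simp add: power3_eq_cube power2_eq_square mult_ac)
    then show ?thesis using rk by (simp only: mult_le_cancel_left_pos)
   qed
   have Nk: "2 * k \<le> N" "N > 0"
   proof -
    have "2 * real k * 1 \<le> 128 * real r ^ 2 * real k * real k"
     using rk by (intro mult_mono) (auto intro: mult_ge1_I one_le_power)
    then have "real (2 * k) \<le> real N" using Nbig by (simp add: power2_eq_square mult_ac)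
    then show "2 * k \<le> N" by (simp only: of_nat_le_iff)
    then show "N > 0" using k by simp
   qed
   define z where "z = 2 * real k / real N"
   have z0: "z \<ge> 0" by (simp add: z_def)
   define w where "w = (\<Sum>i\<in>{2..<j}. (real r * real i ^ 2 / R) * (R * z) ^ i) + (R * z) ^ j"
   define lo where "lo = (\<lambda>c. branching.lost R x y (F S c) S j)"
   have br: "branching R x y (F S c) S" for c
   proof unfold_locales
    show "finite (F S c)" by (rule F(1)[OF S(1)])
    show "v \<subseteq> S" if "v \<in> F S c" for v using that by (simp add: F_def ksub_def)
    show "0 \<le> x" using x0(1) by simp
    show "0 \<le> y" using y(1) by simp
    show "2 \<le> R" by (rule R2)
   qed
   define PP where "PP = (\<lambda>c I. finite I \<and> (\<forall>xs\<in>I. set xs \<subseteq> S \<and> xs \<noteq> []) \<and> (\<forall>v\<in>F S c. v \<notin> lo c \<longrightarrow> (\<exists>xs\<in>I. set xs \<subseteq> v)) \<and>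
    (\<Sum>xs\<in>I. z ^ card (set xs)) \<le> w)"
   have "\<exists>I. PP c I" if c: "c \<in> C" for c
   proof -
    interpret b: branching R x y "F S c" S by (rule br)
    show ?thesis unfolding PP_def w_def lo_def
    proof (rule b.obstacles[OF z0 _ _ _ j(2)])
     show "\<not> b.ker {}"
     proof
      assume ke: "b.ker {}"
      have ke': "kernel (r * k) x y (F S c) {}" using ke[unfolded b.ker_def] by (simp only: R_def)
      from ke' obtain G where "G \<subseteq> F S c" "y \<le> card G" by (auto simp: kernel_def)
      then have "card G \<noteq> 0" "G \<subseteq> F S c" using y by auto
      then obtain v where v: "v \<in> F S c" by (metis card.empty equals0I subsetD)
      have "\<exists>i<r - 1. {} \<inter> v \<noteq> {}"
       by (rule kernels_hit[OF r k F[OF S(1)] x0 y M spF[OF S(1)] _ _ v]) (use ke' in auto)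
      then show False by simp
     qed
     \<comment> \<open>A kernel of the class restricted to S is one of the class on T, and the
       one-point kernels there were removed with X.\<close>
     show "\<not> b.ker {u}" if u: "u \<in> S" for u
     proof
      assume "b.ker {u}"
      then have "kernel R x y (F S c) {u}" by (simp add: b.ker_def)
      then have "kernel R x y (F T c) {u}"
       by (rule kernel_mono) (use ksub_mono[OF S(2)] in \<open>auto simp: F_def\<close>)
      then have "u \<in> X" using u S c by (auto simp: X_def ker_def)
      then show False using u by (simp add: S_def)
     qed
     fix J assume J: "\<And>i. i < r \<Longrightarrow> b.ker (J i)" "\<And>i j. i < r \<Longrightarrow> j < r \<Longrightarrow> i \<noteq> j \<Longrightarrow> J i \<inter> J j = {}"
     show False
     proof (rule no_disjoint_kernels[where F = "F S c" and J = J, OF r k _ _ x0 y M])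
      show "kernel (r * k) x y (F S c) (J i)" if "i < r" for i using J(1)[OF that, unfolded b.ker_def] by (simp only: R_def)
      show "card (kedges r W) < M * card W" if "W \<subseteq> F S c" "W \<noteq> {}" for W using spF[OF S(1) that] .
     qed (use F[OF S(1)] J(2) in blast)+
    qed
   qed
   then obtain I where I0: "\<And>c. c \<in> C \<Longrightarrow> PP c (I c)" by metis
   have I: "\<And>c. c \<in> C \<Longrightarrow> finite (I c)" "\<And>c xs. c \<in> C \<Longrightarrow> xs \<in> I c \<Longrightarrow> set xs \<subseteq> S \<and> xs \<noteq> []"
    "\<And>c v. c \<in> C \<Longrightarrow> v \<in> F S c \<Longrightarrow> v \<notin> lo c \<Longrightarrow> \<exists>xs\<in>I c. set xs \<subseteq> v"
    "\<And>c. c \<in> C \<Longrightarrow> (\<Sum>xs\<in>I c. z ^ card (set xs)) \<le> w"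
    using I0 unfolding PP_def by blast+
   define Fr where "Fr = {v \<in> ksub S k. \<forall>i\<in>Sigma C I. \<not> set (snd i) \<subseteq> v}"
   have w0: "w \<ge> 0" unfolding w_def using z0 by (intro add_nonneg_nonneg sum_nonneg mult_nonneg_nonneg) auto
   have "real (card S choose k) \<le> 2 * 4 ^ k * card Fr"
    unfolding Fr_def
   proof (rule many_obstacle_free[OF S(3) _ k])
    show "finite (Sigma C I)" using fin I(1) by auto
    show "2 * k \<le> card S" using Nk by (simp add: N_def)
    show "set (snd i) \<subseteq> S \<and> set (snd i) \<noteq> {}" if i: "i \<in> Sigma C I" for i
    proof -
     obtain c xs where "i = (c, xs)" "c \<in> C" "xs \<in> I c" using i by auto
     then show ?thesis using I(2)[of c xs] by auto
    qed
    have "(\<Sum>i\<in>Sigma C I. z ^ card (set (snd i))) = (\<Sum>c\<in>C. \<Sum>xs\<in>I c. z ^ card (set xs))"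
     using fin I(1) by (subst sum.Sigma) (auto simp: case_prod_unfold)
    also have "\<dots> \<le> (\<Sum>c\<in>C. w)" by (intro sum_mono I(4))
    also have "\<dots> = card C * w" by simp
    also have "\<dots> \<le> real N * w" using cS(1) w0 by (intro mult_right_mono) auto
    also have "\<dots> \<le> k / 2"
    proof -
     have RX: "R * z = 2 * real r * real k ^ 2 / N" by (simp add: R_def z_def power2_eq_square)
     have "(\<Sum>i\<in>{2..<j}. (real r * real i ^ 2 / R) * (R * z) ^ i) = (\<Sum>i\<in>{2..<j}. real i ^ 2 / k * (R * z) ^ i)"
      using rk by (intro sum.cong) (auto simp: R_def)
     then show ?thesis unfolding w_def using obstacle_weight[OF _ k Nbig j RX] r by simp
    qed
    finally show "(\<Sum>i\<in>Sigma C I. (2 * real k / card S) ^ card (set (snd i))) \<le> k / 2" by (simp add: z_def N_def)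
   qed
   \<comment> \<open>The losses of proportion x add up to a fraction 1/4^(k+1) of all k-sets, which
     the factor 2 * 4^k turns into one half. The losses of size y, for fewer than N colours, are
     excluded by \<open>big\<close>.\<close>
   moreover have "real (card Fr) \<le> N * real R ^ j * y + real (N choose k) / 4 ^ (k + 1)"
   proof -
    have flo: "finite (lo c)" "card (lo c) \<le> real R ^ j * (y + x * card (F S c))" for c
    proof -
     interpret b: branching R x y "F S c" S by (rule br)
     have "b.lost j \<subseteq> F S c" by (auto simp: b.lost_def)
     then show "finite (lo c)" unfolding lo_def using F(1)[OF S(1)] finite_subset by blast
     show "card (lo c) \<le> real R ^ j * (y + x * card (F S c))" unfolding lo_def by (rule b.card_lost_le)
    qed
    have fC: "f ` ksub S k \<subseteq> C" using TC(4) ksub_mono[OF S(2)] by blast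
    have "Fr \<subseteq> (\<Union>c\<in>C. lo c)"
    proof
     fix v assume v: "v \<in> Fr"
     then have fv: "f v \<in> C" "v \<in> F S (f v)" using fC by (auto simp: Fr_def F_def)
     have "v \<in> lo (f v)"
     proof (rule ccontr)
      assume "v \<notin> lo (f v)"
      from I(3)[OF fv this] show False using v fv by (force simp: Fr_def)
     qed
     then show "v \<in> (\<Union>c\<in>C. lo c)" using fv by blast
    qed
    then have "card Fr \<le> card (\<Union>c\<in>C. lo c)" using fin flo by (intro card_mono) auto
    also have "\<dots> \<le> (\<Sum>c\<in>C. card (lo c))" by (rule card_UN_le[OF fin(2)])
    finally have "real (card Fr) \<le> (\<Sum>c\<in>C. real (card (lo c)))" by (simp only: of_nat_sum[symmetric] of_nat_le_iff)
    also have "\<dots> \<le> (\<Sum>c\<in>C. real R ^ j * (y + x * card (F S c)))" by (intro sum_mono flo)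
    also have "\<dots> = real R ^ j * (card C * y + x * (\<Sum>c\<in>C. real (card (F S c))))"
     by (simp add: sum_distrib_left[symmetric] sum.distrib)
    also have "(\<Sum>c\<in>C. real (card (F S c))) = real (N choose k)"
     using sum_popcount[OF S(3) fin(2) fC] by (simp add: popcount_def F_def N_def flip: of_nat_sum)
    also have "real R ^ j * (card C * y + x * real (N choose k)) \<le> real R ^ j * (N * y + x * real (N choose k))"
     using cS(1) y by (intro mult_left_mono add_mono mult_right_mono) auto
    also have "\<dots> = N * real R ^ j * y + real (N choose k) * (real R ^ j * x)" by (simp add: algebra_simps)
    also have "real R ^ j * x = 1 / 4 ^ (k + 1)" using rk by (simp add: x R_def)
    finally show ?thesis by simp
   qed
   ultimately have "real (card S choose k) \<le> 2 * 4 ^ k * real (card Fr)" "real (card Fr) \<le> N * real R ^ j * y + real (N choose k) / 4 ^ (k + 1)"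
    by simp_all
   note Fr = this
   from Fr(2) have "2 * 4 ^ k * real (card Fr) \<le> 2 * 4 ^ k * (N * real R ^ j * y + real (N choose k) / 4 ^ (k + 1))"
    by (rule mult_left_mono) simp
   moreover have "2 * 4 ^ k * (N * real R ^ j * y + real (N choose k) / 4 ^ (k + 1)) = 2 * 4 ^ k * (N * real R ^ j * y) + real (N choose k) / 2"
    by (simp add: distrib_left)
   ultimately have "real (N choose k) \<le> 2 * 4 ^ k * (N * real R ^ j * y) + real (N choose k) / 2"
    using Fr(1) unfolding N_def[symmetric] by linarith
   then have "real (N choose k) \<le> 4 ^ (k + 1) * real N * real R ^ j * y" by simp
   then show False using big[OF Nbig] by (simp add: R_def)
  qed
  then show ?thesis using that TC by blast
qed

section \<open>Statement (f), and the small universe used also for (d)\<close>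

section \<open>Random Kneser hypergraphs with fixed l\<close>

text \<open>A family of w k-sets costs k w ln n, which (k+1) ln n / (- ln (1-p)) edges per member
  can pay for. In the absence of such events every subfamily of a colour class is sparse, as
  \<open>kernels_hit\<close> demands.\<close>

lemma sparse_negligible:
  fixes k :: "nat \<Rightarrow> nat"
  assumes p: "0 < p" "p < 1"
  shows "negligible p (\<lambda>n. \<Union>w\<in>{1..n choose k n}. {kedges r W |W. W \<in> {W. W \<subseteq> ksub {1..n} (k n) \<and> card W = w} \<and>
   real w * ((real (k n) + 1) * ln n / - ln (1 - p)) \<le> real (card (kedges r W))})"
proof (rule negligibleI[OF p, where x = "\<lambda>n. ln (real n)" and a = "\<lambda>n w. real (k n * w) * ln n"])
  show "finite {W. W \<subseteq> ksub {1..n} (k n) \<and> card W = w}" for n w by simp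
  show "\<forall>\<^sub>F n in sequentially. \<forall>w\<in>{1..n choose k n}. real (card {W. W \<subseteq> ksub {1..n} (k n) \<and> card W = w}) \<le> exp (real (k n * w) * ln n) \<and>
    real (k n * w) * ln n + real w * ln n \<le> - ln (1 - p) * (real w * ((real (k n) + 1) * ln n / - ln (1 - p)))"
   using eventually_ge_at_top[of 1]
  proof eventually_elim
   case (elim n)
   show ?case
   proof (intro ballI conjI)
    fix w
    have "card {W. W \<subseteq> ksub {1..n} (k n) \<and> card W = w} = (n choose k n) choose w"
     by (simp add: n_subsets card_ksub)
    also have "\<dots> \<le> (n choose k n) ^ w" by (rule choose_le_pow)
    also have "\<dots> \<le> (n ^ k n) ^ w" by (intro power_mono choose_le_pow) auto
    also have "\<dots> = n ^ (k n * w)" by (simp only: power_mult)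
    finally have "real (card {W. W \<subseteq> ksub {1..n} (k n) \<and> card W = w}) \<le> real (n ^ (k n * w))" by (rule of_nat_mono)
    also have "\<dots> = exp (real (k n * w) * ln n)" using elim by (simp only: exp_of_nat_mult) simp
    finally show "real (card {W. W \<subseteq> ksub {1..n} (k n) \<and> card W = w}) \<le> exp (real (k n * w) * ln n)" .
    have "- ln (1 - p) \<noteq> 0" using p by simp
    then have "- ln (1 - p) * (real w * ((real (k n) + 1) * ln n / - ln (1 - p))) = real w * ((real (k n) + 1) * ln n)"
     by (simp add: field_simps)
    then show "real (k n * w) * ln n + real w * ln n \<le> - ln (1 - p) * (real w * ((real (k n) + 1) * ln n / - ln (1 - p)))"
     by (simp add: algebra_simps)
   qed
  qed
  show "filterlim (\<lambda>n. ln (real n)) at_top sequentially" by real_asymp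
qed

text \<open>L stands for ln n, at most a power of k. With j about log2 of 8rk, (rk)^j is exp(O((ln
  k)^2)). Put Z = 4^(k+1) (rk)^j, x = 1/Z, and y of order Z^(r-1) times a power of k. Then the left
  side of the last condition is N exp(O(k)), while (N choose k) \<ge> (N/k)^k is at least N
  k^(k-2).\<close>

lemma kernel_scales:
  fixes b :: real
  assumes r: "r \<ge> 3" and b: "b > 0"
  shows "\<forall>\<^sub>F k::nat in sequentially. \<forall>L. 0 < L \<longrightarrow> L \<le> real k ^ s \<longrightarrow> (\<exists>x y j. x = 1 / (4 ^ (k + 1) * real (r * k) ^ j) \<and> y \<ge> 1 \<and>
   real r ^ (r + 1) * ((real k + 1) * L / b) \<le> x ^ (r - 1) * y \<and> 8 * real r * real k \<le> 2 ^ (j - 1) \<and> j \<ge> 1 \<and>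
   (\<forall>N::nat. 128 * real r ^ 2 * real k ^ 2 \<le> N \<longrightarrow> 4 ^ (k + 1) * real N * real (r * k) ^ j * y < real (N choose k)))"
proof -
  define D where "D = 2 * real r ^ (r + 1) / b"
  have D: "D > 0" using r b by (simp add: D_def)
  have r0: "real r > 0" using r by simp
  have "\<forall>\<^sub>F x in at_top. ln (D + 1) + (real s + 2) * ln x + real r * ((x + 1) * ln 4 + (ln (8 * real r * x) / ln 2 + 2) * ln (real r * x)) < (x - 1) * ln x"
   using D r0 by real_asymp
  then have ev: "\<forall>\<^sub>F k::nat in sequentially. ln (D + 1) + (real s + 2) * ln k + real r * ((real k + 1) * ln 4 + (ln (8 * real r * k) / ln 2 + 2) * ln (real r * k)) < (real k - 1) * ln k"
   by (rule eventually_compose_filterlim) (rule filterlim_real_sequentially)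
  show ?thesis
   using ev eventually_ge_at_top[of 2]
  proof eventually_elim
   case (elim k)
   have rk: "real r \<ge> 3" "real k \<ge> 2" using r elim by auto
   show ?case
   proof (intro allI impI)
    fix L assume L: "0 < L" "L \<le> real k ^ s"
    define u where "u = log 2 (8 * real r * real k)"
    define j where "j = nat \<lceil>u\<rceil> + 1"
    have rk1: "8 * real r * real k \<ge> 1" using rk by (intro mult_ge1_I) auto
    have rk0: "8 * real r * real k > 0" using rk1 by linarith
    have u0: "u \<ge> 0" unfolding u_def using rk1 rk0 by (intro zero_le_log_cancel_iff[THEN iffD2]) linarith+
    have j: "u \<le> real (j - 1)" "real j \<le> u + 2" "j \<ge> 1" using u0 unfolding j_def by linarith+
    define E where "E = real (r * k) ^ j"
    define Z where "Z = 4 ^ (k + 1) * E"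
    have rk2: "real (r * k) \<ge> 1" using rk by (simp add: mult_ge1_I)
    have E1: "E \<ge> 1" unfolding E_def using rk2 by (rule one_le_power)
    have Z1: "Z \<ge> 1" unfolding Z_def using E1 by (intro mult_ge1_I one_le_power) auto
    define A where "A = real r ^ (r + 1) * ((real k + 1) * L / b)"
    have A0: "A > 0" using L rk b by (simp add: A_def)
    \<comment> \<open>A Z^(r-1) cancels the factor x^(r-1); the added 1 gives y \<ge> 1.\<close>
    define y where "y = A * Z ^ (r - 1) + 1"
    define x where "x = 1 / Z"
    have "A \<le> D * real k ^ (s + 1)"
    proof -
     have "(real k + 1) * L \<le> (2 * real k) * real k ^ s" using L rk by (intro mult_mono) auto
     then have "A \<le> real r ^ (r + 1) * ((2 * real k) * real k ^ s / b)"
      unfolding A_def using b by (intro mult_left_mono divide_right_mono) auto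
     then show ?thesis by (simp add: D_def mult_ac)
    qed
    moreover have "real k ^ (s + 1) \<ge> 1" using rk by (intro one_le_power) auto
    ultimately have A1: "A + 1 \<le> (D + 1) * real k ^ (s + 1)" by (simp add: distrib_right)
    have y2: "y \<le> (D + 1) * real k ^ (s + 1) * Z ^ (r - 1)"
    proof -
     have "Z ^ (r - 1) \<ge> 1" using Z1 by (rule one_le_power)
     then have "y \<le> (A + 1) * Z ^ (r - 1)" by (simp add: y_def distrib_right)
     also have "\<dots> \<le> (D + 1) * real k ^ (s + 1) * Z ^ (r - 1)" using A1 Z1 by (intro mult_right_mono) auto
     finally show ?thesis .
    qed
    have main: "(D + 1) * real k ^ (s + 2) * Z ^ r < real k ^ (k - 1)"
    proof -
     have lnE: "ln E \<le> (u + 2) * ln (real r * real k)"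
     proof -
      have "ln E = real j * ln (real (r * k))" unfolding E_def using rk2 by (simp add: ln_realpow)
      also have "\<dots> \<le> (u + 2) * ln (real (r * k))" using j rk2 by (intro mult_right_mono) auto
      finally show ?thesis by simp
     qed
     have lnZ: "ln Z = (real k + 1) * ln 4 + ln E"
     proof -
      have "ln ((4::real) ^ (k + 1)) = (real k + 1) * ln 4" by (subst ln_realpow) auto
      moreover have "ln (4 ^ (k + 1) * E) = ln (4 ^ (k + 1)) + ln E" using E1 by (intro ln_mult_pos) auto
      ultimately show ?thesis by (simp only: Z_def)
     qed
     have "ln ((D + 1) * real k ^ (s + 2) * Z ^ r) = ln (D + 1) + (real s + 2) * ln k + real r * ln Z"
     proof -
      have "ln ((D + 1) * real k ^ (s + 2) * Z ^ r) = ln ((D + 1) * real k ^ (s + 2)) + ln (Z ^ r)"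
       using D rk Z1 by (intro ln_mult_pos mult_pos_pos zero_less_power) auto
      also have "ln ((D + 1) * real k ^ (s + 2)) = ln (D + 1) + ln (real k ^ (s + 2))"
       using D rk by (intro ln_mult_pos zero_less_power) auto
      also have "ln (real k ^ (s + 2)) = (real s + 2) * ln k" using rk by (subst ln_realpow) auto
      also have "ln (Z ^ r) = real r * ln Z" using Z1 by (subst ln_realpow) auto
      finally show ?thesis .
     qed
     also have "\<dots> \<le> ln (D + 1) + (real s + 2) * ln k + real r * ((real k + 1) * ln 4 + (u + 2) * ln (real r * real k))"
      unfolding lnZ using lnE by (intro add_left_mono mult_left_mono) auto
     also have "\<dots> < (real k - 1) * ln k" using elim(1) by (simp add: u_def log_def)
     also have "\<dots> = ln (real k ^ (k - 1))" using elim(2) by (subst ln_realpow) (auto simp: of_nat_diff)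
     finally have "ln ((D + 1) * real k ^ (s + 2) * Z ^ r) < ln (real k ^ (k - 1))" .
     moreover have "(D + 1) * real k ^ (s + 2) * Z ^ r > 0" using D rk Z1 by (intro mult_pos_pos zero_less_power) auto
     moreover have "real k ^ (k - 1) > 0" using rk by simp
     ultimately show ?thesis by (simp only: ln_less_cancel_iff)
    qed
    have "x = 1 / (4 ^ (k + 1) * real (r * k) ^ j)" by (simp add: x_def Z_def E_def)
    moreover have "y \<ge> 1" using A0 Z1 by (simp add: y_def)
    moreover have "A \<le> x ^ (r - 1) * y"
    proof -
     have "x ^ (r - 1) * y = A + x ^ (r - 1)" using Z1 by (simp add: x_def y_def power_divide distrib_left)
     moreover have "x ^ (r - 1) \<ge> 0" using Z1 by (simp add: x_def)
     ultimately show ?thesis by simp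
    qed
    moreover have "8 * real r * real k \<le> 2 ^ (j - 1)"
    proof -
     have "8 * real r * real k = 2 powr u"
      unfolding u_def by (rule powr_log_cancel[symmetric]) (use rk0 in linarith)+
     also have "\<dots> \<le> 2 powr real (j - 1)" using j(1) by simp
     finally show ?thesis by (simp add: powr_realpow)
    qed
    moreover have "4 ^ (k + 1) * real N * real (r * k) ^ j * y < real (N choose k)"
     if N: "128 * real r ^ 2 * real k ^ 2 \<le> N" for N :: nat
    proof -
     have Nk: "real N \<ge> real k * real k"
     proof -
      have "1 * (real k * real k) \<le> (128 * real r ^ 2) * (real k * real k)"
       using rk by (intro mult_right_mono mult_ge1_I one_le_power) auto
      then show ?thesis using N by (simp add: power2_eq_square)
     qed
     have Nk1: "k \<le> N"
     proof -
      have "real k * 1 \<le> real k * real k" using rk by (intro mult_left_mono) auto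
      then show ?thesis using Nk by simp
     qed
     have N0: "real N > 0" using Nk1 elim by simp
     have "4 ^ (k + 1) * real N * real (r * k) ^ j * y = real N * Z * y" by (simp add: Z_def E_def)
     also have "\<dots> \<le> real N * Z * ((D + 1) * real k ^ (s + 1) * Z ^ (r - 1))" using y2 Z1 by (intro mult_left_mono) auto
     also have "\<dots> = real N / k * ((D + 1) * real k ^ (s + 2) * Z ^ r)"
     proof -
      have "Z ^ r = Z * Z ^ (r - 1)" using r by (metis power_eq_if not_numeral_le_zero)
      then show ?thesis using rk by simp
     qed
     also have "\<dots> < real N / k * real k ^ (k - 1)" using main N0 rk by (intro mult_strict_left_mono) auto
     also have "\<dots> \<le> real N / k * (real N / k) ^ (k - 1)"
     proof (intro mult_left_mono power_mono)
      show "real k \<le> real N / real k" using Nk rk by (simp add: le_divide_eq)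
     qed (use rk in auto)
     also have "\<dots> = (real N / k) ^ k" using elim(2) by (simp add: power_eq_if)
     also have "\<dots> \<le> real (N choose k)" by (rule binomial_ge_n_over_k_pow_k[OF Nk1])
     finally show ?thesis .
    qed
    ultimately show "\<exists>x y j. x = 1 / (4 ^ (k + 1) * real (r * k) ^ j) \<and> y \<ge> 1 \<and>
     real r ^ (r + 1) * ((real k + 1) * L / b) \<le> x ^ (r - 1) * y \<and> 8 * real r * real k \<le> 2 ^ (j - 1) \<and> j \<ge> 1 \<and>
     (\<forall>N::nat. 128 * real r ^ 2 * real k ^ 2 \<le> N \<longrightarrow> 4 ^ (k + 1) * real N * real (r * k) ^ j * y < real (N choose k))"
     using j(3) unfolding A_def by (intro exI[of _ x] exI[of _ y] exI[of _ j] conjI allI impI)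
   qed
  qed
qed

lemma at_top_if_ln_le_power:
  fixes k :: "nat \<Rightarrow> nat"
  assumes "\<forall>\<^sub>F n in sequentially. ln (real n) \<le> real (k n) ^ s"
  shows "filterlim k at_top sequentially"
  unfolding filterlim_at_top
proof
  fix Z
  have "filterlim (\<lambda>n. ln (real n)) at_top sequentially" by real_asymp
  then have "\<forall>\<^sub>F n in sequentially. real Z ^ s < ln (real n)" unfolding filterlim_at_top_dense by blast
  then show "\<forall>\<^sub>F n in sequentially. Z \<le> k n"
   using assms
  proof eventually_elim
   case (elim n)
   show ?case
   proof (rule ccontr)
    assume "\<not> Z \<le> k n"
    then have "real (k n) ^ s \<le> real Z ^ s" by (intro power_mono) auto
    then show False using elim by linarith
   qed
  qed
qed

lemma small_universe_aas:
  fixes k :: "nat \<Rightarrow> nat"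
  assumes p: "0 < p" "p < 1" and r: "r \<ge> 3" and k1: "\<And>n. k n \<ge> 1"
   and lnk: "\<forall>\<^sub>F n in sequentially. ln (real n) \<le> real (k n) ^ s"
  obtains X where "negligible p X"
   "\<forall>\<^sub>F n in sequentially. \<forall>d m f. d \<ge> 1 \<longrightarrow> \<not> colorable r n d m \<longrightarrow> f ` ksub {1..n} (k n) \<subseteq> {..<m} \<longrightarrow>
    (\<exists>E\<in>X n. E \<subseteq> kedges r (ksub {1..n} (k n)) \<and> (\<forall>e\<in>E. mono_edge f e)) \<or>
    (\<exists>T C. T \<subseteq> {1..n} \<and> C \<subseteq> {..<m} \<and> \<not> tcol r T d C \<and> f ` ksub T (k n) \<subseteq> C \<and>
     (r - 1) * card C < card T \<and> real (card T) < 128 * real r ^ 3 * real (k n) ^ 2)"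
proof -
  define b where "b = - ln (1 - p)"
  have b: "b > 0" using p by (simp add: b_def)
  define X where "X = (\<lambda>n. \<Union>w\<in>{1..n choose k n}. {kedges r W |W. W \<in> {W. W \<subseteq> ksub {1..n} (k n) \<and> card W = w} \<and>
   real w * ((real (k n) + 1) * ln n / b) \<le> real (card (kedges r W))})"
  have "negligible p X" unfolding X_def b_def by (rule sparse_negligible[OF p])
  moreover have "\<forall>\<^sub>F n in sequentially. ln (real n) > 0" by real_asymp
  then have "\<forall>\<^sub>F n in sequentially. \<forall>d m f. d \<ge> 1 \<longrightarrow> \<not> colorable r n d m \<longrightarrow> f ` ksub {1..n} (k n) \<subseteq> {..<m} \<longrightarrow>
    (\<exists>E\<in>X n. E \<subseteq> kedges r (ksub {1..n} (k n)) \<and> (\<forall>e\<in>E. mono_edge f e)) \<or>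
    (\<exists>T C. T \<subseteq> {1..n} \<and> C \<subseteq> {..<m} \<and> \<not> tcol r T d C \<and> f ` ksub T (k n) \<subseteq> C \<and>
     (r - 1) * card C < card T \<and> real (card T) < 128 * real r ^ 3 * real (k n) ^ 2)"
   using lnk eventually_compose_filterlim[OF kernel_scales[OF r b, of s] at_top_if_ln_le_power[OF lnk]]
  proof eventually_elim
   case (elim n)
   define kk where "kk = k n"
   define M where "M = (real kk + 1) * ln n / b"
   have M: "M > 0" using elim(1) b by (simp add: M_def)
   obtain x y j where xy: "x = 1 / (4 ^ (kk + 1) * real (r * kk) ^ j)" "y \<ge> 1" "real r ^ (r + 1) * M \<le> x ^ (r - 1) * y"
    "8 * real r * real kk \<le> 2 ^ (j - 1)" "j \<ge> 1"
    "\<And>N::nat. 128 * real r ^ 2 * real kk ^ 2 \<le> N \<Longrightarrow> 4 ^ (kk + 1) * real N * real (r * kk) ^ j * y < real (N choose kk)"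
    using elim(3)[rule_format, OF elim(1,2)] unfolding kk_def[symmetric] M_def by blast
   show ?case
   proof (intro allI impI disjCI)
    fix d m f assume d: "d \<ge> 1" and nc: "\<not> colorable r n d m" and f: "f ` ksub {1..n} (k n) \<subseteq> {..<m}"
     and no: "\<not> (\<exists>T C. T \<subseteq> {1..n} \<and> C \<subseteq> {..<m} \<and> \<not> tcol r T d C \<and> f ` ksub T (k n) \<subseteq> C \<and>
     (r - 1) * card C < card T \<and> real (card T) < 128 * real r ^ 3 * real (k n) ^ 2)"
    have f': "f ` ksub {1..n} kk \<subseteq> {..<m}" using f by (simp add: kk_def)
    have kk1: "kk \<ge> 1" using k1 by (simp add: kk_def)
    show "\<exists>E\<in>X n. E \<subseteq> kedges r (ksub {1..n} (k n)) \<and> (\<forall>e\<in>E. mono_edge f e)"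
    proof (rule ccontr)
     assume noE: "\<not> ?thesis"
     have sparse: "card (kedges r W) < M * card W" if W: "W \<subseteq> ksub {1..n} kk" "\<forall>v\<in>W. f v = c" "W \<noteq> {}" for W c
     proof (rule ccontr)
      assume "\<not> ?thesis"
      then have le: "real (card W) * M \<le> card (kedges r W)" by (simp add: mult.commute)
      have fW: "finite W" using W(1) finite_subset by fastforce
      have "card W \<le> card (ksub {1..n} kk)" using W(1) by (intro card_mono) auto
      then have "card W \<in> {1..n choose kk}" using W(3) fW by (simp add: card_ksub Suc_le_eq card_gt_0_iff)
      then have "kedges r W \<in> X n"
       unfolding X_def using W(1) le unfolding M_def kk_def by blast
      moreover have "kedges r W \<subseteq> kedges r (ksub {1..n} kk)" using W(1) by (rule kedges_mono)
      moreover have "\<forall>e\<in>kedges r W. mono_edge f e" using W(2) by (auto simp: kedges_def mono_edge_def)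
      ultimately show False using noE by (auto simp: kk_def)
     qed
     obtain T C where "T \<subseteq> {1..n}" "C \<subseteq> {..<m}" "\<not> tcol r T d C" "f ` ksub T kk \<subseteq> C"
      "(r - 1) * card C < card T" "real (card T) < 128 * real r ^ 3 * real kk ^ 2"
      by (rule small_universe[OF r kk1 d nc f' xy(1,2,3) M xy(4,5) sparse xy(6)])
     then show False using no unfolding kk_def by blast
    qed
   qed
  qed
  ultimately show ?thesis using that by blast
qed

text \<open>Hosts cost (k+l) ln n and tau is at least kap k^e, so it suffices that k^(re-1) is a
  large multiple of ln n. The cost of the chosen k-subsets is tau O(ln k), while tau^r is at least a
  multiple of k tau.\<close>

lemma hosts_negligible_fixed_l:
  fixes k tau :: "nat \<Rightarrow> nat"
  assumes p: "0 < p" "p < 1" and r: "r \<ge> 2" and l: "l \<ge> 1" and e: "e \<ge> 1" and kap: "kap > 0" and k1: "\<And>n. k n \<ge> 1"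
   and lim: "filterlim k at_top sequentially" and tau: "\<And>n. kap * real (k n) ^ e \<le> tau n"
   and lnk: "\<forall>\<^sub>F n in sequentially. 2 * (real r * (real l + 1) + 1) / (- ln (1 - p) * kap ^ r) * ln n \<le> real (k n) ^ (r * e - 1)"
  shows "negligible p (\<lambda>n. if True then hostev r (k n) (ksub {1..n} (k n + l)) (tau n) else {})"
proof -
  define b where "b = - ln (1 - p)"
  have b: "b > 0" using p by (simp add: b_def)
  have limr: "filterlim (\<lambda>n. real (k n)) at_top sequentially"
   using filterlim_compose[OF filterlim_real_sequentially lim] .
  have lnev: "\<forall>\<^sub>F n in sequentially. real r * real l * (ln (real l + 1) + ln (real (k n))) \<le> b / 2 * kap ^ (r - 1) * real (k n)"
  proof -
   have "\<forall>\<^sub>F x in at_top. real r * real l * (ln (real l + 1) + ln x) \<le> b / 2 * kap ^ (r - 1) * x"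
    using b kap r l by real_asymp
   then show ?thesis using limr by (rule eventually_compose_filterlim)
  qed
  show ?thesis
  proof (rule hostev_negligible[OF p, where L = "\<lambda>n. (k n + l) * ln n" and K = "\<lambda>n. (k n + l) ^ l"])
   fix n A assume A: "A \<in> ksub {1..n} (k n + l)"
   have "(k n + l) choose k n = (k n + l) choose l" using binomial_symmetric[of "k n" "k n + l"] by simp
   then show "finite A \<and> card A choose k n \<le> (k n + l) ^ l"
    using A choose_le_pow[of "k n + l" l] by (auto simp: ksub_def intro: finite_subset)
  next
   show "\<forall>\<^sub>F n in sequentially. True \<longrightarrow> real (card (ksub {1..n} (k n + l))) \<le> exp ((k n + l) * ln n) \<and>
    real r * ((k n + l) * ln n + real (tau n) * ln (real ((k n + l) ^ l))) + ln (real n) \<le> - ln (1 - p) * real (tau n ^ r)"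
    using lnk lnev eventually_ge_at_top[of 1]
   proof eventually_elim
    case (elim n)
    define L where "L = real (k n)"
    have L: "L \<ge> 1" using k1 by (simp add: L_def)
    have ln0: "ln (real n) \<ge> 0" using elim by simp
    have "real (card (ksub {1..n} (k n + l))) \<le> real n ^ (k n + l)"
     using choose_le_pow[of n "k n + l"] by (simp add: card_ksub flip: of_nat_power)
    also have "\<dots> = exp ((k n + l) * ln n)" using elim(3) by (simp only: exp_of_nat_mult) simp
    finally have A: "real (card (ksub {1..n} (k n + l))) \<le> exp ((k n + l) * ln n)" .
    have d: "real (k n + l) \<le> (real l + 1) * L"
    proof -
     have "real l * 1 \<le> real l * L" using L by (intro mult_left_mono) auto
     then show ?thesis by (simp add: L_def algebra_simps)
    qed
    have lnK: "ln (real ((k n + l) ^ l)) \<le> l * (ln (real l + 1) + ln L)"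
    proof -
     have "ln (real ((k n + l) ^ l)) = l * ln (real (k n + l))" using l by (simp add: ln_realpow)
     also have "\<dots> \<le> l * ln ((real l + 1) * L)"
      using d l L by (intro mult_left_mono ln_mono) auto
     finally show ?thesis using L by (simp add: ln_mult)
    qed
    have re: "r * e \<ge> 1" using r e by simp
    have tr: "kap ^ r * (L * L ^ (r * e - 1)) \<le> real (tau n) ^ r"
    proof -
     have "L * L ^ (r * e - 1) = L ^ (r * e)" using re by (simp add: power_eq_if)
     then have "kap ^ r * (L * L ^ (r * e - 1)) = (kap * L ^ e) ^ r"
      by (simp add: power_mult_distrib mult.commute flip: power_mult)
     also have "\<dots> \<le> real (tau n) ^ r" using tau kap L by (intro power_mono) (auto simp: L_def)
     finally show ?thesis .
    qed
    have tr1: "kap ^ (r - 1) * L \<le> real (tau n) ^ (r - 1)"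
    proof -
     have "1 * 1 \<le> e * (r - 1)" using e r by (intro mult_le_mono) auto
     then have "L ^ 1 \<le> L ^ (e * (r - 1))" using L by (intro power_increasing) auto
     then have "kap ^ (r - 1) * L \<le> kap ^ (r - 1) * L ^ (e * (r - 1))" using kap by simp
     also have "\<dots> = (kap * L ^ e) ^ (r - 1)" by (simp only: power_mult_distrib power_mult)
     also have "\<dots> \<le> real (tau n) ^ (r - 1)" using tau kap L by (intro power_mono) (auto simp: L_def)
     finally show ?thesis .
    qed
    have e1: "real r * ((k n + l) * ln n) + ln n \<le> b / 2 * real (tau n) ^ r"
    proof -
     have "real r * ((k n + l) * ln n) + ln n \<le> real r * ((real l + 1) * L * ln n) + L * ln n"
      using d ln0 L by (intro add_mono mult_left_mono mult_right_mono) (auto simp: mult_le_cancel_right1)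
     also have "\<dots> = (real r * (real l + 1) + 1) * ln n * L" by (simp add: algebra_simps)
     also have "\<dots> \<le> (b / 2 * kap ^ r * L ^ (r * e - 1)) * L"
     proof (rule mult_right_mono)
      have "2 * (real r * (real l + 1) + 1) / (b * kap ^ r) * ln n \<le> L ^ (r * e - 1)"
       using elim(1) by (simp only: b_def L_def)
      then have "b / 2 * kap ^ r * (2 * (real r * (real l + 1) + 1) / (b * kap ^ r) * ln n) \<le> b / 2 * kap ^ r * L ^ (r * e - 1)"
       by (rule mult_left_mono) (use b kap in simp)
      moreover have "b / 2 * kap ^ r * (2 * (real r * (real l + 1) + 1) / (b * kap ^ r) * ln n) = (real r * (real l + 1) + 1) * ln n"
       using b kap by simp
      ultimately show "(real r * (real l + 1) + 1) * ln n \<le> b / 2 * kap ^ r * L ^ (r * e - 1)" by linarith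
     qed (use L in simp)
     also have "\<dots> = b / 2 * (kap ^ r * (L * L ^ (r * e - 1)))" by simp
     also have "\<dots> \<le> b / 2 * real (tau n) ^ r" using tr b by (intro mult_left_mono) auto
     finally show ?thesis .
    qed
    have e2: "real r * (real (tau n) * ln (real ((k n + l) ^ l))) \<le> b / 2 * real (tau n) ^ r"
    proof -
     have "real r * (real (tau n) * ln (real ((k n + l) ^ l))) \<le> real r * (real (tau n) * (l * (ln (real l + 1) + ln L)))"
      using lnK by (intro mult_left_mono) auto
     also have "\<dots> = real (tau n) * (real r * real l * (ln (real l + 1) + ln L))" by simp
     also have "\<dots> \<le> real (tau n) * (b / 2 * kap ^ (r - 1) * L)"
      using elim(2) by (intro mult_left_mono) (auto simp: L_def)
     also have "\<dots> = b / 2 * (real (tau n) * (kap ^ (r - 1) * L))" by simp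
     also have "\<dots> \<le> b / 2 * (real (tau n) * real (tau n) ^ (r - 1))"
      using tr1 b by (intro mult_left_mono) auto
     also have "real (tau n) * real (tau n) ^ (r - 1) = real (tau n) ^ r"
      using r by (metis power_eq_if not_numeral_le_zero)
     finally show ?thesis .
    qed
    have "real r * ((k n + l) * ln n + real (tau n) * ln (real ((k n + l) ^ l))) + ln (real n) \<le> b * real (tau n) ^ r"
     using e1 e2 by (simp add: distrib_left)
    then show ?case using A by (simp add: b_def)
   qed
  qed (use k1 in \<open>auto simp: Suc_le_eq\<close>)
qed

lemma choose_fixed_l_ge: "(real k / real l) ^ l \<le> real ((k + l) choose k)"
proof -
  have "(l + k) choose l = (k + l) choose k" using binomial_symmetric[of l "l + k"] by (simp add: add.commute)
  then show ?thesis using choose_ge_pow[of k l] by metis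
qed

text \<open>O(k^2) points of T, hence fewer colours, compete for the (k+l choose k) k-subsets of a
  host, of order at least k^l. So popular colours have multiplicity of order k^(l-2), and the
  exponent is r(l-2) - 1.\<close>

lemma hypergraph_fixed_l:
  fixes p :: real and r l :: nat
  assumes p: "0 < p" "p < 1" and r: "r \<ge> 3" and l: "l \<ge> 3"
  shows "\<exists>C>0. \<forall>k::nat \<Rightarrow> nat. (\<forall>n. k n \<ge> 2) \<and>
    (\<forall>\<^sub>F n in sequentially. real (k n) \<ge> C * ln (real n) powr (1 / (real r * (real l - 2) - 1))) \<longrightarrow>
    aas_chromatic_bound r p k (\<lambda>_. l)"
proof -
  define b where "b = - ln (1 - p)"
  have b: "b > 0" using p by (simp add: b_def)
  define e where "e = l - 2"
  have e: "e \<ge> 1" using l by (simp add: e_def)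
  define th where "th = r * e - 1"
  have re: "r * e \<ge> 3" using mult_le_mono[OF r e] by simp
  have "real e = real l - 2" using l by (simp add: e_def of_nat_diff)
  moreover have "real (r * e - 1) = real (r * e) - 1"
  proof -
   have "1 \<le> r * e" using re by linarith
   then have "real (r * e - 1) = real (r * e) - real 1" by (rule of_nat_diff)
   then show ?thesis by (simp only: of_nat_1)
  qed
  ultimately have th: "th \<ge> 1" "real th = real r * (real l - 2) - 1"
   using re by (auto simp: th_def)
  define A0 where "A0 = 128 * real r ^ 3"
  have A0: "A0 > 0" using r by (simp add: A0_def)
  define kap where "kap = 1 / (real l ^ l * A0)"
  have kap: "kap > 0" using A0 l by (simp add: kap_def)
  define D where "D = max 1 (2 * (real r * (real l + 1) + 1) / (b * kap ^ r))"
  have D: "D \<ge> 1" by (simp add: D_def)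
  define C where "C = D powr (1 / th)"
  have C: "C > 0" using D by (simp add: C_def)
  moreover have "aas_chromatic_bound r p k (\<lambda>_. l)"
   if k2: "\<forall>n. k n \<ge> 2" and kC: "\<forall>\<^sub>F n in sequentially. real (k n) \<ge> C * ln (real n) powr (1 / (real r * (real l - 2) - 1))"
   for k :: "nat \<Rightarrow> nat"
  proof -
   have k1: "k n \<ge> 1" for n using k2 by (metis one_le_numeral order_trans)
   have lnk: "\<forall>\<^sub>F n in sequentially. D * ln n \<le> real (k n) ^ th"
    using kC eventually_ge_at_top[of 1]
   proof eventually_elim
    case (elim n)
    have "C * ln (real n) powr (1 / th) \<le> real (k n)" using elim(1) unfolding th(2) .
    then have "(C * ln (real n) powr (1 / th)) ^ th \<le> real (k n) ^ th"
     using C by (intro power_mono) auto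
    moreover have "(C * ln (real n) powr (1 / th)) ^ th = D * ln n"
     using elim(2) th(1) D by (simp add: C_def power_mult_distrib powr_root_power)
    ultimately show ?case by simp
   qed
   have lnk1: "\<forall>\<^sub>F n in sequentially. ln (real n) \<le> real (k n) ^ th"
    using lnk eventually_ge_at_top[of 1]
   proof eventually_elim
    case (elim n)
    have "1 * ln (real n) \<le> D * ln n" using D elim by (intro mult_right_mono) auto
    then show ?case using elim by simp
   qed
   have lnk2: "\<forall>\<^sub>F n in sequentially. 2 * (real r * (real l + 1) + 1) / (- ln (1 - p) * kap ^ r) * ln n \<le> real (k n) ^ (r * e - 1)"
    using lnk eventually_ge_at_top[of 1]
   proof eventually_elim
    case (elim n)
    have "2 * (real r * (real l + 1) + 1) / (- ln (1 - p) * kap ^ r) * ln n \<le> D * ln n"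
     unfolding D_def b_def using elim by (intro mult_right_mono max.cobounded2) auto
    then show ?case using elim by (simp add: th_def)
   qed
   define K where "K = (\<lambda>n. (k n + l) choose k n)"
   define N0 where "N0 = (\<lambda>n. A0 * real (k n) ^ 2)"
   define tau where "tau = (\<lambda>n. nat \<lceil>real (K n) / N0 n\<rceil>)"
   have N00: "N0 n > 0" for n using k1[of n] A0 by (simp add: N0_def)
   have tau0: "real (K n) / N0 n > 0" for n using N00 by (simp add: K_def)
   note tau = nat_ceiling_props[OF tau0]
   have taul: "kap * real (k n) ^ e \<le> tau n" for n
   proof -
    have "real (k n) ^ l = real (k n) ^ e * real (k n) ^ 2"
    proof -
     have "l = e + 2" using l by (simp add: e_def)
     then show ?thesis by (metis power_add)
    qed
    then have "kap * real (k n) ^ e = (real (k n) / real l) ^ l / N0 n"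
     using k1[of n] by (simp add: kap_def N0_def power_divide)
    also have "\<dots> \<le> real (K n) / N0 n"
     using N00[of n] choose_fixed_l_ge unfolding K_def by (intro divide_right_mono) auto
    finally show ?thesis using tau(1)[of n] unfolding tau_def by linarith
   qed
   obtain X where X: "negligible p X"
    "\<forall>\<^sub>F n in sequentially. \<forall>d m f. d \<ge> 1 \<longrightarrow> \<not> colorable r n d m \<longrightarrow> f ` ksub {1..n} (k n) \<subseteq> {..<m} \<longrightarrow>
    (\<exists>E\<in>X n. E \<subseteq> kedges r (ksub {1..n} (k n)) \<and> (\<forall>e\<in>E. mono_edge f e)) \<or>
    (\<exists>T C. T \<subseteq> {1..n} \<and> C \<subseteq> {..<m} \<and> \<not> tcol r T d C \<and> f ` ksub T (k n) \<subseteq> C \<and>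
     (r - 1) * card C < card T \<and> real (card T) < 128 * real r ^ 3 * real (k n) ^ 2)"
    by (rule small_universe_aas[OF p r k1 lnk1])
   have H: "negligible p (\<lambda>n. if True then hostev r (k n) (ksub {1..n} (k n + l)) (tau n) else {})"
    by (rule hosts_negligible_fixed_l[OF p _ _ e kap k1 at_top_if_ln_le_power[OF lnk1] taul lnk2]) (use r l in auto)
   show ?thesis
   proof (rule aas_chromatic_boundI[OF p _ negligible_Un[OF X(1) H p(2)]])
    show "\<forall>\<^sub>F n in sequentially. \<forall>m f. \<not> colorable r n (k n + l) m \<longrightarrow> f ` ksub {1..n} (k n) \<subseteq> {..<m} \<longrightarrow>
     (\<exists>E\<in>X n \<union> (if True then hostev r (k n) (ksub {1..n} (k n + l)) (tau n) else {}).
      E \<subseteq> kedges r (ksub {1..n} (k n)) \<and> (\<forall>e\<in>E. mono_edge f e))"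
     using X(2)
    proof eventually_elim
     case (elim n)
     show ?case unfolding if_True
     proof (intro allI impI)
      fix m f assume nc: "\<not> colorable r n (k n + l) m" and f: "f ` ksub {1..n} (k n) \<subseteq> {..<m}"
      have "k n + l \<ge> 1" using l by simp
      from elim[rule_format, OF this nc f]
      show "\<exists>E\<in>X n \<union> hostev r (k n) (ksub {1..n} (k n + l)) (tau n). E \<subseteq> kedges r (ksub {1..n} (k n)) \<and> (\<forall>e\<in>E. mono_edge f e)"
      proof (elim disjE exE conjE)
       fix T C assume TC: "T \<subseteq> {1..n}" "C \<subseteq> {..<m}" "\<not> tcol r T (k n + l) C" "f ` ksub T (k n) \<subseteq> C"
        "(r - 1) * card C < card T" "real (card T) < 128 * real r ^ 3 * real (k n) ^ 2"
       have finT: "finite T" "finite C" using TC(1,2) finite_subset by blast+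
       have "1 * card C \<le> (r - 1) * card C" using r by (intro mult_right_mono) auto
       then have CT: "card C < card T" using TC(5) by linarith
       have "\<exists>E\<in>hostev r (k n) (ksub {1..n} (k n + l)) (tau n). E \<subseteq> kedges r (ksub {1..n} (k n)) \<and> (\<forall>x\<in>E. mono_edge f x)"
       proof (rule popular_hosts[where T = T and d = "k n + l" and C = C])
        fix A assume A: "A \<in> ksub T (k n + l)"
        have finA: "finite A" and cA: "card A = k n + l" using A finT by (auto simp: ksub_def intro: finite_subset)
        have "(tau n - 1) * card C < card A choose k n"
        proof -
         have "real (tau n - 1) * card C \<le> real (tau n - 1) * N0 n"
          using TC(6) CT by (intro mult_left_mono) (auto simp: N0_def A0_def)
         also have "\<dots> < real (K n) / N0 n * N0 n"
          using tau(3)[of n] N00[of n] unfolding tau_def by (intro mult_strict_right_mono)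
         also have "\<dots> = real (K n)" using N00[of n] by simp
         finally show ?thesis by (simp only: of_nat_less_iff cA K_def flip: of_nat_mult)
        qed
        moreover have "f ` ksub A (k n) \<subseteq> C" using TC(4) A ksub_mono[of A T "k n"] by (auto simp: ksub_def)
        ultimately obtain c where "c \<in> C" "tau n \<le> popcount f (k n) c A"
         using popular_colour[OF finA finT(2), of f "k n" "tau n"] by auto
        then show "\<exists>c\<in>C. tau n \<le> popcount f (k n) c A" by blast
        show "\<exists>B\<in>ksub {1..n} (k n + l). A \<subseteq> B" using A TC(1) ksub_mono by blast
       qed (use k1 r TC finT in auto)
       then show ?thesis by blast
      qed blast
     qed
    qed
   qed (use r in simp)
  qed
  ultimately show ?thesis by blast
qed

section \<open>Statement (d): the dichotomy for hosts without a popular colour\<close>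

section \<open>Triple systems: slots left free by popular colours\<close>

text \<open>Let Y be the union of the maximal disjoint family B of sets without a popular colour.
  Off Y popular colours define classes without three disjoint hosts; those without even two form NS
  and can each absorb one point of Y, so |NS| \<ge> |Y| would make T colourable. Now either at least
  half of the k-subsets of members of B have colours in NS (light), or some A in B has at least half
  of its k-subsets in colours with two disjoint hosts off Y (heavy).\<close>

lemma slots:
  fixes f :: "nat set \<Rightarrow> nat"
  assumes fin: "finite T" "finite C" and f: "f ` ksub T k \<subseteq> C" and d: "d \<ge> 1" and nt: "\<not> tcol 3 T d C"
   and nohost: "\<And>c. kedges 3 {A \<in> ksub T d. t \<le> popcount f k c A} = {}"
  obtains
   (light) B NS where "B \<subseteq> ksub T d" "pairwise disjnt B" "B \<noteq> {}" "NS \<subseteq> C" "card NS \<le> card B * d"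
    "\<And>A c. A \<in> B \<Longrightarrow> c \<in> C \<Longrightarrow> popcount f k c A < t"
    "card B * (d choose k) \<le> 2 * (\<Sum>A\<in>B. card {v \<in> ksub A k. f v \<in> NS})"
  | (heavy) A V where "A \<in> ksub T d" "V \<subseteq> ksub A k" "d choose k \<le> 2 * card V"
    "\<And>v. v \<in> V \<Longrightarrow> \<exists>D1 D2. D1 \<in> ksub T d \<and> D2 \<in> ksub T d \<and> D1 \<inter> D2 = {} \<and> A \<inter> D1 = {} \<and> A \<inter> D2 = {} \<and>
     t \<le> popcount f k (f v) D1 \<and> t \<le> popcount f k (f v) D2"
proof -
  define bad where "bad = {A \<in> ksub T d. \<forall>c\<in>C. popcount f k c A < t}"
  have finbad: "finite bad" using fin by (simp add: bad_def)
  obtain B where B: "B \<subseteq> bad" "pairwise disjnt B" "\<And>X. X \<in> bad \<Longrightarrow> X \<noteq> {} \<Longrightarrow> X \<inter> \<Union>B \<noteq> {}"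
   using maximal_disjoint_subfamily[OF finbad] by blast
  have finB: "finite B" using B(1) finbad finite_subset by blast
  have Bk: "B \<subseteq> ksub T d" using B(1) by (auto simp: bad_def)
  define Y where "Y = \<Union>B"
  have YT: "Y \<subseteq> T" using Bk by (auto simp: Y_def ksub_def)
  have "card Y \<le> (\<Sum>A\<in>B. card A)" unfolding Y_def using card_UN_le[OF finB, of id] by simp
  also have "\<dots> = card B * d" using Bk by (subst sum.cong[OF refl, of _ _ "\<lambda>_. d"]) (auto simp: ksub_def)
  finally have cY: "card Y \<le> card B * d" .
  have good: "\<exists>c\<in>C. t \<le> popcount f k c A" if A: "A \<in> ksub (T - Y) d" for A
  proof (rule ccontr)
   assume "\<not> ?thesis"
   then have "A \<in> bad" using A ksub_mono[of "T - Y" T d] by (auto simp: bad_def not_le)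
   moreover have "A \<noteq> {}" using A d by (auto simp: ksub_def)
   ultimately have "A \<inter> Y \<noteq> {}" using B(3) by (simp add: Y_def)
   then show False using A by (auto simp: ksub_def)
  qed
  then obtain g where g: "\<And>A. A \<in> ksub (T - Y) d \<Longrightarrow> g A \<in> C \<and> t \<le> popcount f k (g A) A" by metis
  define cls where "cls = (\<lambda>c. {A \<in> ksub (T - Y) d. g A = c})"
  have clsT: "cls c \<subseteq> {A \<in> ksub T d. t \<le> popcount f k c A}" for c
   using g ksub_mono[of "T - Y" T d] by (auto simp: cls_def)
  have k3: "kedges (Suc 2) (cls c) = {}" for c
   using kedges_mono[OF clsT, of 3 c] nohost[of c] by simp
  define NS where "NS = {c \<in> C. kedges 2 (cls c) = {}}"
  have NS: "card NS < card Y"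
  proof (rule ccontr)
   assume "\<not> card NS < card Y"
   then have le: "card Y \<le> card NS" by simp
   have "tcol 3 T d C"
   \<comment> \<open>The capacity is r - 1 = 2: a class without two disjoint hosts has one place
     left, the others none.\<close>
   proof (rule tcol_absorb[where Y = Y and g = g and s = "\<lambda>c. if c \<in> NS then 1 else 2"])
    show "g ` ksub (T - Y) d \<subseteq> C" using g by auto
    show "kedges (Suc (if c \<in> NS then 1 else 2)) {A \<in> ksub (T - Y) d. g A = c} = {}" if "c \<in> C" for c
    proof (cases "c \<in> NS")
     case True
     then have "kedges 2 (cls c) = {}" by (simp add: NS_def)
     then show ?thesis using True by (simp add: cls_def numeral_2_eq_2)
    next
     case False
     then show ?thesis using k3[of c] by (simp add: cls_def)
    qed
    have "(\<Sum>c\<in>C. 3 - 1 - (if c \<in> NS then 1 else 2)) = (\<Sum>c\<in>C. if c \<in> NS then 1 else 0 :: nat)" by (intro sum.cong) auto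
    also have "\<dots> = card (C \<inter> NS)" using fin by (simp add: sum.If_cases)
    also have "C \<inter> NS = NS" by (auto simp: NS_def)
    finally show "card Y \<le> (\<Sum>c\<in>C. 3 - 1 - (if c \<in> NS then 1 else 2))" using le by simp
   qed (use fin YT in auto)
   then show False using nt by simp
  qed
  show thesis
  proof (cases "card B * (d choose k) \<le> 2 * (\<Sum>A\<in>B. card {v \<in> ksub A k. f v \<in> NS})")
   case True
   have "B \<noteq> {}" using NS by (auto simp: Y_def)
   moreover have "card NS \<le> card B * d" using NS cY by linarith
   ultimately show thesis using light[of B NS] B Bk True by (auto simp: bad_def NS_def)
  next
   case False
   have "\<exists>A\<in>B. 2 * card {v \<in> ksub A k. f v \<in> NS} < d choose k"
   proof (rule ccontr)
    assume "\<not> ?thesis"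
    then have "(\<Sum>A\<in>B. d choose k) \<le> (\<Sum>A\<in>B. 2 * card {v \<in> ksub A k. f v \<in> NS})" by (intro sum_mono) (simp add: not_less)
    then show False using False by (simp add: sum_distrib_left)
   qed
   then obtain A where A: "A \<in> B" "2 * card {v \<in> ksub A k. f v \<in> NS} < d choose k" by blast
   have finA: "finite A" "card A = d" "A \<subseteq> T" using A(1) Bk fin by (auto simp: ksub_def intro: finite_subset)
   define V where "V = {v \<in> ksub A k. f v \<notin> NS}"
   have "ksub A k = {v \<in> ksub A k. f v \<in> NS} \<union> V" by (auto simp: V_def)
   then have "card (ksub A k) \<le> card {v \<in> ksub A k. f v \<in> NS} + card V" by (metis card_Un_le)
   then have cV: "d choose k \<le> 2 * card V" using A(2) finA by (simp add: card_ksub)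
   show thesis
   proof (rule heavy[of A V])
    show "A \<in> ksub T d" using A(1) Bk by blast
    fix v assume v: "v \<in> V"
    then have "v \<in> ksub T k" using finA ksub_mono[of A T k] by (auto simp: V_def)
    then have "f v \<in> C" "f v \<notin> NS" using f v by (auto simp: V_def)
    then have "kedges 2 (cls (f v)) \<noteq> {}" by (auto simp: NS_def)
    then obtain e where e: "e \<subseteq> cls (f v)" "card e = 2" "pairwise disjnt e" by (auto simp: kedges_def)
    obtain D1 D2 where D: "e = {D1, D2}" "D1 \<noteq> D2" using e(2) by (auto simp: card_2_iff)
    have "D1 \<inter> D2 = {}" using e(3) D by (auto simp: pairwise_def disjnt_def)
    moreover have "D \<in> ksub T d \<and> A \<inter> D = {} \<and> t \<le> popcount f k (f v) D" if "D \<in> cls (f v)" for D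
    proof -
     have "A \<subseteq> Y" using A(1) by (auto simp: Y_def)
     moreover have "D \<subseteq> T - Y" using that by (auto simp: cls_def ksub_def)
     moreover have "D \<in> ksub T d" "t \<le> popcount f k (f v) D" using that clsT[of "f v"] by auto
     ultimately show ?thesis by blast
    qed
    moreover have "D1 \<in> cls (f v)" "D2 \<in> cls (f v)" using e(1) D(1) by auto
    ultimately show "\<exists>D1 D2. D1 \<in> ksub T d \<and> D2 \<in> ksub T d \<and> D1 \<inter> D2 = {} \<and> A \<inter> D1 = {} \<and> A \<inter> D2 = {} \<and>
     t \<le> popcount f k (f v) D1 \<and> t \<le> popcount f k (f v) D2" by (intro exI[of _ D1] exI[of _ D2]) simp
   qed (use cV in \<open>auto simp: V_def\<close>)
  qed
qed

text \<open>Members taken from three different blocks are disjoint. In a greedy choice each block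
  already used excludes at most t members of colour c, so at least z^3 lists arise. The bound th^2
  (z - th) \<le> z^3 is linear in z and can be summed over the colours.\<close>

lemma card_colour_triples:
  fixes th :: real
  assumes fin: "finite B" "\<And>A. A \<in> B \<Longrightarrow> finite A" and dj: "pairwise disjnt B" and k: "k \<ge> 1" and th: "th \<ge> 0"
   and t: "\<And>A. A \<in> B \<Longrightarrow> card {v \<in> ksub A k. h v = c} \<le> t"
  shows "th ^ 2 * (real (card {v \<in> (\<Union>A\<in>B. ksub A k). h v = c}) - 2 * real t - th) \<le>
   27 * card {e \<in> kedges 3 (\<Union>A\<in>B. ksub A k). \<forall>v\<in>e. h v = c}"
proof -
  define P where "P = (\<Union>A\<in>B. ksub A k)"
  define S where "S = {v \<in> P. h v = c}"
  define E where "E = {e \<in> kedges 3 P. \<forall>v\<in>e. h v = c}"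
  define own where "own = (\<lambda>v. SOME A. A \<in> B \<and> v \<in> ksub A k)"
  have finP: "finite P" using fin by (simp add: P_def)
  have finS: "finite S" using finP by (simp add: S_def)
  have own: "own v \<in> B \<and> v \<in> ksub (own v) k" if "v \<in> P" for v
   unfolding own_def by (rule someI_ex) (use that in \<open>auto simp: P_def\<close>)
  define z where "z = real (card S) - 2 * real t"
  show ?thesis
  proof (cases "z \<le> th")
   case True
   then have "th ^ 2 * (z - th) \<le> 0" by (simp add: mult_le_0_iff)
   then show ?thesis by (simp add: z_def S_def P_def)
  next
   case False
   then have z0: "z \<ge> 0" "th \<le> z" using th by auto
   have "(\<Prod>j<3::nat. z) \<le> card {xs. set xs \<subseteq> S \<and> length xs = 3 \<and> distinct (map own xs)}"
   proof (rule card_lists_ge[OF finS])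
    fix xs :: "nat set list" assume xs: "set xs \<subseteq> S" "length xs < 3" "distinct (map own xs)"
    have "S - {v \<in> S. distinct (map own (xs @ [v]))} \<subseteq> (\<Union>A\<in>own ` set xs. {v \<in> ksub A k. h v = c})"
    proof
     fix v assume v: "v \<in> S - {v \<in> S. distinct (map own (xs @ [v]))}"
     then have "v \<in> P" "h v = c" "own v \<in> own ` set xs" using xs(3) by (auto simp: S_def)
     then show "v \<in> (\<Union>A\<in>own ` set xs. {v \<in> ksub A k. h v = c})" using own[of v] by auto
    qed
    moreover have oB: "own ` set xs \<subseteq> B" using xs(1) own by (auto simp: S_def)
    ultimately have "card (S - {v \<in> S. distinct (map own (xs @ [v]))}) \<le> card (\<Union>A\<in>own ` set xs. {v \<in> ksub A k. h v = c})"
     using fin by (intro card_mono) auto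
    also have "\<dots> \<le> (\<Sum>A\<in>own ` set xs. card {v \<in> ksub A k. h v = c})" by (rule card_UN_le) simp
    also have "\<dots> \<le> (\<Sum>A\<in>own ` set xs. t)" using oB t by (intro sum_mono) auto
    also have "\<dots> = card (own ` set xs) * t" by simp
    also have "\<dots> \<le> 2 * t"
    proof (rule mult_right_mono)
     have "card (own ` set xs) \<le> card (set xs)" by (intro card_image_le) simp
     also have "\<dots> \<le> length xs" by (rule card_length)
     finally show "card (own ` set xs) \<le> 2" using xs(2) by simp
    qed simp
    finally have a: "card (S - {v \<in> S. distinct (map own (xs @ [v]))}) \<le> 2 * t" .
    have "{v \<in> S. distinct (map own (xs @ [v]))} \<subseteq> S" by auto
    then have "card S = card {v \<in> S. distinct (map own (xs @ [v]))} + card (S - {v \<in> S. distinct (map own (xs @ [v]))})"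
    proof -
     assume sub: "{v \<in> S. distinct (map own (xs @ [v]))} \<subseteq> S"
     have "card (S - {v \<in> S. distinct (map own (xs @ [v]))}) = card S - card {v \<in> S. distinct (map own (xs @ [v]))}"
      by (rule card_Diff_subset[OF finite_subset[OF sub finS] sub])
     moreover have "card {v \<in> S. distinct (map own (xs @ [v]))} \<le> card S" by (rule card_mono[OF finS sub])
     ultimately show ?thesis by linarith
    qed
    then show "z \<le> card {v \<in> S. distinct (map own (xs @ [v]))}" using a unfolding z_def by linarith
   qed (use z0 in auto)
   also have "card {xs. set xs \<subseteq> S \<and> length xs = 3 \<and> distinct (map own xs)} \<le> card E * 3 ^ 3"
   proof (rule card_lists_le_edges)
    show "finite E" using finite_kedges[OF finP] by (simp add: E_def)
    show "card e = 3" if "e \<in> E" for e using that by (simp add: E_def kedges_def)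
    fix xs assume "xs \<in> {xs. set xs \<subseteq> S \<and> length xs = 3 \<and> distinct (map own xs)}"
    then have xs: "set xs \<subseteq> S" "length xs = 3" "distinct (map own xs)" by auto
    have "distinct xs" "inj_on own (set xs)" using xs(3) by (auto simp: distinct_map)
    have "pairwise disjnt (set xs)"
    proof (rule pairwiseI)
     fix u v assume uv: "u \<in> set xs" "v \<in> set xs" "u \<noteq> v"
     then have "own u \<noteq> own v" using \<open>inj_on own (set xs)\<close> by (auto simp: inj_on_def)
     moreover have "u \<in> P" "v \<in> P" using uv xs(1) by (auto simp: S_def)
     ultimately have "disjnt (own u) (own v)" "u \<subseteq> own u" "v \<subseteq> own v"
      using own dj by (auto simp: pairwise_def ksub_def)
     then show "disjnt u v" by (auto simp: disjnt_def)
    qed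
    moreover have "card (set xs) = 3" using \<open>distinct xs\<close> xs(2) by (simp add: distinct_card)
    ultimately show "length xs = 3 \<and> set xs \<in> E" using xs(1,2) by (auto simp: E_def S_def kedges_def)
   qed simp
   finally have "z ^ 3 \<le> 27 * card E" by simp
   moreover have "th ^ 2 * (z - th) \<le> z ^ 3"
   proof -
    have "th ^ 2 * (z - th) \<le> z ^ 2 * z" using z0 th by (intro mult_mono power_mono) auto
    then show ?thesis by (simp add: power2_eq_square power3_eq_cube)
   qed
   ultimately show ?thesis by (simp add: z_def S_def P_def E_def)
  qed
qed

text \<open>Label 0 collects the colours outside the relabelled set; edges inside label 0 may fail
  to be monochromatic under f and are left out.\<close>

definition label_edges :: "nat \<Rightarrow> nat set set \<Rightarrow> (nat set \<Rightarrow> nat) \<Rightarrow> nat set set set" where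
  "label_edges k B h = {e \<in> kedges 3 (\<Union>A\<in>B. ksub A k). \<exists>c. c \<noteq> 0 \<and> (\<forall>v\<in>e. h v = c)}"

lemma card_label_edges:
  fixes th :: real
  assumes fin: "finite B" "\<And>A. A \<in> B \<Longrightarrow> finite A" and dj: "pairwise disjnt B" and k: "k \<ge> 1" and th: "th \<ge> 0"
   and t: "\<And>A c. A \<in> B \<Longrightarrow> c \<in> {1..q} \<Longrightarrow> card {v \<in> ksub A k. h v = c} \<le> t"
  shows "th ^ 2 * (real (\<Sum>A\<in>B. card {v \<in> ksub A k. h v \<in> {1..q}}) - real q * (2 * real t + th)) \<le>
   27 * card (label_edges k B h)"
proof -
  define P where "P = (\<Union>A\<in>B. ksub A k)"
  define E where "E = (\<lambda>c. {e \<in> kedges 3 P. \<forall>v\<in>e. h v = c})"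
  define S where "S = (\<lambda>c. {v \<in> P. h v = c})"
  have finP: "finite P" using fin by (simp add: P_def)
  have dis: "E c \<inter> E c' = {}" if "c \<noteq> c'" for c c'
  proof -
   have "e \<noteq> {}" if "e \<in> E c" for e using that by (auto simp: E_def kedges_def)
   then show ?thesis using that by (fastforce simp: E_def)
  qed
  have finE: "finite (E c)" for c using finite_kedges[OF finP] by (simp add: E_def)
  have "(\<Sum>c\<in>{1..q}. card (E c)) = card (\<Union>c\<in>{1..q}. E c)"
   using dis finE by (intro card_UN_disjoint[symmetric]) auto
  also have "\<dots> \<le> card (label_edges k B h)"
  proof (rule card_mono)
   show "finite (label_edges k B h)" using finite_kedges[OF finP] by (simp add: label_edges_def P_def)
   show "(\<Union>c\<in>{1..q}. E c) \<subseteq> label_edges k B h"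
   proof
    fix e assume "e \<in> (\<Union>c\<in>{1..q}. E c)"
    then obtain c where c: "c \<in> {1..q}" "e \<in> kedges 3 P" "\<forall>v\<in>e. h v = c" by (auto simp: E_def)
    then have "c \<noteq> 0" by auto
    then show "e \<in> label_edges k B h" unfolding label_edges_def P_def[symmetric] using c by blast
   qed
  qed
  finally have 1: "real (\<Sum>c\<in>{1..q}. card (E c)) \<le> card (label_edges k B h)" by (rule of_nat_mono)
  have "(\<Sum>A\<in>B. card {v \<in> ksub A k. h v \<in> {1..q}}) = card (\<Union>A\<in>B. {v \<in> ksub A k. h v \<in> {1..q}})"
  proof (rule card_UN_disjoint[symmetric])
   show "\<forall>A\<in>B. \<forall>A'\<in>B. A \<noteq> A' \<longrightarrow> {v \<in> ksub A k. h v \<in> {1..q}} \<inter> {v \<in> ksub A' k. h v \<in> {1..q}} = {}"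
   proof (intro ballI impI)
    fix A A' assume A: "A \<in> B" "A' \<in> B" "A \<noteq> A'"
    then have "A \<inter> A' = {}" using dj by (auto simp: pairwise_def disjnt_def)
    moreover have "v \<subseteq> A \<inter> A' \<and> v \<noteq> {}" if "v \<in> ksub A k" "v \<in> ksub A' k" for v
     using that k unfolding ksub_def by (cases "v = {}") simp_all
    ultimately have "ksub A k \<inter> ksub A' k = {}" by blast
    then show "{v \<in> ksub A k. h v \<in> {1..q}} \<inter> {v \<in> ksub A' k. h v \<in> {1..q}} = {}" by blast
   qed
  qed (use fin in auto)
  also have "(\<Union>A\<in>B. {v \<in> ksub A k. h v \<in> {1..q}}) = (\<Union>c\<in>{1..q}. S c)"
   by (auto simp: S_def P_def)
  also have "card \<dots> \<le> (\<Sum>c\<in>{1..q}. card (S c))" by (rule card_UN_le) simp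
  finally have 2: "real (\<Sum>A\<in>B. card {v \<in> ksub A k. h v \<in> {1..q}}) \<le> (\<Sum>c\<in>{1..q}. real (card (S c)))"
   by (simp only: of_nat_sum[symmetric] of_nat_le_iff)
  have "th ^ 2 * (real (\<Sum>A\<in>B. card {v \<in> ksub A k. h v \<in> {1..q}}) - real q * (2 * real t + th)) \<le>
    th ^ 2 * ((\<Sum>c\<in>{1..q}. real (card (S c))) - real q * (2 * real t + th))"
   using 2 by (intro mult_left_mono) auto
  also have "\<dots> = th ^ 2 * (\<Sum>c\<in>{1..q}. real (card (S c)) - (2 * real t + th))"
   by (simp add: sum_subtractf)
  also have "\<dots> = (\<Sum>c\<in>{1..q}. th ^ 2 * (real (card (S c)) - 2 * real t - th))"
   by (simp only: sum_distrib_left diff_diff_eq)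
  also have "\<dots> \<le> (\<Sum>c\<in>{1..q}. 27 * real (card (E c)))"
  proof (rule sum_mono)
   fix c assume "c \<in> {1..q}"
   then show "th ^ 2 * (real (card (S c)) - 2 * real t - th) \<le> 27 * real (card (E c))"
    using card_colour_triples[OF fin dj k th, of h c t] t by (simp add: S_def E_def P_def)
  qed
  also have "\<dots> = 27 * real (\<Sum>c\<in>{1..q}. card (E c))" by (simp add: sum_distrib_left)
  also have "\<dots> \<le> 27 * card (label_edges k B h)" using 1 by simp
  finally show ?thesis .
qed

text \<open>An entry joins a k-set v to subfamilies F and G of two hosts in which the colour of v is
  popular.\<close>

definition triple_edges :: "(nat set \<times> nat set set \<times> nat set set) list \<Rightarrow> nat set set set" where
  "triple_edges L = {{v, u, w} |v u w F G. (v, F, G) \<in> set L \<and> u \<in> F \<and> w \<in> G}"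

lemma card_triple_edges:
  assumes fn: "distinct (map fst L)" and fin: "\<And>v F G. (v, F, G) \<in> set L \<Longrightarrow> finite F \<and> finite G \<and> card F = t \<and> card G = t"
   and dj: "\<And>v F G u w. (v, F, G) \<in> set L \<Longrightarrow> u \<in> F \<Longrightarrow> w \<in> G \<Longrightarrow> card {v, u, w} = 3"
  shows "length L * t ^ 2 \<le> 27 * card (triple_edges L)"
proof -
  define S where "S = Sigma (set L) (\<lambda>x. fst (snd x) \<times> snd (snd x))"
  define h where "h = (\<lambda>(x :: nat set \<times> nat set set \<times> nat set set, u :: nat set, w :: nat set). [fst x, u, w])"
  have fn': "inj_on fst (set L)" "distinct L" using fn by (auto simp: distinct_map)
  have "card S = (\<Sum>x\<in>set L. card (fst (snd x) \<times> snd (snd x)))"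
   unfolding S_def using fin by (intro card_SigmaI) (auto simp: prod_eq_iff)
  also have "\<dots> = (\<Sum>x\<in>set L. t ^ 2)"
   using fin by (intro sum.cong) (auto simp: card_cartesian_product power2_eq_square)
  also have "\<dots> = length L * t ^ 2" using fn' by (simp add: distinct_card)
  finally have c: "card S = length L * t ^ 2" .
  have "inj_on h S"
  proof (rule inj_onI)
   fix a b assume ab: "a \<in> S" "b \<in> S" "h a = h b"
   obtain x u w where a: "a = (x, u, w)" by (cases a) auto
   obtain x' u' w' where b: "b = (x', u', w')" by (cases b) auto
   have "fst x = fst x'" "u = u'" "w = w'" using ab(3) by (auto simp: a b h_def)
   moreover have "x \<in> set L" "x' \<in> set L" using ab(1,2) by (auto simp: a b S_def)
   ultimately show "a = b" using fn'(1) by (auto simp: a b inj_on_def)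
  qed
  then have "card S = card (h ` S)" by (simp add: card_image)
  also have "\<dots> \<le> card (triple_edges L) * 3 ^ 3"
  proof (rule card_lists_le_edges)
   have "triple_edges L \<subseteq> (\<lambda>(x, u, w). {fst x, u, w}) ` S"
   proof
    fix e assume "e \<in> triple_edges L"
    then obtain v u w F G where e: "e = {v, u, w}" "(v, F, G) \<in> set L" "u \<in> F" "w \<in> G" by (auto simp: triple_edges_def)
    then show "e \<in> (\<lambda>(x, u, w). {fst x, u, w}) ` S" by (intro image_eqI[of _ _ "((v, F, G), u, w)"]) (auto simp: S_def)
   qed
   moreover have "finite S" unfolding S_def using fin by (intro finite_SigmaI) (auto simp: prod_eq_iff)
   ultimately show "finite (triple_edges L)" using finite_surj by blast
   show "card e = 3" if "e \<in> triple_edges L" for e using that dj by (auto simp: triple_edges_def)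
   fix xs assume "xs \<in> h ` S"
   then obtain v F G u w where "xs = [v, u, w]" "(v, F, G) \<in> set L" "u \<in> F" "w \<in> G" by (auto simp: h_def S_def)
   moreover from this have "{v, u, w} \<in> triple_edges L" unfolding triple_edges_def by blast
   ultimately show "length xs = 3 \<and> set xs \<in> triple_edges L" by simp
  qed simp
  finally show ?thesis using c by simp
qed

section \<open>Statement (d): cost of the light and the heavy event\<close>

section \<open>Triple systems: the two events\<close>

text \<open>Recording labels up to N1 instead of colours makes a k-set cost ln (N1 + 1) rather than
  ln n. A block thus costs (k+l) ln n for its points and (k+l choose k) ln (N1 + 1) for its
  labels.\<close>

lemma labels_negligible:
  fixes k N1 :: "nat \<Rightarrow> nat"
  assumes p: "0 < p" "p < 1"
   and ev: "\<forall>\<^sub>F n in sequentially. (real (k n + l) + 1) * ln n + real ((k n + l) choose k n) * ln (real (N1 n + 1)) \<le> - ln (1 - p) * g n"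
  shows "negligible p (\<lambda>n. \<Union>J\<in>{1..n}. {label_edges (k n) (fst i) (snd i) |i.
   i \<in> Sigma {B. B \<subseteq> ksub {1..n} (k n + l) \<and> card B = J} (\<lambda>B. PiE (\<Union>A\<in>B. ksub A (k n)) (\<lambda>_. {..N1 n})) \<and>
   real J * g n \<le> real (card (label_edges (k n) (fst i) (snd i)))})"
proof (rule negligibleI[OF p, where x = "\<lambda>n. ln (real n)" and
   a = "\<lambda>n J. real J * (real (k n + l) * ln n + real ((k n + l) choose k n) * ln (real (N1 n + 1)))"])
  have fB: "finite B \<and> (\<forall>A\<in>B. finite A \<and> card A = k n + l)" if "B \<subseteq> ksub {1..n} (k n + l)" for B n
  proof -
   have "finite B" using that by (rule finite_subset) simp
   moreover have "finite A \<and> card A = k n + l" if A: "A \<in> B" for A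
   proof -
    have "A \<subseteq> {1..n}" "card A = k n + l" using A \<open>B \<subseteq> ksub {1..n} (k n + l)\<close> by (auto simp: ksub_def)
    then show ?thesis using finite_subset[of A "{1..n}"] by simp
   qed
   ultimately show ?thesis by blast
  qed
  have fP: "finite (\<Union>A\<in>B. ksub A (k n))" if "B \<subseteq> ksub {1..n} (k n + l)" for B n
   using fB[OF that] by simp
  have cP: "card (PiE (\<Union>A\<in>B. ksub A (k n)) (\<lambda>_. {..N1 n})) \<le> (N1 n + 1) ^ (J * ((k n + l) choose k n))"
   if B: "B \<subseteq> ksub {1..n} (k n + l)" "card B = J" for B n J
  proof -
   have "card (\<Union>A\<in>B. ksub A (k n)) \<le> (\<Sum>A\<in>B. card (ksub A (k n)))" using fB[OF B(1)] by (intro card_UN_le) auto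
   also have "\<dots> = (\<Sum>A\<in>B. (k n + l) choose k n)" using fB[OF B(1)] by (intro sum.cong) (auto simp: card_ksub)
   also have "\<dots> = J * ((k n + l) choose k n)" using B(2) by simp
   finally have "(N1 n + 1) ^ card (\<Union>A\<in>B. ksub A (k n)) \<le> (N1 n + 1) ^ (J * ((k n + l) choose k n))"
    by (intro power_increasing) auto
   then show ?thesis using fP[OF B(1)] by (simp add: card_PiE)
  qed
  show "finite (Sigma {B. B \<subseteq> ksub {1..n} (k n + l) \<and> card B = J} (\<lambda>B. PiE (\<Union>A\<in>B. ksub A (k n)) (\<lambda>_. {..N1 n})))" for n J
  proof (rule finite_SigmaI)
   show "finite {B. B \<subseteq> ksub {1..n} (k n + l) \<and> card B = J}" by simp
   show "finite (PiE (\<Union>A\<in>B. ksub A (k n)) (\<lambda>_. {..N1 n}))" if "B \<in> {B. B \<subseteq> ksub {1..n} (k n + l) \<and> card B = J}" for B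
    using fP[of B n] that by (intro finite_PiE) auto
  qed
  show "\<forall>\<^sub>F n in sequentially. \<forall>J\<in>{1..n}.
    real (card (Sigma {B. B \<subseteq> ksub {1..n} (k n + l) \<and> card B = J} (\<lambda>B. PiE (\<Union>A\<in>B. ksub A (k n)) (\<lambda>_. {..N1 n})))) \<le>
     exp (real J * (real (k n + l) * ln n + real ((k n + l) choose k n) * ln (real (N1 n + 1)))) \<and>
    real J * (real (k n + l) * ln n + real ((k n + l) choose k n) * ln (real (N1 n + 1))) + real J * ln n \<le> - ln (1 - p) * (real J * g n)"
   using ev eventually_ge_at_top[of 1]
  proof eventually_elim
   case (elim n)
   define K where "K = (k n + l) choose k n"
   show ?case unfolding K_def[symmetric]
   proof (intro ballI conjI)
    fix J
    let ?Bs = "{B. B \<subseteq> ksub {1..n} (k n + l) \<and> card B = J}"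
    have "card (Sigma ?Bs (\<lambda>B. PiE (\<Union>A\<in>B. ksub A (k n)) (\<lambda>_. {..N1 n}))) =
      (\<Sum>B\<in>?Bs. card (PiE (\<Union>A\<in>B. ksub A (k n)) (\<lambda>_. {..N1 n})))"
    proof (rule card_SigmaI)
     show "finite ?Bs" by simp
     show "\<forall>B\<in>?Bs. finite (PiE (\<Union>A\<in>B. ksub A (k n)) (\<lambda>_. {..N1 n}))"
      using fP by (intro ballI finite_PiE) auto
    qed
    also have "\<dots> \<le> (\<Sum>B\<in>?Bs. (N1 n + 1) ^ (J * K))" unfolding K_def using cP by (intro sum_mono) auto
    also have "\<dots> = ((n choose (k n + l)) choose J) * (N1 n + 1) ^ (J * K)" by (simp add: n_subsets card_ksub)
    also have "\<dots> \<le> (n ^ (k n + l)) ^ J * (N1 n + 1) ^ (J * K)"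
    proof (rule mult_right_mono)
     have "(n choose (k n + l)) choose J \<le> (n choose (k n + l)) ^ J" by (rule choose_le_pow)
     also have "\<dots> \<le> (n ^ (k n + l)) ^ J" by (intro power_mono choose_le_pow) auto
     finally show "(n choose (k n + l)) choose J \<le> (n ^ (k n + l)) ^ J" .
    qed simp
    also have "\<dots> = n ^ (J * (k n + l)) * (N1 n + 1) ^ (J * K)" by (simp only: power_mult[symmetric] mult.commute)
    finally have "real (card (Sigma ?Bs (\<lambda>B. PiE (\<Union>A\<in>B. ksub A (k n)) (\<lambda>_. {..N1 n})))) \<le> real (n ^ (J * (k n + l)) * (N1 n + 1) ^ (J * K))"
     by (rule of_nat_mono)
    also have "\<dots> = exp (real (J * (k n + l)) * ln n) * exp (real (J * K) * ln (real (N1 n + 1)))"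
    proof -
     have "exp (real (J * (k n + l)) * ln n) = real n ^ (J * (k n + l))"
      using elim(2) by (simp only: exp_of_nat_mult) simp
     moreover have "exp (real (J * K) * ln (real (N1 n + 1))) = real (N1 n + 1) ^ (J * K)"
      by (simp only: exp_of_nat_mult) simp
     ultimately show ?thesis by (simp only: of_nat_mult of_nat_power)
    qed
    also have "\<dots> = exp (real J * (real (k n + l) * ln n + real K * ln (real (N1 n + 1))))"
     unfolding exp_add[symmetric] by (simp add: algebra_simps)
    finally show "real (card (Sigma ?Bs (\<lambda>B. PiE (\<Union>A\<in>B. ksub A (k n)) (\<lambda>_. {..N1 n})))) \<le>
     exp (real J * (real (k n + l) * ln n + real K * ln (real (N1 n + 1))))" .
    have "real J * (real (k n + l) * ln n + real K * ln (real (N1 n + 1))) + real J * ln n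
      = real J * ((real (k n + l) + 1) * ln n + real K * ln (real (N1 n + 1)))" by (simp add: algebra_simps)
    also have "\<dots> \<le> real J * (- ln (1 - p) * g n)" using elim(1) unfolding K_def by (intro mult_left_mono) auto
    finally show "real J * (real (k n + l) * ln n + real K * ln (real (N1 n + 1))) + real J * ln n \<le> - ln (1 - p) * (real J * g n)"
     by (simp add: mult_ac)
   qed
  qed
  show "filterlim (\<lambda>n. ln (real n)) at_top sequentially" by real_asymp
qed

definition mate_lists :: "nat \<Rightarrow> nat \<Rightarrow> nat \<Rightarrow> nat \<Rightarrow> nat set \<Rightarrow> (nat set \<times> nat set set \<times> nat set set) list set" where
  "mate_lists k d t w T = (let P = {G. \<exists>A\<in>ksub T d. G \<subseteq> ksub A k \<and> card G = t} in
   {L. set L \<subseteq> ksub T k \<times> P \<times> P \<and> length L = w})"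

lemma card_mate_lists:
  assumes fin: "finite T" and T: "card T \<le> N" and N: "N \<ge> 1" and K: "K = d choose k" "K \<ge> 1"
  shows "finite (mate_lists k d t w T)"
   "real (card (mate_lists k d t w T)) \<le> exp (real w * (real (k + 2 * d) * ln N + 2 * real t * ln K))"
proof -
  define P where "P = {G. \<exists>A\<in>ksub T d. G \<subseteq> ksub A k \<and> card G = t}"
  have fA: "finite A \<and> card A choose k \<le> K" if "A \<in> ksub T d" for A
   using that fin K by (auto simp: ksub_def intro: finite_subset)
  have P: "card P \<le> card (ksub T d) * K ^ t" "finite P"
   unfolding P_def by (rule card_subfamilies[OF _ fA]; use fin in simp)+
  have c: "card (ksub T i) \<le> N ^ i" for i
  proof -
   have "card (ksub T i) \<le> card T ^ i" using fin by (simp add: card_ksub choose_le_pow)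
   also have "\<dots> \<le> N ^ i" using T by (intro power_mono) auto
   finally show ?thesis .
  qed
  have eq: "mate_lists k d t w T = {L. set L \<subseteq> ksub T k \<times> P \<times> P \<and> length L = w}"
   by (simp add: mate_lists_def P_def Let_def)
  have fZ: "finite (ksub T k \<times> P \<times> P)" using fin P by simp
  show "finite (mate_lists k d t w T)" unfolding eq by (rule finite_lists_length_eq[OF fZ])
  have "card P \<le> N ^ d * K ^ t" using P(1) c[of d] by (meson mult_le_mono1 order_trans)
  then have "card (ksub T k \<times> P \<times> P) \<le> N ^ k * ((N ^ d * K ^ t) * (N ^ d * K ^ t))"
   unfolding card_cartesian_product using c[of k] by (intro mult_le_mono) auto
  also have "\<dots> = N ^ (k + 2 * d) * K ^ (2 * t)" unfolding mult_2 power_add by (simp only: mult_ac)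
  finally have "card (mate_lists k d t w T) \<le> (N ^ (k + 2 * d) * K ^ (2 * t)) ^ w"
   unfolding eq card_lists_length_eq[OF fZ] by (rule power_mono) simp
  then have "real (card (mate_lists k d t w T)) \<le> real ((N ^ (k + 2 * d) * K ^ (2 * t)) ^ w)" by (rule of_nat_mono)
  also have "\<dots> = (real N ^ (k + 2 * d) * real K ^ (2 * t)) ^ w" by simp
  also have "\<dots> = exp (real w * (real (k + 2 * d) * ln N + 2 * real t * ln K))"
  proof -
   have "exp (real (k + 2 * d) * ln N) = real N ^ (k + 2 * d)" using N by (simp only: exp_of_nat_mult) simp
   moreover have "real K > 0" using K(2) by simp
   then have "exp (real (2 * t) * ln K) = real K ^ (2 * t)" by (simp only: exp_of_nat_mult exp_ln)
   ultimately have "real N ^ (k + 2 * d) * real K ^ (2 * t) = exp (real (k + 2 * d) * ln N + real (2 * t) * ln K)"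
    by (simp only: exp_add)
   then show ?thesis by (simp only: exp_of_nat_mult of_nat_mult of_nat_numeral)
  qed
  finally show "real (card (mate_lists k d t w T)) \<le> exp (real w * (real (k + 2 * d) * ln N + 2 * real t * ln K))" .
qed

text \<open>The universe T is paid for once, with 2 N1 ln n. Inside it a listed k-set and its two
  hosts cost only multiples of ln N1, and the chosen subfamilies 2 t ln K with K = (k+l choose
  k).\<close>

lemma mates_negligible:
  fixes k N1 t w :: "nat \<Rightarrow> nat"
  assumes p: "0 < p" "p < 1" and N1: "\<And>n. N1 n \<ge> 1"
   and ev: "\<forall>\<^sub>F n in sequentially. (2 * real (N1 n) + 1) * ln n + real (w n) * (real (k n + 2 * (k n + l)) * ln (real (N1 n)) + 2 * real (t n) * ln (real ((k n + l) choose k n)))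
    \<le> - ln (1 - p) * g n"
  shows "negligible p (\<lambda>n. {triple_edges L |T L. T \<subseteq> {1..n} \<and> card T \<le> N1 n \<and> L \<in> mate_lists (k n) (k n + l) (t n) (w n) T \<and>
   g n \<le> real (card (triple_edges L))})"
proof -
  define I where "I = (\<lambda>n. Sigma {T. T \<subseteq> {1..n} \<and> card T \<le> N1 n} (mate_lists (k n) (k n + l) (t n) (w n)))"
  define c where "c = (\<lambda>n. real (k n + 2 * (k n + l)) * ln (real (N1 n)) + 2 * real (t n) * ln (real ((k n + l) choose k n)))"
  have fT: "finite T" if "T \<in> {T. T \<subseteq> {1..n} \<and> card T \<le> N1 n}" for T n
   using that by (auto intro: finite_subset)
  have K1: "(k n + l) choose k n \<ge> 1" for n by (simp add: Suc_le_eq)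
  have fm: "finite (mate_lists (k n) (k n + l) (t n) (w n) T)" if "T \<in> {T. T \<subseteq> {1..n} \<and> card T \<le> N1 n}" for T n
   using card_mate_lists(1)[OF fT[OF that] _ N1 refl K1] that by blast
  have "negligible p (\<lambda>n. \<Union>j\<in>{1..1::nat}. {triple_edges (snd i) |i. i \<in> I n \<and> g n \<le> real (card (triple_edges (snd i)))})"
  proof (rule negligibleI[OF p, where x = "\<lambda>n. ln (real n)" and a = "\<lambda>n j. 2 * real (N1 n) * ln n + real (w n) * c n"])
   show "finite (I n)" for n unfolding I_def using fm by (intro finite_SigmaI) auto
   show "filterlim (\<lambda>n. ln (real n)) at_top sequentially" by real_asymp
   show "\<forall>\<^sub>F n in sequentially. \<forall>j\<in>{1..1::nat}. real (card (I n)) \<le> exp (2 * real (N1 n) * ln n + real (w n) * c n) \<and>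
     2 * real (N1 n) * ln n + real (w n) * c n + real j * ln n \<le> - ln (1 - p) * g n"
    using ev eventually_ge_at_top[of 2]
   proof eventually_elim
    case (elim n)
    have n1: "n + 1 \<le> n ^ 2"
    proof -
     have "n * 2 \<le> n * n" using elim by (intro mult_left_mono) auto
     then show ?thesis using elim unfolding power2_eq_square by linarith
    qed
    have "card {T. T \<subseteq> {1..n} \<and> card T \<le> N1 n} \<le> (n + 1) ^ N1 n" by (rule card_small_subsets)
    also have "\<dots> \<le> (n ^ 2) ^ N1 n" using n1 by (rule power_mono) simp
    also have "\<dots> = n ^ (2 * N1 n)" by (simp only: power_mult)
    finally have "real (card {T. T \<subseteq> {1..n} \<and> card T \<le> N1 n}) \<le> real (n ^ (2 * N1 n))" by (rule of_nat_mono)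
    also have "\<dots> = exp (real (2 * N1 n) * ln n)" using elim(2) by (simp only: exp_of_nat_mult) simp
    finally have cT: "real (card {T. T \<subseteq> {1..n} \<and> card T \<le> N1 n}) \<le> exp (2 * real (N1 n) * ln n)" by simp
    have "real (card (I n)) = (\<Sum>T\<in>{T. T \<subseteq> {1..n} \<and> card T \<le> N1 n}. real (card (mate_lists (k n) (k n + l) (t n) (w n) T)))"
     unfolding I_def using fm by (subst card_SigmaI) auto
    also have "\<dots> \<le> (\<Sum>T\<in>{T. T \<subseteq> {1..n} \<and> card T \<le> N1 n}. exp (real (w n) * c n))"
    proof (rule sum_mono)
     fix T assume T: "T \<in> {T. T \<subseteq> {1..n} \<and> card T \<le> N1 n}"
     show "real (card (mate_lists (k n) (k n + l) (t n) (w n) T)) \<le> exp (real (w n) * c n)"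
      unfolding c_def by (rule card_mate_lists(2)[OF fT[OF T] _ N1 refl K1]) (use T in simp)
    qed
    also have "\<dots> = real (card {T. T \<subseteq> {1..n} \<and> card T \<le> N1 n}) * exp (real (w n) * c n)" by simp
    also have "\<dots> \<le> exp (2 * real (N1 n) * ln n) * exp (real (w n) * c n)" using cT by (intro mult_right_mono) auto
    finally have "real (card (I n)) \<le> exp (2 * real (N1 n) * ln n + real (w n) * c n)" by (simp only: exp_add)
    then show ?case using elim(1) by (simp add: c_def algebra_simps)
   qed
  qed
  moreover have "(\<Union>j\<in>{1..1::nat}. {triple_edges (snd i) |i. i \<in> I n \<and> g n \<le> real (card (triple_edges (snd i)))}) =
    {triple_edges L |T L. T \<subseteq> {1..n} \<and> card T \<le> N1 n \<and> L \<in> mate_lists (k n) (k n + l) (t n) (w n) T \<and>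
   g n \<le> real (card (triple_edges L))}" for n
   unfolding I_def by force
  ultimately show ?thesis by simp
qed

text \<open>NS is mapped injectively to {1..q} with q \<le> |B| d \<le> |T|, so the labels no longer
  involve n. No colour of NS occurs t times in a single block, so a frequent one is distributed over
  several blocks and \<open>card_label_edges\<close> applies.\<close>

lemma light_event:
  fixes f :: "nat set \<Rightarrow> nat"
  assumes k: "k \<ge> 1" and d: "d \<ge> 1" "k \<le> d" and B: "B \<subseteq> ksub T d" "pairwise disjnt B" "B \<noteq> {}" and T: "T \<subseteq> {1..n}" "card T \<le> N1"
   and NS: "finite NS" "card NS \<le> card B * d"
   and bad: "\<And>A c. A \<in> B \<Longrightarrow> c \<in> NS \<Longrightarrow> popcount f k c A < t"
   and t: "real (t - 1) \<le> real (d choose k) / (12 * real d)"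
   and le: "card B * (d choose k) \<le> 2 * (\<Sum>A\<in>B. card {v \<in> ksub A k. f v \<in> NS})"
  obtains h where "card B \<in> {1..n}" "h \<in> PiE (\<Union>A\<in>B. ksub A k) (\<lambda>_. {..N1})"
   "real (card B) * (real (d choose k) * (real (d choose k) / d) ^ 2 / 10000) \<le> card (label_edges k B h)"
   "label_edges k B h \<subseteq> kedges 3 (ksub {1..n} k)" "\<forall>e\<in>label_edges k B h. mono_edge f e"
proof -
  define P where "P = (\<Union>A\<in>B. ksub A k)"
  define K where "K = d choose k"
  have finT: "finite T" using T(1) finite_subset by blast
  have finB: "finite B" using B(1) finT finite_subset by fastforce
  have A: "finite A" "card A = d" "A \<subseteq> T" if "A \<in> B" for A
   using that B(1) finT by (auto simp: ksub_def intro: finite_subset)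
  have "card (\<Union>B) = (\<Sum>A\<in>B. card A)" using B(2) A(1) by (intro card_Union_disjoint) auto
  also have "\<dots> = card B * d" using A(2) by simp
  finally have "card B * d = card (\<Union>B)" ..
  also have "\<dots> \<le> card T" using A(3) finT by (intro card_mono) auto
  finally have Jd: "card B * d \<le> card T" .
  have "card T \<le> n" using T(1) card_mono[of "{1..n}" T] by simp
  moreover have "card B * 1 \<le> card B * d" using d by (intro mult_left_mono) auto
  ultimately have "card B \<le> n" using Jd by linarith
  then have Jn: "card B \<in> {1..n}" using B(3) finB by (simp add: Suc_le_eq card_gt_0_iff)
  define q where "q = card NS"
  have q: "q \<le> N1" "q \<le> card B * d" using NS(2) Jd T(2) by (auto simp: q_def)
  have "\<exists>i. bij_betw i NS {1..q}"
   by (rule finite_same_card_bij[OF NS(1)]) (simp_all add: q_def)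
  then obtain i where i: "bij_betw i NS {1..q}" by blast
  have i1: "i c \<in> {1..q}" if "c \<in> NS" for c using i that by (auto simp: bij_betw_def)
  have ii: "i c = i c' \<longleftrightarrow> c = c'" if "c \<in> NS" "c' \<in> NS" for c c'
   using i that by (auto simp: bij_betw_def inj_on_def)
  define h where "h = restrict (\<lambda>v. if f v \<in> NS then i (f v) else 0) P"
  have h: "h v = (if f v \<in> NS then i (f v) else 0)" if "v \<in> P" for v using that by (simp add: h_def)
  have hNS: "h v \<in> {1..q} \<longleftrightarrow> f v \<in> NS" if "v \<in> P" for v using h[OF that] i1 by auto
  have sub: "v \<in> P" if "A \<in> B" "v \<in> ksub A k" for A v using that by (auto simp: P_def)
  have PiE: "h \<in> PiE P (\<lambda>_. {..N1})"
  proof -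
   have "h v \<le> N1" if "v \<in> P" for v using h[OF that] i1[of "f v"] q(1) by auto
   then show ?thesis by (auto simp: h_def)
  qed
  \<comment> \<open>With t - 1 \<le> K/(12d) the subtracted part is at most |B| K (1/6 + 1/8) = 7/24
    |B| K, which leaves 5/24 |B| K out of one half. The 10000 is a round number above 27 * 64 * 24 /
    5.\<close>
  define th where "th = real K / (8 * real d)"
  have th0: "th \<ge> 0" by (simp add: th_def)
  have "th ^ 2 * (real (\<Sum>A\<in>B. card {v \<in> ksub A k. h v \<in> {1..q}}) - real q * (2 * real (t - 1) + th)) \<le>
   27 * card (label_edges k B h)"
  proof (rule card_label_edges[OF finB A(1) B(2) k th0])
   fix X c assume X: "X \<in> B" and c: "c \<in> {1..q}"
   have "c \<in> i ` NS" using i c by (simp add: bij_betw_def)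
   then obtain c' where c': "c' \<in> NS" "i c' = c" by blast
   have "{v \<in> ksub X k. h v = c} \<subseteq> {v \<in> ksub X k. f v = c'}"
   proof
    fix v assume "v \<in> {v \<in> ksub X k. h v = c}"
    then have v: "v \<in> ksub X k" "h v = c" by auto
    have "f v \<in> NS" using hNS[OF sub[OF X v(1)]] v(2) c by simp
    then have "i (f v) = i c'" using h[OF sub[OF X v(1)]] v(2) c'(2) by simp
    then show "v \<in> {v \<in> ksub X k. f v = c'}" using v(1) ii[OF \<open>f v \<in> NS\<close> c'(1)] by simp
   qed
   then have "card {v \<in> ksub X k. h v = c} \<le> popcount f k c' X"
    unfolding popcount_def using A(1)[OF X] by (intro card_mono) auto
   then show "card {v \<in> ksub X k. h v = c} \<le> t - 1" using bad[OF X c'(1)] by linarith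
  qed
  moreover have "(\<Sum>A\<in>B. card {v \<in> ksub A k. h v \<in> {1..q}}) = (\<Sum>A\<in>B. card {v \<in> ksub A k. f v \<in> NS})"
  proof (intro sum.cong refl)
   fix X assume X: "X \<in> B"
   have "{v \<in> ksub X k. h v \<in> {1..q}} = {v \<in> ksub X k. f v \<in> NS}" using hNS sub[OF X] by blast
   then show "card {v \<in> ksub X k. h v \<in> {1..q}} = card {v \<in> ksub X k. f v \<in> NS}" by simp
  qed
  moreover have "real (card B) * K / 2 \<le> real (\<Sum>A\<in>B. card {v \<in> ksub A k. f v \<in> NS})"
  proof -
   have "real (card B * K) \<le> real (2 * (\<Sum>A\<in>B. card {v \<in> ksub A k. f v \<in> NS}))"
    using le unfolding K_def by (rule of_nat_mono)
   then show ?thesis by simp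
  qed
  moreover have "real q * (2 * real (t - 1) + th) \<le> real (card B) * K * (7 / 24)"
  proof -
   have "real q \<le> real (card B * d)" using q(2) by (rule of_nat_mono)
   moreover have "2 * real (t - 1) + th \<le> real K / d * (7 / 24)"
    using t d by (simp add: th_def K_def field_simps)
   ultimately have "real q * (2 * real (t - 1) + th) \<le> real (card B * d) * (real K / d * (7 / 24))"
    using th0 by (intro mult_mono) auto
   then show ?thesis using d by simp
  qed
  ultimately have "th ^ 2 * (real (card B) * K * (5 / 24)) \<le> 27 * card (label_edges k B h)"
  proof -
   assume a: "th ^ 2 * (real (\<Sum>A\<in>B. card {v \<in> ksub A k. h v \<in> {1..q}}) - real q * (2 * real (t - 1) + th)) \<le> 27 * card (label_edges k B h)"
    "(\<Sum>A\<in>B. card {v \<in> ksub A k. h v \<in> {1..q}}) = (\<Sum>A\<in>B. card {v \<in> ksub A k. f v \<in> NS})"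
    "real (card B) * K / 2 \<le> real (\<Sum>A\<in>B. card {v \<in> ksub A k. f v \<in> NS})"
    "real q * (2 * real (t - 1) + th) \<le> real (card B) * K * (7 / 24)"
   have "real (card B) * K * (5 / 24) \<le> real (\<Sum>A\<in>B. card {v \<in> ksub A k. h v \<in> {1..q}}) - real q * (2 * real (t - 1) + th)"
    unfolding a(2) using a(3,4) by linarith
   then have "th ^ 2 * (real (card B) * K * (5 / 24)) \<le> th ^ 2 * (real (\<Sum>A\<in>B. card {v \<in> ksub A k. h v \<in> {1..q}}) - real q * (2 * real (t - 1) + th))"
    by (rule mult_left_mono) simp
   then show ?thesis using a(1) by (rule order_trans)
  qed
  moreover have "th ^ 2 = (real K / d) ^ 2 / 64" by (simp add: th_def power_divide power_mult_distrib)
  ultimately have "(real K / d) ^ 2 * (real (card B) * K) * (5 / 41472) \<le> card (label_edges k B h)" by simp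
  moreover have "(real K / d) ^ 2 * (real (card B) * K) * (1 / 10000) \<le> (real K / d) ^ 2 * (real (card B) * K) * (5 / 41472)"
   by (intro mult_left_mono) auto
  ultimately have g: "real (card B) * (real K * (real K / d) ^ 2 / 10000) \<le> card (label_edges k B h)" by (simp add: mult_ac)
  have PU: "P \<subseteq> ksub {1..n} k"
  proof -
   have "ksub X k \<subseteq> ksub {1..n} k" if "X \<in> B" for X using A(3)[OF that] T(1) by (intro ksub_mono) auto
   then show ?thesis unfolding P_def by blast
  qed
  have le1: "label_edges k B h \<subseteq> kedges 3 P" by (auto simp: label_edges_def P_def)
  have mono: "mono_edge f e" if e: "e \<in> label_edges k B h" for e
  proof -
   obtain c where c: "c \<noteq> 0" "\<forall>v\<in>e. h v = c" using e unfolding label_edges_def by blast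
   have eP: "e \<subseteq> P" using e le1 by (auto simp: kedges_def)
   have fv: "f v \<in> NS \<and> i (f v) = c" if "v \<in> e" for v
    using h[of v] c eP that by (cases "f v \<in> NS") auto
   have eq: "f u = f v" if "u \<in> e" "v \<in> e" for u v using ii[of "f u" "f v"] fv[OF that(1)] fv[OF that(2)] by simp
   show ?thesis
   proof (cases "e = {}")
    case False
    then obtain u where "u \<in> e" by blast
    then show ?thesis unfolding mono_edge_def using eq by (intro exI[of _ "f u"]) blast
   qed (simp add: mono_edge_def)
  qed
  show thesis
  proof (rule that[of h])
   show "label_edges k B h \<subseteq> kedges 3 (ksub {1..n} k)" using le1 kedges_mono[OF PU] by blast
   show "\<forall>e\<in>label_edges k B h. mono_edge f e" using mono by blast
  qed (use Jn PiE g in \<open>auto simp: P_def K_def\<close>)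
qed

text \<open>Each v in a single A has two disjoint hosts of its colour off A, so v forms a
  monochromatic edge with any members of that colour taken from the two hosts: t^2 edges for each of
  w choices of v.\<close>

lemma heavy_event:
  fixes f :: "nat set \<Rightarrow> nat"
  assumes k: "k \<ge> 1" and T: "T \<subseteq> {1..n}" and A: "A \<in> ksub T d" and V: "V \<subseteq> ksub A k" "w \<le> card V"
   and D: "\<And>v. v \<in> V \<Longrightarrow> \<exists>D1 D2. D1 \<in> ksub T d \<and> D2 \<in> ksub T d \<and> D1 \<inter> D2 = {} \<and> A \<inter> D1 = {} \<and> A \<inter> D2 = {} \<and>
     t \<le> popcount f k (f v) D1 \<and> t \<le> popcount f k (f v) D2"
  obtains L where "L \<in> mate_lists k d t w T" "w * t ^ 2 \<le> 27 * card (triple_edges L)"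
   "triple_edges L \<subseteq> kedges 3 (ksub {1..n} k)" "\<forall>e\<in>triple_edges L. mono_edge f e"
proof -
  have finT: "finite T" using T finite_subset by blast
  obtain W where W: "W \<subseteq> V" "card W = w" "finite W" by (rule obtain_subset_with_card_n[OF V(2)]) blast
  define Q where "Q = (\<lambda>v D. fst D \<in> ksub T d \<and> snd D \<in> ksub T d \<and> fst D \<inter> snd D = {} \<and> A \<inter> fst D = {} \<and> A \<inter> snd D = {} \<and>
     t \<le> popcount f k (f v) (fst D) \<and> t \<le> popcount f k (f v) (snd D))"
  have "\<exists>D. Q v D" if v: "v \<in> V" for v
  proof -
   obtain D1 D2 where "D1 \<in> ksub T d \<and> D2 \<in> ksub T d \<and> D1 \<inter> D2 = {} \<and> A \<inter> D1 = {} \<and> A \<inter> D2 = {} \<and>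
     t \<le> popcount f k (f v) D1 \<and> t \<le> popcount f k (f v) D2" using D[OF v] by blast
   then have "Q v (D1, D2)" by (simp add: Q_def)
   then show ?thesis by blast
  qed
  then obtain DD where DD: "\<And>v. v \<in> V \<Longrightarrow> Q v (DD v)" by metis
  define G where "G = (\<lambda>v X. SOME G. G \<subseteq> {u \<in> ksub X k. f u = f v} \<and> card G = t)"
  have G: "G v X \<subseteq> {u \<in> ksub X k. f u = f v} \<and> card (G v X) = t" if "t \<le> popcount f k (f v) X" for v X
  proof -
   have "\<exists>G. G \<subseteq> {u \<in> ksub X k. f u = f v} \<and> card G = t"
    by (rule obtain_subset_with_card_n[OF that[unfolded popcount_def]]) blast
   then show ?thesis unfolding G_def by (rule someI_ex)
  qed
  obtain vs where vs: "set vs = W" "distinct vs" using finite_distinct_list[OF W(3)] by blast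
  define L where "L = map (\<lambda>v. (v, G v (fst (DD v)), G v (snd (DD v)))) vs"
  have mem: "v \<in> V \<and> F1 = G v (fst (DD v)) \<and> F2 = G v (snd (DD v))" if "(v, F1, F2) \<in> set L" for v F1 F2
   using that vs(1) W(1) by (auto simp: L_def)
  have props: "fst (DD v) \<in> ksub T d" "snd (DD v) \<in> ksub T d" "fst (DD v) \<inter> snd (DD v) = {}" "A \<inter> fst (DD v) = {}" "A \<inter> snd (DD v) = {}"
   "G v (fst (DD v)) \<subseteq> {u \<in> ksub (fst (DD v)) k. f u = f v}" "card (G v (fst (DD v))) = t"
   "G v (snd (DD v)) \<subseteq> {u \<in> ksub (snd (DD v)) k. f u = f v}" "card (G v (snd (DD v))) = t"
   if "v \<in> V" for v
   using DD[OF that] G[of v "fst (DD v)"] G[of v "snd (DD v)"] unfolding Q_def by blast+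
  have AT: "A \<subseteq> T" using A by (simp add: ksub_def)
  have inT: "u \<in> ksub T k" if "X \<in> ksub T d" "u \<in> ksub X k" for X u
   using that by (auto simp: ksub_def)
  have VT: "v \<in> ksub T k" "v \<subseteq> A" if "v \<in> V" for v
  proof -
   have "v \<in> ksub A k" using that V(1) by blast
   then show "v \<in> ksub T k" "v \<subseteq> A" using AT by (auto simp: ksub_def)
  qed
  have edge: "e \<in> kedges 3 (ksub T k) \<and> mono_edge f e \<and> card e = 3"
   if e: "e = {v, u, w}" "(v, F1, F2) \<in> set L" "u \<in> F1" "w \<in> F2" for e v u w F1 F2
  proof -
   have v: "v \<in> V" "F1 = G v (fst (DD v))" "F2 = G v (snd (DD v))" using mem[OF e(2)] by auto
   have u: "u \<in> ksub (fst (DD v)) k" "f u = f v" using e(3) v props(6) by auto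
   have w: "w \<in> ksub (snd (DD v)) k" "f w = f v" using e(4) v props(8) by auto
   have uT: "u \<in> ksub T k" "w \<in> ksub T k" using inT[OF props(1)[OF v(1)] u(1)] inT[OF props(2)[OF v(1)] w(1)] .
   have "v \<subseteq> A" "u \<subseteq> fst (DD v)" "w \<subseteq> snd (DD v)" using VT(2)[OF v(1)] u w by (auto simp: ksub_def)
   then have dj: "v \<inter> u = {}" "v \<inter> w = {}" "u \<inter> w = {}" using props(3,4,5)[OF v(1)] by blast+
   have ne: "v \<noteq> {}" "u \<noteq> {}" "w \<noteq> {}" using VT(1)[OF v(1)] uT k by (auto simp: ksub_def)
   have neq: "v \<noteq> u" "v \<noteq> w" "u \<noteq> w" using dj ne by auto
   have c3: "card e = 3" using neq e(1) by simp
   have "pairwise disjnt e" unfolding e(1) using dj by (auto simp: pairwise_insert disjnt_def)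
   then have "e \<in> kedges 3 (ksub T k)" using c3 uT VT(1)[OF v(1)] e(1) by (auto simp: kedges_def)
   moreover have "mono_edge f e" unfolding mono_edge_def e(1) using u(2) w(2) by (intro exI[of _ "f v"]) auto
   ultimately show ?thesis using c3 by simp
  qed
  show thesis
  proof (rule that[of L])
   have "set L \<subseteq> ksub T k \<times> {G. \<exists>A\<in>ksub T d. G \<subseteq> ksub A k \<and> card G = t} \<times> {G. \<exists>A\<in>ksub T d. G \<subseteq> ksub A k \<and> card G = t}"
   proof
    fix x assume x: "x \<in> set L"
    obtain v F1 F2 where xv: "x = (v, F1, F2)" by (cases x) auto
    have v: "v \<in> V" "F1 = G v (fst (DD v))" "F2 = G v (snd (DD v))" using mem x xv by auto
    have "F1 \<subseteq> ksub (fst (DD v)) k" "F2 \<subseteq> ksub (snd (DD v)) k" using props(6,8)[OF v(1)] v by auto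
    then show "x \<in> ksub T k \<times> {G. \<exists>A\<in>ksub T d. G \<subseteq> ksub A k \<and> card G = t} \<times> {G. \<exists>A\<in>ksub T d. G \<subseteq> ksub A k \<and> card G = t}"
     unfolding xv using VT(1)[OF v(1)] props(1,2,7,9)[OF v(1)] v(2,3) by blast
   qed
   moreover have len: "length L = w" using vs W(2) by (simp add: L_def distinct_card[symmetric])
   ultimately show "L \<in> mate_lists k d t w T" by (simp add: mate_lists_def Let_def)
   have "length L * t ^ 2 \<le> 27 * card (triple_edges L)"
   proof (rule card_triple_edges)
    show "distinct (map fst L)" using vs(2) by (simp add: L_def comp_def)
    fix v F1 F2 assume m: "(v, F1, F2) \<in> set L"
    have v: "v \<in> V" "F1 = G v (fst (DD v))" "F2 = G v (snd (DD v))" using mem[OF m] by auto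
    have fD: "finite (ksub X k)" if "X \<in> ksub T d" for X
     using that finT finite_subset[of X T] by (simp add: ksub_def[of T d])
    have "finite F1" unfolding v(2) by (rule finite_subset[OF _ fD[OF props(1)[OF v(1)]]]) (use props(6)[OF v(1)] in blast)
    moreover have "finite F2" unfolding v(3) by (rule finite_subset[OF _ fD[OF props(2)[OF v(1)]]]) (use props(8)[OF v(1)] in blast)
    ultimately show "finite F1 \<and> finite F2 \<and> card F1 = t \<and> card F2 = t" using props(7,9)[OF v(1)] v(2,3) by simp
    show "card {v, u, w} = 3" if "u \<in> F1" "w \<in> F2" for u w using edge[OF refl m that] by simp
   qed
   then show "w * t ^ 2 \<le> 27 * card (triple_edges L)" using len by simp
   have e: "e \<in> kedges 3 (ksub T k) \<and> mono_edge f e" if eL: "e \<in> triple_edges L" for e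
   proof -
    obtain v u w F1 F2 where "e = {v, u, w}" "(v, F1, F2) \<in> set L" "u \<in> F1" "w \<in> F2"
     using eL unfolding triple_edges_def by blast
    from edge[OF this] show ?thesis by simp
   qed
   then show "triple_edges L \<subseteq> kedges 3 (ksub {1..n} k)" using kedges_mono[OF ksub_mono[OF T]] by blast
   show "\<forall>e\<in>triple_edges L. mono_edge f e" using e by blast
  qed
qed

text \<open>In both cases of \<open>slots\<close> the relevant competition is among about d = k + l
  colours per block, not |T|. So tau is K/(12d), of order k^(l-1), and tau^3 edges against a host
  cost of order k ln n give the exponent 3(l-1) - 1 = 3l - 4.\<close>

lemma triple_fixed_l:
  fixes p :: real and l :: nat
  assumes p: "0 < p" "p < 1" and l: "l \<ge> 2"
  shows "\<exists>C>0. \<forall>k::nat \<Rightarrow> nat. (\<forall>n. k n \<ge> 2) \<and>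
    (\<forall>\<^sub>F n in sequentially. real (k n) \<ge> C * ln (real n) powr (1 / (3 * real l - 4))) \<longrightarrow>
    aas_chromatic_bound 3 p k (\<lambda>_. l)"
proof -
  define b where "b = - ln (1 - p)"
  have b: "b > 0" using p by (simp add: b_def)
  define e where "e = l - 1"
  have e: "e \<ge> 1" "l = e + 1" using l by (auto simp: e_def)
  define th where "th = 3 * e - 1"
  have th: "th \<ge> 1" "real th = 3 * real l - 4" "th + 1 = 3 * e"
   using e by (auto simp: th_def of_nat_diff)
  define k1 where "k1 = 1 / (real l ^ l * (real l + 1))"
  have k1: "k1 > 0" using l by (simp add: k1_def)
  define kap where "kap = k1 / 12"
  have kap: "kap > 0" using k1 by (simp add: kap_def)
  \<comment> \<open>The first constant serves the light and the heavy event, the second the hosts in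
    \<open>hosts_negligible_fixed_l\<close>.\<close>
  define D where "D = max (max 1 (200000000 / (b * k1 ^ 3))) (2 * (3 * (real l + 1) + 1) / (b * kap ^ 3))"
  have D: "D \<ge> 1" by (simp add: D_def)
  define C where "C = D powr (1 / th)"
  have C: "C > 0" using D by (simp add: C_def)
  moreover have "aas_chromatic_bound 3 p k (\<lambda>_. l)"
   if k2: "\<forall>n. k n \<ge> 2" and kC: "\<forall>\<^sub>F n in sequentially. real (k n) \<ge> C * ln (real n) powr (1 / (3 * real l - 4))"
   for k :: "nat \<Rightarrow> nat"
  proof -
   have kn1: "k n \<ge> 1" for n using k2 by (metis one_le_numeral order_trans)
   have lnk: "\<forall>\<^sub>F n in sequentially. D * ln n \<le> real (k n) ^ th"
    using kC eventually_ge_at_top[of 1]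
   proof eventually_elim
    case (elim n)
    have "C * ln (real n) powr (1 / th) \<le> real (k n)" using elim(1) unfolding th(2) .
    then have "(C * ln (real n) powr (1 / th)) ^ th \<le> real (k n) ^ th"
     using C by (intro power_mono) auto
    moreover have "(C * ln (real n) powr (1 / th)) ^ th = D * ln n"
     using elim(2) th(1) D by (simp add: C_def power_mult_distrib powr_root_power)
    ultimately show ?case by simp
   qed
   have lnk': "\<forall>\<^sub>F n in sequentially. c * ln n \<le> real (k n) ^ th" if c: "c \<le> D" for c
    using lnk eventually_ge_at_top[of 1]
   proof eventually_elim
    case (elim n)
    have "c * ln (real n) \<le> D * ln n" using c elim by (intro mult_right_mono) auto
    then show ?case using elim by linarith
   qed
   have lnk1: "\<forall>\<^sub>F n in sequentially. ln (real n) \<le> real (k n) ^ th" using lnk'[OF D] by simp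
   have c1: "200000000 / (b * k1 ^ 3) \<le> D" by (simp add: D_def)
   note lim = at_top_if_ln_le_power[OF lnk1]
   have limr: "filterlim (\<lambda>n. real (k n)) at_top sequentially"
    using filterlim_compose[OF filterlim_real_sequentially lim] .
   define d where "d = (\<lambda>n. k n + l)"
   define K where "K = (\<lambda>n. (k n + l) choose k n)"
   define tau where "tau = (\<lambda>n. nat \<lceil>real (K n) / (12 * real (d n))\<rceil>)"
   \<comment> \<open>3456 = 128 * 3^3, the bound on |T| from
     \<open>small_universe_aas\<close>.\<close>
   define N1 where "N1 = (\<lambda>n. 3456 * k n ^ 2)"
   define w where "w = (\<lambda>n. (K n + 1) div 2)"
   have d0: "real (d n) > 0" for n using l by (simp add: d_def)
   have K0: "K n \<ge> 1" for n by (simp add: K_def Suc_le_eq)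
   have tau0: "real (K n) / (12 * real (d n)) > 0" for n using d0[of n] K0[of n] by (intro divide_pos_pos) auto
   note tau = nat_ceiling_props[OF tau0]
   have qk: "k1 * real (k n) ^ e \<le> real (K n) / d n" for n
   proof -
    define x where "x = real (k n)"
    have x: "x \<ge> 1" using kn1 by (simp add: x_def)
    have "x ^ l = x ^ e * x" by (simp add: e(2))
    then have "k1 * x ^ e = (x / real l) ^ l / ((real l + 1) * x)"
     using x by (simp add: k1_def power_divide)
    also have "\<dots> \<le> real (K n) / ((real l + 1) * x)"
     using choose_fixed_l_ge[of "k n" l] x unfolding K_def x_def by (intro divide_right_mono) auto
    also have "\<dots> \<le> real (K n) / d n"
    proof (rule divide_left_mono)
     have "real l * 1 \<le> real l * x" using x by (intro mult_left_mono) auto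
     then show "real (d n) \<le> (real l + 1) * x" by (simp add: d_def x_def distrib_right)
     show "0 < (real l + 1) * x * real (d n)" using x d0[of n] by simp
    qed simp
    finally show ?thesis by (simp add: x_def)
   qed
   have tq: "real (K n) / d n / 12 \<le> tau n" for n using tau(1)[of n] unfolding tau_def by (simp add: mult.commute)
   have taul: "kap * real (k n) ^ e \<le> tau n" for n
    using qk[of n] tq[of n] unfolding kap_def by simp
   have powe: "real (k n) ^ i \<le> real (k n) ^ (i * e)" for n i
    using kn1[of n] e(1) by (intro power_increasing) auto
   have q3: "k1 ^ 3 * (real (k n) ^ th * real (k n)) \<le> (real (K n) / d n) ^ 3" for n
   proof -
    have "real (k n) ^ th * real (k n) = real (k n) ^ (e * 3)"
     using th(3) by (metis mult.commute power_Suc2 Suc_eq_plus1)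
    then have "k1 ^ 3 * (real (k n) ^ th * real (k n)) = (k1 * real (k n) ^ e) ^ 3"
     by (simp only: power_mult_distrib power_mult)
    also have "\<dots> \<le> (real (K n) / d n) ^ 3" using qk k1 by (intro power_mono) auto
    finally show ?thesis .
   qed
   have q2: "k1 ^ 2 * real (k n) ^ 2 \<le> (real (K n) / d n) ^ 2" for n
   proof -
    have "k1 ^ 2 * real (k n) ^ 2 \<le> k1 ^ 2 * real (k n) ^ (2 * e)" using powe[of n 2] k1 by (intro mult_left_mono) auto
    also have "\<dots> = (k1 * real (k n) ^ e) ^ 2" by (simp only: power_mult_distrib power_mult mult.commute[of 2 e])
    also have "\<dots> \<le> (real (K n) / d n) ^ 2" using qk k1 by (intro power_mono) auto
    finally show ?thesis .
   qed
   have ev1: "\<forall>\<^sub>F n in sequentially. ln (3456 * real (k n) ^ 2 + 1) \<le> b * k1 ^ 2 / 20000 * real (k n) ^ 2"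
   proof -
    have "\<forall>\<^sub>F x in at_top. ln (3456 * x ^ 2 + 1) \<le> b * k1 ^ 2 / 20000 * x ^ 2" using b k1 by real_asymp
    then show ?thesis using limr by (rule eventually_compose_filterlim)
   qed
   have ev2: "\<forall>\<^sub>F n in sequentially. (2 * real l + 3) * real (k n) * ln (3456 * real (k n) ^ 2) \<le> b * kap ^ 2 / 81 * real (k n) ^ 2"
   proof -
    have "\<forall>\<^sub>F x in at_top. (2 * real l + 3) * x * ln (3456 * x ^ 2) \<le> b * kap ^ 2 / 81 * x ^ 2" using b kap by real_asymp
    then show ?thesis using limr by (rule eventually_compose_filterlim)
   qed
   have ev3: "\<forall>\<^sub>F n in sequentially. 2 * (real l * (ln (real l + 1) + ln (real (k n)))) \<le> b * kap / 81 * real (k n)"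
   proof -
    have "\<forall>\<^sub>F x in at_top. 2 * (real l * (ln (real l + 1) + ln x)) \<le> b * kap / 81 * x" using b kap l by real_asymp
    then show ?thesis using limr by (rule eventually_compose_filterlim)
   qed
   have lnx: "\<forall>\<^sub>F n in sequentially. 200000000 * ln n \<le> b * k1 ^ 3 * real (k n) ^ th"
    using lnk'[OF c1]
   proof eventually_elim
    case (elim n)
    have "b * k1 ^ 3 * (200000000 / (b * k1 ^ 3) * ln n) \<le> b * k1 ^ 3 * real (k n) ^ th"
     using elim b k1 by (intro mult_left_mono) auto
    then show ?case using b k1 by simp
   qed
   define X1 where "X1 = (\<lambda>n. \<Union>J\<in>{1..n}. {label_edges (k n) (fst i) (snd i) |i.
    i \<in> Sigma {B. B \<subseteq> ksub {1..n} (k n + l) \<and> card B = J} (\<lambda>B. PiE (\<Union>A\<in>B. ksub A (k n)) (\<lambda>_. {..N1 n})) \<and>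
    real J * (real (K n) * (real (K n) / d n) ^ 2 / 10000) \<le> real (card (label_edges (k n) (fst i) (snd i)))})"
   have X1: "negligible p X1" unfolding X1_def
   proof (rule labels_negligible[OF p])
    show "\<forall>\<^sub>F n in sequentially. (real (k n + l) + 1) * ln n + real ((k n + l) choose k n) * ln (real (N1 n + 1))
      \<le> - ln (1 - p) * (real (K n) * (real (K n) / d n) ^ 2 / 10000)"
     using lnx ev1 eventually_ge_at_top[of 1]
    proof eventually_elim
     case (elim n)
     define q where "q = real (K n) / d n"
     have Kq: "real (K n) = q * d n" using d0[of n] by (simp add: q_def)
     have q0: "q \<ge> 0" by (simp add: q_def)
     have ln0: "ln (real n) \<ge> 0" using elim by simp
     have "(real (k n + l) + 1) * ln n \<le> b * (real (K n) * q ^ 2 / 20000)"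
     proof -
      have "(real (k n + l) + 1) * ln n \<le> (2 * real (d n)) * ln n"
       using ln0 l by (intro mult_right_mono) (auto simp: d_def)
      also have "\<dots> = real (d n) * (200000000 * ln n) / 100000000" by simp
      also have "\<dots> \<le> real (d n) * (b * k1 ^ 3 * real (k n) ^ th) / 100000000"
       using elim(1) by (intro divide_right_mono mult_left_mono) auto
      also have "\<dots> \<le> real (d n) * (b * (k1 ^ 3 * (real (k n) ^ th * real (k n)))) / 100000000"
       using b k1 kn1[of n] by (intro divide_right_mono mult_left_mono) (auto simp: mult_le_cancel_left1)
      also have "\<dots> \<le> real (d n) * (b * q ^ 3) / 100000000"
       using q3[of n] b unfolding q_def by (intro divide_right_mono mult_left_mono) auto
      also have "\<dots> \<le> real (d n) * (b * q ^ 3) / 20000"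
       using b q0 by (intro divide_left_mono) auto
      also have "\<dots> = b * (real (K n) * q ^ 2 / 20000)" unfolding Kq by (simp add: power2_eq_square power3_eq_cube)
      finally show ?thesis .
     qed
     moreover have "real (K n) * ln (real (N1 n + 1)) \<le> b * (real (K n) * q ^ 2 / 20000)"
     proof -
      have "ln (real (N1 n + 1)) \<le> b * k1 ^ 2 / 20000 * real (k n) ^ 2" using elim(2) by (simp add: N1_def add.commute)
      also have "\<dots> = b / 20000 * (k1 ^ 2 * real (k n) ^ 2)" by simp
      also have "\<dots> \<le> b / 20000 * q ^ 2" using q2[of n] b unfolding q_def by (intro mult_left_mono) auto
      finally have "real (K n) * ln (real (N1 n + 1)) \<le> real (K n) * (b / 20000 * q ^ 2)" by (rule mult_left_mono) simp
      then show ?thesis by (simp add: mult_ac)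
     qed
     moreover have "b * (real (K n) * q ^ 2 / 20000) + b * (real (K n) * q ^ 2 / 20000) = b * (real (K n) * q ^ 2 / 10000)" by simp
     ultimately have "(real (k n + l) + 1) * ln n + real (K n) * ln (real (N1 n + 1)) \<le> b * (real (K n) * q ^ 2 / 10000)"
      by linarith
     then show ?case by (simp only: K_def q_def b_def)
    qed
   qed
   define X2 where "X2 = (\<lambda>n. {triple_edges L |T L. T \<subseteq> {1..n} \<and> card T \<le> N1 n \<and> L \<in> mate_lists (k n) (k n + l) (tau n) (w n) T \<and>
   real (w n) * real (tau n) ^ 2 / 27 \<le> real (card (triple_edges L))})"
   have X2: "negligible p X2" unfolding X2_def
   proof (rule mates_negligible[OF p])
    show "N1 n \<ge> 1" for n using kn1[of n] by (simp add: N1_def Suc_le_eq)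
    show "\<forall>\<^sub>F n in sequentially. (2 * real (N1 n) + 1) * ln n + real (w n) * (real (k n + 2 * (k n + l)) * ln (real (N1 n)) + 2 * real (tau n) * ln (real ((k n + l) choose k n)))
    \<le> - ln (1 - p) * (real (w n) * real (tau n) ^ 2 / 27)"
     using lnx ev2 ev3 eventually_ge_at_top[of 1]
    proof eventually_elim
     case (elim n)
     define q where "q = real (K n) / d n"
     define x where "x = real (k n)"
     have x: "x \<ge> 1" using kn1 by (simp add: x_def)
     have Kq: "real (K n) = q * d n" using d0[of n] by (simp add: q_def)
     have q0: "q \<ge> 0" by (simp add: q_def)
     have ln0: "ln (real n) \<ge> 0" using elim by simp
     have N1x: "real (N1 n) = 3456 * x ^ 2" by (simp add: N1_def x_def)
     have wK: "real (w n) \<ge> real (K n) / 2" unfolding w_def by linarith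
     have dx: "x \<le> real (d n)" "real (k n + 2 * (k n + l)) \<le> (2 * real l + 3) * x"
     proof -
      have "real l * 1 \<le> real l * x" using x by (intro mult_left_mono) auto
      then show "x \<le> real (d n)" "real (k n + 2 * (k n + l)) \<le> (2 * real l + 3) * x"
       by (auto simp: x_def d_def algebra_simps)
     qed
     have t2: "kap ^ 2 * x ^ 2 \<le> real (tau n) ^ 2"
     proof -
      have "kap ^ 2 * x ^ 2 \<le> kap ^ 2 * x ^ (2 * e)" using powe[of n 2] kap unfolding x_def by (intro mult_left_mono) auto
      also have "\<dots> = (kap * x ^ e) ^ 2" by (simp only: power_mult_distrib power_mult mult.commute[of 2 e])
      also have "\<dots> \<le> real (tau n) ^ 2" using taul kap x unfolding x_def by (intro power_mono) auto
      finally show ?thesis .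
     qed
     have t1: "kap * x \<le> real (tau n)"
     proof -
      have "kap * x \<le> kap * x ^ e" using powe[of n 1] kap by (simp add: x_def)
      then show ?thesis using taul[of n] by (simp add: x_def)
     qed
     have p1: "(2 * real (N1 n) + 1) * ln n \<le> b * (real (w n) * real (tau n) ^ 2 / 81)"
     proof -
      have "2 * real (N1 n) + 1 \<le> 7000 * x ^ 2"
      proof -
       have "1 \<le> x ^ 2" using x by (rule one_le_power)
       then show ?thesis by (simp add: N1x)
      qed
      then have "(2 * real (N1 n) + 1) * ln n \<le> 7000 * x ^ 2 * ln n" using ln0 by (rule mult_right_mono)
      also have "\<dots> = x ^ 2 * (200000000 * ln n) * (7 / 200000)" by simp
      also have "\<dots> \<le> x ^ 2 * (b * k1 ^ 3 * x ^ th) * (7 / 200000)"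
       using elim(1) x unfolding x_def by (intro mult_right_mono mult_left_mono) auto
      also have "\<dots> = x * b * (k1 ^ 3 * (x ^ th * x)) * (7 / 200000)" by (simp add: power2_eq_square)
      also have "\<dots> \<le> x * b * q ^ 3 * (7 / 200000)"
       using q3[of n] b x unfolding x_def q_def by (intro mult_right_mono mult_left_mono) auto
      also have "\<dots> \<le> x * b * q ^ 3 * (1 / 23328)"
       using b x q0 by (intro mult_left_mono) auto
      also have "\<dots> = b * (q * x / 2 * (q / 12) ^ 2 / 81)" by (simp add: power2_eq_square power3_eq_cube)
      also have "\<dots> \<le> b * (real (w n) * real (tau n) ^ 2 / 81)"
      proof (intro mult_left_mono divide_right_mono mult_mono power_mono)
       have "q * x \<le> q * d n" using dx(1) q0 by (rule mult_left_mono)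
       then show "q * x / 2 \<le> real (w n)" using wK unfolding Kq by linarith
       show "q / 12 \<le> real (tau n)" using tq[of n] by (simp add: q_def)
      qed (use b q0 in auto)
      finally show ?thesis .
     qed
     have p2: "real (k n + 2 * (k n + l)) * ln (real (N1 n)) \<le> b * real (tau n) ^ 2 / 81"
     proof -
      have "ln (real (N1 n)) \<ge> 0"
      proof -
       have "1 \<le> x ^ 2" using x by (rule one_le_power)
       then show ?thesis by (simp add: N1x)
      qed
      then have "real (k n + 2 * (k n + l)) * ln (real (N1 n)) \<le> (2 * real l + 3) * x * ln (3456 * x ^ 2)"
       using dx(2) unfolding N1x by (rule mult_right_mono[rotated])
      also have "\<dots> \<le> b * kap ^ 2 / 81 * x ^ 2" using elim(2) by (simp add: x_def)
      also have "\<dots> = b / 81 * (kap ^ 2 * x ^ 2)" by simp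
      also have "\<dots> \<le> b / 81 * real (tau n) ^ 2" using t2 b by (intro mult_left_mono) auto
      finally show ?thesis by simp
     qed
     have p3: "2 * real (tau n) * ln (real (K n)) \<le> b * real (tau n) ^ 2 / 81"
     proof -
      have "K n \<le> (k n + l) ^ l"
       using choose_le_pow[of "k n + l" l] binomial_symmetric[of "k n" "k n + l"] by (simp add: K_def)
      then have "real (K n) \<le> real ((k n + l) ^ l)" by (rule of_nat_mono)
      then have "ln (real (K n)) \<le> ln (real ((k n + l) ^ l))" using K0[of n] by (intro ln_mono) auto
      also have "\<dots> = l * ln (real (k n + l))" using l by (simp add: ln_realpow)
      also have "\<dots> \<le> l * ln ((real l + 1) * x)"
      proof (intro mult_left_mono ln_mono)
       have "real l * 1 \<le> real l * x" using x by (intro mult_left_mono) auto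
       then show "real (k n + l) \<le> (real l + 1) * x" by (simp add: x_def algebra_simps)
      qed (use l in auto)
      also have "ln ((real l + 1) * x) = ln (real l + 1) + ln x" using x by (intro ln_mult_pos) auto
      finally have "2 * ln (real (K n)) \<le> 2 * (l * (ln (real l + 1) + ln x))" by simp
      also have "\<dots> \<le> b * kap / 81 * x" using elim(3) by (simp add: x_def)
      also have "\<dots> = b / 81 * (kap * x)" by simp
      also have "\<dots> \<le> b / 81 * real (tau n)" using t1 b by (intro mult_left_mono) auto
      finally have "real (tau n) * (2 * ln (real (K n))) \<le> real (tau n) * (b / 81 * real (tau n))" by (rule mult_left_mono) simp
      then show ?thesis by (simp add: power2_eq_square mult_ac)
     qed
     have "real (w n) * (real (k n + 2 * (k n + l)) * ln (real (N1 n)) + 2 * real (tau n) * ln (real (K n)))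
       \<le> real (w n) * (b * real (tau n) ^ 2 / 81 + b * real (tau n) ^ 2 / 81)"
      using p2 p3 by (intro mult_left_mono add_mono) auto
     then have "(2 * real (N1 n) + 1) * ln n + real (w n) * (real (k n + 2 * (k n + l)) * ln (real (N1 n)) + 2 * real (tau n) * ln (real (K n)))
       \<le> b * (real (w n) * real (tau n) ^ 2 / 81) + real (w n) * (b * real (tau n) ^ 2 / 81 + b * real (tau n) ^ 2 / 81)"
      using p1 by (rule add_mono[rotated])
     also have "\<dots> = b * (real (w n) * real (tau n) ^ 2 / 27)" by (simp add: field_simps)
     finally show ?case by (simp only: K_def b_def)
    qed
   qed
   obtain X where X: "negligible p X"
    "\<forall>\<^sub>F n in sequentially. \<forall>d m f. d \<ge> 1 \<longrightarrow> \<not> colorable 3 n d m \<longrightarrow> f ` ksub {1..n} (k n) \<subseteq> {..<m} \<longrightarrow>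
    (\<exists>E\<in>X n. E \<subseteq> kedges 3 (ksub {1..n} (k n)) \<and> (\<forall>e\<in>E. mono_edge f e)) \<or>
    (\<exists>T C. T \<subseteq> {1..n} \<and> C \<subseteq> {..<m} \<and> \<not> tcol 3 T d C \<and> f ` ksub T (k n) \<subseteq> C \<and>
     (3 - 1) * card C < card T \<and> real (card T) < 128 * real 3 ^ 3 * real (k n) ^ 2)"
    by (rule small_universe_aas[OF p order_refl kn1 lnk1])
   have H: "negligible p (\<lambda>n. if True then hostev 3 (k n) (ksub {1..n} (k n + l)) (tau n) else {})"
   proof (rule hosts_negligible_fixed_l[OF p _ _ e(1) kap kn1 lim taul])
    have "2 * (real 3 * (real l + 1) + 1) / (- ln (1 - p) * kap ^ 3) \<le> D"
     unfolding D_def b_def[symmetric] by (simp only: of_nat_numeral max.cobounded2)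
    from lnk'[OF this]
    show "\<forall>\<^sub>F n in sequentially. 2 * (real 3 * (real l + 1) + 1) / (- ln (1 - p) * kap ^ 3) * ln n \<le> real (k n) ^ (3 * e - 1)"
     unfolding th_def .
   qed (use l in auto)
   show ?thesis
   proof (rule aas_chromatic_boundI[OF p _ negligible_Un[OF negligible_Un[OF X(1) H p(2)] negligible_Un[OF X1 X2 p(2)] p(2)]])
    show "\<forall>\<^sub>F n in sequentially. \<forall>m f. \<not> colorable 3 n (k n + l) m \<longrightarrow> f ` ksub {1..n} (k n) \<subseteq> {..<m} \<longrightarrow>
     (\<exists>E\<in>X n \<union> (if True then hostev 3 (k n) (ksub {1..n} (k n + l)) (tau n) else {}) \<union> (X1 n \<union> X2 n).
      E \<subseteq> kedges 3 (ksub {1..n} (k n)) \<and> (\<forall>e\<in>E. mono_edge f e))"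
     using X(2)
    proof eventually_elim
     case (elim n)
     show ?case unfolding if_True
     proof (intro allI impI)
      fix m f assume nc: "\<not> colorable 3 n (k n + l) m" and f: "f ` ksub {1..n} (k n) \<subseteq> {..<m}"
      define good where "good = (\<lambda>E. E \<subseteq> kedges 3 (ksub {1..n} (k n)) \<and> (\<forall>e\<in>E. mono_edge f e))"
      have d1: "k n + l \<ge> 1" using l by simp
      have "(\<exists>E\<in>X n. good E) \<or> (\<exists>T C. T \<subseteq> {1..n} \<and> C \<subseteq> {..<m} \<and> \<not> tcol 3 T (k n + l) C \<and> f ` ksub T (k n) \<subseteq> C \<and>
     (3 - 1) * card C < card T \<and> real (card T) < 128 * real 3 ^ 3 * real (k n) ^ 2)"
       using elim[rule_format, OF d1 nc f] unfolding good_def .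
      then have "(\<exists>E\<in>X n. good E) \<or> (\<exists>E\<in>hostev 3 (k n) (ksub {1..n} (k n + l)) (tau n). good E) \<or> (\<exists>E\<in>X1 n. good E) \<or> (\<exists>E\<in>X2 n. good E)"
      proof (elim disjE exE conjE)
       fix T C assume TC: "T \<subseteq> {1..n}" "C \<subseteq> {..<m}" "\<not> tcol 3 T (k n + l) C" "f ` ksub T (k n) \<subseteq> C"
        "real (card T) < 128 * real 3 ^ 3 * real (k n) ^ 2"
       have finT: "finite T" "finite C" using TC(1,2) finite_subset by blast+
       have cT: "card T \<le> N1 n"
       proof -
        have "real (card T) \<le> real (N1 n)" using TC(5) by (simp add: N1_def)
        then show ?thesis by (simp only: of_nat_le_iff)
       qed
       show ?thesis
       proof (cases "\<exists>c. kedges 3 {A \<in> ksub T (k n + l). tau n \<le> popcount f (k n) c A} \<noteq> {}")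
        case True
        then obtain c e where ce: "e \<in> kedges 3 {A \<in> ksub T (k n + l). tau n \<le> popcount f (k n) c A}" by blast
        then have e: "e \<subseteq> {A \<in> ksub T (k n + l). tau n \<le> popcount f (k n) c A}" "card e = 3" "pairwise disjnt e"
         by (auto simp: kedges_def)
        have sub: "D \<in> ksub {1..n} (k n + l)" if "D \<in> e" for D using that e(1) ksub_mono[OF TC(1)] by blast
        have "\<exists>E\<in>hostev 3 (k n) (ksub {1..n} (k n + l)) (tau n). E \<subseteq> kedges 3 (ksub {1..n} (k n)) \<and> (\<forall>x\<in>E. mono_edge f x)"
        proof (rule hostev_hit[OF kn1 e(2,3), where c = c])
         show "finite e" using e(2) card.infinite by fastforce
         show "\<exists>A\<in>ksub {1..n} (k n + l). D \<subseteq> A" if "D \<in> e" for D using sub[OF that] by blast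
         show "D \<subseteq> {1..n}" if "D \<in> e" for D using sub[OF that] by (simp add: ksub_def)
         show "tau n \<le> popcount f (k n) c D" if "D \<in> e" for D using that e(1) by blast
        qed
        then show ?thesis unfolding good_def by blast
       next
        case False
        then have nohost: "kedges 3 {A \<in> ksub T (k n + l). tau n \<le> popcount f (k n) c A} = {}" for c by blast
        show ?thesis
        proof (rule slots[OF finT TC(4) d1 TC(3) nohost])
         fix B NS assume B: "B \<subseteq> ksub T (k n + l)" "pairwise disjnt B" "B \<noteq> {}" "NS \<subseteq> C" "card NS \<le> card B * (k n + l)"
          "\<And>A c. A \<in> B \<Longrightarrow> c \<in> C \<Longrightarrow> popcount f (k n) c A < tau n"
          "card B * ((k n + l) choose k n) \<le> 2 * (\<Sum>A\<in>B. card {v \<in> ksub A (k n). f v \<in> NS})"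
         have finNS: "finite NS" using B(4) finT finite_subset by blast
         have bad: "popcount f (k n) c A < tau n" if "A \<in> B" "c \<in> NS" for A c using B(4,6) that by blast
         have tt: "real (tau n - 1) \<le> real ((k n + l) choose k n) / (12 * real (k n + l))"
          using tau(3)[of n] unfolding tau_def K_def d_def by linarith
         obtain h where h: "card B \<in> {1..n}" "h \<in> PiE (\<Union>A\<in>B. ksub A (k n)) (\<lambda>_. {..N1 n})"
          "real (card B) * (real ((k n + l) choose k n) * (real ((k n + l) choose k n) / real (k n + l)) ^ 2 / 10000) \<le> card (label_edges (k n) B h)"
          "label_edges (k n) B h \<subseteq> kedges 3 (ksub {1..n} (k n))" "\<forall>e\<in>label_edges (k n) B h. mono_edge f e"
          by (rule light_event[OF kn1 d1 le_add1 B(1,2,3) TC(1) cT finNS B(5) bad tt B(7)])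
         have "B \<subseteq> ksub {1..n} (k n + l)" using B(1) ksub_mono[OF TC(1)] by blast
         then have "(B, h) \<in> Sigma {B'. B' \<subseteq> ksub {1..n} (k n + l) \<and> card B' = card B} (\<lambda>B. PiE (\<Union>A\<in>B. ksub A (k n)) (\<lambda>_. {..N1 n}))"
          using h(2) by simp
         then have "label_edges (k n) B h \<in> {label_edges (k n) (fst i) (snd i) |i.
          i \<in> Sigma {B'. B' \<subseteq> ksub {1..n} (k n + l) \<and> card B' = card B} (\<lambda>B. PiE (\<Union>A\<in>B. ksub A (k n)) (\<lambda>_. {..N1 n})) \<and>
          real (card B) * (real (K n) * (real (K n) / d n) ^ 2 / 10000) \<le> real (card (label_edges (k n) (fst i) (snd i)))}"
          using h(3) unfolding K_def d_def by (intro CollectI exI[of _ "(B, h)"]) simp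
         then have "label_edges (k n) B h \<in> X1 n" unfolding X1_def using h(1) by blast
         then show ?thesis using h(4,5) unfolding good_def by blast
        next
         fix A V assume A: "A \<in> ksub T (k n + l)" "V \<subseteq> ksub A (k n)" "(k n + l) choose k n \<le> 2 * card V"
          and D: "\<And>v. v \<in> V \<Longrightarrow> \<exists>D1 D2. D1 \<in> ksub T (k n + l) \<and> D2 \<in> ksub T (k n + l) \<and> D1 \<inter> D2 = {} \<and> A \<inter> D1 = {} \<and> A \<inter> D2 = {} \<and>
           tau n \<le> popcount f (k n) (f v) D1 \<and> tau n \<le> popcount f (k n) (f v) D2"
         have wV: "w n \<le> card V" using A(3) by (simp add: w_def K_def)
         obtain L where L: "L \<in> mate_lists (k n) (k n + l) (tau n) (w n) T" "w n * tau n ^ 2 \<le> 27 * card (triple_edges L)"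
          "triple_edges L \<subseteq> kedges 3 (ksub {1..n} (k n))" "\<forall>e\<in>triple_edges L. mono_edge f e"
          by (rule heavy_event[OF kn1 TC(1) A(1,2) wV D])
         have "real (w n * tau n ^ 2) \<le> real (27 * card (triple_edges L))" using L(2) by (rule of_nat_mono)
         then have "real (w n) * real (tau n) ^ 2 / 27 \<le> real (card (triple_edges L))" by simp
         then have "triple_edges L \<in> X2 n" unfolding X2_def using TC(1) cT L(1) by blast
         then show ?thesis using L(3,4) unfolding good_def by blast
        qed
       qed
      qed blast
      then show "\<exists>E\<in>X n \<union> hostev 3 (k n) (ksub {1..n} (k n + l)) (tau n) \<union> (X1 n \<union> X2 n).
       E \<subseteq> kedges 3 (ksub {1..n} (k n)) \<and> (\<forall>e\<in>E. mono_edge f e)"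
       unfolding good_def by blast
     qed
    qed
   qed simp
  qed
  ultimately show ?thesis by blast
qed

section \<open>Assembly of the seven statements\<close>

theorem theorem1:
  fixes p :: real and r :: nat
  assumes "0 < p" and "p < 1" and "r \<ge> 2"
  shows
    "((\<exists>q::nat. q \<ge> 1 \<and> r = 2 ^ q) \<longrightarrow>
       (\<exists>C::real. C > 0 \<and>
         (\<forall>k :: nat \<Rightarrow> nat.
            (\<forall>n. k n \<ge> 1) \<and>
            (\<forall>\<^sub>F n in sequentially.
               C * (real n - real r * real (k n))
                 \<le> real n powr (real r / (real r + 1)) * ln (real n) powr (- 1 / (real r + 1))) \<longrightarrow>
            aas_chromatic_bound r p k (\<lambda>_. 1))))
     \<and>
     (\<forall>l::nat. l \<ge> 2 \<longrightarrow>
       (\<exists>C::real. C > 0 \<and>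
         (\<forall>k :: nat \<Rightarrow> nat.
            (\<forall>n. k n \<ge> 2) \<and>
            (\<forall>\<^sub>F n in sequentially.
               real (k n) \<ge> C * (real n * ln (real n)) powr (1 / real l)) \<longrightarrow>
            aas_chromatic_bound 2 p k (\<lambda>_. l))))
     \<and>
     (\<forall>k::nat. k \<ge> 2 \<longrightarrow>
       (\<exists>C::real. C > 0 \<and>
         (\<forall>l :: nat \<Rightarrow> nat.
            (\<forall>n. l n \<ge> 2) \<and>
            (\<forall>\<^sub>F n in sequentially.
               real (l n) \<ge> C * (real n * ln (real n)) powr (1 / real k)) \<longrightarrow>
            aas_chromatic_bound 2 p (\<lambda>_. k) l)))
     \<and>
     (\<forall>l::nat. l \<ge> 2 \<longrightarrow>
       (\<exists>C::real. C > 0 \<and>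
         (\<forall>k :: nat \<Rightarrow> nat.
            (\<forall>n. k n \<ge> 2) \<and>
            (\<forall>\<^sub>F n in sequentially.
               real (k n) \<ge> C * ln (real n) powr (1 / (3 * real l - 4))) \<longrightarrow>
            aas_chromatic_bound 3 p k (\<lambda>_. l))))
     \<and>
     (\<forall>k::nat. k \<ge> 2 \<longrightarrow>
       (\<exists>C::real. C > 0 \<and>
         (\<forall>l :: nat \<Rightarrow> nat.
            (\<forall>n. l n \<ge> 2) \<and>
            (\<forall>\<^sub>F n in sequentially.
               real (l n) \<ge> C * ln (real n) powr (2 / (6 * real k - 11))) \<longrightarrow>
            aas_chromatic_bound 3 p (\<lambda>_. k) l)))
     \<and>
     (r > 3 \<longrightarrow> (\<forall>l::nat. l \<ge> 3 \<longrightarrow>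
       (\<exists>C::real. C > 0 \<and>
         (\<forall>k :: nat \<Rightarrow> nat.
            (\<forall>n. k n \<ge> 2) \<and>
            (\<forall>\<^sub>F n in sequentially.
               real (k n) \<ge> C * ln (real n) powr (1 / (real r * (real l - 2) - 1))) \<longrightarrow>
            aas_chromatic_bound r p k (\<lambda>_. l)))))
     \<and>
     (r > 3 \<longrightarrow> (\<forall>k::nat. k \<ge> 2 \<longrightarrow>
       (\<exists>C::real. C > 0 \<and>
         (\<forall>l :: nat \<Rightarrow> nat.
            (\<forall>n. l n \<ge> 2) \<and>
            (\<forall>\<^sub>F n in sequentially.
               real (l n) \<ge> C * ln (real n) powr
                 (1 / (real r * (real k - 1) - (2 * real r - 1) / (real r - 1)))) \<longrightarrow>
            aas_chromatic_bound r p (\<lambda>_. k) l))))"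
proof (intro conjI impI allI, goal_cases)
  case 1
  then obtain q where "r = 2 ^ q" by blast
  then show ?case by (rule near_extremal[OF assms(1,2) _ assms(3)])
next
  case (2 l)
  then show ?case by (rule graph_fixed_l[OF assms(1,2)])
next
  case (3 k)
  then show ?case by (rule graph_fixed_k[OF assms(1,2)])
next
  case (4 l)
  then show ?case by (rule triple_fixed_l[OF assms(1,2)])
next
  case (5 k)
  \<comment> \<open>The exponent in (e) is that of (g) for r = 3.\<close>
  have e: "real 3 * (real k - 1) - (2 * real 3 - 1) / (real 3 - 1) = (6 * real k - 11) / 2"
    by (simp add: field_simps)
  have "2 / (6 * real k - 11) = 1 / (real 3 * (real k - 1) - (2 * real 3 - 1) / (real 3 - 1))"
    unfolding e by (simp only: divide_divide_eq_right mult_1)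
  then show ?case using hypergraph_fixed_k[OF assms(1,2) order_refl 5 refl] by (simp only:)
next
  case (6 l)
  then show ?case by (intro hypergraph_fixed_l[OF assms(1,2)]) simp_all
next
  case (7 k)
  then show ?case by (intro hypergraph_fixed_k[OF assms(1,2) _ _ refl]) simp_all
qed

end
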